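(* Let $M$ be a closed connected oriented smooth $2n$-manifold, let $\rho\in\Omega^{2n}(M)$ be a positive volume form and let $J$ be an integrable almost complex structure on $M$ compatible with the orientation. Then $\tfrac1{2\pi}\mathrm{Ric}_{\rho,J}$ is a $(1,1)$-form and represents the first Bott--Chern class of $J$. Moreover, the first Bott--Chern class of $J$ vanishes if and only if there exists a diffeomorphism $\phi\in\mathrm{Diff}_0(M)$ such that $\mathrm{Ric}_{\rho,\phi^*J}=0$. If $\mathrm{Ric}_{\rho,J}=\mathrm{Ric}_{\rho,\phi^*J}=0$ for some orientation preserving diffeomorphism $\phi$ of $M$, then $\phi^*\rho=\rho$.
   Context: $\mathrm{Diff}_0(M)$ is the group of diffeomorphisms of $M$ isotopic to the identity. For an almost complex structure $J$ compatible with the orientation let $\nabla$ be any torsion-free connection on $TM$ with $\nabla\rho=0$ (the following is independent of this choice), with usual curvature tensor $R^\nabla$. The Ricci form $\mathrm{Ric}_{\rho,J}\in\Omega^2(M)$ is $$\mathrm{Ric}_{\rho,J}(u,v):=\tfrac14\mathrm{trace}\bigl((\nabla_uJ)J(\nabla_vJ)\bigr)+\tfrac12\mathrm{trace}\bigl(JR^\nabla(u,v)\bigr)+\tfrac12 d\lambda^\nabla_J(u,v),$$ where $\lambda_J^\nabla(u):=\mathrm{trace}(w\mapsto(\nabla_wJ)u)$. $\Omega^{1,1}_J(M)$ denotes the real $2$-forms $\tau$ with $\tau(Ju,Jv)=\tau(u,v)$. For integrable $J$ the Bott--Chern group is $H^{1,1}_{\mathrm{BC}}(M,J):=(\ker d\cap\Omega^{1,1}_J(M))/\{d(df\circ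 J) : f\in\Omega^0(M)\}$. The first Bott--Chern class of $J$ is the class in $H^{1,1}_{\mathrm{BC}}(M,J)$ of $\tfrac{\mathbf i}{2\pi}\mathrm{trace}^c(F^\nabla)$, where $F^\nabla$ is the curvature of the Chern connection (the Hermitian connection whose $(0,1)$-part is the Cauchy--Riemann operator) of any Hermitian metric on the holomorphic tangent bundle $(TM,J)$; it does not depend on the Hermitian metric. *)

theory Defs
  imports "HOL-Analysis.Analysis"
begin

section \<open>Smooth maps between Euclidean domains\<close>

text \<open>On an open subset of a finite-dimensional space, being of class C^(k+1) means being
  differentiable with all directional derivatives of class C^k.\<close>

primrec Ck_on :: "nat \<Rightarrow> 'a::euclidean_space set \<Rightarrow> ('a \<Rightarrow> 'b::real_normed_vector) \<Rightarrow> bool" where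
  "Ck_on 0 S f \<longleftrightarrow> continuous_on S f"
| "Ck_on (Suc k) S f \<longleftrightarrow>
     (\<exists>f'. (\<forall>x\<in>S. (f has_derivative f' x) (at x)) \<and> (\<forall>v. Ck_on k S (\<lambda>x. f' x v)))"

definition smooth_on :: "'a::euclidean_space set \<Rightarrow> ('a \<Rightarrow> 'b::real_normed_vector) \<Rightarrow> bool" where
  "smooth_on S f \<longleftrightarrow> open S \<and> (\<forall>k. Ck_on k S f)"


section \<open>Oriented smooth manifolds of dimension 2n\<close>

text \<open>The model space of dimension 2n, where n is the cardinality of \<open>'n\<close>.  The coordinates
  \<open>(i, False)\<close> and \<open>(i, True)\<close> are thought of as x_i and y_i.  Indexing in this way makes the
  orientation of a complex basis independent of any ordering of the index type.\<close>

type_synonym 'n model = "real ^ ('n \<times> bool)"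
type_synonym ('m, 'n) chart = "'m set \<times> ('m \<Rightarrow> 'n model)"

definition is_chart :: "('m::topological_space, 'n::finite) chart \<Rightarrow> bool" where
  "is_chart = (\<lambda>(U, \<phi>). open U \<and> open (\<phi> ` U) \<and> homeomorphism U (\<phi> ` U) \<phi> (inv_into U \<phi>))"

definition smooth_transition ::
    "('m, 'n::finite) chart \<Rightarrow> ('m, 'n) chart \<Rightarrow> bool" where
  "smooth_transition = (\<lambda>(U, \<phi>) (V, \<psi>). smooth_on (\<phi> ` (U \<inter> V)) (\<psi> \<circ> inv_into U \<phi>))"

text \<open>An orientation of a manifold (of positive dimension) together with its smooth structure
  is the same thing as an equivalence class of smooth atlases whose transition maps have
  positive Jacobian determinant.\<close>

definition oriented_atlas :: "('m::topological_space, 'n::finite) chart set \<Rightarrow> bool" where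
  "oriented_atlas A \<longleftrightarrow>
     (\<forall>c\<in>A. is_chart c) \<and> (\<Union>c\<in>A. fst c) = UNIV \<and>
     (\<forall>c\<in>A. \<forall>d\<in>A. smooth_transition c d) \<and>
     (\<forall>(U, \<phi>)\<in>A. \<forall>(V, \<psi>)\<in>A. \<forall>p\<in>U \<inter> V.
        det (matrix (frechet_derivative (\<psi> \<circ> inv_into U \<phi>) (at (\<phi> p)))) > 0)"

text \<open>Hausdorffness is part of the type class; second countability follows from compactness.\<close>

definition closed_connected_oriented_manifold :: "('m::t2_space, 'n::finite) chart set \<Rightarrow> bool" where
  "closed_connected_oriented_manifold A \<longleftrightarrow>
     oriented_atlas A \<and> compact (UNIV :: 'm set) \<and> connected (UNIV :: 'm set)"

definition smooth_fun_on ::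
    "('m::topological_space, 'n::finite) chart set \<Rightarrow> 'm set \<Rightarrow> ('m \<Rightarrow> 'b::real_normed_vector) \<Rightarrow> bool" where
  "smooth_fun_on A W f \<longleftrightarrow>
     open W \<and> (\<forall>(U, \<phi>)\<in>A. smooth_on (\<phi> ` (U \<inter> W)) (f \<circ> inv_into U \<phi>))"

abbreviation smooth_fun ::
    "('m::topological_space, 'n::finite) chart set \<Rightarrow> ('m \<Rightarrow> 'b::real_normed_vector) \<Rightarrow> bool" where
  "smooth_fun A \<equiv> smooth_fun_on A UNIV"


subsection \<open>Tangent vectors\<close>

text \<open>The tangent space at \<open>p\<close> is identified with the model space by means of a fixed chart
  \<open>chart_at A p\<close> around \<open>p\<close>.  Different points may use different charts, so smoothness of a
  vector field has to be tested after transforming to a common chart.\<close>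

definition chart_at :: "('m, 'n) chart set \<Rightarrow> 'm \<Rightarrow> ('m, 'n) chart" where
  "chart_at A p = (SOME c. c \<in> A \<and> p \<in> fst c)"

text \<open>The derivative at \<open>p\<close> of a vector-valued function defined near \<open>p\<close>.\<close>

definition dfun ::
    "('m, 'n::finite) chart set \<Rightarrow> ('m \<Rightarrow> 'b::real_normed_vector) \<Rightarrow> 'm \<Rightarrow> 'n model \<Rightarrow> 'b" where
  "dfun A f p = (let (U, \<phi>) = chart_at A p in
     frechet_derivative (f \<circ> inv_into U \<phi>) (at (\<phi> p)))"

text \<open>The tangent map of \<open>F\<close> at \<open>p\<close>, from the tangent space at \<open>p\<close> to that at \<open>F p\<close>.\<close>

definition tmap ::
    "('m, 'n::finite) chart set \<Rightarrow> ('m \<Rightarrow> 'm) \<Rightarrow> 'm \<Rightarrow> 'n model \<Rightarrow> 'n model" where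
  "tmap A F p = dfun A (snd (chart_at A (F p)) \<circ> F) p"

text \<open>\<open>dfun A \<phi> q (X q)\<close> is the coordinate vector of \<open>X\<close> at \<open>q\<close> in the chart \<open>\<phi>\<close>.\<close>

definition vector_field ::
    "('m::topological_space, 'n::finite) chart set \<Rightarrow> ('m \<Rightarrow> 'n model) \<Rightarrow> bool" where
  "vector_field A X \<longleftrightarrow> (\<forall>(U, \<phi>)\<in>A. smooth_fun_on A U (\<lambda>q. dfun A \<phi> q (X q)))"

text \<open>Computed at \<open>p\<close> in the chart \<open>chart_at A p\<close>: [X, Y] = dY(X) - dX(Y).\<close>

definition bracket ::
    "('m, 'n::finite) chart set \<Rightarrow> ('m \<Rightarrow> 'n model) \<Rightarrow> ('m \<Rightarrow> 'n model) \<Rightarrow> 'm \<Rightarrow> 'n model" where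
  "bracket A X Y p = (let \<phi> = snd (chart_at A p) in
     dfun A (\<lambda>q. dfun A \<phi> q (Y q)) p (X p) - dfun A (\<lambda>q. dfun A \<phi> q (X q)) p (Y p))"

text \<open>A choice of global smooth extension of a tangent vector, used to evaluate expressions
  that are tensorial, hence independent of this choice.\<close>

definition extend ::
    "('m::topological_space, 'n::finite) chart set \<Rightarrow> 'm \<Rightarrow> 'n model \<Rightarrow> 'm \<Rightarrow> 'n model" where
  "extend A p v = (SOME X. vector_field A X \<and> X p = v)"


subsection \<open>Diffeomorphisms\<close>

definition smooth_map ::
    "('m::topological_space, 'n::finite) chart set \<Rightarrow> ('m \<Rightarrow> 'm) \<Rightarrow> bool" where
  "smooth_map A F \<longleftrightarrow> continuous_on UNIV F \<and> (\<forall>(V, \<psi>)\<in>A. smooth_fun_on A (F -` V) (\<psi> \<circ> F))"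

definition diffeo :: "('m::topological_space, 'n::finite) chart set \<Rightarrow> ('m \<Rightarrow> 'm) \<Rightarrow> bool" where
  "diffeo A F \<longleftrightarrow> bij F \<and> smooth_map A F \<and> smooth_map A (inv F)"

definition orientation_preserving ::
    "('m, 'n::finite) chart set \<Rightarrow> ('m \<Rightarrow> 'm) \<Rightarrow> bool" where
  "orientation_preserving A F \<longleftrightarrow> (\<forall>p. det (matrix (tmap A F p)) > 0)"

text \<open>Smoothness of \<open>H\<close> on the product of the real line with the manifold.\<close>

definition smooth_homotopy ::
    "('m::topological_space, 'n::finite) chart set \<Rightarrow> (real \<Rightarrow> 'm \<Rightarrow> 'm) \<Rightarrow> bool" where
  "smooth_homotopy A H \<longleftrightarrow>
     continuous_on UNIV (\<lambda>(t, p). H t p) \<and>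
     (\<forall>(U, \<phi>)\<in>A. \<forall>(V, \<psi>)\<in>A.
        smooth_on {(t, x). x \<in> \<phi> ` U \<and> H t (inv_into U \<phi> x) \<in> V}
          (\<lambda>(t, x). \<psi> (H t (inv_into U \<phi> x))))"

text \<open>The group Diff_0.  Reparametrising the time by a function that is constant near 0 and
  near 1 shows that requiring the isotopy to be defined for all real times is no restriction.\<close>

definition Diff0 :: "('m::topological_space, 'n::finite) chart set \<Rightarrow> ('m \<Rightarrow> 'm) set" where
  "Diff0 A = {F. \<exists>H. smooth_homotopy A H \<and> (\<forall>t\<in>{0..1}. diffeo A (H t)) \<and> H 0 = id \<and> H 1 = F}"


section \<open>Differential forms\<close>

type_synonym ('m, 'n) one_form = "'m \<Rightarrow> 'n model \<Rightarrow> real"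
type_synonym ('m, 'n) two_form = "'m \<Rightarrow> 'n model \<Rightarrow> 'n model \<Rightarrow> real"
type_synonym ('m, 'n) top_form = "'m \<Rightarrow> ('n \<times> bool \<Rightarrow> 'n model) \<Rightarrow> real"

definition is_two_form ::
    "('m::topological_space, 'n::finite) chart set \<Rightarrow> ('m, 'n) two_form \<Rightarrow> bool" where
  "is_two_form A \<tau> \<longleftrightarrow>
     (\<forall>p u. linear (\<tau> p u)) \<and> (\<forall>p v. linear (\<lambda>u. \<tau> p u v)) \<and> (\<forall>p u. \<tau> p u u = 0) \<and>
     (\<forall>X Y. vector_field A X \<longrightarrow> vector_field A Y \<longrightarrow> smooth_fun A (\<lambda>p. \<tau> p (X p) (Y p)))"

definition is_top_form ::
    "('m::topological_space, 'n::finite) chart set \<Rightarrow> ('m, 'n) top_form \<Rightarrow> bool" where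
  "is_top_form A \<rho> \<longleftrightarrow>
     (\<forall>p b k. linear (\<lambda>v. \<rho> p (b(k := v)))) \<and>
     (\<forall>p b j k. j \<noteq> k \<longrightarrow> b j = b k \<longrightarrow> \<rho> p b = 0) \<and>
     (\<forall>X. (\<forall>k. vector_field A (X k)) \<longrightarrow> smooth_fun A (\<lambda>p. \<rho> p (\<lambda>k. X k p)))"

definition positive_frame :: "('n::finite \<times> bool \<Rightarrow> 'n model) \<Rightarrow> bool" where
  "positive_frame b \<longleftrightarrow> det (\<chi> k. b k) > 0"

definition positive_volume_form ::
    "('m::topological_space, 'n::finite) chart set \<Rightarrow> ('m, 'n) top_form \<Rightarrow> bool" where
  "positive_volume_form A \<rho> \<longleftrightarrow> is_top_form A \<rho> \<and> (\<forall>p b. positive_frame b \<longrightarrow> \<rho> p b > 0)"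

definition d_one_form ::
    "('m::topological_space, 'n::finite) chart set \<Rightarrow> ('m, 'n) one_form \<Rightarrow> ('m, 'n) two_form" where
  "d_one_form A \<alpha> p u v = (let X = extend A p u; Y = extend A p v in
     dfun A (\<lambda>q. \<alpha> q (Y q)) p u - dfun A (\<lambda>q. \<alpha> q (X q)) p v - \<alpha> p (bracket A X Y p))"

definition d_two_form ::
    "('m::topological_space, 'n::finite) chart set \<Rightarrow> ('m, 'n) two_form \<Rightarrow>
     'm \<Rightarrow> 'n model \<Rightarrow> 'n model \<Rightarrow> 'n model \<Rightarrow> real" where
  "d_two_form A \<tau> p u v w = (let X = extend A p u; Y = extend A p v; Z = extend A p w in
     dfun A (\<lambda>q. \<tau> q (Y q) (Z q)) p u - dfun A (\<lambda>q. \<tau> q (X q) (Z q)) p v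
     + dfun A (\<lambda>q. \<tau> q (X q) (Y q)) p w
     - \<tau> p (bracket A X Y p) w + \<tau> p (bracket A X Z p) v - \<tau> p (bracket A Y Z p) u)"

definition pullback_top_form ::
    "('m, 'n::finite) chart set \<Rightarrow> ('m \<Rightarrow> 'm) \<Rightarrow> ('m, 'n) top_form \<Rightarrow> ('m, 'n) top_form" where
  "pullback_top_form A F \<rho> p b = \<rho> (F p) (\<lambda>k. tmap A F p (b k))"


section \<open>Almost complex structures\<close>

type_synonym ('m, 'n) endo = "'m \<Rightarrow> 'n model \<Rightarrow> 'n model"

definition almost_complex ::
    "('m::topological_space, 'n::finite) chart set \<Rightarrow> ('m, 'n) endo \<Rightarrow> bool" where
  "almost_complex A J \<longleftrightarrow>
     (\<forall>p. linear (J p)) \<and> (\<forall>p v. J p (J p v) = - v) \<and>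
     (\<forall>X. vector_field A X \<longrightarrow> vector_field A (\<lambda>p. J p (X p)))"

text \<open>The real frame e_1, I e_1, ..., e_n, I e_n; swapping two such pairs does not change its
  orientation.\<close>

definition complex_frame ::
    "('n model \<Rightarrow> 'n model) \<Rightarrow> ('n \<Rightarrow> 'n model) \<Rightarrow> 'n \<times> bool \<Rightarrow> 'n model" where
  "complex_frame I e = (\<lambda>(i, b). if b then I (e i) else e i)"

definition complex_basis ::
    "('n::finite model \<Rightarrow> 'n model) \<Rightarrow> ('n \<Rightarrow> 'n model) \<Rightarrow> bool" where
  "complex_basis I e \<longleftrightarrow> det (\<chi> k. complex_frame I e k) \<noteq> 0"

definition compatible_with_orientation :: "('m, 'n::finite) endo \<Rightarrow> bool" where
  "compatible_with_orientation J \<longleftrightarrow>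
     (\<forall>p e. complex_basis (J p) e \<longrightarrow> positive_frame (complex_frame (J p) e))"

definition std_complex :: "'n::finite model \<Rightarrow> 'n model" where
  "std_complex x = (\<chi> k. if snd k then x $ (fst k, False) else - x $ (fst k, True))"

definition holomorphic_charts ::
    "('m::topological_space, 'n::finite) chart set \<Rightarrow> ('m, 'n) endo \<Rightarrow> ('m, 'n) chart set" where
  "holomorphic_charts A J = {c. is_chart c \<and>
     (\<forall>d\<in>A. smooth_transition c d \<and> smooth_transition d c) \<and>
     (\<forall>p\<in>fst c. \<forall>v. dfun A (snd c) p (J p v) = std_complex (dfun A (snd c) p v))}"

definition integrable_complex ::
    "('m::topological_space, 'n::finite) chart set \<Rightarrow> ('m, 'n) endo \<Rightarrow> bool" where
  "integrable_complex A J \<longleftrightarrow> almost_complex A J \<and> (\<Union>c\<in>holomorphic_charts A J. fst c) = UNIV"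

definition pullback_endo ::
    "('m, 'n::finite) chart set \<Rightarrow> ('m \<Rightarrow> 'm) \<Rightarrow> ('m, 'n) endo \<Rightarrow> ('m, 'n) endo" where
  "pullback_endo A F J p v = inv (tmap A F p) (J (F p) (tmap A F p v))"


section \<open>Connections on the tangent bundle\<close>

text \<open>\<open>D p u Y\<close> is the covariant derivative at \<open>p\<close> of the vector field \<open>Y\<close> in the direction
  \<open>u\<close>.  Only the values on smooth vector fields matter.\<close>

type_synonym ('m, 'n) conn = "'m \<Rightarrow> 'n model \<Rightarrow> ('m \<Rightarrow> 'n model) \<Rightarrow> 'n model"

definition connection ::
    "('m::topological_space, 'n::finite) chart set \<Rightarrow> ('m, 'n) conn \<Rightarrow> bool" where
  "connection A D \<longleftrightarrow>
     (\<forall>p Y. vector_field A Y \<longrightarrow> linear (\<lambda>u. D p u Y)) \<and>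
     (\<forall>p u Y Z. vector_field A Y \<longrightarrow> vector_field A Z \<longrightarrow>
        D p u (\<lambda>q. Y q + Z q) = D p u Y + D p u Z) \<and>
     (\<forall>p u f Y. smooth_fun A f \<longrightarrow> vector_field A Y \<longrightarrow>
        D p u (\<lambda>q. f q *\<^sub>R Y q) = dfun A f p u *\<^sub>R Y p + f p *\<^sub>R D p u Y) \<and>
     (\<forall>X Y. vector_field A X \<longrightarrow> vector_field A Y \<longrightarrow> vector_field A (\<lambda>p. D p (X p) Y))"

definition torsion_free ::
    "('m::topological_space, 'n::finite) chart set \<Rightarrow> ('m, 'n) conn \<Rightarrow> bool" where
  "torsion_free A D \<longleftrightarrow>
     (\<forall>X Y p. vector_field A X \<longrightarrow> vector_field A Y \<longrightarrow>
        D p (X p) Y - D p (Y p) X = bracket A X Y p)"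

definition preserves_top_form ::
    "('m::topological_space, 'n::finite) chart set \<Rightarrow> ('m, 'n) conn \<Rightarrow> ('m, 'n) top_form \<Rightarrow> bool" where
  "preserves_top_form A D \<rho> \<longleftrightarrow>
     (\<forall>X p u. (\<forall>k. vector_field A (X k)) \<longrightarrow>
        dfun A (\<lambda>q. \<rho> q (\<lambda>k. X k q)) p u = (\<Sum>j\<in>UNIV. \<rho> p ((\<lambda>k. X k p)(j := D p u (X j)))))"

definition curvature ::
    "('m::topological_space, 'n::finite) chart set \<Rightarrow> ('m, 'n) conn \<Rightarrow>
     'm \<Rightarrow> 'n model \<Rightarrow> 'n model \<Rightarrow> 'n model \<Rightarrow> 'n model" where
  "curvature A D p u v w = (let X = extend A p u; Y = extend A p v; W = extend A p w in
     D p u (\<lambda>q. D q (Y q) W) - D p v (\<lambda>q. D q (X q) W) - D p (bracket A X Y p) W)"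

text \<open>The endomorphism that is the covariant derivative of \<open>J\<close> at \<open>p\<close> in the direction \<open>u\<close>.\<close>

definition nabla_endo ::
    "('m::topological_space, 'n::finite) chart set \<Rightarrow> ('m, 'n) conn \<Rightarrow> ('m, 'n) endo \<Rightarrow>
     'm \<Rightarrow> 'n model \<Rightarrow> 'n model \<Rightarrow> 'n model" where
  "nabla_endo A D J p u w = (let W = extend A p w in
     D p u (\<lambda>q. J q (W q)) - J p (D p u W))"


section \<open>The Ricci form\<close>

definition endo_trace :: "('n::finite model \<Rightarrow> 'n model) \<Rightarrow> real" where
  "endo_trace T = trace (matrix T)"

definition ricci_lambda ::
    "('m::topological_space, 'n::finite) chart set \<Rightarrow> ('m, 'n) conn \<Rightarrow> ('m, 'n) endo \<Rightarrow>
     ('m, 'n) one_form" where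
  "ricci_lambda A D J p u = endo_trace (\<lambda>w. nabla_endo A D J p w u)"

definition ricci_form_of ::
    "('m::topological_space, 'n::finite) chart set \<Rightarrow> ('m, 'n) conn \<Rightarrow> ('m, 'n) endo \<Rightarrow>
     ('m, 'n) two_form" where
  "ricci_form_of A D J p u v =
     1/4 * endo_trace (nabla_endo A D J p u \<circ> J p \<circ> nabla_endo A D J p v)
     + 1/2 * endo_trace (J p \<circ> curvature A D p u v)
     + 1/2 * d_one_form A (ricci_lambda A D J) p u v"

text \<open>The Ricci form is the common value of \<open>ricci_form_of\<close> for all torsion-free connections
  that preserve the volume form.\<close>

definition Ric ::
    "('m::topological_space, 'n::finite) chart set \<Rightarrow> ('m, 'n) top_form \<Rightarrow> ('m, 'n) endo \<Rightarrow>
     ('m, 'n) two_form" where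
  "Ric A \<rho> J = (THE R. \<exists>D. connection A D \<and> torsion_free A D \<and> preserves_top_form A D \<rho> \<and>
     R = ricci_form_of A D J)"


section \<open>Bott--Chern cohomology in bidegree (1,1)\<close>

definition form11 ::
    "('m::topological_space, 'n::finite) chart set \<Rightarrow> ('m, 'n) endo \<Rightarrow> ('m, 'n) two_form set" where
  "form11 A J = {\<tau>. is_two_form A \<tau> \<and> (\<forall>p u v. \<tau> p (J p u) (J p v) = \<tau> p u v)}"

definition closed_form11 ::
    "('m::topological_space, 'n::finite) chart set \<Rightarrow> ('m, 'n) endo \<Rightarrow> ('m, 'n) two_form set" where
  "closed_form11 A J = {\<tau> \<in> form11 A J. \<forall>p u v w. d_two_form A \<tau> p u v w = 0}"

definition bott_chern_rel ::
    "('m::topological_space, 'n::finite) chart set \<Rightarrow> ('m, 'n) endo \<Rightarrow>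
     (('m, 'n) two_form \<times> ('m, 'n) two_form) set" where
  "bott_chern_rel A J = {(\<tau>, \<sigma>). \<tau> \<in> closed_form11 A J \<and> \<sigma> \<in> closed_form11 A J \<and>
     (\<exists>f. smooth_fun A f \<and>
       (\<forall>p u v. \<sigma> p u v - \<tau> p u v = d_one_form A (\<lambda>q w. dfun A f q (J q w)) p u v))}"

text \<open>The class of a closed (1,1)-form, as an element of the quotient
  \<open>closed_form11 A J // bott_chern_rel A J\<close>.\<close>

definition bott_chern_class ::
    "('m::topological_space, 'n::finite) chart set \<Rightarrow> ('m, 'n) endo \<Rightarrow> ('m, 'n) two_form \<Rightarrow>
     ('m, 'n) two_form set" where
  "bott_chern_class A J \<tau> = bott_chern_rel A J `` {\<tau>}"


section \<open>The first Bott--Chern class\<close>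

text \<open>A Hermitian metric on the complex vector bundle \<open>(TM, J)\<close>, given by its real part.\<close>

definition hermitian_metric ::
    "('m::topological_space, 'n::finite) chart set \<Rightarrow> ('m, 'n) endo \<Rightarrow>
     ('m \<Rightarrow> 'n model \<Rightarrow> 'n model \<Rightarrow> real) \<Rightarrow> bool" where
  "hermitian_metric A J g \<longleftrightarrow>
     (\<forall>p u. linear (g p u)) \<and> (\<forall>p u v. g p u v = g p v u) \<and> (\<forall>p u. u \<noteq> 0 \<longrightarrow> g p u u > 0) \<and>
     (\<forall>X Y. vector_field A X \<longrightarrow> vector_field A Y \<longrightarrow> smooth_fun A (\<lambda>p. g p (X p) (Y p))) \<and>
     (\<forall>p u v. g p (J p u) (J p v) = g p u v)"

text \<open>The Cauchy--Riemann operator of the holomorphic tangent bundle, applied to \<open>Y\<close> at \<open>p\<close>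
  and to the tangent vector \<open>u\<close>: componentwise the usual operator in holomorphic coordinates
  (the coordinate vector fields are a holomorphic frame).\<close>

definition cauchy_riemann ::
    "('m::topological_space, 'n::finite) chart set \<Rightarrow> ('m, 'n) endo \<Rightarrow> ('m, 'n) conn" where
  "cauchy_riemann A J p u Y = (THE w. \<forall>(U, \<psi>)\<in>holomorphic_charts A J. p \<in> U \<longrightarrow>
     (let y = (\<lambda>q. dfun A \<psi> q (Y q)) in
       dfun A \<psi> p w = (1/2) *\<^sub>R (dfun A y p u + std_complex (dfun A y p (J p u)))))"

text \<open>For a complex linear connection, being compatible with the Hermitian metric is the same
  as being compatible with its real part \<open>g\<close>.\<close>

definition chern_connection ::
    "('m::topological_space, 'n::finite) chart set \<Rightarrow> ('m, 'n) endo \<Rightarrow>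
     ('m \<Rightarrow> 'n model \<Rightarrow> 'n model \<Rightarrow> real) \<Rightarrow> ('m, 'n) conn \<Rightarrow> bool" where
  "chern_connection A J g D \<longleftrightarrow> connection A D \<and>
     (\<forall>p u Y. vector_field A Y \<longrightarrow> D p u (\<lambda>q. J q (Y q)) = J p (D p u Y)) \<and>
     (\<forall>p u Y Z. vector_field A Y \<longrightarrow> vector_field A Z \<longrightarrow>
        dfun A (\<lambda>q. g q (Y q) (Z q)) p u = g p (D p u Y) (Z p) + g p (Y p) (D p u Z)) \<and>
     (\<forall>p u Y. vector_field A Y \<longrightarrow>
        (1/2) *\<^sub>R (D p u Y + J p (D p (J p u) Y)) = cauchy_riemann A J p u Y)"

text \<open>The trace of an endomorphism \<open>T\<close> that is complex linear for the complex structure \<open>I\<close>,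
  computed from its matrix \<open>a\<close> in any complex basis.\<close>

definition complex_trace :: "('n::finite model \<Rightarrow> 'n model) \<Rightarrow> ('n model \<Rightarrow> 'n model) \<Rightarrow> complex" where
  "complex_trace I T = (THE t. \<exists>e a. complex_basis I e \<and>
     (\<forall>j. T (e j) = (\<Sum>i\<in>UNIV. Re (a i j) *\<^sub>R e i + Im (a i j) *\<^sub>R I (e i))) \<and>
     t = (\<Sum>i\<in>UNIV. a i i))"

text \<open>The curvature of a Hermitian connection is skew-Hermitian, so that \<open>Re\<close> is applied to a
  real number here.\<close>

definition chern_form ::
    "('m::topological_space, 'n::finite) chart set \<Rightarrow> ('m, 'n) endo \<Rightarrow> ('m, 'n) conn \<Rightarrow>
     ('m, 'n) two_form" where
  "chern_form A J D p u v =
     Re (\<i> / (2 * of_real pi) * complex_trace (J p) (curvature A D p u v))"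

text \<open>The common value of the class of the Chern form for all Hermitian metrics.\<close>

definition first_bott_chern_class ::
    "('m::topological_space, 'n::finite) chart set \<Rightarrow> ('m, 'n) endo \<Rightarrow> ('m, 'n) two_form set" where
  "first_bott_chern_class A J = (THE C. \<exists>g D. hermitian_metric A J g \<and> chern_connection A J g D \<and>
     C = bott_chern_class A J (chern_form A J D))"

end

theory Submission imports Defs "HOL-Complex_Analysis.Conformal_Mappings"
begin

text \<open>In a holomorphic chart the Ricci form is \<open>(1/2) d(dh \<circ> J)\<close>, where \<open>h\<close> is the logarithm of the density of
 \<open>\<rho>\<close>, for every torsion-free connection that preserves \<open>\<rho>\<close>, and the Chern form of a Hermitian metric is
 \<open>(1/(4 \<pi>)) d(dk \<circ> J)\<close>, where \<open>k\<close> is half the logarithm of the determinant of the Gram matrix. Since \<open>h\<close> and \<open>k\<close>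
 change by the same amount under holomorphic coordinate changes, \<open>k - h\<close> is a global function, and so both forms
 represent the same class. Multiplying \<open>\<rho>\<close> by \<open>exp f\<close> adds \<open>(1/2) d(df \<circ> J)\<close> to the Ricci form. Hence the class
 vanishes if and only if some positive multiple of \<open>\<rho>\<close> has vanishing Ricci form, and Moser's theorem moves this multiple
 to \<open>\<rho>\<close> (up to a constant factor) by a diffeomorphism isotopic to the identity. No flow is needed for Moser's theorem:
 a density that differs from another one by a sum of functions \<open>\<partial>w/\<partial>x\<^sub>k\<close> with \<open>w\<close> supported in a chart is reached
 from it by finitely many rearrangements along coordinate lines. Finally, if both Ricci forms vanish, then the logarithm
 of the ratio of \<open>\<rho>\<close> and its pullback is pluriharmonic, hence constant by the maximum principle, and the constant is
 zero since both forms have the same total volume.\<close>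

section \<open>Smooth functions on Euclidean spaces\<close>

text \<open>\<open>Ric\<close> and \<open>first_bott_chern_class\<close> are definite descriptions:
  a formula valid for all admissible connections or metrics is only half of the work, and a
  torsion-free connection preserving \<open>rho\<close>, a Hermitian metric and a Chern connection
  must also be constructed, in charts and then by gluing. The tangent space at each point refers to
  its own arbitrarily chosen chart, so everything is tested on germs and moved to a common chart
  before it is differentiated. The core of the Moser step is that two densities differ by such a sum
  of derivatives once one of them is suitably scaled, a fact usually drawn from top-degree
  cohomology. Here it comes from integration along coordinate lines: in a cube every non-negative
  density reduces to a positive multiple of one product bump, and connectedness links the bumps of
  different cubes. The multiples are never computed; their positivity suffices, and the resulting
  unknown constant is harmless because the Ricci form depends only on the differential of the
  logarithm of the density. Only the uniqueness statement has to determine such a constant.\<close>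

lemma Ck_on_SucI:
 assumes "\<And>x. x \<in> S ==> (f has_derivative f' x) (at x)" "\<And>v. Ck_on k S (\<lambda>x. f' x v)"
 shows "Ck_on (Suc k) S f"
 using assms by auto

lemma Ck_on_subset: "Ck_on k S f ==> T \<subseteq> S ==> Ck_on k T f"
proof (induction k arbitrary: f)
 case 0
 then show ?case by (auto intro: continuous_on_subset)
next
 case (Suc k)
 then obtain f' where "\<forall>x\<in>S. (f has_derivative f' x) (at x)" "\<And>v. Ck_on k S (\<lambda>x. f' x v)"
  by auto
 with Suc show ?case by (auto intro!: exI[of _ f'])
qed

lemma Ck_on_cong: "Ck_on k S f ==> open S ==> (\<And>x. x \<in> S ==> f x = g x) ==> Ck_on k S g"
proof (induction k arbitrary: f)
 case 0
 then show ?case by (simp cong: continuous_on_cong)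
next
 case (Suc k)
 then obtain f' where f': "\<forall>x\<in>S. (f has_derivative f' x) (at x)" "\<And>v. Ck_on k S (\<lambda>x. f' x v)"
  by auto
 have "(g has_derivative f' x) (at x)" if "x \<in> S" for x
  using f'(1) that Suc.prems has_derivative_transform_within_open by blast
 with f' show ?case by auto
qed

lemma Ck_on_SucD: "Ck_on (Suc k) S f ==> Ck_on k S f"
proof (induction k arbitrary: f)
 case 0
 then have "isCont f x" if "x \<in> S" for x
  using that by (auto intro: has_derivative_continuous)
 then show ?case by (simp add: continuous_at_imp_continuous_on)
next
 case (Suc k)
 then obtain f' where f': "\<forall>x\<in>S. (f has_derivative f' x) (at x)" "\<And>v. Ck_on (Suc k) S (\<lambda>x. f' x v)"
  by auto
 then have "\<And>v. Ck_on k S (\<lambda>x. f' x v)" using Suc.IH by blast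
 with f' show ?case by auto
qed

abbreviation fd :: "('a::real_normed_vector => 'b::real_normed_vector) => 'a => 'a => 'b" where
 "fd f x \<equiv> frechet_derivative f (at x)"

lemma fd_eqI: "(f has_derivative f') (at x) ==> fd f x = f'"
 by (metis frechet_derivative_at)

text \<open>The derivative hidden in the existential of \<open>Ck_on\<close> is unique, so it can be
  replaced by \<open>frechet_derivative\<close>, which does not depend on the set. This is what
  makes the C^k conditions local.\<close>

lemma Ck_on_Suc_iff:
 assumes "open S"
 shows "Ck_on (Suc k) S f \<longleftrightarrow> (\<forall>x\<in>S. f differentiable at x) \<and> (\<forall>v. Ck_on k S (\<lambda>x. fd f x v))"
proof
 assume "Ck_on (Suc k) S f"
 then obtain f' where f': "\<forall>x\<in>S. (f has_derivative f' x) (at x)" "\<And>v. Ck_on k S (\<lambda>x. f' x v)"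
  by auto
 have "Ck_on k S (\<lambda>x. fd f x v)" for v
  by (rule Ck_on_cong[OF f'(2)[of v] assms]) (metis f'(1) fd_eqI)
 then show "(\<forall>x\<in>S. f differentiable at x) \<and> (\<forall>v. Ck_on k S (\<lambda>x. fd f x v))"
  using f'(1) by (auto simp: differentiable_def)
next
 assume "(\<forall>x\<in>S. f differentiable at x) \<and> (\<forall>v. Ck_on k S (\<lambda>x. fd f x v))"
 then show "Ck_on (Suc k) S f"
  by (auto simp: frechet_derivative_works intro!: exI[of _ "\<lambda>x. fd f x"])
qed

lemma Ck_on_local:
 assumes "open S" "\<And>x. x \<in> S ==> \<exists>T. open T \<and> x \<in> T \<and> Ck_on k T f"
 shows "Ck_on k S f"
 using assms(2)
proof (induction k arbitrary: f)
 case 0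
 have "isCont f x" if "x \<in> S" for x
  using 0[OF that] by (auto simp: continuous_on_eq_continuous_at)
 then show ?case by (simp add: continuous_at_imp_continuous_on)
next
 case (Suc k)
 have *: "\<exists>T. open T \<and> x \<in> T \<and> f differentiable at x \<and> (\<forall>v. Ck_on k T (\<lambda>x. fd f x v))"
  if x: "x \<in> S" for x
 proof -
  obtain T where "open T" "x \<in> T" "Ck_on (Suc k) T f" using Suc.prems[OF x] by blast
  then show ?thesis using Ck_on_Suc_iff[of T k f] by blast
 qed
 then have "f differentiable at x" if "x \<in> S" for x
  using that by blast
 moreover have "Ck_on k S (\<lambda>x. fd f x v)" for v
  by (rule Suc.IH) (use * in blast)
 ultimately show ?case using assms(1) by (simp add: Ck_on_Suc_iff del: Ck_on.simps)
qed

text \<open>Smoothness of a germ. Functions on the manifold are compared in charts with different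
  domains, and no common domain has to be carried along when the condition is attached to a
  point.\<close>

definition smooth_at :: "('a::euclidean_space => 'b::real_normed_vector) => 'a => bool" where
 "smooth_at f x \<longleftrightarrow> (\<exists>S. x \<in> S \<and> smooth_on S f)"

lemma smooth_on_iff_smooth_at: "smooth_on S f \<longleftrightarrow> open S \<and> (\<forall>x\<in>S. smooth_at f x)"
proof
 assume "open S \<and> (\<forall>x\<in>S. smooth_at f x)"
 then have "open S" "\<And>x. x \<in> S ==> \<exists>T. x \<in> T \<and> open T \<and> (\<forall>k. Ck_on k T f)"
  by (auto simp: smooth_on_def smooth_at_def)
 then have "Ck_on k S f" for k
  by (intro Ck_on_local) blast+
 then show "smooth_on S f"
  using \<open>open S\<close> by (simp add: smooth_on_def)
qed (auto simp: smooth_at_def smooth_on_def)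

lemma smooth_at_iff_Ck: "smooth_at f x \<longleftrightarrow> (\<exists>S. open S \<and> x \<in> S \<and> (\<forall>k. Ck_on k S f))"
 by (auto simp: smooth_at_def smooth_on_def)

lemma smooth_at_has_derivative: "smooth_at f x ==> (f has_derivative fd f x) (at x)"
proof -
 assume "smooth_at f x"
 then obtain S where "open S" "x \<in> S" "Ck_on (Suc 0) S f" by (auto simp: smooth_at_iff_Ck simp del: Ck_on.simps)
 then show ?thesis by (auto simp: Ck_on_Suc_iff frechet_derivative_works simp del: Ck_on.simps)
qed

lemma smooth_at_isCont: "smooth_at f x ==> isCont f x"
 by (meson has_derivative_continuous smooth_at_has_derivative)

lemma smooth_at_fd: "smooth_at f x ==> smooth_at (\<lambda>y. fd f y v) x"
proof -
 assume "smooth_at f x"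
 then obtain S where S: "open S" "x \<in> S" "\<And>k. Ck_on k S f" by (auto simp: smooth_at_iff_Ck)
 then have "Ck_on k S (\<lambda>y. fd f y v)" for k using S(3)[of "Suc k"] Ck_on_Suc_iff[of S k f] by blast
 then show ?thesis using S unfolding smooth_at_iff_Ck by blast
qed

lemma smooth_at_eventually: "smooth_at f x ==> \<forall>\<^sub>F y in nhds x. smooth_at f y"
 unfolding eventually_nhds smooth_at_iff_Ck by blast

lemma smooth_at_cong: "smooth_at f x ==> \<forall>\<^sub>F y in nhds x. f y = g y ==> smooth_at g x"
proof -
 assume "smooth_at f x" "\<forall>\<^sub>F y in nhds x. f y = g y"
 then obtain S T where "open S" "x \<in> S" "\<And>k. Ck_on k S f" "open T" "x \<in> T" "\<And>y. y \<in> T ==> f y = g y"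
  by (auto simp: smooth_at_iff_Ck eventually_nhds)
 then have "Ck_on k (S \<inter> T) g" for k
  using Ck_on_cong[OF Ck_on_subset[of k S f "S \<inter> T"], of g] by (simp add: open_Int)
 moreover have "open (S \<inter> T)" "x \<in> S \<inter> T"
  using \<open>open S\<close> \<open>open T\<close> \<open>x \<in> S\<close> \<open>x \<in> T\<close> by auto
 ultimately show "smooth_at g x" unfolding smooth_at_iff_Ck by blast
qed

lemma fd_cong: "\<forall>\<^sub>F y in nhds x. f y = g y ==> fd f x = fd g x"
proof -
 assume "\<forall>\<^sub>F y in nhds x. f y = g y"
 then have ev: "\<forall>\<^sub>F y in at x. f y = g y" "\<forall>\<^sub>F y in at x. g y = f y" "f x = g x"
  by (auto simp: eventually_at_filter elim: eventually_mono dest: eventually_nhds_x_imp_x)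
 then have "(f has_derivative f') (at x) \<longleftrightarrow> (g has_derivative f') (at x)" for f'
  using has_derivative_transform_eventually[of f f' x UNIV g]
   has_derivative_transform_eventually[of g f' x UNIV f] by auto
 then show ?thesis by (simp add: frechet_derivative_def)
qed

lemma smooth_at_linear: "smooth_at f x ==> linear (fd f x)"
 using has_derivative_linear smooth_at_has_derivative by blast

lemma fd_scale_right: "smooth_at f x ==> fd f x (c *\<^sub>R u) = c *\<^sub>R fd f x u"
 by (simp add: linear_scale smooth_at_linear)

subsection \<open>Closure properties\<close>

lemma Ck_on_const: "Ck_on k S (\<lambda>x. c)"
proof (induction k arbitrary: c)
 case (Suc k)
 show ?case by (rule Ck_on_SucI[of _ _ "\<lambda>x v. 0"]) (simp, rule Suc)
qed simp

lemma Ck_on_bounded_linear: "bounded_linear f ==> Ck_on k S f"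
proof (cases k)
 case (Suc j)
 assume f: "bounded_linear f"
 show ?thesis unfolding Suc
  by (rule Ck_on_SucI[of _ _ "\<lambda>x. f"]) (auto simp: f bounded_linear_imp_has_derivative Ck_on_const)
qed (simp add: linear_continuous_on)

lemma Ck_on_add: "Ck_on k S f ==> Ck_on k S g ==> Ck_on k S (\<lambda>x. f x + g x)"
proof (induction k arbitrary: f g)
 case (Suc k)
 then obtain f' g' where f': "\<forall>x\<in>S. (f has_derivative f' x) (at x)" "\<And>v. Ck_on k S (\<lambda>x. f' x v)"
  and g': "\<forall>x\<in>S. (g has_derivative g' x) (at x)" "\<And>v. Ck_on k S (\<lambda>x. g' x v)"
  by auto
 show ?case
  by (rule Ck_on_SucI[of _ _ "\<lambda>x v. f' x v + g' x v"]) (auto intro!: has_derivative_add Suc.IH f' g' simp: f'(1) g'(1))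
qed (auto intro: continuous_on_add)

lemma Ck_on_sum: "(\<And>i. i \<in> I ==> Ck_on k S (f i)) ==> Ck_on k S (\<lambda>x. \<Sum>i\<in>I. f i x)"
proof (induction I rule: infinite_finite_induct)
 case (insert i I)
 then show ?case by (simp add: Ck_on_add)
qed (auto simp: Ck_on_const)

lemma Ck_on_bilinear:
 assumes "bounded_bilinear pr"
 shows "Ck_on k S f ==> Ck_on k S g ==> Ck_on k S (\<lambda>x. pr (f x) (g x))"
proof (induction k arbitrary: f g)
 case 0
 then show ?case by (simp add: bounded_bilinear.continuous_on[OF assms])
next
 case (Suc k)
 then obtain f' g' where f': "\<forall>x\<in>S. (f has_derivative f' x) (at x)" "\<And>v. Ck_on k S (\<lambda>x. f' x v)"
  and g': "\<forall>x\<in>S. (g has_derivative g' x) (at x)" "\<And>v. Ck_on k S (\<lambda>x. g' x v)"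
  by auto
 have "Ck_on k S (\<lambda>x. pr (f x) (g' x v) + pr (f' x v) (g x))" for v
  using Suc.prems by (intro Ck_on_add Suc.IH f' g') (auto dest: Ck_on_SucD simp del: Ck_on.simps)
 then show ?case
  by (intro Ck_on_SucI[of _ _ "\<lambda>x v. pr (f x) (g' x v) + pr (f' x v) (g x)"])
   (auto intro!: bounded_bilinear.FDERIV[OF assms] simp: f'(1) g'(1))
qed

lemma Ck_on_compose:
 fixes f :: "'b::euclidean_space => 'c::real_normed_vector" and g :: "'a::euclidean_space => 'b"
 shows "Ck_on k T f ==> Ck_on k S g ==> g ` S \<subseteq> T ==> Ck_on k S (\<lambda>x. f (g x))"
proof (induction k arbitrary: f g)
 case 0
 then show ?case by (auto intro: continuous_on_compose2)
next
 case (Suc k)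
 then obtain f' g' where f': "\<forall>x\<in>T. (f has_derivative f' x) (at x)" "\<And>v. Ck_on k T (\<lambda>x. f' x v)"
  and g': "\<forall>x\<in>S. (g has_derivative g' x) (at x)" "\<And>v. Ck_on k S (\<lambda>x. g' x v)"
  by auto
 \<comment> \<open>The induction hypothesis controls \<open>f'\<close> only in fixed directions,
   whereas the chain rule produces the moving direction \<open>g' x v\<close>; expansion in
   \<open>Basis\<close> separates the two.\<close>
 let ?h = "\<lambda>x v. \<Sum>i\<in>Basis. (g' x v \<bullet> i) *\<^sub>R f' (g x) i"
 have "Ck_on k S g" using Suc.prems Ck_on_SucD by blast
 then have "Ck_on k S (\<lambda>x. ?h x v)" for v
  using Suc.prems(3)
  by (intro Ck_on_sum Ck_on_bilinear[OF bounded_bilinear_scaleR] Ck_on_bilinear[OF bounded_bilinear_inner]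
    Suc.IH f' g' Ck_on_const) auto
 moreover have D: "((\<lambda>x. f (g x)) has_derivative ?h x) (at x)" if "x \<in> S" for x
 proof -
  have fx: "(f has_derivative f' (g x)) (at (g x))" using f'(1) Suc.prems(3) that by auto
  have "((\<lambda>x. f (g x)) has_derivative (\<lambda>v. f' (g x) (g' x v))) (at x)"
   using has_derivative_compose[of g "g' x" x UNIV f] g'(1) that fx by auto
  moreover have "f' (g x) (g' x v) = ?h x v" for v
  proof -
   have "linear (f' (g x))" using fx has_derivative_linear by blast
   then show ?thesis
    by (subst euclidean_representation[of "g' x v", symmetric])
     (simp add: linear_sum linear_scale del: euclidean_representation)
  qed
  ultimately show ?thesis by (simp only:)
 qed
 ultimately show ?case by (intro Ck_on_SucI[of _ _ ?h]) auto
qed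

declare Ck_on.simps [simp del]

lemma smooth_at_Ck_2:
 assumes "\<And>k S. Ck_on k S f ==> Ck_on k S g ==> Ck_on k S h" "smooth_at f x" "smooth_at g x"
 shows "smooth_at h x"
proof -
 obtain S T where "open S" "x \<in> S" "\<And>k. Ck_on k S f" "open T" "x \<in> T" "\<And>k. Ck_on k T g"
  using assms(2,3) by (auto simp: smooth_at_iff_Ck)
 then have "Ck_on k (S \<inter> T) h" for k
  by (meson Ck_on_subset assms(1) inf_le1 inf_le2)
 then show ?thesis unfolding smooth_at_iff_Ck
  using \<open>open S\<close> \<open>x \<in> S\<close> \<open>open T\<close> \<open>x \<in> T\<close> by blast
qed

named_theorems smooth_intros

lemma smooth_at_const [smooth_intros]: "smooth_at (\<lambda>x. c) x"
 by (auto simp: smooth_at_iff_Ck Ck_on_const intro!: exI[of _ UNIV])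

lemma smooth_at_bounded_linear: "bounded_linear f ==> smooth_at f x"
 by (auto simp: smooth_at_iff_Ck Ck_on_bounded_linear intro!: exI[of _ UNIV])

lemma smooth_at_linear_map: "linear f ==> smooth_at f x"
 by (simp add: linear_conv_bounded_linear smooth_at_bounded_linear)

lemma smooth_at_id [smooth_intros]: "smooth_at (\<lambda>x. x) x"
 by (rule smooth_at_bounded_linear) simp

lemma smooth_at_add [smooth_intros]: "smooth_at f x ==> smooth_at g x ==> smooth_at (\<lambda>x. f x + g x) x"
 by (rule smooth_at_Ck_2[OF Ck_on_add])

lemma smooth_at_bilinear:
 "bounded_bilinear pr ==> smooth_at f x ==> smooth_at g x ==> smooth_at (\<lambda>x. pr (f x) (g x)) x"
 by (rule smooth_at_Ck_2[OF Ck_on_bilinear])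

lemmas smooth_at_scaleR [smooth_intros] = smooth_at_bilinear[OF bounded_bilinear_scaleR]
 and smooth_at_mult [smooth_intros] = smooth_at_bilinear[OF bounded_bilinear_mult]
 and smooth_at_inner [smooth_intros] = smooth_at_bilinear[OF bounded_bilinear_inner]

lemma smooth_at_compose:
 fixes f :: "'b::euclidean_space => 'c::real_normed_vector" and g :: "'a::euclidean_space => 'b"
 assumes "smooth_at f (g x)" "smooth_at g x"
 shows "smooth_at (\<lambda>x. f (g x)) x"
proof -
 obtain S T where *: "open S" "x \<in> S" "\<And>k. Ck_on k S g" "open T" "g x \<in> T" "\<And>k. Ck_on k T f"
  using assms by (auto simp: smooth_at_iff_Ck)
 have "continuous_on S g" using *(3)[of 0] by (simp add: Ck_on.simps)
 then have "open (S \<inter> g -` T)" using * by (simp add: continuous_on_open_vimage Int_commute)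
 moreover have "Ck_on k (S \<inter> g -` T) (\<lambda>x. f (g x))" for k
  by (rule Ck_on_compose[OF *(6) Ck_on_subset[OF *(3)]]) auto
 ultimately show ?thesis unfolding smooth_at_iff_Ck using * by blast
qed

lemma smooth_at_linear_compose: "linear f ==> smooth_at g x ==> smooth_at (\<lambda>x. f (g x)) x"
 for f :: "'b::euclidean_space => 'c::real_normed_vector"
 by (rule smooth_at_compose[OF smooth_at_linear_map])

lemma smooth_at_minus [smooth_intros]: "smooth_at f x ==> smooth_at (\<lambda>x. - f x) x"
 using smooth_at_scaleR[OF smooth_at_const, of f x "-1"] by simp

lemma smooth_at_diff [smooth_intros]: "smooth_at f x ==> smooth_at g x ==> smooth_at (\<lambda>x. f x - g x) x"
 unfolding diff_conv_add_uminus by (intro smooth_at_add smooth_at_minus)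

lemma smooth_at_sum [smooth_intros]: "(\<And>i. i \<in> I ==> smooth_at (f i) x) ==> smooth_at (\<lambda>x. \<Sum>i\<in>I. f i x) x"
 by (induction I rule: infinite_finite_induct) (simp_all add: smooth_at_const smooth_at_add)

lemma smooth_at_prod [smooth_intros]:
 "(\<And>i. i \<in> I ==> smooth_at (f i) x) ==> smooth_at (\<lambda>x. \<Prod>i\<in>I. f i x :: real) x"
 by (induction I rule: infinite_finite_induct) (simp_all add: smooth_at_const smooth_at_mult)

lemma smooth_at_euclideanI:
 fixes f :: "'a::euclidean_space => 'b::euclidean_space"
 assumes "\<And>i. i \<in> Basis ==> smooth_at (\<lambda>x. f x \<bullet> i) x"
 shows "smooth_at f x"
 using smooth_at_sum[of Basis "\<lambda>i x. (f x \<bullet> i) *\<^sub>R i" x, OF smooth_at_scaleR[OF assms smooth_at_const]]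
 by (simp add: euclidean_representation)

lemma smooth_at_vec_nth [smooth_intros]: "smooth_at f x ==> smooth_at (\<lambda>x. f x $ i :: 'b::euclidean_space) x"
 by (rule smooth_at_linear_compose[of "\<lambda>y. y $ i"]) (simp_all add: bounded_linear.linear bounded_linear_vec_nth)

lemma smooth_at_vec_lambda [smooth_intros]:
 fixes f :: "_ => 'k::finite => real"
 assumes "\<And>i. smooth_at (\<lambda>x. f x i) x"
 shows "smooth_at (\<lambda>x. \<chi> i. f x i) x"
proof (rule smooth_at_euclideanI)
 fix b :: "real^'k" assume "b \<in> Basis"
 then obtain k where "b = axis k 1" by (auto simp: Basis_vec_def)
 then show "smooth_at (\<lambda>x. (\<chi> i. f x i) \<bullet> b) x"
  using assms by (simp add: inner_axis)
qed

lemma smooth_at_vecI: "(\<And>i. smooth_at (\<lambda>x. f x $ i :: real) x) ==> smooth_at f x"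
 using smooth_at_vec_lambda[of "\<lambda>x i. f x $ i"] by simp

lemma smooth_at_fst [smooth_intros]: "smooth_at f x ==> smooth_at (\<lambda>x. fst (f x)) x"
 for f :: "_ => 'b::euclidean_space \<times> 'c::euclidean_space"
 by (rule smooth_at_linear_compose[of fst]) (simp_all add: linear_fst)

lemma smooth_at_snd [smooth_intros]: "smooth_at f x ==> smooth_at (\<lambda>x. snd (f x)) x"
 for f :: "_ => 'b::euclidean_space \<times> 'c::euclidean_space"
 by (rule smooth_at_linear_compose[of snd]) (simp_all add: linear_snd)

lemma smooth_at_Pair [smooth_intros]:
 fixes f :: "_ => 'b::euclidean_space" and g :: "_ => 'c::euclidean_space"
 assumes "smooth_at f x" "smooth_at g x"
 shows "smooth_at (\<lambda>x. (f x, g x)) x"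
proof -
 have "smooth_at (\<lambda>x. (f x, 0) + (0, g x)) x"
  using assms by (intro smooth_at_add smooth_at_linear_compose[of "\<lambda>y. (y, 0)"] smooth_at_linear_compose[of "\<lambda>y. (0, y)"])
   (simp_all add: linear_iff)
 then show ?thesis by simp
qed

lemma smooth_at_det [smooth_intros]:
 assumes "\<And>i j. smooth_at (\<lambda>x. M x $ i $ j) x"
 shows "smooth_at (\<lambda>x. det (M x :: real^'k^'k)) x"
 unfolding det_def by (intro smooth_intros assms)

lemma Ck_on_inverse: "Ck_on k (- {0}) (inverse :: real => real)"
proof (induction k)
 case 0
 show ?case by (auto simp: Ck_on.simps intro!: continuous_intros)
next
 case (Suc k)
 have "Ck_on k (- {0}) (\<lambda>x::real. - (inverse x * v * inverse x))" for v
  using Ck_on_bilinear[OF bounded_bilinear_mult Ck_on_bilinear[OF bounded_bilinear_mult Ck_on_const[of k _ "-v"] Suc] Suc]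
  by (simp add: mult_ac)
 then show ?case
  by (intro Ck_on_SucI[of _ _ "\<lambda>x h. - (inverse x * h * inverse x)"]) (auto intro!: has_derivative_inverse')
qed

lemma smooth_at_inverse [smooth_intros]:
 "smooth_at f x ==> f x \<noteq> 0 ==> smooth_at (\<lambda>x. inverse (f x) :: real) x"
 by (rule smooth_at_compose[of inverse])
  (auto simp: smooth_at_iff_Ck Ck_on_inverse intro!: exI[of _ "- {0}"])

lemma smooth_at_divide [smooth_intros]:
 "smooth_at f x ==> smooth_at g x ==> g x \<noteq> 0 ==> smooth_at (\<lambda>x. f x / g x :: real) x"
 unfolding divide_inverse by (intro smooth_intros)

lemma Ck_on_exp: "Ck_on k S (exp :: real => real)"
proof (induction k)
 case (Suc k)
 have "Ck_on k S (\<lambda>x::real. v * exp x)" for v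
  using Ck_on_bilinear[OF bounded_bilinear_mult Ck_on_const[of k S v] Suc] by simp
 moreover have "(exp has_derivative (\<lambda>h. h * exp x)) (at x)" for x :: real
  using DERIV_exp[of x] by (simp add: has_field_derivative_def mult.commute[of _ "exp x"])
 ultimately show ?case by (intro Ck_on_SucI[of _ _ "\<lambda>x h. h * exp x"]) auto
qed (auto simp: Ck_on.simps intro!: continuous_intros)

lemma smooth_at_exp [smooth_intros]: "smooth_at f x ==> smooth_at (\<lambda>x. exp (f x) :: real) x"
 by (rule smooth_at_compose[of exp])
  (auto simp: smooth_at_iff_Ck Ck_on_exp intro!: exI[of _ "UNIV"])

lemma Ck_on_ln: "Ck_on k {0<..} (ln :: real => real)"
proof (cases k)
 case (Suc j)
 have "Ck_on j {0<..} (\<lambda>x::real. v * inverse x)" for v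
  using Ck_on_bilinear[OF bounded_bilinear_mult Ck_on_const[of j _ v] Ck_on_subset[OF Ck_on_inverse, of "{0<..}"]] by auto
 moreover have "(ln has_derivative (\<lambda>h. h * inverse x)) (at x)" if "x > 0" for x :: real
  using DERIV_ln[OF that] by (simp add: has_field_derivative_def mult.commute[of _ "inverse x"])
 ultimately show ?thesis unfolding Suc by (intro Ck_on_SucI[of _ _ "\<lambda>x h. h * inverse x"]) auto
qed (auto simp: Ck_on.simps intro!: continuous_intros)

lemma smooth_at_ln [smooth_intros]: "smooth_at f x ==> f x > 0 ==> smooth_at (\<lambda>x. ln (f x) :: real) x"
 by (rule smooth_at_compose[of ln])
  (auto simp: smooth_at_iff_Ck Ck_on_ln intro!: exI[of _ "{0<..}"])

subsection \<open>Rules for derivatives\<close>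

lemma fd_compose:
 assumes "smooth_at f (g x)" "smooth_at g x"
 shows "fd (\<lambda>x. f (g x)) x v = fd f (g x) (fd g x v)"
 using has_derivative_compose[of g "fd g x" x UNIV f "fd f (g x)"] assms
 by (simp add: smooth_at_has_derivative fd_eqI)

lemma fd_const [simp]: "fd (\<lambda>x. c) x v = 0"
 by (simp add: fd_eqI)

lemma fd_linear: "linear f ==> fd f x = f" for f :: "'a::euclidean_space => _"
 by (simp add: linear_conv_bounded_linear bounded_linear_imp_has_derivative fd_eqI)

lemma fd_bilinear:
 assumes "bounded_bilinear pr" "smooth_at f x" "smooth_at g x"
 shows "fd (\<lambda>x. pr (f x) (g x)) x v = pr (f x) (fd g x v) + pr (fd f x v) (g x)"
 by (rule fun_cong[OF fd_eqI]) (intro bounded_bilinear.FDERIV[OF assms(1)] assms smooth_at_has_derivative)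

lemma fd_add:
 "smooth_at f x ==> smooth_at g x ==> fd (\<lambda>x. f x + g x) x v = fd f x v + fd g x v"
 by (rule fun_cong[OF fd_eqI]) (intro has_derivative_add smooth_at_has_derivative)

lemma fd_sum:
 assumes "\<And>i. i \<in> I ==> smooth_at (f i) x"
 shows "fd (\<lambda>x. \<Sum>i\<in>I. f i x) x v = (\<Sum>i\<in>I. fd (f i) x v)"
 by (rule fun_cong[OF fd_eqI]) (intro has_derivative_sum smooth_at_has_derivative assms)

lemma fd_line_deriv:
 assumes "smooth_at f (x + s *\<^sub>R u)"
 shows "((\<lambda>s. f (x + s *\<^sub>R u)) has_real_derivative fd f (x + s *\<^sub>R u) u) (at s)"
proof -
 have "((\<lambda>s. x + s *\<^sub>R u) has_derivative (\<lambda>h. h *\<^sub>R u)) (at s)"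
  by (auto intro!: derivative_eq_intros)
 from has_derivative_compose[OF this smooth_at_has_derivative[OF assms]]
 show ?thesis
  using assms by (simp add: has_field_derivative_def fd_scale_right mult.commute[of _ "fd f (x + s *\<^sub>R u) u"])
qed

lemma fd_mean_value:
 assumes "h > 0" "\<And>s. 0 \<le> s ==> s \<le> h ==> smooth_at f (x + s *\<^sub>R u)"
 obtains s where "0 < s" "s < h" "f (x + h *\<^sub>R u) - f x = h * fd f (x + s *\<^sub>R u) u"
 using MVT2[of 0 h "\<lambda>s. f (x + s *\<^sub>R u)" "\<lambda>s. fd f (x + s *\<^sub>R u) u"] assms(1)
  fd_line_deriv[OF assms(2)] by auto

text \<open>The mean value theorem is applied twice: to the increment in direction \<open>v\<close>,
  moved in direction \<open>u\<close>, and then to the resulting increment of the first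
  derivative.\<close>

lemma fd_second_difference:
 fixes f :: "'a::euclidean_space => real"
 assumes "h > 0" "\<And>s t. 0 \<le> s ==> s \<le> h ==> 0 \<le> t ==> t \<le> h ==> smooth_at f (x + s *\<^sub>R u + t *\<^sub>R v)"
 obtains s t where "0 < s" "s < h" "0 < t" "t < h"
  "f (x + h *\<^sub>R u + h *\<^sub>R v) - f (x + h *\<^sub>R u) - f (x + h *\<^sub>R v) + f x
   = h * (h * fd (\<lambda>y. fd f y u) (x + s *\<^sub>R u + t *\<^sub>R v) v)"
proof -
 let ?a = "\<lambda>y. f (y + h *\<^sub>R v) - f y"
 have sm: "smooth_at f (x + s *\<^sub>R u)" "smooth_at (\<lambda>y. f (y + h *\<^sub>R v)) (x + s *\<^sub>R u)" if "0 \<le> s" "s \<le> h" for s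
  using assms(1) assms(2)[OF that, of 0] assms(2)[OF that, of h]
  by (auto intro!: smooth_at_compose[of f] smooth_intros)
 obtain s where s: "0 < s" "s < h" "?a (x + h *\<^sub>R u) - ?a x = h * fd ?a (x + s *\<^sub>R u) u"
  by (rule fd_mean_value[OF assms(1), of ?a x u]) (auto intro: smooth_at_diff sm)
 have trans: "fd (\<lambda>y. y + h *\<^sub>R v) z w = w" for z w
  by (rule fun_cong[OF fd_eqI]) (auto intro!: derivative_eq_intros)
 have "fd ?a (x + s *\<^sub>R u) u = fd (\<lambda>y. f (y + h *\<^sub>R v)) (x + s *\<^sub>R u) u - fd f (x + s *\<^sub>R u) u"
  by (rule fun_cong[OF fd_eqI]) (use sm s in "auto intro!: has_derivative_diff smooth_at_has_derivative")
 also have "fd (\<lambda>y. f (y + h *\<^sub>R v)) (x + s *\<^sub>R u) u = fd f (x + s *\<^sub>R u + h *\<^sub>R v) u"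
  using assms(2)[of s h] s assms(1)
  by (subst fd_compose) (auto simp: trans intro!: smooth_intros)
 finally have 1: "fd ?a (x + s *\<^sub>R u) u = fd f (x + s *\<^sub>R u + h *\<^sub>R v) u - fd f (x + s *\<^sub>R u) u" .
 obtain t where t: "0 < t" "t < h" "fd f (x + s *\<^sub>R u + h *\<^sub>R v) u - fd f (x + s *\<^sub>R u) u
   = h * fd (\<lambda>y. fd f y u) (x + s *\<^sub>R u + t *\<^sub>R v) v"
  by (rule fd_mean_value[OF assms(1), of "\<lambda>y. fd f y u" "x + s *\<^sub>R u" v])
   (use s assms(2) in "auto intro: smooth_at_fd")
 show ?thesis by (rule that[OF s(1,2) t(1,2)]) (use s(3) t(3) 1 in "simp add: algebra_simps")
qed

text \<open>The second difference is symmetric in \<open>u\<close> and \<open>v\<close>, so the two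
  mixed derivatives take a common value at points of an arbitrarily small parallelogram; their
  continuity does the rest.\<close>

lemma fd_commute_real:
 fixes f :: "'a::euclidean_space => real"
 assumes "smooth_at f x"
 shows "fd (\<lambda>y. fd f y u) x v = fd (\<lambda>y. fd f y v) x u"
proof (rule ccontr)
 let ?A = "\<lambda>z. fd (\<lambda>y. fd f y u) z v" and ?B = "\<lambda>z. fd (\<lambda>y. fd f y v) z u"
 assume ne: "?A x \<noteq> ?B x"
 define e where "e = \<bar>?A x - ?B x\<bar> / 2"
 have "e > 0" using ne by (simp add: e_def)
 have cont: "isCont ?A x" "isCont ?B x"
  by (rule smooth_at_isCont[OF smooth_at_fd[OF smooth_at_fd[OF assms]]])+
 have "\<forall>\<^sub>F z in nhds x. dist (?A z) (?A x) < e" "\<forall>\<^sub>F z in nhds x. dist (?B z) (?B x) < e"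
  by (rule tendstoD[OF tendsto_at_iff_tendsto_nhds[THEN iffD1, OF isContD]], rule cont, rule \<open>e > 0\<close>)+
 then have ev: "\<forall>\<^sub>F z in nhds x. dist (?A z) (?A x) < e \<and> dist (?B z) (?B x) < e \<and> smooth_at f z"
  using smooth_at_eventually[OF assms] by eventually_elim simp
 obtain r where r: "r > 0" "\<And>z. dist z x < r ==> dist (?A z) (?A x) < e \<and> dist (?B z) (?B x) < e \<and> smooth_at f z"
  by (rule exE[OF ev[unfolded eventually_nhds_metric]]) blast
 define N where "N = norm u + norm v + 1"
 have N: "N > 0" "norm u + norm v \<le> N" by (simp_all add: N_def add_nonneg_pos)
 \<comment> \<open>As \<open>N\<close> bounds the sum of the two norms, the parallelogram with side
   factor \<open>h\<close> lies in the ball of radius \<open>r\<close>, where each mixed derivative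
   differs from its value at \<open>x\<close> by less than \<open>e\<close>.\<close>
 define h where "h = r / (2 * N)"
 have h: "h > 0" using r(1) N(1) by (simp add: h_def)
 have near: "dist (x + s *\<^sub>R u + t *\<^sub>R v) x < r" if "0 \<le> s" "s \<le> h" "0 \<le> t" "t \<le> h" for s t
 proof -
  have "norm (s *\<^sub>R u + t *\<^sub>R v) \<le> norm (s *\<^sub>R u) + norm (t *\<^sub>R v)" by (rule norm_triangle_ineq)
  also have "\<dots> = s * norm u + t * norm v" using that by simp
  also have "\<dots> \<le> h * norm u + h * norm v" by (intro add_mono mult_right_mono that norm_ge_zero)
  also have "\<dots> = h * (norm u + norm v)" by (simp only: distrib_left)
  also have "\<dots> \<le> h * N" using h N(2) by (intro mult_left_mono) auto
  also have "h * N < r" using N(1) r(1) by (simp add: h_def)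
  finally show ?thesis by (simp add: dist_norm add.assoc)
 qed
 have sm: "smooth_at f (x + s *\<^sub>R u + t *\<^sub>R v)" if "0 \<le> s" "s \<le> h" "0 \<le> t" "t \<le> h" for s t
  using near[OF that] r(2) by blast
 obtain s t where st: "0 < s" "s < h" "0 < t" "t < h"
  "f (x + h *\<^sub>R u + h *\<^sub>R v) - f (x + h *\<^sub>R u) - f (x + h *\<^sub>R v) + f x
   = h * (h * fd (\<lambda>y. fd f y u) (x + s *\<^sub>R u + t *\<^sub>R v) v)"
  by (rule fd_second_difference[OF h, of f x u v]) (rule sm)
 have near': "dist (x + s *\<^sub>R v + t *\<^sub>R u) x < r" if "0 \<le> s" "s \<le> h" "0 \<le> t" "t \<le> h" for s t
  using near[OF that(3,4,1,2)] by (metis (no_types) add.assoc add.commute)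
 have sm': "smooth_at f (x + s *\<^sub>R v + t *\<^sub>R u)" if "0 \<le> s" "s \<le> h" "0 \<le> t" "t \<le> h" for s t
  using near'[OF that] r(2) by blast
 obtain s' t' where st': "0 < s'" "s' < h" "0 < t'" "t' < h"
  "f (x + h *\<^sub>R v + h *\<^sub>R u) - f (x + h *\<^sub>R v) - f (x + h *\<^sub>R u) + f x
   = h * (h * fd (\<lambda>y. fd f y v) (x + s' *\<^sub>R v + t' *\<^sub>R u) u)"
  by (rule fd_second_difference[OF h, of f x v u]) (rule sm')
 have sw: "x + h *\<^sub>R v + h *\<^sub>R u = x + h *\<^sub>R u + h *\<^sub>R v" by (simp only: add_ac)
 have "h * (h * ?A (x + s *\<^sub>R u + t *\<^sub>R v)) = h * (h * ?B (x + s' *\<^sub>R v + t' *\<^sub>R u))"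
  using st(5) st'(5) unfolding sw by linarith
 then have "?A (x + s *\<^sub>R u + t *\<^sub>R v) = ?B (x + s' *\<^sub>R v + t' *\<^sub>R u)" using h by simp
 moreover have "\<bar>?A (x + s *\<^sub>R u + t *\<^sub>R v) - ?A x\<bar> < e"
  using r(2)[OF near[of s t]] st(1-4) by (simp add: dist_real_def)
 moreover have "\<bar>?B (x + s' *\<^sub>R v + t' *\<^sub>R u) - ?B x\<bar> < e"
  using r(2)[OF near'[of s' t']] st'(1-4) by (simp add: dist_real_def)
 ultimately have "\<bar>?A x - ?B x\<bar> < 2 * e" by linarith
 then show False by (simp add: e_def)
qed

lemma fd_commute:
 fixes f :: "'a::euclidean_space => 'b::euclidean_space"
 assumes "smooth_at f x"
 shows "fd (\<lambda>y. fd f y u) x v = fd (\<lambda>y. fd f y v) x u"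
proof (rule euclidean_eqI)
 fix b :: 'b assume "b \<in> Basis"
 have 1: "fd (\<lambda>y. g y \<bullet> b) y w = fd g y w \<bullet> b" if "smooth_at g y" for g :: "'a => 'b" and y w
  using fd_bilinear[OF bounded_bilinear_inner that smooth_at_const, of b] by simp
 have 2: "fd (\<lambda>y. fd f y p) x q \<bullet> b = fd (\<lambda>y. fd (\<lambda>y. f y \<bullet> b) y p) x q" for p q
 proof -
  have "fd (\<lambda>y. fd f y p) x q \<bullet> b = fd (\<lambda>y. fd f y p \<bullet> b) x q"
   by (rule 1[OF smooth_at_fd[OF assms], symmetric])
  also have "\<dots> = fd (\<lambda>y. fd (\<lambda>y. f y \<bullet> b) y p) x q"
   by (rule fun_cong[OF fd_cong], rule eventually_mono[OF smooth_at_eventually[OF assms]]) (rule 1[symmetric])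
  finally show ?thesis .
 qed
 show "fd (\<lambda>y. fd f y u) x v \<bullet> b = fd (\<lambda>y. fd f y v) x u \<bullet> b"
  unfolding 2 by (rule fd_commute_real[OF smooth_at_inner[OF assms smooth_at_const]])
qed

section \<open>Bump functions\<close>

text \<open>The family consists of exp (-1/x) multiplied by the powers of 1/x that its derivatives
  produce. It is closed under differentiation up to linear combinations, so all members are treated
  in one induction.\<close>

definition flat :: "nat => real => real" where
 "flat j x = (if x > 0 then inverse x ^ j * exp (- inverse x) else 0)"

lemma power_le_fact_exp: "y ^ n \<le> fact n * exp y" if "y \<ge> 0" for y :: real
proof -
 have "(\<Sum>k\<in>{n}. y ^ k /\<^sub>R fact k) \<le> (\<Sum>k. y ^ k /\<^sub>R fact k)"
  using that by (intro sum_le_suminf summable_exp_generic) auto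
 then have "y ^ n / fact n \<le> exp y" by (simp add: exp_def divide_inverse mult.commute)
 then show ?thesis by (simp add: divide_le_eq mult.commute)
qed

text \<open>With y = 1/x this is y^(j+2) <= (j+2)! exp y, which compares the exponential series with
  one of its terms. A bound of order greater than one makes the difference quotient at 0 vanish in
  the limit.\<close>

lemma flat_bound: "\<bar>flat j x\<bar> \<le> fact (j + 2) * x\<^sup>2"
proof (cases "x > 0")
 case True
 define y where "y = inverse x"
 have y: "y > 0" "x = inverse y" using True by (simp_all add: y_def)
 define F where "F = (fact (j + 2) :: real)"
 have "y ^ (j + 2) \<le> F * exp y" using power_le_fact_exp[of y "j + 2"] y(1) by (simp only: F_def less_imp_le)
 then have "y ^ (j + 2) * exp (- y) \<le> F * exp y * exp (- y)" by (rule mult_right_mono) simp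
 moreover have "F * exp y * exp (- y) = F" by (simp add: exp_minus)
 moreover have "y ^ (j + 2) * exp (- y) = y ^ j * exp (- y) * y\<^sup>2" by (simp add: power_add power2_eq_square)
 ultimately have 1: "y ^ j * exp (- y) * y\<^sup>2 \<le> F" by (simp only:)
 have 2: "y\<^sup>2 * x\<^sup>2 = 1" using y by (simp add: power_mult_distrib[symmetric])
 have "y ^ j * exp (- y) = (y ^ j * exp (- y) * y\<^sup>2) * x\<^sup>2" using 2 by (simp add: mult.assoc)
 also have "\<dots> \<le> F * x\<^sup>2" using 1 by (rule mult_right_mono) simp
 finally show ?thesis using True y(1) unfolding F_def[symmetric] by (simp add: flat_def y_def[symmetric])
qed (simp add: flat_def)

lemma flat_deriv: "(flat j has_real_derivative (flat (j + 2) x - j * flat (j + 1) x)) (at x)"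
proof -
 consider "x > 0" | "x < 0" | "x = 0" by linarith
 then show ?thesis
 proof cases
  case 1
  have D: "((\<lambda>x. inverse x ^ j * exp (- inverse x)) has_real_derivative (flat (j + 2) x - j * flat (j + 1) x)) (at x)"
  proof -
   have "((\<lambda>x. inverse x ^ j) has_real_derivative (- (real j * inverse x ^ (j + 1)))) (at x)"
    by (rule DERIV_cong[OF DERIV_power[OF DERIV_inverse]]) (use 1 in "cases j; simp")+
   moreover have "((\<lambda>x. exp (- inverse x)) has_real_derivative (exp (- inverse x) * inverse x ^ 2)) (at x)"
    using 1 by (auto intro!: derivative_eq_intros simp: power2_eq_square)
   ultimately show ?thesis
    by (rule DERIV_cong[OF DERIV_mult]) (use 1 in "simp add: flat_def power_add algebra_simps power2_eq_square")
  qed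
  show ?thesis
   by (rule DERIV_cong_ev[THEN iffD1, OF refl _ refl D])
    (rule eventually_mono[OF eventually_nhds_in_open[of "{0<..}"]], use 1 in "auto simp: flat_def")
 next
  case 2
  have D: "((\<lambda>x. 0) has_real_derivative (flat (j + 2) x - j * flat (j + 1) x)) (at x)"
   using 2 by (simp add: flat_def)
  show ?thesis
   by (rule DERIV_cong_ev[THEN iffD1, OF refl _ refl D])
    (rule eventually_mono[OF eventually_nhds_in_open[of "{..<0}"]], use 2 in "auto simp: flat_def")
 next
  case 3
  have "(\<lambda>h. (flat j (0 + h) - flat j 0) / h) \<midarrow>0\<rightarrow> 0"
  proof (rule Lim_null_comparison)
   show "\<forall>\<^sub>F h in at 0. norm ((flat j (0 + h) - flat j 0) / h) \<le> fact (j + 2) * \<bar>h\<bar>"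
   proof (rule always_eventually, rule allI)
    fix h :: real
    show "norm ((flat j (0 + h) - flat j 0) / h) \<le> fact (j + 2) * \<bar>h\<bar>"
    proof (cases "h = 0")
     case False
     have "\<bar>flat j h\<bar> \<le> (fact (j + 2) * \<bar>h\<bar>) * \<bar>h\<bar>"
      using flat_bound[of j h] by (simp only: power2_abs[of h, symmetric] power2_eq_square mult.assoc)
     then have "\<bar>flat j h\<bar> / \<bar>h\<bar> \<le> fact (j + 2) * \<bar>h\<bar>" using False by (subst pos_divide_le_eq) simp_all
     moreover have "flat j 0 = 0" by (simp add: flat_def)
     ultimately show ?thesis by (simp only: add_0_left diff_zero real_norm_def abs_divide)
    qed simp
   qed
   show "(\<lambda>h. fact (j + 2) * \<bar>h\<bar>) \<midarrow>0\<rightarrow> (0::real)"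
    by (rule tendsto_mult_right_zero) (rule tendsto_rabs_zero, rule tendsto_ident_at)
  qed
  then show ?thesis using 3 by (simp add: DERIV_def flat_def)
 qed
qed

lemma Ck_on_flat: "Ck_on k UNIV (flat j)"
proof (induction k arbitrary: j)
 case 0
 have "isCont (flat j) x" for x using flat_deriv DERIV_isCont by blast
 then show ?case by (simp add: Ck_on.simps continuous_at_imp_continuous_on)
next
 case (Suc k)
 show ?case
 proof (rule Ck_on_SucI[of _ _ "\<lambda>x v. v * (flat (j + 2) x + (- real j) * flat (j + 1) x)"])
  fix x :: real
  have "(*) (flat (j + 2) x - j * flat (j + 1) x) = (\<lambda>v. v * (flat (j + 2) x + (- real j) * flat (j + 1) x))"
   by (rule ext) (simp add: algebra_simps)
  then show "(flat j has_derivative (\<lambda>v. v * (flat (j + 2) x + (- real j) * flat (j + 1) x))) (at x)"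
   using flat_deriv[of j x] by (simp only: has_field_derivative_def)
 next
  fix v :: real
  show "Ck_on k UNIV (\<lambda>x. v * (flat (j + 2) x + (- real j) * flat (j + 1) x))"
   by (rule Ck_on_bilinear[OF bounded_bilinear_mult Ck_on_const
      Ck_on_add[OF Suc Ck_on_bilinear[OF bounded_bilinear_mult Ck_on_const Suc]]])
 qed
qed

lemma smooth_at_flat: "smooth_at (flat j) x"
 unfolding smooth_at_iff_Ck using Ck_on_flat open_UNIV by blast

definition smooth_step :: "real => real" where
 "smooth_step t = flat 0 t / (flat 0 t + flat 0 (1 - t))"

lemma flat0_pos: "flat 0 t \<ge> 0" "t > 0 ==> flat 0 t > 0" "t \<le> 0 ==> flat 0 t = 0"
 by (simp_all add: flat_def)

lemma flat0_sum_pos: "flat 0 t + flat 0 (1 - t) > 0"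
 using flat0_pos[of t] flat0_pos[of "1 - t"] by (cases "t > 0") (simp_all add: add_pos_nonneg add_nonneg_pos)

lemma smooth_step_props:
 "smooth_step t \<ge> 0" "smooth_step t \<le> 1" "t \<le> 0 ==> smooth_step t = 0" "t \<ge> 1 ==> smooth_step t = 1"
 "t > 0 ==> smooth_step t > 0"
proof -
 note p = flat0_pos(1)[of t] flat0_pos(1)[of "1 - t"] flat0_sum_pos[of t]
 show "smooth_step t \<ge> 0" "smooth_step t \<le> 1" unfolding smooth_step_def
  using p by (auto intro!: divide_nonneg_pos simp: pos_divide_le_eq)
 show "t \<le> 0 ==> smooth_step t = 0" by (simp add: smooth_step_def flat0_pos(3))
 show "t \<ge> 1 ==> smooth_step t = 1"
  using flat0_pos(3)[of "1 - t"] p(3) by (simp add: smooth_step_def)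
 show "t > 0 ==> smooth_step t > 0"
  unfolding smooth_step_def using p(3) flat0_pos(2)[of t] by (intro divide_pos_pos)
qed

lemma smooth_at_step: "smooth_at smooth_step x"
proof -
 have 1: "smooth_at (\<lambda>t. flat 0 (1 - t)) x"
  by (rule smooth_at_compose[OF smooth_at_flat]) (intro smooth_intros)
 show ?thesis unfolding smooth_step_def[abs_def]
  by (rule smooth_at_divide[OF smooth_at_flat smooth_at_add[OF smooth_at_flat 1]])
   (use flat0_sum_pos[of x] in simp)
qed

text \<open>The squared norm keeps the function smooth at the centre. The argument of
  \<open>smooth_step\<close> is at least 1 within distance \<open>r\<close> and at most 0 from
  distance sqrt 2 times \<open>r\<close> on, so \<open>2 * r\<close> is a safe bound for the
  support.\<close>

definition ball_bump :: "'a::euclidean_space => real => 'a => real" where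
 "ball_bump a r x = smooth_step (2 - (norm (x - a))\<^sup>2 / r\<^sup>2)"

lemma smooth_at_ball_bump: "smooth_at (ball_bump a r) x"
proof -
 have "smooth_at (\<lambda>x. 2 - ((x - a) \<bullet> (x - a)) * inverse (r\<^sup>2)) x"
  by (intro smooth_intros)
 then show ?thesis
  unfolding ball_bump_def[abs_def] divide_inverse dot_square_norm[symmetric]
  by (rule smooth_at_compose[OF smooth_at_step])
qed

lemma ball_bump_props:
 assumes "r > 0"
 shows "ball_bump a r x \<ge> 0" "ball_bump a r x \<le> 1"
  "dist x a \<le> r ==> ball_bump a r x = 1" "dist x a \<ge> 2 * r ==> ball_bump a r x = 0"
proof -
 show "ball_bump a r x \<ge> 0" "ball_bump a r x \<le> 1" by (simp_all add: ball_bump_def smooth_step_props)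
 show "ball_bump a r x = 1" if "dist x a \<le> r"
 proof -
  have "(norm (x - a))\<^sup>2 \<le> r\<^sup>2" using that by (intro power_mono) (simp_all add: dist_norm)
  then have "(norm (x - a))\<^sup>2 / r\<^sup>2 \<le> 1" using assms by simp
  then show ?thesis unfolding ball_bump_def by (intro smooth_step_props(4)) linarith
 qed
 show "ball_bump a r x = 0" if "dist x a \<ge> 2 * r"
 proof -
  have "(2 * r)\<^sup>2 \<le> (norm (x - a))\<^sup>2" using that assms by (intro power_mono) (simp_all add: dist_norm)
  moreover have "r\<^sup>2 > 0" using assms by simp
  moreover have "(2 * r)\<^sup>2 = 4 * r\<^sup>2" by (simp add: power_mult_distrib)
  ultimately have "2 * r\<^sup>2 \<le> (norm (x - a))\<^sup>2" by linarith
  then have "2 \<le> (norm (x - a))\<^sup>2 / r\<^sup>2" using \<open>r\<^sup>2 > 0\<close> by (subst pos_le_divide_eq)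
  then show ?thesis unfolding ball_bump_def by (intro smooth_step_props(3)) linarith
 qed
qed

section \<open>Smooth functions on manifolds\<close>

lemma is_chartD:
 assumes "is_chart (U, phi)"
 shows "open U" "open (phi ` U)" "inj_on phi U" "continuous_on U phi" "continuous_on (phi ` U) (inv_into U phi)"
  "p \<in> U ==> inv_into U phi (phi p) = p"
  "x \<in> phi ` U ==> phi (inv_into U phi x) = x" "x \<in> phi ` U ==> inv_into U phi x \<in> U"
proof -
 have h: "homeomorphism U (phi ` U) phi (inv_into U phi)" and o: "open U" "open (phi ` U)"
  using assms by (auto simp: is_chart_def)
 show "open U" "open (phi ` U)" by fact+
 have apply_inv: "\<And>p. p \<in> U ==> inv_into U phi (phi p) = p" using h by (simp add: homeomorphism_apply1)
 then show "inj_on phi U" by (metis inj_onI)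
 show "continuous_on U phi" "continuous_on (phi ` U) (inv_into U phi)" using h by (auto simp: homeomorphism_def)
 show "p \<in> U ==> inv_into U phi (phi p) = p" by fact
 show "x \<in> phi ` U ==> phi (inv_into U phi x) = x" "x \<in> phi ` U ==> inv_into U phi x \<in> U"
  by (rule f_inv_into_f, assumption) (rule inv_into_into)
qed

lemma isCont_iff_filterlim_nhds: "isCont f x \<longleftrightarrow> filterlim f (nhds (f x)) (nhds x)"
 by (simp add: isCont_def tendsto_at_iff_tendsto_nhds)

lemma chart_filterlim:
 fixes phi :: "'m::t2_space => 'n::finite model"
 assumes "is_chart (U, phi)" "p \<in> U"
 shows "filterlim phi (nhds (phi p)) (nhds p)" "filterlim (inv_into U phi) (nhds p) (nhds (phi p))"
proof -
 note c = is_chartD[OF assms(1)]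
 show "filterlim phi (nhds (phi p)) (nhds p)"
 proof -
  have "isCont phi p" using c(1,4) assms(2) by (simp add: continuous_on_eq_continuous_at)
  then show ?thesis by (simp add: isCont_def tendsto_at_iff_tendsto_nhds)
 qed
 have "isCont (inv_into U phi) (phi p)"
  using c(2,5) assms(2) by (simp add: continuous_on_eq_continuous_at)
 then show "filterlim (inv_into U phi) (nhds p) (nhds (phi p))"
  using tendsto_at_iff_tendsto_nhds[of "inv_into U phi" "phi p"] by (simp only: isCont_def c(6)[OF assms(2)])
qed

lemma eventually_in_chart:
 assumes "is_chart (U, phi)" "p \<in> U"
 shows "\<forall>\<^sub>F q in nhds p. q \<in> U" "\<forall>\<^sub>F x in nhds (phi p). x \<in> phi ` U"
 using is_chartD(1,2)[OF assms(1)] assms(2) by (auto intro: eventually_nhds_in_open)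

lemma eventually_chart_iff:
 fixes phi :: "'m::t2_space => 'n::finite model"
 assumes "is_chart (U, phi)" "p \<in> U"
 shows "(\<forall>\<^sub>F x in nhds (phi p). P (inv_into U phi x)) \<longleftrightarrow> (\<forall>\<^sub>F q in nhds p. P q)"
proof
 assume "\<forall>\<^sub>F q in nhds p. P q"
 then show "\<forall>\<^sub>F x in nhds (phi p). P (inv_into U phi x)"
  by (rule eventually_compose_filterlim[OF _ chart_filterlim(2)[OF assms]])
next
 assume "\<forall>\<^sub>F x in nhds (phi p). P (inv_into U phi x)"
 then have "\<forall>\<^sub>F q in nhds p. P (inv_into U phi (phi q))"
  by (rule eventually_compose_filterlim[OF _ chart_filterlim(1)[OF assms]])
 then show "\<forall>\<^sub>F q in nhds p. P q"
  using eventually_in_chart(1)[OF assms] by eventually_elim (simp add: is_chartD(6)[OF assms(1)])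
qed

text \<open>Holomorphic charts and charts pulled back by a diffeomorphism lie here without belonging
  to \<open>A\<close>. No sign is imposed on the Jacobians of the transition maps; the orientation
  is controlled only by the charts of \<open>A\<close> itself.\<close>

definition max_atlas :: "('m::topological_space, 'n::finite) chart set => ('m, 'n) chart set" where
 "max_atlas A = {c. is_chart c \<and> (\<forall>d\<in>A. smooth_transition c d \<and> smooth_transition d c)}"

locale manifold =
 fixes A :: "('m::t2_space, 'n::finite) chart set"
 assumes atlas: "oriented_atlas A"
begin

lemma in_atlas_max: "c \<in> A ==> c \<in> max_atlas A"
 using atlas by (auto simp: oriented_atlas_def max_atlas_def)

lemma max_is_chart: "c \<in> max_atlas A ==> is_chart c"
 by (simp add: max_atlas_def)

abbreviation cU :: "'m => 'm set" where "cU p \<equiv> fst (chart_at A p)"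
abbreviation cf :: "'m => 'm => 'n model" where "cf p \<equiv> snd (chart_at A p)"
abbreviation ci :: "'m => 'n model => 'm" where "ci p \<equiv> inv_into (cU p) (cf p)"
abbreviation cx :: "'m => 'n model" where "cx p \<equiv> cf p p"

lemma chart_at_in: "chart_at A p \<in> A" "p \<in> cU p"
proof -
 have "p \<in> (\<Union>c\<in>A. fst c)" using atlas by (simp add: oriented_atlas_def)
 then have "\<exists>c. c \<in> A \<and> p \<in> fst c" by auto
 from someI_ex[OF this] show "chart_at A p \<in> A" "p \<in> cU p" by (simp_all add: chart_at_def)
qed

lemma chart_at_max: "(cU p, cf p) \<in> max_atlas A"
 using in_atlas_max[OF chart_at_in(1)] by simp

lemma chart_at_is_chart: "is_chart (cU p, cf p)"
 using max_is_chart[OF chart_at_max] .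

lemma ci_cx [simp]: "ci p (cx p) = p"
 using is_chartD(6)[OF chart_at_is_chart chart_at_in(2)] .

lemma smooth_transition_at:
 assumes "smooth_transition (U, phi) (V, psi)" "p \<in> U" "p \<in> V"
 shows "smooth_at (psi \<circ> inv_into U phi) (phi p)"
 using assms by (auto simp: smooth_transition_def smooth_on_iff_smooth_at)

text \<open>The transition map factors through the atlas chart chosen at \<open>p\<close>, with
  which both charts are compatible.\<close>

lemma max_transition:
 assumes c: "(U, phi) \<in> max_atlas A" and d: "(V, psi) \<in> max_atlas A" and p: "p \<in> U" "p \<in> V"
 shows "smooth_at (psi \<circ> inv_into U phi) (phi p)"
proof -
 have 1: "smooth_at (cf p \<circ> inv_into U phi) (phi p)"
  using c chart_at_in[of p] p by (intro smooth_transition_at[of U phi "cU p"]) (auto simp: max_atlas_def)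
 have 2: "smooth_at (psi \<circ> ci p) (cx p)"
  using d chart_at_in[of p] p by (intro smooth_transition_at[of _ _ V]) (auto simp: max_atlas_def)
 note ch = max_is_chart[OF c] max_is_chart[OF d]
 have e: "(cf p \<circ> inv_into U phi) (phi p) = cx p" using is_chartD(6)[OF ch(1) p(1)] by simp
 have "smooth_at (\<lambda>x. (psi \<circ> ci p) ((cf p \<circ> inv_into U phi) x)) (phi p)"
  by (rule smooth_at_compose) (use 1 2 in "simp_all only: e")
 moreover have "\<forall>\<^sub>F x in nhds (phi p). (psi \<circ> ci p) ((cf p \<circ> inv_into U phi) x) = (psi \<circ> inv_into U phi) x"
 proof -
  have "\<forall>\<^sub>F x in nhds (phi p). inv_into U phi x \<in> cU p"
   by (rule eventually_chart_iff[OF ch(1) p(1), where P="\<lambda>q. q \<in> cU p", THEN iffD2])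
    (rule eventually_in_chart(1)[OF chart_at_is_chart chart_at_in(2)])
  then show ?thesis
   by eventually_elim (simp add: is_chartD(6)[OF chart_at_is_chart])
 qed
 ultimately show ?thesis by (rule smooth_at_cong)
qed

definition msmooth :: "('m => 'b::real_normed_vector) => 'm => bool" where
 "msmooth f p \<longleftrightarrow> smooth_at (\<lambda>x. f (ci p x)) (cx p)"

lemma smooth_at_change_chart:
 assumes c: "(U, phi) \<in> max_atlas A" and d: "(V, psi) \<in> max_atlas A" and p: "p \<in> U" "p \<in> V"
  and f: "smooth_at (\<lambda>x. f (inv_into U phi x)) (phi p)"
 shows "smooth_at (\<lambda>x. f (inv_into V psi x)) (psi p)"
proof -
 note ch = max_is_chart[OF c] max_is_chart[OF d]
 have e: "(phi \<circ> inv_into V psi) (psi p) = phi p" using is_chartD(6)[OF ch(2) p(2)] by simp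
 have "smooth_at (\<lambda>x. f (inv_into U phi ((phi \<circ> inv_into V psi) x))) (psi p)"
  by (rule smooth_at_compose[of "\<lambda>x. f (inv_into U phi x)" "phi \<circ> inv_into V psi"])
   (use f max_transition[OF d c p(2,1)] in "simp_all only: e")
 moreover have "\<forall>\<^sub>F x in nhds (psi p). f (inv_into U phi ((phi \<circ> inv_into V psi) x)) = f (inv_into V psi x)"
 proof -
  have "\<forall>\<^sub>F x in nhds (psi p). inv_into V psi x \<in> U"
   by (rule eventually_chart_iff[OF ch(2) p(2), where P="\<lambda>q. q \<in> U", THEN iffD2])
    (rule eventually_in_chart(1)[OF ch(1) p(1)])
  then show ?thesis
   by eventually_elim (simp add: is_chartD(6)[OF ch(1)])
 qed
 ultimately show ?thesis by (rule smooth_at_cong)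
qed

lemma msmooth_iff:
 assumes c: "(U, phi) \<in> max_atlas A" and p: "p \<in> U"
 shows "msmooth f p \<longleftrightarrow> smooth_at (\<lambda>x. f (inv_into U phi x)) (phi p)"
 unfolding msmooth_def
 using smooth_at_change_chart[OF chart_at_max c chart_at_in(2) p, of f]
  smooth_at_change_chart[OF c chart_at_max p chart_at_in(2), of f] by blast

lemmas msmoothD = msmooth_iff[THEN iffD1]

lemma msmooth_eventually: "msmooth f p ==> \<forall>\<^sub>F q in nhds p. msmooth f q"
proof -
 assume "msmooth f p"
 then have "\<forall>\<^sub>F x in nhds (cx p). smooth_at (\<lambda>x. f (ci p x)) x"
  unfolding msmooth_def by (rule smooth_at_eventually)
 then have "\<forall>\<^sub>F q in nhds p. smooth_at (\<lambda>x. f (ci p x)) (cf p q)"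
  by (rule eventually_compose_filterlim[OF _ chart_filterlim(1)[OF chart_at_is_chart chart_at_in(2)]])
 then show ?thesis
  using eventually_in_chart(1)[OF chart_at_is_chart chart_at_in(2)]
  by eventually_elim (simp add: msmooth_iff[OF chart_at_max])
qed

lemma msmooth_cong: "msmooth f p ==> \<forall>\<^sub>F q in nhds p. f q = g q ==> msmooth g p"
 unfolding msmooth_def eventually_chart_iff[OF chart_at_is_chart chart_at_in(2), symmetric]
 by (rule smooth_at_cong)

lemma msmooth_chart:
 assumes "(U, phi) \<in> max_atlas A" "p \<in> U"
 shows "msmooth phi p"
 unfolding msmooth_iff[OF assms]
proof (rule smooth_at_cong[OF smooth_at_id])
 show "\<forall>\<^sub>F x in nhds (phi p). x = phi (inv_into U phi x)"
  using eventually_in_chart(2)[OF max_is_chart[OF assms(1)] assms(2)]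
  by eventually_elim (simp add: is_chartD(7)[OF max_is_chart[OF assms(1)]])
qed

lemma msmooth_compose:
 fixes g :: "'m => 'b::euclidean_space"
 assumes "smooth_at F (g p)" "msmooth g p"
 shows "msmooth (\<lambda>q. F (g q)) p"
 using assms smooth_at_compose[of F "\<lambda>x. g (ci p x)" "cx p"] by (simp add: msmooth_def)

lemma smooth_fun_on_iff: "smooth_fun_on A W f \<longleftrightarrow> open W \<and> (\<forall>p\<in>W. msmooth f p)"
proof
 assume L: "smooth_fun_on A W f"
 have "msmooth f p" if "p \<in> W" for p
 proof -
  have "smooth_on (cf p ` (cU p \<inter> W)) (f \<circ> ci p)"
   using L chart_at_in(1)[of p] by (auto simp: smooth_fun_on_def)
  moreover have "cx p \<in> cf p ` (cU p \<inter> W)" using that chart_at_in(2) by auto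
  ultimately have "smooth_at (f \<circ> ci p) (cx p)" unfolding smooth_on_iff_smooth_at by blast
  then show ?thesis by (simp add: msmooth_def comp_def)
 qed
 then show "open W \<and> (\<forall>p\<in>W. msmooth f p)" using L by (simp add: smooth_fun_on_def)
next
 assume R: "open W \<and> (\<forall>p\<in>W. msmooth f p)"
 have "smooth_on (phi ` (U \<inter> W)) (f \<circ> inv_into U phi)" if c: "(U, phi) \<in> A" for U phi
  unfolding smooth_on_iff_smooth_at
 proof
  note ch = is_chartD[OF max_is_chart[OF in_atlas_max[OF c]]]
  have "phi ` (U \<inter> W) = phi ` U \<inter> inv_into U phi -` W"
   using ch(6) by (auto simp: image_iff)
  then show "open (phi ` (U \<inter> W))"
   using continuous_open_preimage[OF ch(5,2), of W] R by (simp add: Int_commute)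
  show "\<forall>x\<in>phi ` (U \<inter> W). smooth_at (f \<circ> inv_into U phi) x"
   using R msmooth_iff[OF in_atlas_max[OF c], of _ f] by (auto simp: comp_def)
 qed
 then show "smooth_fun_on A W f" using R by (auto simp: smooth_fun_on_def)
qed

lemma smooth_fun_iff: "smooth_fun A f \<longleftrightarrow> (\<forall>p. msmooth f p)"
 by (simp add: smooth_fun_on_iff)

named_theorems msmooth_intros

lemma msmooth_const [msmooth_intros]: "msmooth (\<lambda>q. c) p"
 unfolding msmooth_def by (rule smooth_at_const)

lemma msmooth_add [msmooth_intros]: "msmooth f p ==> msmooth g p ==> msmooth (\<lambda>q. f q + g q) p"
 unfolding msmooth_def by (rule smooth_at_add)

lemma msmooth_diff [msmooth_intros]: "msmooth f p ==> msmooth g p ==> msmooth (\<lambda>q. f q - g q) p"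
 unfolding msmooth_def by (rule smooth_at_diff)

lemma msmooth_minus [msmooth_intros]: "msmooth f p ==> msmooth (\<lambda>q. - f q) p"
 unfolding msmooth_def by (rule smooth_at_minus)

lemma msmooth_bilinear:
 "bounded_bilinear pr ==> msmooth f p ==> msmooth g p ==> msmooth (\<lambda>q. pr (f q) (g q)) p"
 unfolding msmooth_def by (rule smooth_at_bilinear)

lemmas msmooth_scaleR [msmooth_intros] = msmooth_bilinear[OF bounded_bilinear_scaleR]
 and msmooth_mult [msmooth_intros] = msmooth_bilinear[OF bounded_bilinear_mult]
 and msmooth_inner [msmooth_intros] = msmooth_bilinear[OF bounded_bilinear_inner]

lemma msmooth_sum [msmooth_intros]:
 "(\<And>i. i \<in> I ==> msmooth (f i) p) ==> msmooth (\<lambda>q. \<Sum>i\<in>I. f i q) p"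
 unfolding msmooth_def by (rule smooth_at_sum)

lemma msmooth_divide [msmooth_intros]:
 "msmooth f p ==> msmooth g p ==> g p \<noteq> 0 ==> msmooth (\<lambda>q. f q / g q :: real) p"
 unfolding msmooth_def by (rule smooth_at_divide) simp_all

lemma msmooth_ln [msmooth_intros]: "msmooth f p ==> f p > 0 ==> msmooth (\<lambda>q. ln (f q) :: real) p"
 unfolding msmooth_def by (rule smooth_at_ln) simp_all

lemma msmooth_exp [msmooth_intros]: "msmooth f p ==> msmooth (\<lambda>q. exp (f q) :: real) p"
 unfolding msmooth_def by (rule smooth_at_exp)

lemma msmooth_vec_nth [msmooth_intros]: "msmooth f p ==> msmooth (\<lambda>q. f q $ i) p"
 for f :: "'m => 'b::euclidean_space ^ 'k::finite"
 unfolding msmooth_def by (rule smooth_at_vec_nth)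

lemma msmooth_vecI:
 fixes f :: "'m => real ^ 'k::finite"
 shows "(\<And>i. msmooth (\<lambda>q. f q $ i) p) ==> msmooth f p"
 unfolding msmooth_def by (rule smooth_at_vecI)

lemma msmooth_euclideanI:
 fixes f :: "'m => 'b::euclidean_space"
 shows "(\<And>i. i \<in> Basis ==> msmooth (\<lambda>q. f q \<bullet> i) p) ==> msmooth f p"
 unfolding msmooth_def by (rule smooth_at_euclideanI)

lemma msmooth_det [msmooth_intros]:
 fixes M :: "'m => real ^ 'k::finite ^ 'k"
 shows "(\<And>i j. msmooth (\<lambda>q. M q $ i $ j) p) ==> msmooth (\<lambda>q. det (M q)) p"
 unfolding msmooth_def by (rule smooth_at_det)

lemma msmooth_linear: "linear F ==> msmooth g p ==> msmooth (\<lambda>q. F (g q)) p"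
 for g :: "'m => 'b::euclidean_space"
 by (rule msmooth_compose[OF smooth_at_linear_map])

lemma msmooth_isCont: "msmooth f p ==> isCont f p"
proof -
 assume "msmooth f p"
 then have "filterlim (\<lambda>x. f (ci p x)) (nhds (f p)) (nhds (cx p))"
  using smooth_at_isCont[of "\<lambda>x. f (ci p x)" "cx p"]
  by (simp only: msmooth_def isCont_iff_filterlim_nhds ci_cx)
 then have "filterlim (\<lambda>q. f (ci p (cf p q))) (nhds (f p)) (nhds p)"
  by (rule filterlim_compose[OF _ chart_filterlim(1)[OF chart_at_is_chart chart_at_in(2)]])
 moreover have "\<forall>\<^sub>F q in nhds p. f (ci p (cf p q)) = f q"
  using eventually_in_chart(1)[OF chart_at_is_chart chart_at_in(2)]
  by eventually_elim (simp add: is_chartD(6)[OF chart_at_is_chart])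
 ultimately have "filterlim f (nhds (f p)) (nhds p)"
  by (simp only: filterlim_cong[OF refl refl, of "\<lambda>q. f (ci p (cf p q))" f])
 then show "isCont f p" by (simp add: isCont_def tendsto_at_iff_tendsto_nhds)
qed

subsection \<open>Directional derivatives\<close>

abbreviation dd :: "('m => 'b::real_normed_vector) => 'm => 'n model => 'b" where
 "dd \<equiv> dfun A"

lemma dd_def: "dd f p = fd (\<lambda>x. f (ci p x)) (cx p)"
 by (simp add: dfun_def case_prod_beta Let_def comp_def)

lemmas max_chartD = is_chartD[OF max_is_chart] and ev_chart = eventually_in_chart[OF max_is_chart]

lemma dd_cong: "\<forall>\<^sub>F q in nhds p. f q = g q ==> dd f p = dd g p"
 unfolding dd_def eventually_chart_iff[OF chart_at_is_chart chart_at_in(2), symmetric]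
 by (rule fd_cong)

lemma dd_linear: "msmooth f p ==> linear (dd f p)"
 unfolding dd_def msmooth_def by (rule smooth_at_linear)

lemma dd_const [simp]: "dd (\<lambda>q. c) p v = 0"
 by (simp add: dd_def)

lemma dd_compose:
 fixes g :: "'m => 'b::euclidean_space"
 assumes "smooth_at F (g p)" "msmooth g p"
 shows "dd (\<lambda>q. F (g q)) p v = fd F (g p) (dd g p v)"
 using assms fd_compose[of F "\<lambda>x. g (ci p x)" "cx p" v] by (simp add: msmooth_def dd_def)

lemma dd_bilinear:
 assumes "bounded_bilinear pr" "msmooth f p" "msmooth g p"
 shows "dd (\<lambda>q. pr (f q) (g q)) p v = pr (f p) (dd g p v) + pr (dd f p v) (g p)"
 using assms fd_bilinear[of pr "\<lambda>x. f (ci p x)" "cx p" "\<lambda>x. g (ci p x)" v] by (simp add: msmooth_def dd_def)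

lemmas dd_scaleR = dd_bilinear[OF bounded_bilinear_scaleR]
 and dd_mult = dd_bilinear[OF bounded_bilinear_mult]

lemma dd_add: "msmooth f p ==> msmooth g p ==> dd (\<lambda>q. f q + g q) p v = dd f p v + dd g p v"
 unfolding dd_def msmooth_def by (rule fd_add)

lemma dd_sum:
 "(\<And>i. i \<in> I ==> msmooth (f i) p) ==> dd (\<lambda>q. \<Sum>i\<in>I. f i q) p v = (\<Sum>i\<in>I. dd (f i) p v)"
 unfolding dd_def msmooth_def by (rule fd_sum)

lemma dd_linear_compose:
 fixes g :: "'m => 'b::euclidean_space"
 assumes "linear F" "msmooth g p"
 shows "dd (\<lambda>q. F (g q)) p v = F (dd g p v)"
 using dd_compose[OF smooth_at_linear_map[OF assms(1)] assms(2)] by (simp add: fd_linear[OF assms(1)])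

lemma dd_minus: "msmooth f p ==> dd (\<lambda>q. - f q) p v = - dd f p v"
 for f :: "'m => 'b::euclidean_space"
 by (rule dd_linear_compose) (simp_all add: linear_iff)

lemma dd_diff: "msmooth f p ==> msmooth g p ==> dd (\<lambda>q. f q - g q) p v = dd f p v - dd g p v"
 for f g :: "'m => 'b::euclidean_space"
 using dd_add[OF _ msmooth_minus, of f p g v] dd_minus[of g p v] by simp

lemma dd_vec_nth: "msmooth g p ==> dd (\<lambda>q. g q $ i) p v = dd g p v $ i"
 for g :: "'m => real ^ 'k::finite"
 by (rule dd_linear_compose[of "\<lambda>y. y $ i"]) (simp_all add: linear_iff)

text \<open>\<open>dd psi p\<close> is the differential of the coordinate change to
  \<open>psi\<close> from the chart that identifies the tangent space at \<open>p\<close> with the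
  model space, so this is the chain rule for that change.\<close>

lemma dd_in_chart:
 assumes c: "(U, psi) \<in> max_atlas A" "p \<in> U" and f: "msmooth f p"
 shows "dd f p v = fd (\<lambda>x. f (inv_into U psi x)) (psi p) (dd psi p v)"
proof -
 have s: "smooth_at (\<lambda>x. f (inv_into U psi x)) (psi p)" using f msmooth_iff[OF c] by blast
 have ev: "\<forall>\<^sub>F q in nhds p. f q = f (inv_into U psi (psi q))"
  using eventually_in_chart(1)[OF max_is_chart[OF c(1)] c(2)]
  by eventually_elim (simp add: is_chartD(6)[OF max_is_chart[OF c(1)]])
 have "dd f p v = dd (\<lambda>q. (\<lambda>x. f (inv_into U psi x)) (psi q)) p v"
  unfolding dd_cong[OF ev] ..
 also have "\<dots> = fd (\<lambda>x. f (inv_into U psi x)) (psi p) (dd psi p v)"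
  by (rule dd_compose[OF s msmooth_chart[OF c]])
 finally show ?thesis .
qed

lemma fd_chart_self:
 assumes c: "(U, psi) \<in> max_atlas A" "p \<in> U"
 shows "fd (\<lambda>x. psi (inv_into U psi x)) (psi p) v = v"
proof -
 have "\<forall>\<^sub>F x in nhds (psi p). psi (inv_into U psi x) = x"
  using eventually_in_chart(2)[OF max_is_chart[OF c(1)] c(2)]
  by eventually_elim (simp add: is_chartD(7)[OF max_is_chart[OF c(1)]])
 from fd_cong[OF this] show ?thesis by (simp add: fd_eqI)
qed

lemma dd_chart_at [simp]: "dd (cf p) p v = v"
 unfolding dd_def by (rule fd_chart_self[OF chart_at_max chart_at_in(2)])

lemma dd_chart_linear: "(U, psi) \<in> max_atlas A ==> p \<in> U ==> linear (dd psi p)"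
 by (rule dd_linear[OF msmooth_chart])

lemma dd_chart_inverse:
 assumes c: "(U, psi) \<in> max_atlas A" "p \<in> U"
 shows "fd (\<lambda>x. cf p (inv_into U psi x)) (psi p) (dd psi p v) = v"
  "dd psi p (fd (\<lambda>x. cf p (inv_into U psi x)) (psi p) w) = w"
proof -
 let ?T = "fd (\<lambda>x. cf p (inv_into U psi x)) (psi p)"
 show 1: "?T (dd psi p v) = v" for v
  using dd_in_chart[OF c msmooth_chart[OF chart_at_max chart_at_in(2)], of v] by simp
 have "linear ?T"
  by (rule smooth_at_linear) (use msmooth_chart[OF chart_at_max chart_at_in(2)] msmooth_iff[OF c] in blast)
 moreover have "linear (dd psi p)" by (rule dd_chart_linear[OF c])
 moreover have "?T \<circ> dd psi p = id" by (rule ext) (simp add: 1)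
 ultimately have "dd psi p \<circ> ?T = id" using linear_inverse_left by blast
 from fun_cong[OF this, of w] show "dd psi p (?T w) = w" by simp
qed

lemma bij_dd_chart:
 assumes c: "(U, psi) \<in> max_atlas A" "p \<in> U"
 shows "bij (dd psi p)"
 by (rule o_bij[of "fd (\<lambda>x. cf p (inv_into U psi x)) (psi p)"]; rule ext)
  (simp_all add: dd_chart_inverse[OF c])

text \<open>Turns a coordinate vector with respect to \<open>psi\<close> into a tangent vector at
  \<open>p\<close>; thus \<open>lift psi p (axis k 1)\<close> is the k-th coordinate vector field of
  the chart.\<close>

definition lift :: "('m => 'n model) => 'm => 'n model => 'n model" where
 "lift psi p = inv (dd psi p)"

lemma lift:
 assumes c: "(U, psi) \<in> max_atlas A" "p \<in> U"
 shows "dd psi p (lift psi p w) = w" "lift psi p (dd psi p v) = v" "linear (lift psi p)"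
proof -
 note b = bij_dd_chart[OF c]
 show 1: "dd psi p (lift psi p w) = w" for w
  unfolding lift_def by (rule surj_f_inv_f[OF bij_is_surj[OF b]])
 show "lift psi p (dd psi p v) = v"
  unfolding lift_def by (rule inv_f_f[OF bij_is_inj[OF b]])
 show "linear (lift psi p)"
  unfolding lift_def by (rule inj_linear_imp_inv_linear[OF dd_chart_linear[OF c] bij_is_inj[OF b]])
qed

lemma dd_chart_inj: "(U, psi) \<in> max_atlas A ==> p \<in> U ==> dd psi p v = dd psi p w ==> v = w"
 by (rule injD[OF bij_is_inj[OF bij_dd_chart]])

end

lemma positive_top_form: "positive_volume_form A rho ==> is_top_form A rho"
 by (simp add: positive_volume_form_def)

lemma integrable_almost_complex: "integrable_complex A J ==> almost_complex A J"
 by (simp add: integrable_complex_def)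

context manifold
begin

section \<open>Vector fields and differential forms\<close>

definition vsmooth :: "('m => 'n model) => 'm => bool" where
 "vsmooth X p \<longleftrightarrow> msmooth (\<lambda>q. dd (cf p) q (X q)) p"

lemma msmooth_fd_chart:
 fixes f :: "'m => 'b::euclidean_space"
 assumes c: "(U, psi) \<in> max_atlas A" "p \<in> U" and f: "msmooth f p"
 shows "msmooth (\<lambda>q. fd (\<lambda>x. f (inv_into U psi x)) (psi q) b) p"
 using f msmooth_iff[OF c, of f]
 by (intro msmooth_compose[of "\<lambda>x. fd (\<lambda>x. f (inv_into U psi x)) x b" psi] smooth_at_fd msmooth_chart[OF c]) simp

text \<open>Fixed basis directions separate the dependence on the vector from the dependence on the
  function. This is how \<open>dd f q (X q)\<close> is seen to be smooth although the chart behind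
  \<open>dd\<close> may jump with \<open>q\<close>.\<close>

lemma dd_expand:
 fixes f :: "'m => 'b::euclidean_space"
 assumes c: "(U, psi) \<in> max_atlas A" "p \<in> U" and f: "msmooth f p"
 shows "\<forall>\<^sub>F q in nhds p. \<forall>v. dd f q v = (\<Sum>b\<in>Basis. (dd psi q v \<bullet> b) *\<^sub>R fd (\<lambda>x. f (inv_into U psi x)) (psi q) b)"
 using msmooth_eventually[OF f] ev_chart(1)[OF c(1) c(2)]
proof eventually_elim
 case (elim q)
 let ?F = "\<lambda>x. f (inv_into U psi x)"
 have "smooth_at ?F (psi q)" using elim msmooth_iff[OF c(1)] by blast
 then have l: "linear (fd ?F (psi q))" by (rule smooth_at_linear)
 have "dd f q v = (\<Sum>b\<in>Basis. (dd psi q v \<bullet> b) *\<^sub>R fd ?F (psi q) b)" for v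
 proof -
  have "dd f q v = fd ?F (psi q) (\<Sum>b\<in>Basis. (dd psi q v \<bullet> b) *\<^sub>R b)"
   using dd_in_chart[OF c(1) elim(2,1)] by (simp add: euclidean_representation)
  then show ?thesis by (simp add: linear_sum[OF l] linear_scale[OF l])
 qed
 then show ?case by blast
qed

lemma msmooth_dd_chart:
 fixes f :: "'m => 'b::euclidean_space"
 assumes c: "(U, psi) \<in> max_atlas A" "p \<in> U" and f: "msmooth f p" and X: "msmooth (\<lambda>q. dd psi q (X q)) p"
 shows "msmooth (\<lambda>q. dd f q (X q)) p"
proof (rule msmooth_cong)
 show "msmooth (\<lambda>q. \<Sum>b\<in>Basis. (dd psi q (X q) \<bullet> b) *\<^sub>R fd (\<lambda>x. f (inv_into U psi x)) (psi q) b) p"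
  by (intro msmooth_sum msmooth_scaleR msmooth_inner X msmooth_const msmooth_fd_chart[OF c f])
 show "\<forall>\<^sub>F q in nhds p. (\<Sum>b\<in>Basis. (dd psi q (X q) \<bullet> b) *\<^sub>R fd (\<lambda>x. f (inv_into U psi x)) (psi q) b) = dd f q (X q)"
  using dd_expand[OF c f] by eventually_elim simp
qed

lemma vsmooth_iff:
 assumes c: "(U, psi) \<in> max_atlas A" "p \<in> U"
 shows "vsmooth X p \<longleftrightarrow> msmooth (\<lambda>q. dd psi q (X q)) p"
 using msmooth_dd_chart[OF c msmooth_chart[OF chart_at_max chart_at_in(2)], of X]
  msmooth_dd_chart[OF chart_at_max chart_at_in(2) msmooth_chart[OF c], of X]
 by (auto simp: vsmooth_def)

lemmas vsmoothD = vsmooth_iff[THEN iffD1]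

lemma msmooth_dd [msmooth_intros]: "vsmooth X p ==> msmooth f p ==> msmooth (\<lambda>q. dd f q (X q)) p"
 for f :: "'m => 'b::euclidean_space"
 using msmooth_dd_chart[OF chart_at_max chart_at_in(2)] by (simp add: vsmooth_def)

lemma vector_field_iff: "vector_field A X \<longleftrightarrow> (\<forall>p. vsmooth X p)"
proof
 assume L: "vector_field A X"
 show "\<forall>p. vsmooth X p"
 proof
  fix p
  have "smooth_fun_on A (cU p) (\<lambda>q. dd (cf p) q (X q))"
   using L chart_at_in(1)[of p] by (auto simp: vector_field_def)
  then show "vsmooth X p" using chart_at_in(2)[of p] by (simp add: vsmooth_def smooth_fun_on_iff)
 qed
next
 assume R: "\<forall>p. vsmooth X p"
 have "smooth_fun_on A U (\<lambda>q. dd phi q (X q))" if "(U, phi) \<in> A" for U phi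
  unfolding smooth_fun_on_iff
  using R vsmooth_iff[OF in_atlas_max[OF that]] max_chartD(1)[OF in_atlas_max[OF that]] by blast
 then show "vector_field A X" by (auto simp: vector_field_def)
qed

lemma vector_fieldD: "vector_field A X ==> vsmooth X p"
 by (simp add: vector_field_iff)

lemma vsmoothI:
 assumes c: "(U, psi) \<in> max_atlas A" "p \<in> U"
  and "msmooth g p" "\<forall>\<^sub>F q in nhds p. dd psi q (X q) = g q"
 shows "vsmooth X p"
 unfolding vsmooth_iff[OF c] using assms(4)
 by (intro msmooth_cong[OF assms(3)]) (simp only: eq_commute)

lemma vsmooth_cong: "vsmooth X p ==> \<forall>\<^sub>F q in nhds p. X q = Y q ==> vsmooth Y p"
 by (rule vsmoothI[OF chart_at_max chart_at_in(2)], unfold vsmooth_def, assumption)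
  (auto elim: eventually_mono)

lemma vsmooth_zero: "vsmooth (\<lambda>q. 0) p"
proof (rule vsmoothI[OF chart_at_max chart_at_in(2) msmooth_const[of 0]])
 show "\<forall>\<^sub>F q in nhds p. dd (cf p) q 0 = 0"
  using eventually_in_chart(1)[OF chart_at_is_chart chart_at_in(2)]
  by eventually_elim (rule linear_0[OF dd_chart_linear[OF chart_at_max]])
qed

lemma vsmooth_add: "vsmooth X p ==> vsmooth Y p ==> vsmooth (\<lambda>q. X q + Y q) p"
proof (rule vsmoothI[OF chart_at_max chart_at_in(2)])
 assume "vsmooth X p" "vsmooth Y p"
 then show "msmooth (\<lambda>q. dd (cf p) q (X q) + dd (cf p) q (Y q)) p"
  unfolding vsmooth_def by (rule msmooth_add)
 show "\<forall>\<^sub>F q in nhds p. dd (cf p) q (X q + Y q) = dd (cf p) q (X q) + dd (cf p) q (Y q)"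
  using eventually_in_chart(1)[OF chart_at_is_chart chart_at_in(2)]
  by eventually_elim (rule linear_add[OF dd_chart_linear[OF chart_at_max]])
qed

lemma vsmooth_scaleR: "msmooth f p ==> vsmooth X p ==> vsmooth (\<lambda>q. f q *\<^sub>R X q) p"
proof (rule vsmoothI[OF chart_at_max chart_at_in(2)])
 assume "msmooth f p" "vsmooth X p"
 then show "msmooth (\<lambda>q. f q *\<^sub>R dd (cf p) q (X q)) p"
  unfolding vsmooth_def by (rule msmooth_scaleR)
 show "\<forall>\<^sub>F q in nhds p. dd (cf p) q (f q *\<^sub>R X q) = f q *\<^sub>R dd (cf p) q (X q)"
  using eventually_in_chart(1)[OF chart_at_is_chart chart_at_in(2)]
  by eventually_elim (rule linear_scale[OF dd_chart_linear[OF chart_at_max]])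
qed

lemma vsmooth_sum: "(\<And>i. i \<in> I ==> vsmooth (X i) p) ==> vsmooth (\<lambda>q. \<Sum>i\<in>I. X i q) p"
 by (induction I rule: infinite_finite_induct) (simp_all add: vsmooth_zero vsmooth_add)

lemma vsmooth_lift:
 assumes c: "(U, psi) \<in> max_atlas A" "p \<in> U" and g: "msmooth g p"
 shows "vsmooth (\<lambda>q. lift psi q (g q)) p"
proof (rule vsmoothI[OF c g])
 show "\<forall>\<^sub>F q in nhds p. dd psi q (lift psi q (g q)) = g q"
  using ev_chart(1)[OF c(1) c(2)]
  by eventually_elim (rule lift(1)[OF c(1)])
qed

subsection \<open>Cut-off functions\<close>

lemma open_chart_image:
 assumes c: "(U, psi) \<in> max_atlas A" and W: "open W"
 shows "open (psi ` (U \<inter> W))"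
proof -
 note ch = max_chartD[OF c]
 have "psi ` (U \<inter> W) = psi ` U \<inter> inv_into U psi -` W"
  using ch(6) by (auto simp: image_iff)
 then show ?thesis using continuous_open_preimage[OF ch(5,2) W] by simp
qed

lemma manifold_bump:
 assumes c: "(U, psi) \<in> max_atlas A" "p \<in> U" and W: "open W" "p \<in> W"
 obtains b :: "'m => real" and K where "compact K" "closed K" "K \<subseteq> U \<inter> W" "\<And>q. msmooth b q"
  "\<And>q. 0 \<le> b q" "\<And>q. b q \<le> 1" "\<And>q. q \<notin> K ==> b q = 0" "\<forall>\<^sub>F q in nhds p. b q = 1"
proof -
 note ch = max_chartD[OF c(1)]
 have "open (psi ` (U \<inter> W))" "psi p \<in> psi ` (U \<inter> W)" using open_chart_image[OF c(1) W(1)] c W by auto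
 then obtain R where R: "R > 0" "cball (psi p) R \<subseteq> psi ` (U \<inter> W)" by (meson open_contains_cball)
 define r where "r = R / 2"
 have r: "r > 0" "2 * r = R" using R(1) by (simp_all add: r_def)
 define K where "K = inv_into U psi ` cball (psi p) R"
 define b where "b q = (if q \<in> U then ball_bump (psi p) r (psi q) else 0)" for q
 have sub: "cball (psi p) R \<subseteq> psi ` U" using R(2) by auto
 have K: "compact K" unfolding K_def
  by (rule compact_continuous_image[OF continuous_on_subset[OF ch(5) sub] compact_cball])
 \<comment> \<open>The Hausdorff property enters here: a compact set is closed, so the function
   vanishes near every point outside the chart domain and its extension by zero is smooth.\<close>
 then have cl: "closed K" by (rule compact_imp_closed)
 have KU: "K \<subseteq> U \<inter> W"
 proof
  fix q assume "q \<in> K"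
  then obtain x where x: "x \<in> cball (psi p) R" "q = inv_into U psi x" by (auto simp: K_def)
  with R(2) obtain q' where q': "q' \<in> U \<inter> W" "x = psi q'" by blast
  have "q = q'" unfolding x(2) q'(2) by (rule ch(6)) (use q'(1) in blast)
  with q' show "q \<in> U \<inter> W" by simp
 qed
 have off: "b q = 0" if "q \<notin> K" for q
 proof (cases "q \<in> U")
  case True
  have "psi q \<notin> cball (psi p) R"
  proof
   assume "psi q \<in> cball (psi p) R"
   then have "inv_into U psi (psi q) \<in> K" unfolding K_def by (rule imageI)
   then show False using that ch(6)[OF True] by simp
  qed
  then have "dist (psi q) (psi p) \<ge> 2 * r" by (simp add: r dist_commute)
  then have "ball_bump (psi p) r (psi q) = 0" by (rule ball_bump_props(4)[OF r(1)])
  then show ?thesis by (simp add: b_def)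
 qed (simp add: b_def)
 have sm: "msmooth b q" for q
 proof (cases "q \<in> U")
  case True
  show ?thesis
  proof (rule msmooth_cong)
   show "msmooth (\<lambda>q. ball_bump (psi p) r (psi q)) q"
    by (rule msmooth_compose[OF smooth_at_ball_bump msmooth_chart[OF c(1) True]])
   show "\<forall>\<^sub>F q in nhds q. ball_bump (psi p) r (psi q) = b q"
    using eventually_nhds_in_open[OF ch(1) True] by eventually_elim (simp add: b_def)
  qed
 next
  case False
  then have "q \<in> - K" using KU by auto
  then have "\<forall>\<^sub>F q in nhds q. q \<in> - K" using cl by (intro eventually_nhds_in_open) auto
  then have "\<forall>\<^sub>F q in nhds q. 0 = b q" by eventually_elim (simp add: off)
  then show ?thesis by (rule msmooth_cong[OF msmooth_const])
 qed
 have "open (ball (psi p) r)" "psi p \<in> ball (psi p) r" using r by auto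
 then have "\<forall>\<^sub>F x in nhds (psi p). x \<in> ball (psi p) r" by (rule eventually_nhds_in_open)
 then have "\<forall>\<^sub>F q in nhds p. psi q \<in> ball (psi p) r"
  by (rule eventually_compose_filterlim[OF _ chart_filterlim(1)[OF max_is_chart[OF c(1)] c(2)]])
 then have one: "\<forall>\<^sub>F q in nhds p. b q = 1"
  using ev_chart(1)[OF c(1) c(2)]
  by eventually_elim (simp add: b_def ball_bump_props(3)[OF r(1)] dist_commute)
 show ?thesis
  by (rule that[OF K cl KU sm _ _ off one])
   (simp_all add: b_def ball_bump_props[OF r(1)])
qed

text \<open>At a point outside \<open>U\<close> the complement of the closed set \<open>K\<close> is
  a neighbourhood on which the product vanishes, whatever values \<open>f\<close> takes
  there.\<close>

lemma msmooth_cutoff: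
 assumes "\<And>q. msmooth b q" "closed K" "K \<subseteq> U" "\<And>q. q \<notin> K ==> b q = 0" "\<And>q. q \<in> U ==> msmooth f q"
 shows "msmooth (\<lambda>q. b q *\<^sub>R f q) q"
proof (cases "q \<in> U")
 case False
 then have "q \<in> - K" using assms(3) by auto
 then have "\<forall>\<^sub>F q in nhds q. q \<in> - K" using assms(2) by (intro eventually_nhds_in_open) auto
 then have "\<forall>\<^sub>F q in nhds q. 0 = b q *\<^sub>R f q" by eventually_elim (simp add: assms(4))
 then show ?thesis by (rule msmooth_cong[OF msmooth_const])
qed (intro msmooth_scaleR assms)

lemma vsmooth_cutoff:
 assumes "\<And>q. msmooth b q" "closed K" "K \<subseteq> U" "\<And>q. q \<notin> K ==> b q = 0" "\<And>q. q \<in> U ==> vsmooth X q"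
 shows "vsmooth (\<lambda>q. b q *\<^sub>R X q) q"
proof (cases "q \<in> U")
 case False
 then have "q \<in> - K" using assms(3) by auto
 then have "\<forall>\<^sub>F q in nhds q. q \<in> - K" using assms(2) by (intro eventually_nhds_in_open) auto
 then have "\<forall>\<^sub>F q in nhds q. 0 = b q *\<^sub>R X q" by eventually_elim (simp add: assms(4))
 then show ?thesis by (rule vsmooth_cong[OF vsmooth_zero])
qed (intro vsmooth_scaleR assms)

lemma coordinate_field:
 assumes c: "(U, psi) \<in> max_atlas A" "p \<in> U"
 obtains X where "vector_field A X" "\<forall>\<^sub>F q in nhds p. dd psi q (X q) = v"
proof -
 obtain b :: "'m => real" and K where b: "closed K" "K \<subseteq> U \<inter> UNIV" "\<And>q. msmooth b q"
  "\<And>q. q \<notin> K ==> b q = 0" "\<forall>\<^sub>F q in nhds p. b q = 1"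
  by (rule manifold_bump[OF c open_UNIV UNIV_I]) blast
 have "vsmooth (\<lambda>q. b q *\<^sub>R lift psi q v) q" for q
  by (rule vsmooth_cutoff[OF b(3,1) _ b(4)]) (use b(2) vsmooth_lift[OF c(1) _ msmooth_const] in auto)
 moreover have "\<forall>\<^sub>F q in nhds p. dd psi q (b q *\<^sub>R lift psi q v) = v"
  using b(5) ev_chart(1)[OF c(1) c(2)]
  by eventually_elim (simp add: lift[OF c(1)])
 ultimately show ?thesis using that[of "\<lambda>q. b q *\<^sub>R lift psi q v"] by (simp add: vector_field_iff)
qed

text \<open>A bump function times a constant coordinate field is a global field with the prescribed
  value, so the choice made in \<open>extend\<close> is a genuine extension.\<close>

lemma extend: "vector_field A (extend A p v)" "extend A p v p = v"
proof -
 obtain X where X: "vector_field A X" "\<forall>\<^sub>F q in nhds p. dd (cf p) q (X q) = v"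
  by (rule coordinate_field[OF chart_at_max chart_at_in(2)])
 from eventually_nhds_x_imp_x[OF X(2)] X(1) have "\<exists>X. vector_field A X \<and> X p = v" by auto
 from someI_ex[OF this] show "vector_field A (extend A p v)" "extend A p v p = v"
  by (simp_all add: extend_def)
qed

lemmas extend_vsmooth = vector_fieldD[OF extend(1)]

subsection \<open>The Lie bracket and exterior derivatives\<close>

text \<open>The derivative of \<open>Y\<close> and the second derivative of \<open>f\<close> are
  separated. The latter is a coordinate Hessian, symmetric in \<open>u\<close> and
  \<open>Y p\<close>, and therefore drops out of every commutator of derivations.\<close>

lemma dd_dd:
 fixes f :: "'m => 'b::euclidean_space"
 assumes c: "(U, psi) \<in> max_atlas A" "p \<in> U" and f: "msmooth f p" and Y: "vsmooth Y p"
 shows "dd (\<lambda>q. dd f q (Y q)) p u = fd (\<lambda>x. f (inv_into U psi x)) (psi p) (dd (\<lambda>q. dd psi q (Y q)) p u)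
  + fd (\<lambda>x. fd (\<lambda>x. f (inv_into U psi x)) x (dd psi p u)) (psi p) (dd psi p (Y p))"
proof -
 let ?F = "\<lambda>x. f (inv_into U psi x)" and ?Y = "\<lambda>q. dd psi q (Y q)"
 have F: "smooth_at ?F (psi p)" by (rule msmoothD[OF c f])
 have Ys: "msmooth ?Y p" by (rule vsmoothD[OF c Y])
 have Yb: "msmooth (\<lambda>q. ?Y q \<bullet> b) p" for b by (intro msmooth_inner Ys msmooth_const)
 have dYb: "dd (\<lambda>q. ?Y q \<bullet> b) p u = dd ?Y p u \<bullet> b" for b
  by (rule dd_linear_compose[OF _ Ys, of "\<lambda>y. y \<bullet> b"]) (simp add: linear_iff inner_add_left)
 have Fb: "msmooth (\<lambda>q. fd ?F (psi q) b) p" for b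
  by (rule msmooth_fd_chart[OF c f])
 have dFb: "dd (\<lambda>q. fd ?F (psi q) b) p u = fd (\<lambda>x. fd ?F x b) (psi p) (dd psi p u)" for b
  by (rule dd_compose[of "\<lambda>x. fd ?F x b" psi p u, OF smooth_at_fd[OF F] msmooth_chart[OF c]])
 have "dd (\<lambda>q. dd f q (Y q)) p u = dd (\<lambda>q. \<Sum>b\<in>Basis. (?Y q \<bullet> b) *\<^sub>R fd ?F (psi q) b) p u"
  by (rule fun_cong[OF dd_cong], rule eventually_mono[OF dd_expand[OF c f]]) blast
 also have "\<dots> = (\<Sum>b\<in>Basis. (?Y p \<bullet> b) *\<^sub>R fd (\<lambda>x. fd ?F x b) (psi p) (dd psi p u) + (dd ?Y p u \<bullet> b) *\<^sub>R fd ?F (psi p) b)"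
  by (subst dd_sum) (simp_all add: msmooth_scaleR Yb Fb dd_scaleR dYb dFb)
 also have "\<dots> = (\<Sum>b\<in>Basis. (?Y p \<bullet> b) *\<^sub>R fd (\<lambda>x. fd ?F x (dd psi p u)) (psi p) b) + (\<Sum>b\<in>Basis. (dd ?Y p u \<bullet> b) *\<^sub>R fd ?F (psi p) b)"
  by (simp add: sum.distrib fd_commute[OF F, of _ "dd psi p u"])
 also have "(\<Sum>b\<in>Basis. (?Y p \<bullet> b) *\<^sub>R fd (\<lambda>x. fd ?F x (dd psi p u)) (psi p) b) = fd (\<lambda>x. fd ?F x (dd psi p u)) (psi p) (?Y p)"
 proof -
  note l = smooth_at_linear[OF smooth_at_fd[OF F, of "dd psi p u"]]
  show ?thesis
   by (subst (2) euclidean_representation[of "?Y p", symmetric]) (simp only: linear_sum[OF l] linear_scale[OF l])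
 qed
 also have "(\<Sum>b\<in>Basis. (dd ?Y p u \<bullet> b) *\<^sub>R fd ?F (psi p) b) = fd ?F (psi p) (dd ?Y p u)"
 proof -
  note l = smooth_at_linear[OF F]
  show ?thesis
   by (subst (2) euclidean_representation[of "dd ?Y p u", symmetric]) (simp only: linear_sum[OF l] linear_scale[OF l])
 qed
 finally show ?thesis by (simp only: add.commute)
qed

lemma dd_bracket:
 fixes f :: "'m => 'b::euclidean_space"
 assumes f: "msmooth f p" and X: "vsmooth X p" and Y: "vsmooth Y p"
 shows "dd f p (bracket A X Y p) = dd (\<lambda>q. dd f q (Y q)) p (X p) - dd (\<lambda>q. dd f q (X q)) p (Y p)"
proof -
 let ?F = "\<lambda>x. f (ci p x)"
 have F: "smooth_at ?F (cx p)" using f by (simp add: msmooth_def)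
 have "dd f p w = fd ?F (cx p) w" for w by (simp add: dd_def)
 moreover have "bracket A X Y p = dd (\<lambda>q. dd (cf p) q (Y q)) p (X p) - dd (\<lambda>q. dd (cf p) q (X q)) p (Y p)"
  by (simp add: bracket_def Let_def)
 ultimately show ?thesis
  using fd_commute[OF F, of "X p" "Y p"]
  by (simp only: dd_dd[OF chart_at_max chart_at_in(2) f Y] dd_dd[OF chart_at_max chart_at_in(2) f X]
    linear_diff[OF smooth_at_linear[OF F]] dd_chart_at) simp
qed

text \<open>The derivatives of the chosen extensions cancel against the bracket, which leaves the
  wedge products of the da_j and df_j. In particular the value does not depend on the
  extensions.\<close>

lemma d_one_form_local:
 fixes a f :: "'i => 'm => real"
 assumes a: "\<And>j. j \<in> S ==> msmooth (a j) p" and f: "\<And>j. j \<in> S ==> msmooth (f j) p"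
  and ev: "\<forall>\<^sub>F q in nhds p. \<forall>w. \<alpha> q w = (\<Sum>j\<in>S. a j q * dd (f j) q w)"
 shows "d_one_form A \<alpha> p u v = (\<Sum>j\<in>S. dd (a j) p u * dd (f j) p v - dd (a j) p v * dd (f j) p u)"
proof -
 define X where "X = extend A p u"
 define Y where "Y = extend A p v"
 have XY: "vsmooth X p" "vsmooth Y p" "X p = u" "Y p = v"
  by (simp_all add: X_def Y_def extend extend_vsmooth)
 have D: "dd (\<lambda>q. \<alpha> q (Z q)) p w = (\<Sum>j\<in>S. dd (a j) p w * dd (f j) p (Z p) + a j p * dd (\<lambda>q. dd (f j) q (Z q)) p w)"
  if Z: "vsmooth Z p" for Z w
 proof -
  have "dd (\<lambda>q. \<alpha> q (Z q)) p w = dd (\<lambda>q. \<Sum>j\<in>S. a j q * dd (f j) q (Z q)) p w"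
   by (rule fun_cong[OF dd_cong], rule eventually_mono[OF ev]) blast
  also have "\<dots> = (\<Sum>j\<in>S. dd (\<lambda>q. a j q * dd (f j) q (Z q)) p w)"
   by (rule dd_sum) (intro msmooth_mult a msmooth_dd Z f)
  also have "\<dots> = (\<Sum>j\<in>S. dd (a j) p w * dd (f j) p (Z p) + a j p * dd (\<lambda>q. dd (f j) q (Z q)) p w)"
   by (rule sum.cong[OF refl]) (simp add: dd_mult a f msmooth_dd Z)
  finally show ?thesis .
 qed
 have B: "\<alpha> p (bracket A X Y p) = (\<Sum>j\<in>S. a j p * (dd (\<lambda>q. dd (f j) q (Y q)) p u - dd (\<lambda>q. dd (f j) q (X q)) p v))"
  using eventually_nhds_x_imp_x[OF ev] dd_bracket[OF f XY(1,2)] XY by simp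
 show ?thesis
  unfolding d_one_form_def X_def[symmetric] Y_def[symmetric] Let_def D[OF XY(1)] D[OF XY(2)] B
   sum_subtractf[symmetric] XY
  by (rule sum.cong[OF refl]) (simp add: algebra_simps)
qed

text \<open>A sum of wedge products of exact forms is closed: once the brackets are expanded by
  \<open>dd_bracket\<close>, all terms with second derivatives cancel in pairs.\<close>

lemma d_two_form_local:
 fixes a f :: "'i => 'm => real"
 assumes a: "\<And>j. j \<in> S ==> msmooth (a j) p" and f: "\<And>j. j \<in> S ==> msmooth (f j) p"
  and ev: "\<forall>\<^sub>F q in nhds p. \<forall>v w. tau q v w = (\<Sum>j\<in>S. dd (a j) q v * dd (f j) q w - dd (a j) q w * dd (f j) q v)"
 shows "d_two_form A tau p u v w = 0"
proof -
 define X where "X = extend A p u"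
 define Y where "Y = extend A p v"
 define Z where "Z = extend A p w"
 have XYZ: "vsmooth X p" "vsmooth Y p" "vsmooth Z p" "X p = u" "Y p = v" "Z p = w"
  by (simp_all add: X_def Y_def Z_def extend extend_vsmooth)
 have D: "dd (\<lambda>q. tau q (V q) (W q)) p t = (\<Sum>j\<in>S.
   dd (a j) p (V p) * dd (\<lambda>q. dd (f j) q (W q)) p t + dd (\<lambda>q. dd (a j) q (V q)) p t * dd (f j) p (W p)
   - (dd (a j) p (W p) * dd (\<lambda>q. dd (f j) q (V q)) p t + dd (\<lambda>q. dd (a j) q (W q)) p t * dd (f j) p (V p)))"
  if V: "vsmooth V p" and W: "vsmooth W p" for V W t
 proof -
  have "dd (\<lambda>q. tau q (V q) (W q)) p t
   = dd (\<lambda>q. \<Sum>j\<in>S. dd (a j) q (V q) * dd (f j) q (W q) - dd (a j) q (W q) * dd (f j) q (V q)) p t"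
   by (rule fun_cong[OF dd_cong], rule eventually_mono[OF ev]) blast
  also have "\<dots> = (\<Sum>j\<in>S. dd (\<lambda>q. dd (a j) q (V q) * dd (f j) q (W q) - dd (a j) q (W q) * dd (f j) q (V q)) p t)"
   by (rule dd_sum) (intro msmooth_diff msmooth_mult a msmooth_dd V W f)
  also have "\<dots> = (\<Sum>j\<in>S.
   dd (a j) p (V p) * dd (\<lambda>q. dd (f j) q (W q)) p t + dd (\<lambda>q. dd (a j) q (V q)) p t * dd (f j) p (W p)
   - (dd (a j) p (W p) * dd (\<lambda>q. dd (f j) q (V q)) p t + dd (\<lambda>q. dd (a j) q (W q)) p t * dd (f j) p (V p)))"
   by (rule sum.cong[OF refl]) (simp add: dd_diff dd_mult a f msmooth_dd msmooth_mult V W)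
  finally show ?thesis .
 qed
 have T: "tau p s t = (\<Sum>j\<in>S. dd (a j) p s * dd (f j) p t - dd (a j) p t * dd (f j) p s)" for s t
  using eventually_nhds_x_imp_x[OF ev] by blast
 have "d_two_form A tau p u v w = (\<Sum>j\<in>S. 0)"
  unfolding d_two_form_def X_def[symmetric] Y_def[symmetric] Z_def[symmetric] Let_def
   D[OF XYZ(1,2)] D[OF XYZ(1,3)] D[OF XYZ(2,3)] T XYZ sum_subtractf[symmetric] sum.distrib[symmetric]
  by (rule sum.cong[OF refl]) (simp add: dd_bracket a f XYZ algebra_simps)
 then show ?thesis by simp
qed

end

section \<open>Traces and determinants\<close>

lemma endo_trace_sum: "endo_trace T = (\<Sum>k\<in>UNIV. T (axis k 1) $ k)"
 by (simp add: endo_trace_def trace_def matrix_def)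

lemma endo_trace_comm:
 assumes "linear f" "linear g"
 shows "endo_trace (\<lambda>x. f (g x)) = endo_trace (\<lambda>x. g (f x))"
 using trace_mul_sym[of "matrix f" "matrix g"] matrix_compose[OF assms(2,1)] matrix_compose[OF assms]
 by (simp add: endo_trace_def comp_def)

lemma endo_trace_conj:
 assumes "linear T" "linear E" "linear L" "\<And>x. L (E x) = x"
 shows "endo_trace (\<lambda>x. E (T (L x))) = endo_trace T"
 using endo_trace_comm[OF assms(2) linear_compose[OF assms(3,1)]] assms(4) by (simp add: comp_def)

lemma endo_trace_add: "endo_trace (\<lambda>x. f x + g x) = endo_trace f + endo_trace g"
 by (simp add: endo_trace_sum sum.distrib)

lemma endo_trace_diff: "endo_trace (\<lambda>x. f x - g x) = endo_trace f - endo_trace g"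
 by (simp add: endo_trace_sum sum_subtractf)

lemma endo_trace_minus: "endo_trace (\<lambda>x. - f x) = - endo_trace f"
 by (simp add: endo_trace_sum sum_negf)

lemma endo_trace_scale: "endo_trace (\<lambda>x. c *\<^sub>R f x) = c * endo_trace f"
 by (simp add: endo_trace_sum sum_distrib_left)

lemma endo_trace_id: "endo_trace (\<lambda>x::'n::finite model. x) = real CARD('n \<times> bool)"
 by (simp add: endo_trace_sum)

lemma sum_axis: "(\<Sum>k\<in>UNIV. (x $ k) *\<^sub>R axis k 1) = (x :: real ^ 'k::finite)"
 using basis_expansion[of x] by (simp add: scalar_mult_eq_scaleR)

lemma endo_trace_rank_one:
 assumes "linear a"
 shows "endo_trace (\<lambda>w. a w *\<^sub>R v) = a v"
proof -
 have "a v = a (\<Sum>k\<in>UNIV. (v $ k) *\<^sub>R axis k 1)" by (simp only: sum_axis)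
 also have "\<dots> = (\<Sum>k\<in>UNIV. v $ k * a (axis k 1))"
  by (simp add: linear_sum[OF assms] linear_scale[OF assms])
 finally show ?thesis by (simp add: endo_trace_sum mult.commute)
qed

definition alternating :: "(('k => real ^ 'k) => real) => bool" where
 "alternating g \<longleftrightarrow> (\<forall>b k. linear (\<lambda>v. g (b(k := v)))) \<and> (\<forall>b j k. j \<noteq> k --> b j = b k --> g b = 0)"

lemma alternating_swap:
 assumes g: "alternating g" and jk: "j \<noteq> k"
 shows "g (b(j := b k, k := b j)) = - g b"
proof -
 define h where "h x y = g (b(j := x, k := y))" for x y
 have l2: "linear (h x)" for x using g by (simp add: alternating_def h_def[abs_def])
 have l1: "linear (\<lambda>x. h x y)" for y
  unfolding h_def using g fun_upd_twist[OF jk, of b _ y] by (simp add: alternating_def)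
 have z: "h x x = 0" for x using g jk unfolding alternating_def h_def by (metis fun_upd_apply)
 have "h (b j + b k) (b j + b k) = (h (b j) (b j) + h (b k) (b j)) + (h (b j) (b k) + h (b k) (b k))"
  using linear_add[OF l2, of "b j + b k" "b j" "b k"] linear_add[OF l1, of "b j" "b k"] by metis
 then have "h (b k) (b j) = - h (b j) (b k)" using z by simp
 then show ?thesis by (simp add: h_def)
qed

lemma alternating_permute:
 fixes g :: "('k::finite => real ^ 'k) => real"
 assumes g: "alternating g" and z: "g (\<lambda>k. axis k 1) = 0" and p: "p permutes UNIV"
 shows "g (\<lambda>k. axis (p k) 1) = 0"
 using p finite[of "UNIV :: 'k set"]
proof (induction rule: permutes_induct)
 case (swap a b p)
 show ?case
 proof (cases "a = b")
  case False
  let ?c = "\<lambda>k. axis (p k) (1::real)"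
  define j k where "j = inv p a" and "k = inv p b"
  have jk: "p j = a" "p k = b" using swap by (simp_all add: j_def k_def permutes_inverses)
  then have "j \<noteq> k" using False by auto
  have "inj p" using swap permutes_inj by blast
  have "(\<lambda>k. axis ((Transposition.transpose a b \<circ> p) k) (1::real)) = ?c(j := ?c k, k := ?c j)"
   using jk \<open>j \<noteq> k\<close> injD[OF \<open>inj p\<close>] by (auto simp: fun_eq_iff Transposition.transpose_def)
  then show ?thesis using alternating_swap[OF g \<open>j \<noteq> k\<close>, of ?c] swap by simp
 qed (use swap in "simp add: comp_def")
qed (simp add: z)

text \<open>The induction runs over the set of slots that may hold arbitrary vectors, the other
  slots holding standard basis vectors. If all slots hold basis vectors, either two of them agree or
  they form a permutation of the standard frame.\<close>

lemma alternating_zero: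
 fixes g :: "('k::finite => real ^ 'k) => real"
 assumes g: "alternating g" and z: "g (\<lambda>k. axis k 1) = 0"
 shows "g b = 0"
proof -
 have "\<forall>b. (\<forall>k. k \<notin> S --> (\<exists>i. b k = axis i 1)) --> g b = 0" if "finite S" for S
  using that
 proof (induction S rule: finite_induct)
  case empty
  show ?case
  proof (intro allI impI)
   fix b :: "'k => real ^ 'k"
   assume "\<forall>k. k \<notin> {} --> (\<exists>i. b k = axis i 1)"
   then obtain p where p: "\<And>k. b k = axis (p k) 1" by (metis empty_iff)
   then have bp: "b = (\<lambda>k. axis (p k) 1)" by auto
   show "g b = 0"
   proof (cases "inj p")
    case True
    then have "bij p" using finite_UNIV_inj_surj[of p] by (simp add: bij_def)
    then have "p permutes UNIV" by (intro bij_imp_permutes) simp_all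
    then show ?thesis unfolding bp by (rule alternating_permute[OF g z])
   next
    case False
    then obtain j k where "j \<noteq> k" "p j = p k" by (auto simp: inj_def)
    then show ?thesis using g p by (metis alternating_def)
   qed
  qed
 next
  case (insert k S)
  show ?case
  proof (intro allI impI)
   fix b :: "'k => real ^ 'k"
   assume b: "\<forall>j. j \<notin> insert k S --> (\<exists>i. b j = axis i 1)"
   have l: "linear (\<lambda>v. g (b(k := v)))" using g by (simp add: alternating_def)
   have 0: "g (b(k := axis i 1)) = 0" for i
   proof -
    have "\<forall>j. j \<notin> S --> (\<exists>i'. (b(k := axis i 1)) j = axis i' 1)"
     using b by (auto simp: fun_upd_def)
    then show ?thesis using insert.IH by blast
   qed
   have "g b = g (b(k := b k))" by simp
   also have "\<dots> = g (b(k := (\<Sum>i\<in>UNIV. (b k $ i) *\<^sub>R axis i 1)))" by (simp only: sum_axis)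
   also have "\<dots> = (\<Sum>i\<in>UNIV. g (b(k := (b k $ i) *\<^sub>R axis i 1)))" by (rule linear_sum[OF l])
   also have "\<dots> = 0" by (rule sum.neutral) (simp only: linear_scale[OF l] 0, simp)
   finally show "g b = 0" .
  qed
 qed
 from this[OF finite[of UNIV]] show ?thesis by blast
qed

lemma alternating_det: "alternating (\<lambda>b :: 'k::finite => real ^ 'k. det (\<chi> k. b k))"
 unfolding alternating_def
proof (intro conjI allI impI)
 fix b :: "'k => real ^ 'k" and k
 have e: "(\<chi> i. (b(k := v)) i) = (\<chi> i. if i = k then v else b i)" for v
  by (simp add: fun_upd_def)
 show "linear (\<lambda>v. det (\<chi> i. (b(k := v)) i))"
  unfolding e
 proof (rule linearI)
  fix x y :: "real ^ 'k" and c :: real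
  show "det (\<chi> i. if i = k then x + y else b i) = det (\<chi> i. if i = k then x else b i) + det (\<chi> i. if i = k then y else b i)"
   using det_row_add[of k "\<lambda>_. x" "\<lambda>_. y" b] .
  show "det (\<chi> i. if i = k then c *\<^sub>R x else b i) = c *\<^sub>R det (\<chi> i. if i = k then x else b i)"
   using det_row_mul[of k c "\<lambda>_. x" b] unfolding scalar_mult_eq_scaleR by simp
 qed
next
 fix b :: "'k => real ^ 'k" and j k :: 'k
 assume "j \<noteq> k" "b j = b k"
 then show "det (\<chi> k. b k) = 0" by (intro det_identical_rows[of j k]) (simp_all add: row_def vec_eq_iff)
qed

lemma alternating_eq_det:
 fixes g :: "('k::finite => real ^ 'k) => real"
 assumes g: "alternating g"
 shows "g b = g (\<lambda>k. axis k 1) * det (\<chi> k. b k)"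
proof -
 let ?h = "\<lambda>b. g b - g (\<lambda>k. axis k 1) * det (\<chi> k. b k)"
 have I: "(\<chi> k. axis k 1) = (mat 1 :: real ^ 'k ^ 'k)"
  by (simp add: mat_def vec_eq_iff axis_def eq_commute)
 have "alternating ?h"
  unfolding alternating_def
 proof (intro conjI allI impI)
  fix b :: "'k => real ^ 'k" and k
  have "linear (\<lambda>v. g (b(k := v)))" "linear (\<lambda>v. det (\<chi> i. (b(k := v)) i))"
   using g alternating_det[where 'k = 'k] unfolding alternating_def by blast+
  then show "linear (\<lambda>v. ?h (b(k := v)))"
   by (simp add: linear_iff algebra_simps)
 next
  fix b :: "'k => real ^ 'k" and j k
  assume "j \<noteq> k" "b j = b k"
  then have "g b = 0" "det (\<chi> k. b k) = 0"
   using g alternating_det[where 'k = 'k] unfolding alternating_def by blast+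
  then show "?h b = 0" by simp
 qed
 from alternating_zero[OF this, of b] show ?thesis by (simp add: I)
qed

lemma det_axis_upd: "det (\<chi> k. ((\<lambda>k. axis k 1)(j := r)) k) = (r $ j :: real)" for j :: "'k::finite"
proof -
 have "(\<chi> k. ((\<lambda>k. axis k 1)(j := r)) k) = (\<chi> i. if i = j then (\<Sum>i\<in>UNIV. r $ i *s row i (mat 1)) else row i (mat 1 :: real ^ 'k ^ 'k))"
 proof -
  have r: "row i (mat 1 :: real ^ 'k ^ 'k) = axis i 1" for i
   by (simp add: row_def mat_def vec_eq_iff axis_def eq_commute)
  show ?thesis by (simp add: r fun_upd_def basis_expansion vec_eq_iff)
 qed
 then show ?thesis using cramer_lemma_transpose[where k = j and x = r and A = "mat 1"] by simp
qed

text \<open>The left side is again alternating in \<open>b\<close>, hence a multiple of the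
  determinant, and on the standard frame it is the trace. It is the infinitesimal form of the
  multiplicativity of the determinant.\<close>

lemma sum_det_upd:
 fixes b :: "'k::finite => real ^ 'k"
 assumes T: "linear T"
 shows "(\<Sum>j\<in>UNIV. det (\<chi> k. (b(j := T (b j))) k)) = (\<Sum>k\<in>UNIV. T (axis k 1) $ k) * det (\<chi> k. b k)"
proof -
 let ?d = "\<lambda>b. det (\<chi> k. b k) :: real"
 let ?g = "\<lambda>b. \<Sum>j\<in>UNIV. ?d (b(j := T (b j)))"
 have lin: "linear (\<lambda>v. ?d (b(k := v)))" and alt: "\<And>j k. j \<noteq> k ==> b j = b k ==> ?d b = 0" for b :: "'k => real ^ 'k" and k
  using alternating_det[where 'k = 'k] unfolding alternating_def by blast+
 have "alternating ?g"
  unfolding alternating_def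
 proof (intro conjI allI impI)
  fix b :: "'k => real ^ 'k" and k
  have "linear (\<lambda>v. ?d ((b(k := v))(j := T ((b(k := v)) j))))" for j
  proof (cases "j = k")
   case True
   then show ?thesis using linear_compose[OF T lin[of b k]] by (simp add: comp_def)
  next
   case False
   then show ?thesis using lin[of "b(j := T (b j))" k] by (simp add: fun_upd_twist[OF False])
  qed
  then show "linear (\<lambda>v. ?g (b(k := v)))" by (intro linear_compose_sum) auto
 next
  fix b :: "'k => real ^ 'k" and j k :: 'k
  assume jk: "j \<noteq> k" "b j = b k"
  have 0: "?d (b(i := T (b i))) = 0" if "i \<notin> {j, k}" for i
   using jk that by (intro alt[of j k]) auto
  have "?g b = (\<Sum>i\<in>{j, k}. ?d (b(i := T (b i))))"
   by (rule sum.mono_neutral_right) (use 0 in auto)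
  also have "\<dots> = ?d (b(j := T (b j))) + ?d (b(k := T (b k)))" using jk(1) by simp
  also have "?d (b(k := T (b k))) = - ?d (b(j := T (b j)))"
  proof -
   let ?c = "b(j := T (b j))"
   have "b(k := T (b k)) = ?c(j := ?c k, k := ?c j)" using jk by (auto simp: fun_eq_iff)
   then show ?thesis using alternating_swap[OF alternating_det jk(1), of ?c] by simp
  qed
  finally show "?g b = 0" by simp
 qed
 from alternating_eq_det[OF this, of b] show ?thesis by (simp only: det_axis_upd)
qed

lemma det_has_derivative:
 fixes B :: "real ^ 'k ^ 'k::finite"
 shows "(det has_derivative (\<lambda>H. \<Sum>j\<in>UNIV. det (\<chi> k. ((($) B)(j := H $ j)) k))) (at B)"
proof -
 let ?h = "\<lambda>H. \<Sum>p\<in>{p. p permutes UNIV}. of_int (sign p) * (\<Sum>j\<in>UNIV. H $ j $ p j * (\<Prod>i\<in>UNIV - {j}. B $ i $ p i))"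
 have "((\<lambda>B. \<Sum>p\<in>{p. p permutes UNIV}. of_int (sign p) * (\<Prod>i\<in>UNIV. B $ i $ p i)) has_derivative ?h) (at B)"
  by (intro has_derivative_sum has_derivative_mult_right has_derivative_prod bounded_linear_imp_has_derivative
    bounded_linear_vec_nth[THEN bounded_linear_compose] bounded_linear_vec_nth)
 moreover have "?h H = (\<Sum>j\<in>UNIV. det (\<chi> k. ((($) B)(j := H $ j)) k))" for H
 proof -
  have "(\<Prod>i\<in>UNIV. ((\<chi> k. ((($) B)(j := H $ j)) k) $ i $ p i)) = H $ j $ p j * (\<Prod>i\<in>UNIV - {j}. B $ i $ p i)" for j p
   by (subst prod.remove[of _ j]) (auto intro!: prod.cong)
  then show ?thesis unfolding det_def by (subst sum.swap) (simp add: sum_distrib_left)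
 qed
 ultimately show ?thesis unfolding det_def[abs_def, symmetric] by simp
qed

lemma det_frame_nonzero:
 fixes b :: "'k::finite => real ^ 'k"
 assumes "det (\<chi> k. b k) \<noteq> 0"
 shows "linear (\<lambda>x. \<Sum>k\<in>UNIV. (x $ k) *\<^sub>R b k)" "bij (\<lambda>x. \<Sum>k\<in>UNIV. (x $ k) *\<^sub>R b k)"
proof -
 let ?E = "\<lambda>x. \<Sum>k\<in>UNIV. (x $ k) *\<^sub>R b k"
 show l: "linear ?E"
  by (rule linearI) (simp_all add: scaleR_add_left sum.distrib scaleR_sum_right)
 have "matrix ?E = transpose (\<chi> k. b k)"
  by (simp add: matrix_def transpose_def vec_eq_iff axis_def if_distrib[of "\<lambda>x. x *\<^sub>R _"] cong: if_cong)
 then have "inj ?E" using assms det_nz_iff_inj[OF l] by simp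
 then show "bij ?E" using linear_injective_imp_surjective[OF l] by (simp add: bij_def)
qed

lemma endo_trace_frame:
 fixes b :: "'n::finite \<times> bool => 'n model"
 assumes "linear T" "det (\<chi> k. b k) \<noteq> 0" "\<And>k. T (b k) = (\<Sum>l\<in>UNIV. m l k *\<^sub>R b l)"
 shows "endo_trace T = (\<Sum>k\<in>UNIV. m k k)"
proof -
 let ?E = "\<lambda>x. \<Sum>k\<in>UNIV. (x $ k) *\<^sub>R b k"
 define L where "L = inv ?E"
 note E = det_frame_nonzero[OF assms(2)]
 have LE: "L (?E x) = x" for x
  unfolding L_def by (rule inv_f_f[OF bij_is_inj[OF E(2)]])
 have EL: "?E (L x) = x" for x
  unfolding L_def by (rule surj_f_inv_f[OF bij_is_surj[OF E(2)]])
 have lL: "linear L" unfolding L_def by (rule inj_linear_imp_inv_linear[OF E(1) bij_is_inj[OF E(2)]])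
 have "endo_trace T = endo_trace (\<lambda>x. L (T (?E x)))"
  using endo_trace_conj[OF assms(1) lL E(1) EL] by simp
 also have "\<dots> = (\<Sum>k\<in>UNIV. m k k)"
 proof -
  have "?E (axis k 1) = b k" for k
   by (simp add: axis_def if_distrib[of "\<lambda>x. x *\<^sub>R _"] cong: if_cong)
  moreover have "L (T (b k)) = (\<chi> l. m l k)" for k
   using LE[of "\<chi> l. m l k"] by (simp add: assms(3))
  ultimately show ?thesis by (simp add: endo_trace_sum)
 qed
 finally show ?thesis .
qed

lemma sum_model: "(\<Sum>k\<in>(UNIV :: ('n::finite \<times> bool) set). f k) = (\<Sum>i\<in>UNIV. f (i, False) + f (i, True))"
proof -
 have U: "(UNIV :: ('n \<times> bool) set) = UNIV \<times> UNIV" by auto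
 have "(\<Sum>k\<in>UNIV \<times> UNIV. f k) = (\<Sum>i\<in>UNIV. \<Sum>b\<in>UNIV. f (i, b))" by (simp add: sum.cartesian_product)
 also have "\<dots> = (\<Sum>i\<in>UNIV. f (i, False) + f (i, True))" by (simp add: UNIV_bool)
 finally show ?thesis by (simp only: U)
qed

text \<open>In the real frame e_i, I e_i a complex entry a becomes the block with rows (Re a, - Im
  a) and (Im a, Re a). So the real trace is twice the real part of the complex one, and composition
  with \<open>I\<close> brings out the imaginary part. Independence of the basis, on which the
  description \<open>complex_trace\<close> rests, follows as well.\<close>

lemma complex_trace_eq:
 assumes T: "linear T" and I: "linear I" "\<And>v. I (I v) = - v" and TI: "\<And>v. T (I v) = I (T v)"
  and ex: "\<exists>e. complex_basis I e"
 shows "complex_trace I T = Complex (endo_trace T / 2) (- endo_trace (\<lambda>v. I (T v)) / 2)"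
proof -
 have val: "t = Complex (endo_trace T / 2) (- endo_trace (\<lambda>v. I (T v)) / 2)"
  if e: "complex_basis I e" and a: "\<forall>j. T (e j) = (\<Sum>i\<in>UNIV. Re (a i j) *\<^sub>R e i + Im (a i j) *\<^sub>R I (e i))"
   and t: "t = (\<Sum>i\<in>UNIV. a i i)" for e a t
 proof -
  let ?b = "complex_frame I e"
  have d: "det (\<chi> k. ?b k) \<noteq> 0" using e by (simp add: complex_basis_def)
  have b: "?b (i, False) = e i" "?b (i, True) = I (e i)" for i by (simp_all add: complex_frame_def)
  define m where "m = (\<lambda>l k. case (l, k) of ((i, x), (j, y)) =>
   (if x = y then Re (a i j) else if x then Im (a i j) else - Im (a i j)))"
  define m' where "m' = (\<lambda>l k. case (l, k) of ((i, x), (j, y)) =>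
   (if x = y then - Im (a i j) else if x then Re (a i j) else - Re (a i j)))"
  have Te: "T (e j) = (\<Sum>i\<in>UNIV. Re (a i j) *\<^sub>R e i + Im (a i j) *\<^sub>R I (e i))" for j using a by blast
  have ITe: "I (T (e j)) = (\<Sum>i\<in>UNIV. - Im (a i j) *\<^sub>R e i + Re (a i j) *\<^sub>R I (e i))" for j
   by (simp add: Te linear_sum[OF I(1)] linear_add[OF I(1)] linear_scale[OF I(1)] I(2) add.commute)
  have TIe: "T (I (e j)) = (\<Sum>i\<in>UNIV. - Im (a i j) *\<^sub>R e i + Re (a i j) *\<^sub>R I (e i))" for j
   by (simp only: TI ITe)
  have ITIe: "I (T (I (e j))) = (\<Sum>i\<in>UNIV. - Re (a i j) *\<^sub>R e i - Im (a i j) *\<^sub>R I (e i))" for j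
   unfolding TI I(2) Te sum_negf[symmetric] by simp
  have "endo_trace T = (\<Sum>k\<in>UNIV. m k k)"
  proof (rule endo_trace_frame[OF T d, where m = m])
   fix k :: "'a \<times> bool"
   obtain j y where k: "k = (j, y)" by (cases k)
   show "T (?b k) = (\<Sum>l\<in>UNIV. m l k *\<^sub>R ?b l)"
    by (cases y) (simp_all add: k b sum_model m_def Te TIe)
  qed
  then have 1: "endo_trace T = 2 * (\<Sum>i\<in>UNIV. Re (a i i))"
   by (simp add: sum_model m_def sum_distrib_left)
  have "endo_trace (\<lambda>v. I (T v)) = (\<Sum>k\<in>UNIV. m' k k)"
  proof (rule endo_trace_frame[OF _ d, where m = m'])
   show "linear (\<lambda>v. I (T v))" using linear_compose[OF T I(1)] by (simp add: comp_def)
   fix k :: "'a \<times> bool"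
   obtain j y where k: "k = (j, y)" by (cases k)
   show "I (T (?b k)) = (\<Sum>l\<in>UNIV. m' l k *\<^sub>R ?b l)"
    by (cases y) (simp_all add: k b sum_model m'_def ITe ITIe)
  qed
  then have 2: "endo_trace (\<lambda>v. I (T v)) = - 2 * (\<Sum>i\<in>UNIV. Im (a i i))"
   by (simp add: sum_model m'_def sum_distrib_left sum_negf)
  show ?thesis unfolding t by (rule complex_eqI) (simp_all add: 1 2)
 qed
 obtain e where e: "complex_basis I e" using ex by blast
 let ?b = "complex_frame I e"
 have d: "det (\<chi> k. ?b k) \<noteq> 0" using e by (simp add: complex_basis_def)
 have "\<exists>x. T (e j) = (\<Sum>k\<in>UNIV. (x $ k) *\<^sub>R ?b k)" for j
  by (rule surjD[OF bij_is_surj[OF det_frame_nonzero(2)[OF d]]])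
 then obtain x where x: "\<And>j. T (e j) = (\<Sum>k\<in>UNIV. (x j $ k) *\<^sub>R ?b k)" by metis
 define a where "a i j = Complex (x j $ (i, False)) (x j $ (i, True))" for i j
 have a: "\<forall>j. T (e j) = (\<Sum>i\<in>UNIV. Re (a i j) *\<^sub>R e i + Im (a i j) *\<^sub>R I (e i))"
  by (simp add: x sum_model a_def complex_frame_def)
 show ?thesis unfolding complex_trace_def
 proof (rule the_equality)
  show "\<exists>e a. complex_basis I e \<and> (\<forall>j. T (e j) = (\<Sum>i\<in>UNIV. Re (a i j) *\<^sub>R e i + Im (a i j) *\<^sub>R I (e i))) \<and>
   Complex (endo_trace T / 2) (- endo_trace (\<lambda>v. I (T v)) / 2) = (\<Sum>i\<in>UNIV. a i i)"
   by (rule exI[of _ e], rule exI[of _ a], intro conjI e a) (rule val[OF e a refl, symmetric])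
 qed (elim exE conjE, rule val)
qed

context manifold
begin

section \<open>Connections in charts\<close>

lemma dd_linear_field:
 fixes L :: "'m => 'a::euclidean_space => 'b::euclidean_space"
 assumes l: "\<forall>\<^sub>F q in nhds p. linear (L q)" and L: "\<And>a. msmooth (\<lambda>q. L q a) p" and X: "msmooth X p"
 shows "msmooth (\<lambda>q. L q (X q)) p"
  "dd (\<lambda>q. L q (X q)) p u = dd (\<lambda>q. L q (X p)) p u + L p (dd X p u)"
proof -
 let ?S = "\<lambda>x q. \<Sum>b\<in>Basis. (x q \<bullet> b) *\<^sub>R L q b"
 have ex: "L q x = (\<Sum>b\<in>Basis. (x \<bullet> b) *\<^sub>R L q b)" if "linear (L q)" for q x
  by (subst (1) euclidean_representation[of x, symmetric]) (simp only: linear_sum[OF that] linear_scale[OF that])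
 have ev: "\<forall>\<^sub>F q in nhds p. ?S Y q = L q (Y q)" for Y
  by (rule eventually_mono[OF l]) (rule ex[symmetric])
 have Xb: "msmooth (\<lambda>q. X q \<bullet> b) p" for b by (intro msmooth_inner X msmooth_const)
 have "msmooth (?S X) p" by (intro msmooth_sum msmooth_scaleR Xb L)
 then show "msmooth (\<lambda>q. L q (X q)) p" by (rule msmooth_cong) (rule ev)
 have dXb: "dd (\<lambda>q. X q \<bullet> b) p u = dd X p u \<bullet> b" for b
  by (rule dd_linear_compose[OF _ X, of "\<lambda>y. y \<bullet> b"]) (simp add: linear_iff inner_add_left)
 have "dd (\<lambda>q. L q (X q)) p u = dd (?S X) p u" using dd_cong[OF ev[of X]] by simp
 also have "\<dots> = (\<Sum>b\<in>Basis. (X p \<bullet> b) *\<^sub>R dd (\<lambda>q. L q b) p u + (dd X p u \<bullet> b) *\<^sub>R L p b)"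
  by (subst dd_sum) (simp_all add: msmooth_scaleR Xb L dd_scaleR dXb)
 also have "\<dots> = (\<Sum>b\<in>Basis. (X p \<bullet> b) *\<^sub>R dd (\<lambda>q. L q b) p u) + L p (dd X p u)"
  using ex[OF eventually_nhds_x_imp_x[OF l], of "dd X p u"] by (simp add: sum.distrib)
 also have "(\<Sum>b\<in>Basis. (X p \<bullet> b) *\<^sub>R dd (\<lambda>q. L q b) p u) = dd (?S (\<lambda>q. X p)) p u"
  by (subst dd_sum) (simp_all add: msmooth_scaleR msmooth_const L dd_scaleR)
 also have "\<dots> = dd (\<lambda>q. L q (X p)) p u" using dd_cong[OF ev[of "\<lambda>q. X p"]] by simp
 finally show "dd (\<lambda>q. L q (X q)) p u = dd (\<lambda>q. L q (X p)) p u + L p (dd X p u)" .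
qed

text \<open>\<open>Gam\<close> holds the Christoffel symbols of \<open>D\<close> in the chart
  \<open>psi\<close>. A connection acts on global fields, so the symbols are obtained on a possibly
  smaller open set \<open>W\<close>, where cut-off coordinate fields agree with the true
  ones.\<close>

definition conn_rep ::
  "'m set => ('m => 'n model) => ('m, 'n) conn => 'm set => ('m => 'n model => 'n model => 'n model) => bool" where
 "conn_rep U psi D W Gam \<longleftrightarrow> (U, psi) \<in> max_atlas A \<and> open W \<and> W \<subseteq> U \<and>
   (\<forall>q\<in>W. (\<forall>y. linear (\<lambda>u. Gam q u y)) \<and> (\<forall>u. linear (Gam q u)) \<and> (\<forall>u y. msmooth (\<lambda>q. Gam q u y) q) \<and>
    (\<forall>u Y. vector_field A Y -->
      dd psi q (D q u Y) = dd (\<lambda>q. dd psi q (Y q)) q u + Gam q (dd psi q u) (dd psi q (Y q))))"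

lemma connectionD:
 assumes "connection A D"
 shows "vector_field A Y ==> linear (\<lambda>u. D p u Y)"
  "vector_field A Y ==> vector_field A Z ==> D p u (\<lambda>q. Y q + Z q) = D p u Y + D p u Z"
  "smooth_fun A f ==> vector_field A Y ==> D p u (\<lambda>q. f q *\<^sub>R Y q) = dd f p u *\<^sub>R Y p + f p *\<^sub>R D p u Y"
  "vector_field A X ==> vector_field A Y ==> vector_field A (\<lambda>p. D p (X p) Y)"
 using assms unfolding connection_def by blast+

lemma connection_sum:
 assumes D: "connection A D" and Y: "\<And>i. i \<in> I ==> vector_field A (Y i)"
 shows "D p u (\<lambda>q. \<Sum>i\<in>I. Y i q) = (\<Sum>i\<in>I. D p u (Y i))"
 using Y
proof (induction I rule: infinite_finite_induct)
 case (insert i I)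
 have "vector_field A (\<lambda>q. \<Sum>i\<in>I. Y i q)"
  using insert.prems by (simp add: vector_field_iff vsmooth_sum)
 then show ?case using insert connectionD(2)[OF D, of "Y i" "\<lambda>q. \<Sum>i\<in>I. Y i q"] by simp
next
 have z: "D p u (\<lambda>q. 0) = 0"
  using connectionD(3)[OF D, of "\<lambda>q. 0" "\<lambda>q. 0" p u] by (simp add: smooth_fun_iff msmooth_const vector_field_iff vsmooth_zero)
 case (infinite I) then show ?case using z by simp
next
 case empty
 show ?case
  using connectionD(3)[OF D, of "\<lambda>q. 0" "\<lambda>q. 0" p u] by (simp add: smooth_fun_iff msmooth_const vector_field_iff vsmooth_zero)
qed

text \<open>In place of \<open>Y\<close> its product with the square of a bump function is expanded
  in global fields: one factor cuts off the coefficients, the other one the coordinate fields. Near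
  \<open>p\<close> the square is 1, so the Leibniz rule gives back the derivative of
  \<open>Y\<close>.\<close>

lemma connection_local:
 assumes D: "connection A D" and c: "(U, psi) \<in> max_atlas A" "p \<in> U"
 obtains W Gam where "conn_rep U psi D W Gam" "p \<in> W"
proof -
 obtain b :: "'m => real" and K where b: "closed K" "K \<subseteq> U \<inter> UNIV" "\<And>q. msmooth b q"
  "\<And>q. q \<notin> K ==> b q = 0" "\<forall>\<^sub>F q in nhds p. b q = 1"
  by (rule manifold_bump[OF c open_UNIV UNIV_I]) blast
 have KU: "K \<subseteq> U" using b(2) by simp
 obtain W0 where W0: "open W0" "p \<in> W0" "\<And>q. q \<in> W0 ==> b q = 1" using b(5) by (auto simp: eventually_nhds)
 define W where "W = W0 \<inter> U"
 have W: "open W" "p \<in> W" "W \<subseteq> U" "\<And>q. q \<in> W ==> b q = 1" "\<And>q. q \<in> W ==> \<forall>\<^sub>F q in nhds q. q \<in> W"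
  using W0 c max_chartD(1)[OF c(1)] by (auto simp: W_def eventually_conj_iff intro!: eventually_nhds_in_open)
 define E where "E v q = b q *\<^sub>R lift psi q v" for v q
 have E: "vector_field A (E v)" for v
  unfolding vector_field_iff E_def
  by (intro allI vsmooth_cutoff[OF b(3,1) KU b(4)] vsmooth_lift[OF c(1) _ msmooth_const])
 have EW: "E v q = lift psi q v" if "q \<in> W" for v q using W(4)[OF that] by (simp add: E_def)
 define Gam where "Gam q u y = (\<Sum>k\<in>UNIV. (y $ k) *\<^sub>R dd psi q (D q (lift psi q u) (E (axis k 1))))" for q u y
 have "conn_rep U psi D W Gam"
  unfolding conn_rep_def
 proof (intro conjI ballI allI impI)
  fix q assume q: "q \<in> W"
  then have qU: "q \<in> U" using W(3) by auto
  note lin = dd_chart_linear[OF c(1) qU]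
  show "linear (Gam q u)" for u
   unfolding Gam_def by (rule linearI) (simp_all add: scaleR_add_left sum.distrib scaleR_sum_right)
  have "linear (\<lambda>u. dd psi q (D q (lift psi q u) (E (axis k 1))))" for k
   using linear_compose[OF linear_compose[OF lift(3)[OF c(1) qU] connectionD(1)[OF D E]] lin] by (simp add: comp_def)
  then show "linear (\<lambda>u. Gam q u y)" for y
   unfolding Gam_def by (intro linear_compose_sum ballI) (simp add: linear_iff scaleR_add_right)
  have "msmooth (\<lambda>q. dd psi q (D q (lift psi q u) (E v))) q" for u v
  proof (rule msmooth_cong)
   show "msmooth (\<lambda>q. dd psi q (D q (E u q) (E v))) q"
    by (rule vsmoothD[OF c(1) qU vector_fieldD[OF connectionD(4)[OF D E E]]])
   show "\<forall>\<^sub>F q in nhds q. dd psi q (D q (E u q) (E v)) = dd psi q (D q (lift psi q u) (E v))"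
    using W(5)[OF q] by eventually_elim (simp add: EW)
  qed
  then show "msmooth (\<lambda>q. Gam q u y) q" for u y
   unfolding Gam_def by (intro msmooth_sum msmooth_scaleR msmooth_const)
  fix u Y assume Y: "vector_field A Y"
  let ?Y = "\<lambda>q. dd psi q (Y q)"
  have Ys: "msmooth ?Y q" if "q \<in> U" for q by (rule vsmoothD[OF c(1) that vector_fieldD[OF Y]])
  define f where "f k q = b q * ?Y q $ k" for k q
  have f: "smooth_fun A (f k)" for k
   unfolding smooth_fun_iff f_def real_scaleR_def[symmetric]
   by (intro allI msmooth_cutoff[OF b(3,1) KU b(4)] msmooth_vec_nth Ys)
  have b2: "smooth_fun A (\<lambda>q. b q * b q)" by (simp add: smooth_fun_iff msmooth_mult b)
  have fE: "vector_field A (\<lambda>q. f k q *\<^sub>R E (axis k 1) q)" for k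
   using f E by (simp add: smooth_fun_iff vector_field_iff vsmooth_scaleR)
  have "(b q' * b q') *\<^sub>R Y q' = (\<Sum>k\<in>UNIV. f k q' *\<^sub>R E (axis k 1) q')" for q'
  proof (cases "q' \<in> U")
   case True
   note ll = lift(3)[OF c(1) True]
   have "Y q' = lift psi q' (\<Sum>k\<in>UNIV. (?Y q' $ k) *\<^sub>R axis k 1)" by (simp add: sum_axis lift[OF c(1) True])
   then have "Y q' = (\<Sum>k\<in>UNIV. (?Y q' $ k) *\<^sub>R lift psi q' (axis k 1))" by (simp only: linear_sum[OF ll] linear_scale[OF ll])
   then have "(b q' * b q') *\<^sub>R Y q' = (b q' * b q') *\<^sub>R (\<Sum>k\<in>UNIV. (?Y q' $ k) *\<^sub>R lift psi q' (axis k 1))" by (rule arg_cong)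
   also have "\<dots> = (\<Sum>k\<in>UNIV. f k q' *\<^sub>R E (axis k 1) q')"
    unfolding scaleR_sum_right by (rule sum.cong[OF refl]) (simp add: f_def E_def mult.assoc mult.commute mult.left_commute)
   finally show ?thesis .
  next
   case False
   then have "b q' = 0" using b(4) KU by auto
   then show ?thesis by (simp add: f_def)
  qed
  then have "D q u (\<lambda>q. (b q * b q) *\<^sub>R Y q) = (\<Sum>k\<in>UNIV. D q u (\<lambda>q. f k q *\<^sub>R E (axis k 1) q))"
   using connection_sum[OF D, of UNIV "\<lambda>k q. f k q *\<^sub>R E (axis k 1) q" q u] fE by simp
  moreover have "D q u (\<lambda>q. (b q * b q) *\<^sub>R Y q) = D q u Y"
  proof -
   have "\<forall>\<^sub>F q in nhds q. b q * b q = 1" using W(5)[OF q] by eventually_elim (simp add: W(4))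
   then have "dd (\<lambda>q. b q * b q) q u = 0" using dd_cong[of "\<lambda>q. b q * b q" "\<lambda>q. 1" q] by simp
   then show ?thesis using connectionD(3)[OF D b2 Y, of q u] W(4)[OF q] by simp
  qed
  moreover have "D q u (\<lambda>q. f k q *\<^sub>R E (axis k 1) q)
    = (dd ?Y q u $ k) *\<^sub>R lift psi q (axis k 1) + (?Y q $ k) *\<^sub>R D q u (E (axis k 1))" for k
  proof -
   have "\<forall>\<^sub>F q in nhds q. f k q = ?Y q $ k" using W(5)[OF q] by eventually_elim (simp add: f_def W(4))
   then have "dd (f k) q u = dd ?Y q u $ k" using dd_cong[of "f k" "\<lambda>q. ?Y q $ k" q] dd_vec_nth[OF Ys[OF qU]] by simp
   then show ?thesis using connectionD(3)[OF D f E, of q u k] W(4)[OF q] by (simp add: f_def EW[OF q])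
  qed
  ultimately have "D q u Y = (\<Sum>k\<in>UNIV. (dd ?Y q u $ k) *\<^sub>R lift psi q (axis k 1) + (?Y q $ k) *\<^sub>R D q u (E (axis k 1)))"
   by simp
  then have "dd psi q (D q u Y) = (\<Sum>k\<in>UNIV. (dd ?Y q u $ k) *\<^sub>R axis k 1 + (?Y q $ k) *\<^sub>R dd psi q (D q u (E (axis k 1))))"
   by (simp add: linear_sum[OF lin] linear_add[OF lin] linear_scale[OF lin] lift[OF c(1) qU])
  then show "dd psi q (D q u Y) = dd ?Y q u + Gam q (dd psi q u) (?Y q)"
   by (simp add: sum.distrib sum_axis Gam_def lift[OF c(1) qU])
 qed (use c W in auto)
 then show ?thesis using W(2) by (rule that)
qed

lemma conn_repD:
 assumes "conn_rep U psi D W Gam" "q \<in> W"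
 shows "(U, psi) \<in> max_atlas A" "q \<in> U" "\<forall>\<^sub>F q in nhds q. q \<in> W" "linear (\<lambda>u. Gam q u y)" "linear (Gam q u)"
  "msmooth (\<lambda>q. Gam q u y) q"
  "vector_field A Y ==> dd psi q (D q u Y) = dd (\<lambda>q. dd psi q (Y q)) q u + Gam q (dd psi q u) (dd psi q (Y q))"
 using assms unfolding conn_rep_def by (auto intro: eventually_nhds_in_open)

lemma conn_rep_dd:
 assumes r: "conn_rep U psi D W Gam" "p \<in> W" and Y: "msmooth Y p" and Z: "msmooth Z p"
 shows "msmooth (\<lambda>q. Gam q (Y q) (Z q)) p"
  "dd (\<lambda>q. Gam q (Y q) (Z q)) p u = dd (\<lambda>q. Gam q (Y p) (Z p)) p u + Gam p (dd Y p u) (Z p) + Gam p (Y p) (dd Z p u)"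
proof -
 have l1: "\<forall>\<^sub>F q in nhds p. linear (\<lambda>y. Gam q y z)" for z
  using conn_repD(3)[OF r] by eventually_elim (rule conn_repD(4)[OF r(1)])
 have l2: "\<forall>\<^sub>F q in nhds p. linear (Gam q (Y q))"
  using conn_repD(3)[OF r] by eventually_elim (rule conn_repD(5)[OF r(1)])
 note 1 = dd_linear_field[OF l1 conn_repD(6)[OF r] Y]
 note 2 = dd_linear_field[OF l2 1(1) Z]
 show "msmooth (\<lambda>q. Gam q (Y q) (Z q)) p" by (rule 2(1))
 show "dd (\<lambda>q. Gam q (Y q) (Z q)) p u = dd (\<lambda>q. Gam q (Y p) (Z p)) p u + Gam p (dd Y p u) (Z p) + Gam p (Y p) (dd Z p u)"
  using 1(2)[of "Z p" u] 2(2)[of u] by simp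
qed

text \<open>The second derivatives of the extension of \<open>w\<close> and the first derivatives of
  the extensions of \<open>u\<close> and \<open>v\<close> cancel against the bracket term. What
  remains is the derivative of the Christoffel symbols, skew-symmetrised, plus their
  commutator.\<close>

lemma curvature_local:
 assumes D: "connection A D" and r: "conn_rep U psi D W Gam" "p \<in> W"
 shows "dd psi p (curvature A D p u v w) =
  dd (\<lambda>q. Gam q (dd psi p v) (dd psi p w)) p u - dd (\<lambda>q. Gam q (dd psi p u) (dd psi p w)) p v
  + Gam p (dd psi p u) (Gam p (dd psi p v) (dd psi p w)) - Gam p (dd psi p v) (Gam p (dd psi p u) (dd psi p w))"
proof -
 define X where "X = extend A p u"
 define Y where "Y = extend A p v"
 define Z where "Z = extend A p w"
 have vf: "vector_field A X" "vector_field A Y" "vector_field A Z" and at: "X p = u" "Y p = v" "Z p = w"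
  by (simp_all add: X_def Y_def Z_def extend)
 note c = conn_repD(1,2)[OF r]
 have hat: "msmooth (\<lambda>q. dd psi q (V q)) p" if "vector_field A V" for V
  by (rule vsmoothD[OF c vector_fieldD[OF that]])
 let ?Z = "\<lambda>q. dd psi q (Z q)"
 note lin = dd_chart_linear[OF c]
 have second: "dd psi p (D p t (\<lambda>q. D q (V q) Z)) =
   dd (\<lambda>q. dd ?Z q (V q)) p t + (dd (\<lambda>q. Gam q (dd psi p (V p)) (?Z p)) p t
    + Gam p (dd (\<lambda>q. dd psi q (V q)) p t) (?Z p) + Gam p (dd psi p (V p)) (dd ?Z p t))
   + Gam p (dd psi p t) (dd ?Z p (V p) + Gam p (dd psi p (V p)) (?Z p))" if V: "vector_field A V" for V t
 proof -
  have ev: "\<forall>\<^sub>F q in nhds p. dd psi q (D q (V q) Z) = dd ?Z q (V q) + Gam q (dd psi q (V q)) (?Z q)"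
   using conn_repD(3)[OF r] by eventually_elim (rule conn_repD(7)[OF r(1) _ vf(3)])
  have "dd (\<lambda>q. dd psi q (D q (V q) Z)) p t = dd (\<lambda>q. dd ?Z q (V q) + Gam q (dd psi q (V q)) (?Z q)) p t"
   using dd_cong[OF ev] by simp
  also have "\<dots> = dd (\<lambda>q. dd ?Z q (V q)) p t + dd (\<lambda>q. Gam q (dd psi q (V q)) (?Z q)) p t"
   by (rule dd_add[OF msmooth_dd[OF vector_fieldD[OF V] hat[OF vf(3)]] conn_rep_dd(1)[OF r hat[OF V] hat[OF vf(3)]]])
  finally show ?thesis
   using conn_repD(7)[OF r connectionD(4)[OF D V vf(3)], of t] eventually_nhds_x_imp_x[OF ev]
    conn_rep_dd(2)[OF r hat[OF V] hat[OF vf(3)], of t] by simp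
 qed
 have br: "dd psi p (bracket A X Y p) = dd (\<lambda>q. dd psi q (Y q)) p u - dd (\<lambda>q. dd psi q (X q)) p v"
  and bZ: "dd ?Z p (bracket A X Y p) = dd (\<lambda>q. dd ?Z q (Y q)) p u - dd (\<lambda>q. dd ?Z q (X q)) p v"
  using dd_bracket[OF msmooth_chart[OF c] vector_fieldD[OF vf(1)] vector_fieldD[OF vf(2)]]
   dd_bracket[OF hat[OF vf(3)] vector_fieldD[OF vf(1)] vector_fieldD[OF vf(2)]] by (simp_all add: at)
 have "curvature A D p u v w = D p u (\<lambda>q. D q (Y q) Z) - D p v (\<lambda>q. D q (X q) Z) - D p (bracket A X Y p) Z"
  by (simp add: curvature_def Let_def X_def Y_def Z_def)
 then show ?thesis
  by (simp add: linear_diff[OF lin] second vf conn_repD(7)[OF r vf(3)] br bZ at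
    linear_diff[OF conn_repD(4)[OF r]] linear_add[OF conn_repD(5)[OF r]])
qed

text \<open>Torsion is tested on fields with prescribed coordinate vectors at \<open>q\<close>;
  their derivatives make up the bracket and cancel, so only the symbols are compared.\<close>

lemma torsion_free_symmetric:
 assumes D: "torsion_free A D" and r: "conn_rep U psi D W Gam" "q \<in> W"
 shows "Gam q a b = Gam q b a"
proof -
 note c = conn_repD(1,2)[OF r]
 define X where "X = extend A q (lift psi q a)"
 define Y where "Y = extend A q (lift psi q b)"
 have vf: "vector_field A X" "vector_field A Y" and at: "dd psi q (X q) = a" "dd psi q (Y q) = b"
  by (simp_all add: X_def Y_def extend lift[OF c])
 have "D q (X q) Y - D q (Y q) X = bracket A X Y q" using D vf by (simp add: torsion_free_def)
 then have "dd psi q (D q (X q) Y) - dd psi q (D q (Y q) X) = dd psi q (bracket A X Y q)"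
  by (simp add: linear_diff[OF dd_chart_linear[OF c], symmetric])
 then show ?thesis
  unfolding dd_bracket[OF msmooth_chart[OF c] vector_fieldD[OF vf(1)] vector_fieldD[OF vf(2)]]
   conn_repD(7)[OF r vf(1)] conn_repD(7)[OF r vf(2)] at by simp
qed

end

section \<open>The Ricci form in holomorphic charts\<close>

lemma linear_std_complex: "linear (std_complex :: 'n::finite model => 'n model)"
 by (rule linearI) (simp_all add: std_complex_def vec_eq_iff)

lemma std_complex_square [simp]: "std_complex (std_complex x) = - x"
 by (simp add: std_complex_def vec_eq_iff split_paired_all)

context manifold
begin

lemma holomorphic_chartD:
 assumes "(U, psi) \<in> holomorphic_charts A J"
 shows "(U, psi) \<in> max_atlas A" "p \<in> U ==> dd psi p (J p v) = std_complex (dd psi p v)"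
 using assms by (auto simp: holomorphic_charts_def max_atlas_def)

lemma endo_trace_chart:
 assumes c: "(U, psi) \<in> max_atlas A" "p \<in> U"
  and T: "\<And>w. dd psi p (T w) = S (dd psi p w)" and S: "linear S"
 shows "endo_trace T = endo_trace S" "linear T"
proof -
 note l = lift[OF c]
 have T': "T = (\<lambda>w. lift psi p (S (dd psi p w)))" by (simp only: T[symmetric] l(2))
 show "endo_trace T = endo_trace S"
  unfolding T' by (rule endo_trace_conj[OF S l(3) dd_chart_linear[OF c] l(1)])
 show "linear T"
  unfolding T' using linear_compose[OF linear_compose[OF dd_chart_linear[OF c] S] l(3)] by (simp add: comp_def)
qed

definition ddc :: "('m, 'n) endo => ('m => real) => ('m, 'n) two_form" where
 "ddc J h = d_one_form A (\<lambda>q w. dd h q (J q w))"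

text \<open>The k-th coefficient of dh composed with \<open>J\<close> with respect to the coordinate
  differentials of a holomorphic chart, where \<open>J\<close> is the constant standard
  structure.\<close>

definition jcoeff :: "'m set => ('m => 'n model) => ('m => real) => 'n \<times> bool => 'm => real" where
 "jcoeff U psi h k q = fd (\<lambda>x. h (inv_into U psi x)) (psi q) (std_complex (axis k 1))"

lemma msmooth_jcoeff: "(U, psi) \<in> max_atlas A ==> p \<in> U ==> msmooth h p ==> msmooth (jcoeff U psi h k) p"
 unfolding jcoeff_def by (rule msmooth_fd_chart)

lemma msmooth_chart_nth: "(U, psi) \<in> max_atlas A ==> p \<in> U ==> msmooth (\<lambda>q. psi q $ k) p"
 by (intro msmooth_vec_nth msmooth_chart)

lemma dd_chart_nth: "(U, psi) \<in> max_atlas A ==> p \<in> U ==> dd (\<lambda>q. psi q $ k) p v = dd psi p v $ k"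
 by (rule dd_vec_nth[OF msmooth_chart])

lemma dd_J_expand:
 assumes c: "(U, psi) \<in> holomorphic_charts A J" "p \<in> U" and h: "msmooth h p"
 shows "\<forall>\<^sub>F q in nhds p. \<forall>w. dd h q (J q w) = (\<Sum>k\<in>UNIV. jcoeff U psi h k q * dd (\<lambda>q. psi q $ k) q w)"
proof -
 note c' = holomorphic_chartD(1)[OF c(1)]
 show ?thesis
  using msmooth_eventually[OF h] ev_chart(1)[OF c' c(2)]
 proof eventually_elim
  case (elim q)
  let ?F = "fd (\<lambda>x. h (inv_into U psi x)) (psi q)"
  have "smooth_at (\<lambda>x. h (inv_into U psi x)) (psi q)" using elim msmooth_iff[OF c'] by blast
  then have l: "linear ?F" by (rule smooth_at_linear)
  have "dd h q (J q w) = ?F (std_complex (\<Sum>k\<in>UNIV. (dd psi q w $ k) *\<^sub>R axis k 1))" for w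
   using dd_in_chart[OF c' elim(2,1)] holomorphic_chartD(2)[OF c(1) elim(2)] by (simp add: sum_axis)
  then show ?case
   by (simp add: linear_sum[OF linear_std_complex] linear_scale[OF linear_std_complex] linear_sum[OF l] linear_scale[OF l]
     jcoeff_def dd_chart_nth[OF c' elim(2)] mult.commute)
 qed
qed

lemma ddc_local:
 assumes c: "(U, psi) \<in> holomorphic_charts A J" "p \<in> U" and h: "msmooth h p"
 shows "ddc J h p u v = (\<Sum>k\<in>UNIV. dd (jcoeff U psi h k) p u * dd (\<lambda>q. psi q $ k) p v
  - dd (jcoeff U psi h k) p v * dd (\<lambda>q. psi q $ k) p u)"
 unfolding ddc_def
 by (rule d_one_form_local[OF msmooth_jcoeff[OF holomorphic_chartD(1)[OF c(1)] c(2) h]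
    msmooth_chart_nth[OF holomorphic_chartD(1)[OF c(1)] c(2)] dd_J_expand[OF c h]])

text \<open>With H the coordinate Hessian and I the standard structure this reads H(u, I v) - H(v, I
  u). Both type (1,1) and the meaning of pluriharmonicity can be read off from it.\<close>

lemma ddc_hess:
 assumes c: "(U, psi) \<in> holomorphic_charts A J" "p \<in> U" and h: "msmooth h p"
 defines "F \<equiv> \<lambda>x. h (inv_into U psi x)"
 shows "ddc J h p u v = fd (\<lambda>x. fd F x (std_complex (dd psi p v))) (psi p) (dd psi p u)
  - fd (\<lambda>x. fd F x (std_complex (dd psi p u))) (psi p) (dd psi p v)"
proof -
 note c' = holomorphic_chartD(1)[OF c(1)]
 have F: "smooth_at F (psi p)" unfolding F_def by (rule msmoothD[OF c' c(2) h])
 have *: "(\<Sum>k\<in>UNIV. dd (jcoeff U psi h k) p s * (t $ k)) = fd (\<lambda>x. fd F x (std_complex t)) (psi p) (dd psi p s)" for s t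
 proof -
  have d: "dd (jcoeff U psi h k) p s = fd (\<lambda>x. fd F x (dd psi p s)) (psi p) (std_complex (axis k 1))" for k
   unfolding jcoeff_def F_def[symmetric]
   using dd_compose[OF smooth_at_fd[OF F] msmooth_chart[OF c' c(2)]] fd_commute[OF F] by simp
  note l = smooth_at_linear[OF smooth_at_fd[OF F, of "dd psi p s"]]
  have "(\<Sum>k\<in>UNIV. dd (jcoeff U psi h k) p s * (t $ k))
   = fd (\<lambda>x. fd F x (dd psi p s)) (psi p) (std_complex (\<Sum>k\<in>UNIV. (t $ k) *\<^sub>R axis k 1))"
   by (simp add: d linear_sum[OF linear_std_complex] linear_scale[OF linear_std_complex] linear_sum[OF l] linear_scale[OF l]
     mult.commute)
  then show ?thesis using fd_commute[OF F] by (simp add: sum_axis)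
 qed
 show ?thesis
  unfolding ddc_local[OF c h] sum_subtractf dd_chart_nth[OF c' c(2)] * by simp
qed

text \<open>Inserting I u and I v into H(u, I v) - H(v, I u) gives - H(I u, v) + H(I v, u), which is
  the same by symmetry of the Hessian.\<close>

lemma ddc_11:
 assumes c: "(U, psi) \<in> holomorphic_charts A J" "p \<in> U" and h: "msmooth h p"
 shows "ddc J h p (J p u) (J p v) = ddc J h p u v"
proof -
 let ?F = "\<lambda>x. h (inv_into U psi x)"
 have F: "smooth_at ?F (psi p)" by (rule msmoothD[OF holomorphic_chartD(1)[OF c(1)] c(2) h])
 have "\<forall>\<^sub>F x in nhds (psi p). fd ?F x (- w) = - fd ?F x w" for w
  using smooth_at_eventually[OF F] by eventually_elim (rule linear_neg[OF smooth_at_linear])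
 from fd_cong[OF this] have "fd (\<lambda>x. fd ?F x (- w)) (psi p) = fd (\<lambda>x. - fd ?F x w) (psi p)" for w .
 moreover have "fd (\<lambda>x. - fd ?F x w) (psi p) t = - fd (\<lambda>x. fd ?F x w) (psi p) t" for w t
  using fd_compose[of uminus "\<lambda>x. fd ?F x w" "psi p" t] smooth_at_fd[OF F]
  by (simp add: smooth_at_linear_map fd_linear linear_iff)
 ultimately show ?thesis
  unfolding ddc_hess[OF c h] holomorphic_chartD(2)[OF c] std_complex_square
  using fd_commute[OF F] by simp
qed

lemma almost_complex_vf: "almost_complex A J ==> vector_field A X ==> vector_field A (\<lambda>q. J q (X q))"
 by (simp add: almost_complex_def)

text \<open>Two derivatives are taken, so agreement near \<open>p\<close> is passed on to agreement
  of the differentials at all nearby points before the second one is applied.\<close>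

lemma ddc_cong:
 assumes "\<forall>\<^sub>F q in nhds p. h q = g q"
 shows "ddc J h p = ddc J g p"
proof -
 have "\<forall>\<^sub>F q in nhds p. \<forall>\<^sub>F q' in nhds q. h q' = g q'" using assms by (simp only: eventually_eventually)
 then have ev: "\<forall>\<^sub>F q in nhds p. dd h q = dd g q" by eventually_elim (rule dd_cong)
 have "dd (\<lambda>q. dd h q (J q (Y q))) p = dd (\<lambda>q. dd g q (J q (Y q))) p" for Y
  by (rule dd_cong, rule eventually_mono[OF ev]) simp
 then show ?thesis
  using eventually_nhds_x_imp_x[OF ev] by (intro ext) (simp add: ddc_def d_one_form_def Let_def)
qed

lemma ddc_linear:
 assumes J: "almost_complex A J" and h: "msmooth h p" and g: "msmooth g p"
 shows "ddc J (\<lambda>q. a * h q + b * g q) p u v = a * ddc J h p u v + b * ddc J g p u v"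
proof -
 let ?f = "\<lambda>q. a * h q + b * g q"
 have D: "dd ?f q w = a * dd h q w + b * dd g q w" if "msmooth h q" "msmooth g q" for q w
  using that by (simp add: dd_add dd_mult msmooth_mult msmooth_const)
 have ev: "\<forall>\<^sub>F q in nhds p. dd ?f q (J q (Y q)) = a * dd h q (J q (Y q)) + b * dd g q (J q (Y q))" for Y
  using msmooth_eventually[OF h] msmooth_eventually[OF g] by eventually_elim (rule D)
 have "dd (\<lambda>q. dd ?f q (J q (extend A p w q))) p t
   = a * dd (\<lambda>q. dd h q (J q (extend A p w q))) p t + b * dd (\<lambda>q. dd g q (J q (extend A p w q))) p t" for w t
 proof -
  have "msmooth (\<lambda>q. dd f q (J q (extend A p w q))) p" if "msmooth f p" for f :: "'m => real"
   by (rule msmooth_dd[OF vector_fieldD[OF almost_complex_vf[OF J extend(1)]] that])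
  then show ?thesis
   using h g unfolding dd_cong[OF ev] by (simp add: dd_add dd_mult msmooth_mult msmooth_const)
 qed
 then show ?thesis
  by (simp add: ddc_def d_one_form_def Let_def D[OF h g] algebra_simps)
qed

text \<open>A common criterion for the Ricci form, the Chern form and the zero form, each of which
  is described by local potentials. The functions \<open>jcoeff\<close> exhibit such a form as a sum
  of products of exact forms, which gives smoothness and closedness.\<close>

lemma local_potential_closed_form11:
 assumes "\<And>p. \<exists>U psi h. (U, psi) \<in> holomorphic_charts A J \<and> p \<in> U \<and> msmooth h p \<and> (\<forall>\<^sub>F q in nhds p. tau q = ddc J h q)"
 shows "tau \<in> closed_form11 A J"
proof -
 have main: "(linear (tau p u) \<and> linear (\<lambda>u. tau p u v) \<and> tau p u u = 0 \<and> tau p (J p u) (J p v) = tau p u v) \<and>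
  (vector_field A X --> vector_field A Y --> msmooth (\<lambda>p. tau p (X p) (Y p)) p) \<and> d_two_form A tau p u v w = 0"
  for p u v w X Y
 proof -
  obtain U psi h where c: "(U, psi) \<in> holomorphic_charts A J" "p \<in> U" and h: "msmooth h p"
   and t: "\<forall>\<^sub>F q in nhds p. tau q = ddc J h q" using assms[of p] by blast
  note c' = holomorphic_chartD(1)[OF c(1)] c(2)
  let ?a = "jcoeff U psi h" and ?f = "\<lambda>k q. psi q $ k"
  have sm: "msmooth (?a k) p" "msmooth (?f k) p" for k
   by (rule msmooth_jcoeff[OF c' h]) (rule msmooth_chart_nth[OF c'])
  have ev: "\<forall>\<^sub>F q in nhds p. \<forall>v w. tau q v w = (\<Sum>k\<in>UNIV. dd (?a k) q v * dd (?f k) q w - dd (?a k) q w * dd (?f k) q v)"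
   using t msmooth_eventually[OF h] ev_chart(1)[OF c'(1) c(2)]
  proof eventually_elim
   case (elim q)
   show ?case unfolding elim(1) using ddc_local[OF c(1) elim(3,2)] by blast
  qed
  have tp: "tau p s r = (\<Sum>k\<in>UNIV. dd (?a k) p s * dd (?f k) p r - dd (?a k) p r * dd (?f k) p s)" for s r
   using eventually_nhds_x_imp_x[OF ev] by blast
  have "linear (dd (?a k) p)" "linear (dd (?f k) p)" for k by (rule dd_linear[OF sm(1)], rule dd_linear[OF sm(2)])
  then have "linear (\<lambda>r. dd (?a k) p s * dd (?f k) p r - dd (?a k) p r * dd (?f k) p s)"
   "linear (\<lambda>r. dd (?a k) p r * dd (?f k) p s - dd (?a k) p s * dd (?f k) p r)" for k s
   by (simp_all add: linear_iff algebra_simps)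
  then have "linear (\<lambda>r. tau p u r)" "linear (\<lambda>u. tau p u v)"
   unfolding tp by (intro linear_compose_sum ballI; blast)+
  moreover have "tau p u u = 0" unfolding tp by (simp add: mult.commute)
  moreover have "tau p (J p u) (J p v) = tau p u v"
   using ddc_11[OF c h] eventually_nhds_x_imp_x[OF t] by simp
  moreover have "msmooth (\<lambda>p. tau p (X p) (Y p)) p" if "vector_field A X" "vector_field A Y"
  proof (rule msmooth_cong)
   show "msmooth (\<lambda>q. \<Sum>k\<in>UNIV. dd (?a k) q (X q) * dd (?f k) q (Y q) - dd (?a k) q (Y q) * dd (?f k) q (X q)) p"
    by (intro msmooth_sum msmooth_diff msmooth_mult msmooth_dd vector_fieldD that sm)
   show "\<forall>\<^sub>F q in nhds p. (\<Sum>k\<in>UNIV. dd (?a k) q (X q) * dd (?f k) q (Y q) - dd (?a k) q (Y q) * dd (?f k) q (X q)) = tau q (X q) (Y q)"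
    using ev by eventually_elim simp
  qed
  moreover have "d_two_form A tau p u v w = 0"
   by (rule d_two_form_local[OF sm ev])
  ultimately show ?thesis by blast
 qed
 then show ?thesis
  unfolding closed_form11_def form11_def is_two_form_def smooth_fun_iff by blast
qed

subsection \<open>Densities of volume forms\<close>

text \<open>The coordinate density of \<open>rho\<close>. Its sign depends on the orientation of the
  chart, which membership in \<open>max_atlas A\<close> does not fix; hence the absolute values
  inside the logarithms that follow.\<close>

definition dens :: "('m, 'n) top_form => ('m => 'n model) => 'm => real" where
 "dens rho psi q = rho q (\<lambda>k. lift psi q (axis k 1))"

lemma top_form_alternating: "is_top_form A rho ==> alternating (rho p)"
 by (simp add: is_top_form_def alternating_def)

lemma top_form_dens:
 assumes rho: "is_top_form A rho" and c: "(U, psi) \<in> max_atlas A" "p \<in> U"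
 shows "rho p b = dens rho psi p * det (\<chi> k. dd psi p (b k))"
proof -
 let ?g = "\<lambda>b. rho p (\<lambda>k. lift psi p (b k))"
 note al = top_form_alternating[OF rho, of p, unfolded alternating_def]
 have "alternating ?g"
  unfolding alternating_def
 proof (intro conjI allI impI)
  fix b :: "'n \<times> bool => 'n model" and k
  have "(\<lambda>j. lift psi p ((b(k := v)) j)) = (\<lambda>j. lift psi p (b j))(k := lift psi p v)" for v by auto
  moreover have "linear (\<lambda>v. rho p ((\<lambda>j. lift psi p (b j))(k := lift psi p v)))"
   using linear_compose[OF lift(3)[OF c], of "\<lambda>v. rho p ((\<lambda>j. lift psi p (b j))(k := v))"] al by (simp add: comp_def)
  ultimately show "linear (\<lambda>v. ?g (b(k := v)))" by simp
 next
  fix b :: "'n \<times> bool => 'n model" and j k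
  assume "j \<noteq> k" "b j = b k"
  then have "(\<lambda>k. lift psi p (b k)) j = (\<lambda>k. lift psi p (b k)) k" by simp
  then show "?g b = 0" by (rule conjunct2[OF al, rule_format, OF \<open>j \<noteq> k\<close>])
 qed
 from alternating_eq_det[OF this, of "\<lambda>k. dd psi p (b k)"] show ?thesis
  by (simp add: dens_def lift(2)[OF c])
qed

lemma positive_top_form_axis: "positive_volume_form A rho ==> rho p (\<lambda>k. axis k 1) > 0"
proof -
 assume rho: "positive_volume_form A rho"
 have "(\<chi> k. axis k 1) = (mat 1 :: real ^ ('n \<times> bool) ^ ('n \<times> bool))"
  by (simp add: mat_def vec_eq_iff axis_def eq_commute)
 then show ?thesis using rho by (simp add: positive_volume_form_def positive_frame_def)
qed

lemma positive_top_form_eq: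
 assumes "positive_volume_form A rho"
 shows "rho p b = rho p (\<lambda>k. axis k 1) * det (\<chi> k. b k)"
 using assms alternating_eq_det[OF top_form_alternating] by (auto simp: positive_volume_form_def)

lemma dens_nonzero:
 assumes rho: "positive_volume_form A rho" and c: "(U, psi) \<in> max_atlas A" "p \<in> U"
 shows "dens rho psi p \<noteq> 0"
 using top_form_dens[OF _ c, of rho "\<lambda>k. axis k 1"] positive_top_form_axis[OF rho, of p] rho
 by (auto simp: positive_volume_form_def)

lemma coordinate_frame:
 assumes c: "(U, psi) \<in> max_atlas A" "p \<in> U"
 obtains X where "\<And>k. vector_field A (X k)" "\<forall>\<^sub>F q in nhds p. \<forall>k. X k q = lift psi q (axis k 1)"
  "\<forall>\<^sub>F q in nhds p. \<forall>k. dd psi q (X k q) = axis k 1"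
proof -
 have "\<exists>X. vector_field A X \<and> (\<forall>\<^sub>F q in nhds p. dd psi q (X q) = axis k 1)" for k
  by (rule coordinate_field[OF c]) blast
 then obtain X where X: "\<And>k. vector_field A (X k)" "\<And>k. \<forall>\<^sub>F q in nhds p. dd psi q (X k q) = axis k 1" by metis
 have ev: "\<forall>\<^sub>F q in nhds p. \<forall>k. dd psi q (X k q) = axis k 1" using X(2) by (rule eventually_all_finite)
 then have "\<forall>\<^sub>F q in nhds p. \<forall>k. X k q = lift psi q (axis k 1)"
  using ev_chart(1)[OF c(1) c(2)]
 proof eventually_elim
  case (elim q)
  have "X k q = lift psi q (axis k 1)" for k
   using lift(2)[OF c(1) elim(2), of "X k q"] spec[OF elim(1), of k] by (simp only:)
  then show ?case by blast
 qed
 then show ?thesis using X(1) ev that by blast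
qed

lemma msmooth_dens:
 assumes rho: "is_top_form A rho" and c: "(U, psi) \<in> max_atlas A" "p \<in> U"
 shows "msmooth (dens rho psi) p"
proof -
 obtain X where X: "\<And>k. vector_field A (X k)" "\<forall>\<^sub>F q in nhds p. \<forall>k. X k q = lift psi q (axis k 1)"
  by (rule coordinate_frame[OF c]) blast
 have "msmooth (\<lambda>q. rho q (\<lambda>k. X k q)) p" using rho X(1) by (simp add: is_top_form_def smooth_fun_iff)
 moreover have "\<forall>\<^sub>F q in nhds p. rho q (\<lambda>k. X k q) = dens rho psi q"
  using X(2) by eventually_elim (simp only: dens_def)
 ultimately show ?thesis by (rule msmooth_cong)
qed

lemma dd_ln_abs:
 fixes f :: "'m => real"
 assumes "msmooth f p" "f p \<noteq> 0"
 shows "msmooth (\<lambda>q. ln \<bar>f q\<bar>) p" "dd (\<lambda>q. ln \<bar>f q\<bar>) p v = dd f p v / f p"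
proof -
 \<comment> \<open>Passing to the square avoids a distinction of signs. At 0 both sides have the
   default value 0 of \<open>ln\<close>.\<close>
 have e: "ln \<bar>x\<bar> = ln (x * x) / 2" for x :: real
 proof (cases "x = 0")
  case False
  have "ln (x * x) = ln (\<bar>x\<bar> * \<bar>x\<bar>)" by simp
  also have "\<dots> = 2 * ln \<bar>x\<bar>" using False by (subst ln_mult) simp_all
  finally show ?thesis by simp
 qed simp
 have s: "msmooth (\<lambda>q. f q * f q) p" "f p * f p > 0" using assms by (auto simp: msmooth_mult zero_less_mult_iff)
 show "msmooth (\<lambda>q. ln \<bar>f q\<bar>) p" unfolding e by (intro msmooth_divide msmooth_ln s msmooth_const) simp
 have "smooth_at (\<lambda>x. ln x / 2) (f p * f p)"
  by (intro smooth_at_divide smooth_at_ln smooth_at_id smooth_at_const s) simp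
 from dd_compose[OF this s(1)] have "dd (\<lambda>q. ln (f q * f q) / 2) p v = fd (\<lambda>x. ln x / 2) (f p * f p) (dd (\<lambda>q. f q * f q) p v)" .
 also have "fd (\<lambda>x. ln x / 2) (f p * f p) = (*) (inverse (f p * f p) / 2)"
 proof (rule fd_eqI)
  have "((\<lambda>x. ln x / 2) has_real_derivative (inverse (f p * f p) / 2)) (at (f p * f p))"
   using s(2) by (intro DERIV_cdivide DERIV_ln)
  then show "((\<lambda>x. ln x / 2) has_derivative (*) (inverse (f p * f p) / 2)) (at (f p * f p))"
   by (simp only: has_field_derivative_def)
 qed
 also have "dd (\<lambda>q. f q * f q) p v = 2 * f p * dd f p v" using assms(1) by (simp add: dd_mult)
 finally show "dd (\<lambda>q. ln \<bar>f q\<bar>) p v = dd f p v / f p" unfolding e using assms(2) by (simp add: field_simps)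
qed

text \<open>Evaluated on the coordinate frame, parallelism of \<open>rho\<close> says that the
  logarithmic derivative of the density is the trace of the Christoffel endomorphism.\<close>

lemma dd_dens_trace:
 assumes rho: "is_top_form A rho" and pr: "preserves_top_form A D rho" and r: "conn_rep U psi D W Gam" "p \<in> W"
 shows "dd (dens rho psi) p u = dens rho psi p * endo_trace (Gam p (dd psi p u))"
proof -
 note c = conn_repD(1,2)[OF r]
 obtain X where X: "\<And>k. vector_field A (X k)" "\<forall>\<^sub>F q in nhds p. \<forall>k. X k q = lift psi q (axis k 1)"
  "\<forall>\<^sub>F q in nhds p. \<forall>k. dd psi q (X k q) = axis k 1"
  by (rule coordinate_frame[OF c]) blast
 have ev: "\<forall>\<^sub>F q in nhds p. rho q (\<lambda>k. X k q) = dens rho psi q"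
  using X(2) by eventually_elim (simp only: dens_def)
 have at: "dd psi p (X k p) = axis k 1" for k using eventually_nhds_x_imp_x[OF X(3)] by blast
 have DX: "dd psi p (D p u (X j)) = Gam p (dd psi p u) (axis j 1)" for j
 proof -
  have "\<forall>\<^sub>F q in nhds p. dd psi q (X j q) = axis j 1" using X(3) by eventually_elim blast
  from dd_cong[OF this] have "dd (\<lambda>q. dd psi q (X j q)) p u = 0" by simp
  then show ?thesis using conn_repD(7)[OF r X(1)] by (simp add: at)
 qed
 have "dd (dens rho psi) p u = dd (\<lambda>q. rho q (\<lambda>k. X k q)) p u" using dd_cong[OF ev] by simp
 also have "\<dots> = (\<Sum>j\<in>UNIV. rho p ((\<lambda>k. X k p)(j := D p u (X j))))"
  using pr X(1) unfolding preserves_top_form_def by blast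
 also have "\<dots> = (\<Sum>j\<in>UNIV. dens rho psi p * Gam p (dd psi p u) (axis j 1) $ j)"
 proof (rule sum.cong[OF refl])
  fix j
  have "(\<lambda>k. dd psi p (((\<lambda>k. X k p)(j := D p u (X j))) k)) = (\<lambda>k. axis k 1)(j := Gam p (dd psi p u) (axis j 1))"
   by (auto simp: at DX)
  then show "rho p ((\<lambda>k. X k p)(j := D p u (X j))) = dens rho psi p * Gam p (dd psi p u) (axis j 1) $ j"
   unfolding top_form_dens[OF rho c, of "(\<lambda>k. X k p)(j := D p u (X j))"] by (simp only: det_axis_upd)
 qed
 finally show ?thesis by (simp add: endo_trace_sum sum_distrib_left)
qed

lemma conn_rep_dd_linear:
 assumes r: "conn_rep U psi D W Gam" "p \<in> W"
 shows "linear (\<lambda>y. dd (\<lambda>q. Gam q a y) p u)" "linear (\<lambda>y. dd (\<lambda>q. Gam q y a) p u)"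
proof -
 note W = conn_repD(3)[OF r] and sm = conn_repD(6)[OF r]
 show "linear (\<lambda>y. dd (\<lambda>q. Gam q a y) p u)"
 proof (rule linearI)
  fix x y and c :: real
  have "\<forall>\<^sub>F q in nhds p. Gam q a (x + y) = Gam q a x + Gam q a y"
   using W by eventually_elim (rule linear_add[OF conn_repD(5)[OF r(1)]])
  from dd_cong[OF this] show "dd (\<lambda>q. Gam q a (x + y)) p u = dd (\<lambda>q. Gam q a x) p u + dd (\<lambda>q. Gam q a y) p u"
   by (simp add: dd_add sm)
  have "\<forall>\<^sub>F q in nhds p. Gam q a (c *\<^sub>R x) = c *\<^sub>R Gam q a x"
   using W by eventually_elim (rule linear_scale[OF conn_repD(5)[OF r(1)]])
  from dd_cong[OF this] show "dd (\<lambda>q. Gam q a (c *\<^sub>R x)) p u = c *\<^sub>R dd (\<lambda>q. Gam q a x) p u"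
   by (simp add: dd_scaleR msmooth_const sm)
 qed
 show "linear (\<lambda>y. dd (\<lambda>q. Gam q y a) p u)"
 proof (rule linearI)
  fix x y and c :: real
  have "\<forall>\<^sub>F q in nhds p. Gam q (x + y) a = Gam q x a + Gam q y a"
   using W by eventually_elim (rule linear_add[OF conn_repD(4)[OF r(1)]])
  from dd_cong[OF this] show "dd (\<lambda>q. Gam q (x + y) a) p u = dd (\<lambda>q. Gam q x a) p u + dd (\<lambda>q. Gam q y a) p u"
   by (simp add: dd_add sm)
  have "\<forall>\<^sub>F q in nhds p. Gam q (c *\<^sub>R x) a = c *\<^sub>R Gam q x a"
   using W by eventually_elim (rule linear_scale[OF conn_repD(4)[OF r(1)]])
  from dd_cong[OF this] show "dd (\<lambda>q. Gam q (c *\<^sub>R x) a) p u = c *\<^sub>R dd (\<lambda>q. Gam q x a) p u"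
   by (simp add: dd_scaleR msmooth_const sm)
 qed
qed

text \<open>In a holomorphic chart \<open>J\<close> has constant coefficients, so its covariant
  derivative is the commutator of the Christoffel endomorphism with
  \<open>std_complex\<close>.\<close>

lemma nabla_endo_local:
 assumes J: "almost_complex A J" and h: "(U, psi) \<in> holomorphic_charts A J" and r: "conn_rep U psi D W Gam" "q \<in> W"
 shows "dd psi q (nabla_endo A D J q u w) = Gam q (dd psi q u) (std_complex (dd psi q w)) - std_complex (Gam q (dd psi q u) (dd psi q w))"
proof -
 define X where "X = extend A q w"
 have X: "vector_field A X" "X q = w" by (simp_all add: X_def extend)
 note c = conn_repD(1,2)[OF r] and JX = almost_complex_vf[OF J X(1)]
 let ?X = "\<lambda>q. dd psi q (X q)"
 have ev: "\<forall>\<^sub>F q in nhds q. dd psi q (J q (X q)) = std_complex (?X q)"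
  using ev_chart(1)[OF c(1) c(2)] by eventually_elim (rule holomorphic_chartD(2)[OF h])
 have "dd (\<lambda>q. dd psi q (J q (X q))) q u = std_complex (dd ?X q u)"
  unfolding dd_cong[OF ev]
  by (rule dd_linear_compose[OF linear_std_complex vsmoothD[OF c vector_fieldD[OF X(1)]]])
 then show ?thesis
  unfolding nabla_endo_def Let_def X_def[symmetric] linear_diff[OF dd_chart_linear[OF c]]
   conn_repD(7)[OF r JX] holomorphic_chartD(2)[OF h c(2)] conn_repD(7)[OF r X(1)] X(2)
   linear_add[OF linear_std_complex] by simp
qed

text \<open>\<open>S\<close> and \<open>T\<close> stand for the Christoffel endomorphisms of \<open>u\<close> and \<open>v\<close>: the first term of the Ricci
 form cancels the commutator term of the curvature.\<close>

lemma trace_quadratic_terms: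
 fixes S T :: "'n model => 'n model"
 assumes S: "linear S" and T: "linear T"
 defines "I \<equiv> std_complex :: 'n model => 'n model"
 shows "endo_trace (\<lambda>w. S (I (I (T (I w) - I (T w)))) - I (S (I (T (I w) - I (T w)))))
  = - 2 * endo_trace (\<lambda>w. I (S (T w) - T (S w)))"
proof -
 have I: "linear I" "\<And>x. I (I x) = - x" by (simp_all add: I_def linear_std_complex)
 note lin = linear_add[OF S] linear_diff[OF S] linear_neg[OF S] linear_diff[OF T] linear_diff[OF I(1)] linear_neg[OF I(1)] linear_add[OF I(1)]
 have lST: "linear (\<lambda>w. S (T w))" using linear_compose[OF T S] by (simp add: comp_def)
 have lIT: "linear (\<lambda>w. I (T w))" using linear_compose[OF T I(1)] by (simp add: comp_def)
 have lSI: "linear (\<lambda>w. S (I w))" using linear_compose[OF I(1) S] by (simp add: comp_def)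
 have lSIT: "linear (\<lambda>w. S (I (T (I w))))" using linear_compose[OF linear_compose[OF I(1) lIT] S] by (simp add: comp_def)
 have t1: "endo_trace (\<lambda>w. S (T (I w))) = endo_trace (\<lambda>w. I (S (T w)))"
  by (rule endo_trace_comm[OF lST I(1)])
 have t2: "endo_trace (\<lambda>w. S (I (T w))) = endo_trace (\<lambda>w. I (T (S w)))"
  by (rule endo_trace_comm[OF S lIT])
 have t3: "endo_trace (\<lambda>w. I (S (I (T (I w))))) = - endo_trace (\<lambda>w. I (T (S w)))"
  using endo_trace_comm[OF I(1) lSIT] t2
  by (simp add: I(2) linear_neg[OF T] lin endo_trace_minus)
 have "endo_trace (\<lambda>w. S (I (I (T (I w) - I (T w)))) - I (S (I (T (I w) - I (T w)))))
  = endo_trace (\<lambda>w. ((- S (T (I w)) + S (I (T w))) - I (S (I (T (I w))))) - I (S (T w)))"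
  by (simp add: I(2) lin algebra_simps)
 also have "\<dots> = - 2 * endo_trace (\<lambda>w. I (S (T w) - T (S w)))"
  unfolding endo_trace_diff endo_trace_add endo_trace_minus t1 t2 t3 lin(5) by simp
 finally show ?thesis .
qed

text \<open>The one-form sending \<open>y\<close> to the trace of I composed with the Christoffel
  endomorphism of \<open>y\<close>. Its exterior derivative is the part of trace (J R) that is
  linear in the Christoffel symbols.\<close>

definition trJ :: "('m => 'n model => 'n model => 'n model) => 'n model => 'm => real" where
 "trJ Gam y q = endo_trace (\<lambda>x. std_complex (Gam q y x))"

lemma trJ_expand:
 assumes r: "conn_rep U psi D W Gam" "q \<in> W"
 shows "trJ Gam y q = (\<Sum>k\<in>UNIV. (y $ k) * trJ Gam (axis k 1) q)"
proof -
 have l: "linear (\<lambda>y. trJ Gam y q)"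
  unfolding trJ_def endo_trace_sum
  by (intro linear_compose_sum ballI)
   (simp add: linear_iff linear_add[OF conn_repD(4)[OF r]] linear_scale[OF conn_repD(4)[OF r]]
    linear_add[OF linear_std_complex] linear_scale[OF linear_std_complex])
 have "trJ Gam y q = trJ Gam (\<Sum>k\<in>UNIV. (y $ k) *\<^sub>R axis k 1) q" by (simp only: sum_axis)
 then show ?thesis by (simp only: linear_sum[OF l] linear_scale[OF l] real_scaleR_def)
qed

lemma msmooth_trJ:
 assumes r: "conn_rep U psi D W Gam" "p \<in> W"
 shows "msmooth (trJ Gam y) p"
 unfolding trJ_def endo_trace_sum
 by (intro msmooth_sum msmooth_vec_nth msmooth_linear[OF linear_std_complex] conn_repD(6)[OF r])

lemma dd_trJ:
 assumes r: "conn_rep U psi D W Gam" "p \<in> W"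
 shows "dd (trJ Gam y) p w = endo_trace (\<lambda>x. std_complex (dd (\<lambda>q. Gam q y x) p w))"
  "dd (trJ Gam y) p w = (\<Sum>k\<in>UNIV. (y $ k) * dd (trJ Gam (axis k 1)) p w)"
proof -
 have s: "msmooth (\<lambda>q. std_complex (Gam q y x)) p" for x by (rule msmooth_linear[OF linear_std_complex conn_repD(6)[OF r]])
 show "dd (trJ Gam y) p w = endo_trace (\<lambda>x. std_complex (dd (\<lambda>q. Gam q y x) p w))"
  unfolding trJ_def[abs_def] endo_trace_sum
  by (simp add: dd_sum msmooth_vec_nth s dd_vec_nth dd_linear_compose[OF linear_std_complex conn_repD(6)[OF r]])
 have "\<forall>\<^sub>F q in nhds p. trJ Gam y q = (\<Sum>k\<in>UNIV. (y $ k) * trJ Gam (axis k 1) q)"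
  using conn_repD(3)[OF r] by eventually_elim (rule trJ_expand[OF r(1)])
 from dd_cong[OF this] show "dd (trJ Gam y) p w = (\<Sum>k\<in>UNIV. (y $ k) * dd (trJ Gam (axis k 1)) p w)"
  by (simp add: dd_sum msmooth_mult msmooth_const msmooth_trJ[OF r] dd_mult)
qed

lemma linear_std_complex_compose: "linear f ==> linear (\<lambda>w. std_complex (f w))"
 for f :: "'n model => 'n model"
 using linear_compose[OF _ linear_std_complex] by (simp add: comp_def)

lemma linear_model_compose: "linear f ==> linear g ==> linear (\<lambda>w. f (g w))"
 for f g :: "'n model => 'n model"
 using linear_compose[of g f] by (simp add: comp_def)

text \<open>The trace is taken in the coordinate formula for the curvature. Linearity of the
  curvature in its last argument is not visible from the definition, which passes through
  \<open>extend\<close>, and is read off from the same formula.\<close>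

lemma trace_J_curvature:
 fixes u v :: "'n model"
 assumes h: "(U, psi) \<in> holomorphic_charts A J" and D: "connection A D" and r: "conn_rep U psi D W Gam" "p \<in> W"
 defines "S \<equiv> Gam p (dd psi p u)" and "T \<equiv> Gam p (dd psi p v)"
 shows "endo_trace (J p \<circ> curvature A D p u v) = dd (trJ Gam (dd psi p v)) p u - dd (trJ Gam (dd psi p u)) p v
   + endo_trace (\<lambda>w. std_complex (S (T w) - T (S w)))" "linear (curvature A D p u v)"
proof -
 note c = conn_repD(1,2)[OF r]
 have ST: "linear S" "linear T" unfolding S_def T_def by (rule conn_repD(5)[OF r])+
 let ?R = "\<lambda>y. dd (\<lambda>q. Gam q (dd psi p v) y) p u - dd (\<lambda>q. Gam q (dd psi p u) y) p v + S (T y) - T (S y)"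
 have lR: "linear ?R"
  by (intro linear_compose_add linear_compose_sub conn_rep_dd_linear[OF r] linear_model_compose[OF ST] linear_model_compose[OF ST(2,1)])
 have R: "dd psi p (curvature A D p u v w) = ?R (dd psi p w)" for w
  unfolding S_def T_def by (rule curvature_local[OF D r])
 show "linear (curvature A D p u v)" by (rule endo_trace_chart(2)[OF c R lR])
 have "endo_trace (J p \<circ> curvature A D p u v) = endo_trace (\<lambda>y. std_complex (?R y))"
 proof (rule endo_trace_chart[OF c])
  show "dd psi p ((J p \<circ> curvature A D p u v) w) = std_complex (?R (dd psi p w))" for w
   by (simp add: holomorphic_chartD(2)[OF h c(2)] R)
 qed (rule linear_std_complex_compose[OF lR])
 also have "\<dots> = endo_trace (\<lambda>y. std_complex (dd (\<lambda>q. Gam q (dd psi p v) y) p u) - std_complex (dd (\<lambda>q. Gam q (dd psi p u) y) p v)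
   + std_complex (S (T y) - T (S y)))"
  by (simp add: linear_add[OF linear_std_complex] linear_diff[OF linear_std_complex] add_diff_eq)
 finally show "endo_trace (J p \<circ> curvature A D p u v) = dd (trJ Gam (dd psi p v)) p u - dd (trJ Gam (dd psi p u)) p v
   + endo_trace (\<lambda>w. std_complex (S (T w) - T (S w)))"
  by (simp only: endo_trace_add endo_trace_diff dd_trJ(1)[OF r])
qed

text \<open>For a torsion-free connection, lambda is dh composed with \<open>J\<close> minus the
  form \<open>trJ\<close>. Half of its exterior derivative cancels the linear part of half of trace
  (J R), and a quarter of the quadratic term cancels the commutator part. Half of d (dh composed
  with \<open>J\<close>) is left, and the connection has disappeared.\<close>

lemma ricci_form_of_local:
 assumes J: "almost_complex A J" and h: "(U, psi) \<in> holomorphic_charts A J" and p: "p \<in> U"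
  and D: "connection A D" "torsion_free A D" "preserves_top_form A D rho" and rho: "positive_volume_form A rho"
 shows "ricci_form_of A D J p u v = 1 / 2 * ddc J (\<lambda>q. ln \<bar>dens rho psi q\<bar>) p u v"
proof -
 note c = holomorphic_chartD(1)[OF h]
 obtain W Gam where r: "conn_rep U psi D W Gam" "p \<in> W" by (rule connection_local[OF D(1) c p])
 define I where "I = (std_complex :: 'n model => 'n model)"
 have I: "linear I" "\<And>x. I (I x) = - x" by (simp_all add: I_def linear_std_complex)
 note lin = dd_chart_linear[OF c p]
 have top: "is_top_form A rho" using rho by (simp add: positive_volume_form_def)
 define H where "H q = ln \<bar>dens rho psi q\<bar>" for q
 have H: "msmooth H q" if "q \<in> U" for q
  unfolding H_def by (rule dd_ln_abs(1)[OF msmooth_dens[OF top c that] dens_nonzero[OF rho c that]])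
 have ddH: "dd H q w = endo_trace (Gam q (dd psi q w))" if "q \<in> W" for q w
 proof -
  note qU = conn_repD(2)[OF r(1) that]
  show ?thesis
   unfolding H_def[abs_def] dd_ln_abs(2)[OF msmooth_dens[OF top c qU] dens_nonzero[OF rho c qU]]
    dd_dens_trace[OF top D(3) r(1) that] using dens_nonzero[OF rho c qU] by simp
 qed
 let ?t = "trJ Gam"
 note t_sm = msmooth_trJ[OF r] and dt_exp = dd_trJ(2)[OF r]
 have lam: "\<forall>\<^sub>F q in nhds p. \<forall>w. ricci_lambda A D J q w
   = (\<Sum>k\<in>UNIV. (jcoeff U psi H k q - ?t (axis k 1) q) * dd (\<lambda>q. psi q $ k) q w)"
  using conn_repD(3)[OF r] dd_J_expand[OF h p H[OF p]]
 proof eventually_elim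
  case (elim q)
  note q = conn_repD(2)[OF r(1) elim(1)]
  have "ricci_lambda A D J q w = (\<Sum>k\<in>UNIV. (jcoeff U psi H k q - ?t (axis k 1) q) * dd (\<lambda>q. psi q $ k) q w)" for w
  proof -
   let ?w = "dd psi q w"
   \<comment> \<open>Symmetry of the Christoffel symbols turns the trace over the direction of
     differentiation into a trace over the other slot; one part of it is then \<open>trJ\<close>,
     and \<open>ddH\<close> applies to the other.\<close>
   note sym = torsion_free_symmetric[OF D(2) r(1) elim(1)]
   have "ricci_lambda A D J q w = endo_trace (\<lambda>y. Gam q y (I ?w) - I (Gam q y ?w))"
    unfolding ricci_lambda_def I_def
   proof (rule endo_trace_chart[OF c q])
    show "dd psi q (nabla_endo A D J q y w) = Gam q (dd psi q y) (std_complex ?w) - std_complex (Gam q (dd psi q y) ?w)" for y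
     by (rule nabla_endo_local[OF J h r(1) elim(1)])
    show "linear (\<lambda>y. Gam q y (std_complex ?w) - std_complex (Gam q y ?w))"
     by (intro linear_compose_sub conn_repD(4)[OF r(1) elim(1)]
       linear_compose[OF conn_repD(4)[OF r(1) elim(1)] linear_std_complex, unfolded comp_def])
   qed
   also have "\<dots> = endo_trace (Gam q (I ?w)) - ?t ?w q"
    unfolding trJ_def I_def sym[of _ "std_complex ?w"] sym[of _ ?w] endo_trace_diff by simp
   also have "endo_trace (Gam q (I ?w)) = dd H q (J q w)"
    unfolding ddH[OF elim(1)] holomorphic_chartD(2)[OF h q] I_def ..
   finally show ?thesis
    unfolding trJ_expand[OF r(1) elim(1), of ?w] elim(2)[rule_format] dd_chart_nth[OF c q]
    by (simp add: sum_subtractf algebra_simps)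
  qed
  then show ?case by blast
 qed
 have dlam: "d_one_form A (ricci_lambda A D J) p u v = ddc J H p u v - (dd (?t (dd psi p v)) p u - dd (?t (dd psi p u)) p v)"
 proof -
  have j: "msmooth (jcoeff U psi H k) p" for k by (rule msmooth_jcoeff[OF c p H[OF p]])
  have "d_one_form A (ricci_lambda A D J) p u v = (\<Sum>k\<in>UNIV.
    dd (\<lambda>q. jcoeff U psi H k q - ?t (axis k 1) q) p u * dd (\<lambda>q. psi q $ k) p v
    - dd (\<lambda>q. jcoeff U psi H k q - ?t (axis k 1) q) p v * dd (\<lambda>q. psi q $ k) p u)"
   by (rule d_one_form_local[OF msmooth_diff[OF j t_sm] msmooth_chart_nth[OF c p] lam])
  then show ?thesis
   unfolding ddc_local[OF h p H[OF p]] dt_exp[of "dd psi p v"] dt_exp[of "dd psi p u"]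
   by (simp add: dd_diff j t_sm dd_chart_nth[OF c p] sum_subtractf sum.distrib algebra_simps)
 qed
 let ?S = "Gam p (dd psi p u)" and ?T = "Gam p (dd psi p v)"
 have ST: "linear ?S" "linear ?T" by (rule conn_repD(5)[OF r])+
 note curv = trace_J_curvature(1)[OF h D(1) r, of u v]
 have quad: "endo_trace (nabla_endo A D J p u \<circ> J p \<circ> nabla_endo A D J p v)
   = - 2 * endo_trace (\<lambda>w. I (?S (?T w) - ?T (?S w)))"
 proof -
  let ?N = "\<lambda>w. ?S (I (I (?T (I w) - I (?T w)))) - I (?S (I (?T (I w) - I (?T w))))"
  have "endo_trace (nabla_endo A D J p u \<circ> J p \<circ> nabla_endo A D J p v) = endo_trace ?N"
  proof (rule endo_trace_chart[OF c p])
   show "dd psi p ((nabla_endo A D J p u \<circ> J p \<circ> nabla_endo A D J p v) w) = ?N (dd psi p w)" for w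
    by (simp add: nabla_endo_local[OF J h r] holomorphic_chartD(2)[OF h p] I_def)
   show "linear ?N"
   proof -
    have M: "linear (\<lambda>w. ?T (I w) - I (?T w))"
     by (intro linear_compose_sub linear_model_compose[OF ST(2) I(1)] linear_model_compose[OF I(1) ST(2)])
    note cl = linear_std_complex_compose[folded I_def]
    show ?thesis
     by (rule linear_compose_sub[OF linear_model_compose[OF ST(1) cl[OF cl[OF M]]] cl[OF linear_model_compose[OF ST(1) cl[OF M]]]])
   qed
  qed
  then show ?thesis unfolding I_def trace_quadratic_terms[OF ST] .
 qed
 show ?thesis
  unfolding ricci_form_of_def quad curv[folded I_def] dlam H_def[symmetric, abs_def] by (simp add: field_simps)
qed

text \<open>The local formula does not contain the connection, so all admissible connections give
  one form, and a single example of such a connection suffices to evaluate the description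
  \<open>Ric\<close>.\<close>

lemma Ric_eq:
 assumes "connection A D" "torsion_free A D" "preserves_top_form A D rho" "positive_volume_form A rho"
  and J: "integrable_complex A J"
 shows "Ric A rho J = ricci_form_of A D J"
proof -
 have "ricci_form_of A D' J = ricci_form_of A D J"
  if D': "connection A D'" "torsion_free A D'" "preserves_top_form A D' rho" for D'
 proof (intro ext)
  fix p u v
  have "p \<in> (\<Union>c\<in>holomorphic_charts A J. fst c)" "almost_complex A J" using J by (simp_all add: integrable_complex_def)
  then obtain U psi where c: "(U, psi) \<in> holomorphic_charts A J" "p \<in> U" and aJ: "almost_complex A J" by auto
  show "ricci_form_of A D' J p u v = ricci_form_of A D J p u v"
   unfolding ricci_form_of_local[OF aJ c D' assms(4)] ricci_form_of_local[OF aJ c assms(1-4)] ..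
 qed
 then show ?thesis unfolding Ric_def
  by (intro the_equality) (use assms in blast)+
qed

end

section \<open>Gluing connections\<close>

locale compact_manifold = manifold A for A :: "('m::t2_space, 'n::finite) chart set" +
 assumes compact: "compact (UNIV :: 'm set)"
begin

text \<open>Bumps that equal 1 on the members of a finite subcover have a positive sum, by which
  they are divided. The sets \<open>K i\<close> are closed so that the weights can cut off objects
  defined on \<open>N i\<close> only.\<close>

lemma partition_of_unity:
 fixes N :: "'m => 'm set"
 assumes N: "\<And>p. open (N p)" "\<And>p. p \<in> N p"
 obtains I K and wt :: "'m => 'm => real" where "finite I" "\<And>i. closed (K i)" "\<And>i. K i \<subseteq> N i"
  "\<And>i q. msmooth (wt i) q" "\<And>i q. wt i q \<ge> 0" "\<And>i q. q \<notin> K i ==> wt i q = 0" "\<And>q. (\<Sum>i\<in>I. wt i q) = 1"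
proof -
 have "\<exists>b K. closed K \<and> K \<subseteq> N i \<and> (\<forall>q. msmooth b q) \<and> (\<forall>q. 0 \<le> b q) \<and> (\<forall>q. q \<notin> K --> b q = (0::real)) \<and>
   (\<forall>\<^sub>F q in nhds i. b q = 1)" for i
  by (rule manifold_bump[OF chart_at_max chart_at_in(2) N]) blast
 then obtain b K where b: "\<And>i. closed (K i)" "\<And>i. K i \<subseteq> N i" "\<And>i q. msmooth (b i) q" "\<And>i q. 0 \<le> b i q"
  "\<And>i q. q \<notin> K i ==> b i q = (0::real)" "\<And>i. \<forall>\<^sub>F q in nhds i. b i q = 1" by metis
 have "\<exists>W. open W \<and> i \<in> W \<and> (\<forall>q\<in>W. b i q = 1)" for i using b(6)[of i] by (simp add: eventually_nhds)
 then obtain W where W: "\<And>i. open (W i)" "\<And>i. i \<in> W i" "\<And>i q. q \<in> W i ==> b i q = 1" by metis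
 obtain I where I: "finite I" "UNIV \<subseteq> (\<Union>i\<in>I. W i)"
  by (rule compactE_image[OF compact, of UNIV W]) (use W in auto)
 define s where "s q = (\<Sum>i\<in>I. b i q)" for q
 have s: "s q > 0" for q
 proof -
  obtain i where i: "i \<in> I" "q \<in> W i" using I(2) by auto
  show ?thesis unfolding s_def by (rule sum_pos2[OF I(1) i(1)]) (use W(3)[OF i(2)] b(4) in auto)
 qed
 show ?thesis
 proof (rule that[OF I(1) b(1,2), of "\<lambda>i q. b i q / s q"])
  show "msmooth (\<lambda>q. b i q / s q) q" for i q
   using s[of q] by (intro msmooth_divide b) (simp_all add: s_def msmooth_sum b)
  show "b i q / s q \<ge> 0" for i q using b(4) s[of q] by (simp add: less_imp_le)
  show "b i q / s q = 0" if "q \<notin> K i" for i q using b(5)[OF that] by simp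
  show "(\<Sum>i\<in>I. b i q / s q) = 1" for q using s[of q] by (simp add: sum_divide_distrib[symmetric] s_def[symmetric])
 qed
qed

end

context manifold
begin

definition christoffel :: "'m set => ('m => 'n model => 'n model => 'n model) => bool" where
 "christoffel U Gam \<longleftrightarrow> (\<forall>q\<in>U. (\<forall>y. linear (\<lambda>u. Gam q u y)) \<and> (\<forall>u. linear (Gam q u)) \<and> (\<forall>u y. msmooth (\<lambda>q. Gam q u y) q))"

text \<open>The formula is meaningful over the chart domain only; when such terms are glued, the
  weights vanish at all other points.\<close>

definition local_conn ::
  "('m => 'n model) => ('m => 'n model => 'n model => 'n model) => ('m, 'n) conn" where
 "local_conn psi Gam p u Y = lift psi p (dd (\<lambda>q. dd psi q (Y q)) p u + Gam p (dd psi p u) (dd psi p (Y p)))"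

lemma local_conn:
 assumes c: "(U, psi) \<in> max_atlas A" "p \<in> U" and Gam: "christoffel U Gam" and Y: "vector_field A Y"
 shows "linear (\<lambda>u. local_conn psi Gam p u Y)"
  "vector_field A Z ==> local_conn psi Gam p u (\<lambda>q. Y q + Z q) = local_conn psi Gam p u Y + local_conn psi Gam p u Z"
  "msmooth f p ==> local_conn psi Gam p u (\<lambda>q. f q *\<^sub>R Y q) = dd f p u *\<^sub>R Y p + f p *\<^sub>R local_conn psi Gam p u Y"
  "vsmooth X p ==> vsmooth (\<lambda>q. local_conn psi Gam q (X q) Y) p"
  "dd psi p (local_conn psi Gam p u Y) = dd (\<lambda>q. dd psi q (Y q)) p u + Gam p (dd psi p u) (dd psi p (Y p))"
proof -
 have hat: "msmooth (\<lambda>q. dd psi q (V q)) p" if "vector_field A V" for V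
  by (rule vsmoothD[OF c vector_fieldD[OF that]])
 have G: "linear (\<lambda>u. Gam q u y)" "linear (Gam q u)" "msmooth (\<lambda>q. Gam q u y) q" if "q \<in> U" for q u y
  using Gam that by (auto simp: christoffel_def)
 note evU = ev_chart(1)[OF c(1) c(2)]
 note l = lift[OF c]
 show lc: "dd psi p (local_conn psi Gam p u Y) = dd (\<lambda>q. dd psi q (Y q)) p u + Gam p (dd psi p u) (dd psi p (Y p))" for u
  by (simp add: local_conn_def l)
 have "linear (\<lambda>u. dd (\<lambda>q. dd psi q (Y q)) p u + Gam p (dd psi p u) (dd psi p (Y p)))"
  using linear_compose[OF dd_chart_linear[OF c] G(1)[OF c(2)]]
  by (intro linear_compose_add dd_linear hat Y) (simp add: comp_def)
 from linear_compose[OF this l(3)] show "linear (\<lambda>u. local_conn psi Gam p u Y)"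
  by (simp add: local_conn_def comp_def)
 show "local_conn psi Gam p u (\<lambda>q. Y q + Z q) = local_conn psi Gam p u Y + local_conn psi Gam p u Z" if Z: "vector_field A Z"
 proof -
  have "\<forall>\<^sub>F q in nhds p. dd psi q (Y q + Z q) = dd psi q (Y q) + dd psi q (Z q)"
   using evU by eventually_elim (rule linear_add[OF dd_chart_linear[OF c(1)]])
  from dd_cong[OF this] show ?thesis
   by (simp add: local_conn_def dd_add hat Y Z linear_add[OF dd_chart_linear[OF c]] linear_add[OF G(2)[OF c(2)]]
     linear_add[OF l(3)])
 qed
 show "local_conn psi Gam p u (\<lambda>q. f q *\<^sub>R Y q) = dd f p u *\<^sub>R Y p + f p *\<^sub>R local_conn psi Gam p u Y" if f: "msmooth f p"
 proof -
  have "\<forall>\<^sub>F q in nhds p. dd psi q (f q *\<^sub>R Y q) = f q *\<^sub>R dd psi q (Y q)"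
   using evU by eventually_elim (rule linear_scale[OF dd_chart_linear[OF c(1)]])
  from dd_cong[OF this] show ?thesis
   by (simp add: local_conn_def dd_scaleR hat Y f linear_scale[OF dd_chart_linear[OF c]] linear_scale[OF G(2)[OF c(2)]]
     linear_add[OF l(3)] linear_scale[OF l(3)] l(2) scaleR_add_right add_ac)
 qed
 show "vsmooth (\<lambda>q. local_conn psi Gam q (X q) Y) p" if X: "vsmooth X p"
  unfolding local_conn_def
 proof (rule vsmooth_lift[OF c], rule msmooth_add)
  show "msmooth (\<lambda>q. dd (\<lambda>q. dd psi q (Y q)) q (X q)) p" by (rule msmooth_dd[OF X hat[OF Y]])
  have 1: "\<forall>\<^sub>F q in nhds p. linear (\<lambda>y. Gam q y z)" for z using evU by eventually_elim (rule G(1))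
  have 2: "\<forall>\<^sub>F q in nhds p. linear (Gam q (dd psi q (X q)))" using evU by eventually_elim (rule G(2))
  show "msmooth (\<lambda>q. Gam q (dd psi q (X q)) (dd psi q (Y q))) p"
   by (rule dd_linear_field(1)[OF 2 dd_linear_field(1)[OF 1 G(3)[OF c(2)] vsmoothD[OF c X]] hat[OF Y]])
 qed
qed

lemma local_conn_torsion:
 assumes c: "(U, psi) \<in> max_atlas A" "p \<in> U" and Gam: "christoffel U Gam" "\<And>a b. Gam p a b = Gam p b a"
  and XY: "vector_field A X" "vector_field A Y"
 shows "local_conn psi Gam p (X p) Y - local_conn psi Gam p (Y p) X = bracket A X Y p"
proof (rule dd_chart_inj[OF c])
 show "dd psi p (local_conn psi Gam p (X p) Y - local_conn psi Gam p (Y p) X) = dd psi p (bracket A X Y p)"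
  using Gam(2)[of "dd psi p (X p)" "dd psi p (Y p)"]
  by (simp add: linear_diff[OF dd_chart_linear[OF c]] local_conn(5)[OF c Gam(1)] XY
    dd_bracket[OF msmooth_chart[OF c] vector_fieldD vector_fieldD])
qed

lemma msmooth_matrixI:
 fixes b :: "'k::finite => 'm => real ^ 'l::finite"
 assumes "\<And>k. msmooth (b k) p"
 shows "msmooth (\<lambda>q. \<chi> k. b k q) p"
proof (rule msmooth_euclideanI)
 fix x :: "real ^ 'l ^ 'k" assume "x \<in> Basis"
 then obtain k y where "x = axis k y" by (auto simp: Basis_vec_def)
 then show "msmooth (\<lambda>q. (\<chi> k. b k q) \<bullet> x) p"
  by (simp add: inner_axis msmooth_inner msmooth_const assms)
qed

lemma dd_det:
 fixes b :: "'k::finite => 'm => real ^ 'k"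
 assumes b: "\<And>k. msmooth (b k) p"
 shows "dd (\<lambda>q. det (\<chi> k. b k q)) p u = (\<Sum>j\<in>UNIV. det (\<chi> k. ((\<lambda>k. b k p)(j := dd (b j) p u)) k))"
proof -
 let ?M = "\<lambda>q. \<chi> k. b k q"
 have M: "msmooth ?M p" by (rule msmooth_matrixI[OF b])
 have dM: "dd ?M p u $ k = dd (b k) p u" for k
  using dd_linear_compose[of "\<lambda>y. y $ k" ?M p u] M by (simp add: linear_iff)
 have "smooth_at det (?M p)" by (intro smooth_at_det smooth_at_vec_nth smooth_at_id)
 from dd_compose[OF this M] have "dd (\<lambda>q. det (?M q)) p u = fd det (?M p) (dd ?M p u)" .
 moreover have "fd det (?M p) = (\<lambda>H. \<Sum>j\<in>UNIV. det (\<chi> k. ((($) (?M p))(j := H $ j)) k))"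
  by (rule fd_eqI[OF det_has_derivative])
 moreover have "($) (?M p) = (\<lambda>k. b k p)" by (simp add: fun_eq_iff)
 ultimately show ?thesis by (simp only: dM)
qed

text \<open>In coordinates \<open>rho\<close> is its density times a determinant. The derivative of
  the density is a multiple of the trace of the Christoffel endomorphism, and
  \<open>sum_det_upd\<close> distributes this trace over the columns of the frame as the Christoffel
  terms that are required.\<close>

lemma local_conn_preserves:
 assumes c: "(U, psi) \<in> max_atlas A" "p \<in> U" and rho: "positive_volume_form A rho" and X: "\<And>k. vector_field A (X k)"
  and Gam: "christoffel U Gam" and tr: "\<And>a. endo_trace (Gam p a) = dd (dens rho psi) p (lift psi p a) / dens rho psi p"
 shows "dd (\<lambda>q. rho q (\<lambda>k. X k q)) p u = (\<Sum>j\<in>UNIV. rho p ((\<lambda>k. X k p)(j := local_conn psi Gam p u (X j))))"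
proof -
 have top: "is_top_form A rho" using rho by (simp add: positive_volume_form_def)
 let ?X = "\<lambda>k q. dd psi q (X k q)" and ?d = "dens rho psi"
 let ?det = "\<lambda>b. det (\<chi> k. b k) :: real"
 have Xs: "msmooth (?X k) p" for k by (rule vsmoothD[OF c vector_fieldD[OF X]])
 have ev: "\<forall>\<^sub>F q in nhds p. rho q (\<lambda>k. X k q) = ?d q * det (\<chi> k. ?X k q)"
  using ev_chart(1)[OF c(1) c(2)] by eventually_elim (rule top_form_dens[OF top c(1)])
 have ds: "msmooth (\<lambda>q. det (\<chi> k. ?X k q)) p" by (intro msmooth_det) (simp add: msmooth_vec_nth Xs)
 let ?b = "\<lambda>k. ?X k p" and ?T = "Gam p (dd psi p u)"
 have lin: "linear (\<lambda>v. ?det (?b(j := v)))" for j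
  using alternating_det[where 'k = "'n \<times> bool"] unfolding alternating_def by blast
 have T: "linear ?T" using Gam c(2) by (auto simp: christoffel_def)
 have "dd (\<lambda>q. rho q (\<lambda>k. X k q)) p u = dd (\<lambda>q. ?d q * det (\<chi> k. ?X k q)) p u" using dd_cong[OF ev] by simp
 also have "\<dots> = ?d p * (\<Sum>j\<in>UNIV. ?det (?b(j := dd (?X j) p u))) + dd ?d p u * ?det ?b"
  using dd_mult[OF msmooth_dens[OF top c] ds] dd_det[OF Xs] by simp
 also have "dd ?d p u = ?d p * endo_trace ?T" using tr dens_nonzero[OF rho c] by (simp add: lift[OF c])
 also have "?d p * endo_trace ?T * ?det ?b = ?d p * (\<Sum>j\<in>UNIV. ?det (?b(j := ?T (?b j))))"
  unfolding sum_det_upd[OF T] endo_trace_sum by (simp only: mult.assoc)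
 also have "?d p * (\<Sum>j\<in>UNIV. ?det (?b(j := dd (?X j) p u))) + ?d p * (\<Sum>j\<in>UNIV. ?det (?b(j := ?T (?b j))))
   = (\<Sum>j\<in>UNIV. ?d p * ?det (?b(j := dd (?X j) p u + ?T (?b j))))"
  by (simp only: linear_add[OF lin] sum.distrib sum_distrib_left distrib_left)
 also have "\<dots> = (\<Sum>j\<in>UNIV. rho p ((\<lambda>k. X k p)(j := local_conn psi Gam p u (X j))))"
 proof (rule sum.cong[OF refl])
  fix j
  have "(\<lambda>k. dd psi p (((\<lambda>k. X k p)(j := local_conn psi Gam p u (X j))) k)) = ?b(j := dd (?X j) p u + ?T (?b j))"
   by (auto simp: local_conn(5)[OF c Gam X])
  then show "?d p * ?det (?b(j := dd (?X j) p u + ?T (?b j))) = rho p ((\<lambda>k. X k p)(j := local_conn psi Gam p u (X j)))"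
   unfolding top_form_dens[OF top c, of "(\<lambda>k. X k p)(j := local_conn psi Gam p u (X j))"] by (simp only:)
 qed
 finally show ?thesis .
qed

end

context compact_manifold
begin

text \<open>Conditions on a connection that are affine pass from the pieces to the glued connection; this is
 expressed by the last clause.\<close>

lemma glue_connection:
 fixes U :: "'m => 'm set" and psi :: "'m => 'm => 'n model"
 assumes c: "\<And>i. (U i, psi i) \<in> max_atlas A" "\<And>i. i \<in> U i" and Gam: "\<And>i. christoffel (U i) (Gam i)"
 obtains D where "connection A D"
  "\<forall>p. \<exists>I w. finite I \<and> (\<forall>i\<in>I. p \<in> U i) \<and> (\<Sum>i\<in>I. w i) = (1::real) \<and>
   (\<forall>u Y. D p u Y = (\<Sum>i\<in>I. w i *\<^sub>R local_conn (psi i) (Gam i) p u Y))"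
proof -
 have "open (U i)" for i using max_chartD(1)[OF c(1)] .
 then obtain I K and wt :: "'m => 'm => real" where P: "finite I" "\<And>i. closed (K i)" "\<And>i. K i \<subseteq> U i"
  "\<And>i q. msmooth (wt i) q" "\<And>i q. wt i q \<ge> 0" "\<And>i q. q \<notin> K i ==> wt i q = 0" "\<And>q. (\<Sum>i\<in>I. wt i q) = 1"
  by (rule partition_of_unity[of U]) (use c in blast)+
 let ?L = "\<lambda>i. local_conn (psi i) (Gam i)"
 define D where "D p u Y = (\<Sum>i\<in>I. wt i p *\<^sub>R ?L i p u Y)" for p u Y
 have in_U: "p \<in> U i" if "wt i p \<noteq> 0" for i p using P(3,6) that by blast
 have conn: "connection A D"
  unfolding connection_def
 proof (intro conjI allI impI)
  fix p Y assume Y: "vector_field A Y"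
  show "linear (\<lambda>u. D p u Y)"
   unfolding D_def
  proof (intro linear_compose_sum ballI)
   fix i
   show "linear (\<lambda>u. wt i p *\<^sub>R ?L i p u Y)"
   proof (cases "wt i p = 0")
    case False
    show ?thesis by (intro linear_compose_scale_right local_conn(1)[OF c(1) in_U[OF False] Gam Y])
   qed (simp add: linear_zero)
  qed
 next
  fix p u Y Z assume Y: "vector_field A Y" and Z: "vector_field A Z"
  have "wt i p *\<^sub>R ?L i p u (\<lambda>q. Y q + Z q) = wt i p *\<^sub>R ?L i p u Y + wt i p *\<^sub>R ?L i p u Z" for i
   using local_conn(2)[OF c(1) in_U Gam Y Z] by (cases "wt i p = 0") (simp_all add: scaleR_add_right)
  then show "D p u (\<lambda>q. Y q + Z q) = D p u Y + D p u Z" by (simp add: D_def sum.distrib)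
 next
  fix p u and f :: "'m => real" and Y assume f: "smooth_fun A f" and Y: "vector_field A Y"
  then have fp: "msmooth f p" by (simp add: smooth_fun_iff)
  have "wt i p *\<^sub>R ?L i p u (\<lambda>q. f q *\<^sub>R Y q) = wt i p *\<^sub>R dd f p u *\<^sub>R Y p + f p *\<^sub>R wt i p *\<^sub>R ?L i p u Y" for i
   using local_conn(3)[OF c(1) in_U Gam Y fp] by (cases "wt i p = 0") (simp_all add: scaleR_add_right mult.commute)
  then have "D p u (\<lambda>q. f q *\<^sub>R Y q) = (\<Sum>i\<in>I. wt i p) *\<^sub>R dd f p u *\<^sub>R Y p + f p *\<^sub>R D p u Y"
   unfolding D_def scaleR_sum_left scaleR_sum_right by (simp only: sum.distrib)
  then show "D p u (\<lambda>q. f q *\<^sub>R Y q) = dd f p u *\<^sub>R Y p + f p *\<^sub>R D p u Y" by (simp add: P(7))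
 next
  fix X Y assume X: "vector_field A X" and Y: "vector_field A Y"
  have "vsmooth (\<lambda>p. wt i p *\<^sub>R ?L i p (X p) Y) p" for i p
   by (rule vsmooth_cutoff[where b = "wt i" and K = "K i" and U = "U i", OF P(4) P(2) P(3) P(6)],
     assumption, rule local_conn(4)[OF c(1) _ Gam Y vector_fieldD[OF X]])
  then show "vector_field A (\<lambda>p. D p (X p) Y)"
   unfolding vector_field_iff D_def by (intro allI vsmooth_sum)
 qed
 show ?thesis
 proof (rule that[OF conn], rule allI)
  fix p
  \<comment> \<open>Indices of weight zero at \<open>p\<close> are dropped, so that \<open>p\<close>
    lies in the domain of every chart that is still mentioned.\<close>
  let ?I = "{i \<in> I. wt i p \<noteq> 0}"
  have "(\<Sum>i\<in>?I. wt i p) = (\<Sum>i\<in>I. wt i p)" by (rule sum.mono_neutral_left) (use P(1) in auto)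
  moreover have "D p u Y = (\<Sum>i\<in>?I. wt i p *\<^sub>R ?L i p u Y)" for u Y
   unfolding D_def by (rule sum.mono_neutral_right) (use P(1) in auto)
  ultimately show "\<exists>I w. finite I \<and> (\<forall>i\<in>I. p \<in> U i) \<and> (\<Sum>i\<in>I. w i) = (1::real) \<and>
   (\<forall>u Y. D p u Y = (\<Sum>i\<in>I. w i *\<^sub>R ?L i p u Y))"
   using P(1,7) in_U by (intro exI[of _ ?I] exI[of _ "\<lambda>i. wt i p"]) auto
 qed
qed

lemma sum_weights_eq:
 fixes x :: "'i => 'v::real_vector"
 assumes "(\<Sum>i\<in>I. w i) = (1::real)" "\<And>i. i \<in> I ==> x i = r"
 shows "(\<Sum>i\<in>I. w i *\<^sub>R x i) = r"
proof -
 have "(\<Sum>i\<in>I. w i *\<^sub>R x i) = (\<Sum>i\<in>I. w i *\<^sub>R r)" using assms(2) by (intro sum.cong) auto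
 then show ?thesis using assms(1) by (simp add: scaleR_sum_left[symmetric])
qed

text \<open>The ansatz \<alpha>(a) b + \<alpha>(b) a is symmetric, hence torsion-free, and its trace
  is (m + 1) \<alpha>(a) with m the real dimension: m from the multiple of the identity and 1 from
  the rank-one term. Requiring the trace to be the logarithmic differential of the density
  determines \<alpha>.\<close>

lemma exists_volume_connection:
 assumes rho: "positive_volume_form A rho"
 obtains D where "connection A D" "torsion_free A D" "preserves_top_form A D rho"
proof -
 have top: "is_top_form A rho" using rho by (simp add: positive_volume_form_def)
 define m where "m = real CARD('n \<times> bool)"
 have m: "m + 1 > 0" by (simp add: m_def add_nonneg_pos)
 define \<alpha> where "\<alpha> i q a = dd (dens rho (cf i)) q (lift (cf i) q a) / dens rho (cf i) q / (m + 1)" for i q a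
 define Gam where "Gam i q a b = \<alpha> i q a *\<^sub>R b + \<alpha> i q b *\<^sub>R a" for i q and a b :: "'n model"
 have l\<alpha>: "linear (\<alpha> i q)" if "q \<in> cU i" for i q
 proof -
  note c = chart_at_max that
  have "linear (\<lambda>a. dd (dens rho (cf i)) q (lift (cf i) q a))"
   using linear_compose[OF lift(3)[OF c] dd_linear[OF msmooth_dens[OF top c]]] by (simp add: comp_def)
  then show ?thesis by (simp add: linear_iff \<alpha>_def add_divide_distrib)
 qed
 have chr: "christoffel (cU i) (Gam i)" for i
  unfolding christoffel_def
 proof (intro ballI conjI allI)
  fix q a assume q: "q \<in> cU i"
  note c = chart_at_max q
  show "linear (\<lambda>u. Gam i q u a)" "linear (Gam i q a)"
   by (simp_all add: linear_iff Gam_def linear_add[OF l\<alpha>[OF q]] linear_scale[OF l\<alpha>[OF q]] algebra_simps)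
  have "msmooth (\<lambda>q. \<alpha> i q a) q" for a
   unfolding \<alpha>_def using m dens_nonzero[OF rho c]
   by (intro msmooth_divide msmooth_dd vsmooth_lift[OF c] msmooth_const msmooth_dens[OF top c]) auto
  then show "msmooth (\<lambda>q. Gam i q a b) q" for b
   unfolding Gam_def by (intro msmooth_add msmooth_scaleR msmooth_const)
 qed
 have tr: "endo_trace (Gam i q a) = dd (dens rho (cf i)) q (lift (cf i) q a) / dens rho (cf i) q" if "q \<in> cU i" for i q a
 proof -
  have "endo_trace (Gam i q a) = \<alpha> i q a * m + \<alpha> i q a"
   unfolding Gam_def[abs_def] endo_trace_add endo_trace_scale endo_trace_rank_one[OF l\<alpha>[OF that]]
   by (simp add: endo_trace_id m_def)
  also have "\<dots> = \<alpha> i q a * (m + 1)" by (simp add: distrib_left)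
  finally show ?thesis using m by (simp add: \<alpha>_def)
 qed
 obtain D where D: "connection A D" "\<forall>p. \<exists>I w. finite I \<and> (\<forall>i\<in>I. p \<in> cU i) \<and> (\<Sum>i\<in>I. w i) = (1::real) \<and>
   (\<forall>u Y. D p u Y = (\<Sum>i\<in>I. w i *\<^sub>R local_conn (cf i) (Gam i) p u Y))"
  by (rule glue_connection[where U = cU and psi = cf, OF chart_at_max chart_at_in(2) chr])
 have "torsion_free A D"
  unfolding torsion_free_def
 proof (intro allI impI)
  fix X Y p assume XY: "vector_field A X" "vector_field A Y"
  obtain I w where I: "\<forall>i\<in>I. p \<in> cU i" "(\<Sum>i\<in>I. w i) = (1::real)"
   "\<And>u Y. D p u Y = (\<Sum>i\<in>I. w i *\<^sub>R local_conn (cf i) (Gam i) p u Y)" using spec[OF D(2), of p] by blast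
  have "(\<Sum>i\<in>I. w i *\<^sub>R (local_conn (cf i) (Gam i) p (X p) Y - local_conn (cf i) (Gam i) p (Y p) X)) = bracket A X Y p"
   by (rule sum_weights_eq[OF I(2)], rule local_conn_torsion[OF chart_at_max _ chr])
    (use I(1) XY in \<open>auto simp: Gam_def add.commute\<close>)
  then show "D p (X p) Y - D p (Y p) X = bracket A X Y p"
   by (simp add: I(3) scaleR_diff_right sum_subtractf)
 qed
 moreover have "preserves_top_form A D rho"
  unfolding preserves_top_form_def
 proof (intro allI impI)
  fix X :: "'n \<times> bool => 'm => 'n model" and p u assume "\<forall>k. vector_field A (X k)"
  then have X: "\<And>k. vector_field A (X k)" by blast
  obtain I w where I: "\<forall>i\<in>I. p \<in> cU i" "(\<Sum>i\<in>I. w i) = (1::real)"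
   "\<And>u Y. D p u Y = (\<Sum>i\<in>I. w i *\<^sub>R local_conn (cf i) (Gam i) p u Y)" using spec[OF D(2), of p] by blast
  have lin: "linear (\<lambda>v. rho p ((\<lambda>k. X k p)(j := v)))" for j
   using top_form_alternating[OF top] unfolding alternating_def by blast
  have "(\<Sum>i\<in>I. w i *\<^sub>R (\<Sum>j\<in>UNIV. rho p ((\<lambda>k. X k p)(j := local_conn (cf i) (Gam i) p u (X j))))) = dd (\<lambda>q. rho q (\<lambda>k. X k q)) p u"
   by (rule sum_weights_eq[OF I(2)], rule local_conn_preserves[OF chart_at_max _ rho X chr tr, symmetric]) (use I(1) in auto)
  also have "(\<Sum>i\<in>I. w i *\<^sub>R (\<Sum>j\<in>UNIV. rho p ((\<lambda>k. X k p)(j := local_conn (cf i) (Gam i) p u (X j)))))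
   = (\<Sum>j\<in>UNIV. \<Sum>i\<in>I. w i *\<^sub>R rho p ((\<lambda>k. X k p)(j := local_conn (cf i) (Gam i) p u (X j))))"
   unfolding scaleR_sum_right by (rule sum.swap)
  also have "\<dots> = (\<Sum>j\<in>UNIV. rho p ((\<lambda>k. X k p)(j := D p u (X j))))"
   by (simp only: I(3) linear_sum[OF lin] linear_scale[OF lin])
  finally show "dd (\<lambda>q. rho q (\<lambda>k. X k q)) p u = (\<Sum>j\<in>UNIV. rho p ((\<lambda>k. X k p)(j := D p u (X j))))" ..
 qed
 ultimately show ?thesis using D(1) that by blast
qed

lemma Ric_local:
 assumes rho: "positive_volume_form A rho" and J: "integrable_complex A J"
  and h: "(U, psi) \<in> holomorphic_charts A J" "p \<in> U"
 shows "Ric A rho J p u v = 1 / 2 * ddc J (\<lambda>q. ln \<bar>dens rho psi q\<bar>) p u v"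
proof -
 obtain D where D: "connection A D" "torsion_free A D" "preserves_top_form A D rho"
  by (rule exists_volume_connection[OF rho])
 have "almost_complex A J" using J by (simp add: integrable_complex_def)
 then show ?thesis unfolding Ric_eq[OF D rho J] by (rule ricci_form_of_local[OF _ h D rho])
qed

end

section \<open>Hermitian metrics and the Chern connection\<close>

context manifold
begin

lemma dd_cong_on:
 assumes "(U, psi) \<in> max_atlas A" "p \<in> U" "\<And>q. q \<in> U ==> f q = g q"
 shows "dd f p = dd g p"
 by (rule dd_cong, rule eventually_mono[OF ev_chart(1)[OF assms(1) assms(2)]]) (rule assms(3))

lemma lift_J:
 assumes "(U, psi) \<in> holomorphic_charts A J" "p \<in> U"
 shows "lift psi p (std_complex a) = J p (lift psi p a)"
proof -
 note c = holomorphic_chartD(1)[OF assms(1)] assms(2)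
 have "std_complex a = dd psi p (J p (lift psi p a))" by (simp add: holomorphic_chartD(2)[OF assms] lift(1)[OF c])
 then show ?thesis by (simp add: lift(2)[OF c])
qed

definition gram :: "('m => 'n model => 'n model => real) => ('m => 'n model) => 'm => 'n model => 'n model => real" where
 "gram g psi q a b = g q (lift psi q a) (lift psi q b)"

lemma hermitian_metricD:
 assumes "hermitian_metric A J g"
 shows "linear (g p u)" "g p u v = g p v u" "u \<noteq> 0 ==> g p u u > 0"
  "vector_field A X ==> vector_field A Y ==> msmooth (\<lambda>p. g p (X p) (Y p)) p"
  "g p (J p u) (J p v) = g p u v"
 using assms unfolding hermitian_metric_def smooth_fun_iff by blast+

lemma gram_props:
 assumes g: "hermitian_metric A J g" and h: "(U, psi) \<in> holomorphic_charts A J" "p \<in> U"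
 shows "linear (gram g psi p a)" "linear (\<lambda>a. gram g psi p a b)" "gram g psi p a b = gram g psi p b a"
  "(\<And>z. gram g psi p a z = gram g psi p b z) ==> a = b" "msmooth (\<lambda>q. gram g psi q a b) p"
  "gram g psi p (std_complex a) b = - gram g psi p a (std_complex b)"
  "gram g psi p (std_complex a) (std_complex b) = gram g psi p a b"
proof -
 note c = holomorphic_chartD(1)[OF h(1)] h(2) and gD = hermitian_metricD[OF g]
 show l: "linear (gram g psi p a)" for a
  using linear_compose[OF lift(3)[OF c] gD(1)[of p "lift psi p a"]] by (simp add: gram_def[abs_def] comp_def)
 show sym: "gram g psi p a b = gram g psi p b a" for a b unfolding gram_def by (rule gD(2))
 show l2: "linear (\<lambda>a. gram g psi p a b)" for b unfolding sym[of _ b] by (rule l)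
 show "a = b" if "\<And>z. gram g psi p a z = gram g psi p b z"
 proof (rule ccontr)
  assume "a \<noteq> b"
  have "lift psi p (a - b) \<noteq> 0"
  proof
   assume "lift psi p (a - b) = 0"
   then have "dd psi p (lift psi p (a - b)) = 0" by (simp add: linear_0[OF dd_chart_linear[OF c]])
   then show False using \<open>a \<noteq> b\<close> by (simp add: lift(1)[OF c])
  qed
  from gD(3)[OF this, of p] have "gram g psi p (a - b) (a - b) > 0" by (simp add: gram_def)
  then show False using that[of "a - b"] by (simp add: linear_diff[OF l2])
 qed
 show J2: "gram g psi p (std_complex a) (std_complex b) = gram g psi p a b" for a b
  unfolding gram_def lift_J[OF h] by (rule gD(5))
 show "gram g psi p (std_complex a) b = - gram g psi p a (std_complex b)"
  using J2[of a "std_complex b"] by (simp add: linear_neg[OF l])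
 show "msmooth (\<lambda>q. gram g psi q a b) p"
 proof -
  obtain X where X: "vector_field A X" "\<forall>\<^sub>F q in nhds p. dd psi q (X q) = a" by (rule coordinate_field[OF c])
  obtain Y where Y: "vector_field A Y" "\<forall>\<^sub>F q in nhds p. dd psi q (Y q) = b" by (rule coordinate_field[OF c])
  have "\<forall>\<^sub>F q in nhds p. g q (X q) (Y q) = gram g psi q a b"
   using X(2) Y(2) ev_chart(1)[OF c(1) c(2)]
  proof eventually_elim
   case (elim q)
   show ?case unfolding gram_def elim(1,2)[symmetric] lift(2)[OF c(1) elim(3)] ..
  qed
  with gD(4)[OF X(1) Y(1)] show ?thesis by (rule msmooth_cong)
 qed
qed

definition dgram where
 "dgram g psi q u a b = dd (\<lambda>q. gram g psi q a b) q (lift psi q u)"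

lemma dgram_props:
 assumes g: "hermitian_metric A J g" and h: "(U, psi) \<in> holomorphic_charts A J" "p \<in> U"
 shows "linear (\<lambda>u. dgram g psi p u a b)" "linear (dgram g psi p u a)" "dgram g psi p u a b = dgram g psi p u b a"
  "msmooth (\<lambda>q. dgram g psi q u a b) p" "dgram g psi p u (std_complex a) b = - dgram g psi p u a (std_complex b)"
  "dgram g psi p u a (std_complex (std_complex b)) = - dgram g psi p u a b"
proof -
 note c = holomorphic_chartD(1)[OF h(1)] h(2) and G = gram_props[OF g h(1)]
 show "linear (\<lambda>u. dgram g psi p u a b)"
  using linear_compose[OF lift(3)[OF c] dd_linear[OF G(5)[OF h(2)]]] by (simp add: dgram_def comp_def)
 show l: "linear (dgram g psi p u a)" for u a
 proof (rule linearI)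
  fix x y :: "'n model" and r :: real
  have "dd (\<lambda>q. gram g psi q a (x + y)) p = dd (\<lambda>q. gram g psi q a x + gram g psi q a y) p"
   by (rule dd_cong_on[OF c]) (rule linear_add[OF G(1)])
  then show "dgram g psi p u a (x + y) = dgram g psi p u a x + dgram g psi p u a y"
   by (simp add: dgram_def dd_add G(5)[OF h(2)])
  have "dd (\<lambda>q. gram g psi q a (r *\<^sub>R x)) p = dd (\<lambda>q. r *\<^sub>R gram g psi q a x) p"
   by (rule dd_cong_on[OF c]) (rule linear_scale[OF G(1)])
  then show "dgram g psi p u a (r *\<^sub>R x) = r *\<^sub>R dgram g psi p u a x"
   unfolding dgram_def by (simp only: dd_scaleR[OF msmooth_const G(5)[OF h(2)]]) simp
 qed
 have "dd (\<lambda>q. gram g psi q a b) p = dd (\<lambda>q. gram g psi q b a) p" by (rule dd_cong_on[OF c]) (rule G(3))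
 then show "dgram g psi p u a b = dgram g psi p u b a" by (simp add: dgram_def)
 have "dd (\<lambda>q. gram g psi q (std_complex a) b) p = dd (\<lambda>q. - gram g psi q a (std_complex b)) p"
  by (rule dd_cong_on[OF c]) (rule G(6))
 then show "dgram g psi p u (std_complex a) b = - dgram g psi p u a (std_complex b)"
  by (simp add: dgram_def dd_minus G(5)[OF h(2)])
 show "msmooth (\<lambda>q. dgram g psi q u a b) p"
  unfolding dgram_def by (intro msmooth_dd vsmooth_lift[OF c] msmooth_const G(5)[OF h(2)])
 show "dgram g psi p u a (std_complex (std_complex b)) = - dgram g psi p u a b"
  by (simp add: linear_neg[OF l])
qed

text \<open>In a holomorphic frame the Chern connection is determined by \<open>\<nabla>'' = d''\<close> and
 \<open>h(\<nabla>'\<^sub>u y, z) = d'\<^sub>u h(y, z)\<close> for constant \<open>y\<close> and \<open>z\<close>; the following is the real part of the right-hand side.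
 The Christoffel symbols are then given by Cramer's rule, which makes them smooth.\<close>

definition chern_rhs where
 "chern_rhs g psi q u y z = (dgram g psi q u y z + dgram g psi q (std_complex u) y (std_complex z)) / 2"

definition gram_matrix :: "('m => 'n model => 'n model => real) => ('m => 'n model) => 'm => real ^ ('n \<times> bool) ^ ('n \<times> bool)" where
 "gram_matrix g psi q = (\<chi> i j. gram g psi q (axis i 1) (axis j 1))"

definition chern_gamma where
 "chern_gamma g psi q u y = (\<chi> k. det (\<chi> i j. if j = k then chern_rhs g psi q u y (axis i 1)
   else gram_matrix g psi q $ i $ j) / det (gram_matrix g psi q))"

lemma gram_matrix_mult:
 assumes g: "hermitian_metric A J g" and h: "(U, psi) \<in> holomorphic_charts A J" "p \<in> U"
 shows "(gram_matrix g psi p *v w) $ i = gram g psi p w (axis i 1)"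
proof -
 note G = gram_props[OF g h]
 have "gram g psi p w (axis i 1) = gram g psi p (axis i 1) (\<Sum>k\<in>UNIV. (w $ k) *\<^sub>R axis k 1)"
  by (simp only: sum_axis G(3)[of w])
 also have "\<dots> = (\<Sum>k\<in>UNIV. w $ k * gram g psi p (axis i 1) (axis k 1))"
  by (simp add: linear_sum[OF G(1)] linear_scale[OF G(1)])
 finally show ?thesis by (simp add: matrix_vector_mult_def gram_matrix_def mult.commute)
qed

lemma det_gram_nonzero:
 assumes g: "hermitian_metric A J g" and h: "(U, psi) \<in> holomorphic_charts A J" "p \<in> U"
 shows "det (gram_matrix g psi p) \<noteq> 0"
proof -
 note G = gram_props[OF g h]
 have "inj ((*v) (gram_matrix g psi p))"
 proof (rule injI)
  fix a b assume "gram_matrix g psi p *v a = gram_matrix g psi p *v b"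
  then have e: "gram g psi p a (axis i 1) = gram g psi p b (axis i 1)" for i
   using gram_matrix_mult[OF g h] by metis
  show "a = b"
  proof (rule G(4))
   fix z
   have "gram g psi p x z = (\<Sum>k\<in>UNIV. z $ k * gram g psi p x (axis k 1))" for x
   proof -
    have "gram g psi p x z = gram g psi p x (\<Sum>k\<in>UNIV. (z $ k) *\<^sub>R axis k 1)" by (simp only: sum_axis)
    then show ?thesis by (simp add: linear_sum[OF G(1)] linear_scale[OF G(1)])
   qed
   then show "gram g psi p a z = gram g psi p b z" by (simp only: e)
  qed
 qed
 then show ?thesis using det_nz_iff_inj[of "(*v) (gram_matrix g psi p)"] by simp
qed

text \<open>Non-degeneracy of \<open>gram\<close> reduces each identity to one for
  \<open>chern_rhs\<close>. Complex linearity in both slots reflects the Hermitian symmetry of the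
  metric and the fact that only the (1,0)-part of the derivative enters.\<close>

lemma chern_gamma:
 assumes g: "hermitian_metric A J g" and h: "(U, psi) \<in> holomorphic_charts A J"
 shows "p \<in> U ==> gram g psi p (chern_gamma g psi p u y) z = chern_rhs g psi p u y z"
  "p \<in> U ==> chern_gamma g psi p u (std_complex y) = std_complex (chern_gamma g psi p u y)"
  "p \<in> U ==> chern_gamma g psi p (std_complex u) y = std_complex (chern_gamma g psi p u y)"
  "christoffel U (chern_gamma g psi)"
proof -
 let ?Gam = "chern_gamma g psi"
 note G = gram_props[OF g h] and dG = dgram_props[OF g h]
 have lz: "linear (chern_rhs g psi p u y)" if "p \<in> U" for p u y
  unfolding chern_rhs_def linear_iff
  by (simp add: linear_add[OF dG(2)[OF that]] linear_scale[OF dG(2)[OF that]] linear_add[OF linear_std_complex]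
    linear_scale[OF linear_std_complex] field_simps)
 show main: "gram g psi p (?Gam p u y) z = chern_rhs g psi p u y z" if p: "p \<in> U" for p u y z
 proof -
  have "gram_matrix g psi p *v ?Gam p u y = (\<chi> i. chern_rhs g psi p u y (axis i 1))"
   by (subst cramer[OF det_gram_nonzero[OF g h p]]) (simp only: chern_gamma_def vec_lambda_beta)
  then have e: "gram g psi p (?Gam p u y) (axis i 1) = chern_rhs g psi p u y (axis i 1)" for i
   using gram_matrix_mult[OF g h p, of "?Gam p u y" i] by simp
  have "gram g psi p (?Gam p u y) z = gram g psi p (?Gam p u y) (\<Sum>k\<in>UNIV. (z $ k) *\<^sub>R axis k 1)" by (simp only: sum_axis)
  also have "\<dots> = chern_rhs g psi p u y (\<Sum>k\<in>UNIV. (z $ k) *\<^sub>R axis k 1)"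
   by (simp only: linear_sum[OF G(1)[OF p]] linear_scale[OF G(1)[OF p]] linear_sum[OF lz[OF p]] linear_scale[OF lz[OF p]] e)
  finally show ?thesis by (simp only: sum_axis)
 qed
 have neg: "dgram g psi p (std_complex (std_complex u)) a b = - dgram g psi p u a b" if "p \<in> U" for p u a b
  by (simp add: linear_neg[OF dG(1)[OF that]])
 show "?Gam p u (std_complex y) = std_complex (?Gam p u y)" if p: "p \<in> U" for p u y
  by (rule G(4)[OF p], unfold G(6)[OF p] main[OF p])
   (simp add: chern_rhs_def dG(5)[OF p] dG(6)[OF p] linear_neg[OF dG(2)[OF p]] field_simps)
 show "?Gam p (std_complex u) y = std_complex (?Gam p u y)" if p: "p \<in> U" for p u y
  by (rule G(4)[OF p], unfold G(6)[OF p] main[OF p])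
   (simp add: chern_rhs_def neg[OF p] dG(5)[OF p] dG(6)[OF p] linear_neg[OF dG(1)[OF p]] linear_neg[OF dG(2)[OF p]] field_simps)
 show "christoffel U ?Gam"
  unfolding christoffel_def
 proof (intro ballI conjI allI)
  fix p u y assume p: "p \<in> U"
  have dG2: "linear (\<lambda>a. dgram g psi p u a b)" for u b unfolding dG(3)[OF p, of u _ b] by (rule dG(2)[OF p])
  show "linear (\<lambda>u. ?Gam p u y)"
   by (rule linearI; rule G(4)[OF p]; simp add: main[OF p] linear_add[OF G(2)[OF p]] linear_scale[OF G(2)[OF p]]
     chern_rhs_def linear_add[OF dG(1)[OF p]] linear_scale[OF dG(1)[OF p]] linear_add[OF linear_std_complex]
     linear_scale[OF linear_std_complex] field_simps)
  show "linear (?Gam p u)"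
   by (rule linearI; rule G(4)[OF p]; simp add: main[OF p] linear_add[OF G(2)[OF p]] linear_scale[OF G(2)[OF p]]
     chern_rhs_def linear_add[OF dG2] linear_scale[OF dG2] field_simps)
  have M: "msmooth (\<lambda>q. gram_matrix g psi q $ i $ j) p" for i j
   by (simp add: gram_matrix_def G(5)[OF p])
  have R: "msmooth (\<lambda>q. chern_rhs g psi q u y z) p" for z
   unfolding chern_rhs_def by (intro msmooth_divide msmooth_add dG(4)[OF p] msmooth_const) simp
  show "msmooth (\<lambda>q. ?Gam q u y) p"
  proof (rule msmooth_vecI)
   fix k
   have "msmooth (\<lambda>q. det (\<chi> i j. if j = k then chern_rhs g psi q u y (axis i 1) else gram_matrix g psi q $ i $ j)) p"
   proof (rule msmooth_det)
    fix i j
    show "msmooth (\<lambda>q. (\<chi> i j. if j = k then chern_rhs g psi q u y (axis i 1) else gram_matrix g psi q $ i $ j) $ i $ j) p"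
     by (cases "j = k") (simp_all add: M R)
   qed
   from msmooth_divide[OF this msmooth_det[OF M] det_gram_nonzero[OF g h p]]
   show "msmooth (\<lambda>q. ?Gam q u y $ k) p" by (simp only: chern_gamma_def vec_lambda_beta)
  qed
 qed
qed

text \<open>The transition map between holomorphic charts commutes with \<open>std_complex\<close>, which makes the second-order
 terms in the transformed Cauchy--Riemann operator cancel.\<close>

lemma cauchy_riemann_local:
 assumes h: "(U, psi) \<in> holomorphic_charts A J" "p \<in> U" and Y: "vector_field A Y"
 shows "dd psi p (cauchy_riemann A J p u Y)
  = (1/2) *\<^sub>R (dd (\<lambda>q. dd psi q (Y q)) p u + std_complex (dd (\<lambda>q. dd psi q (Y q)) p (J p u)))"
proof -
 note c = holomorphic_chartD(1)[OF h(1)] h(2)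
 let ?R = "\<lambda>eta. (1/2) *\<^sub>R (dd (\<lambda>q. dd eta q (Y q)) p u + std_complex (dd (\<lambda>q. dd eta q (Y q)) p (J p u)))"
 define w where "w = lift psi p (?R psi)"
 have w: "dd psi p w = ?R psi" by (simp add: w_def lift(1)[OF c])
 have other: "dd eta p w = ?R eta" if k: "(V, eta) \<in> holomorphic_charts A J" "p \<in> V" for V eta
 proof -
  note d = holomorphic_chartD(1)[OF k(1)] k(2)
  let ?T = "\<lambda>x. eta (inv_into U psi x)"
  have T: "smooth_at ?T (psi p)" by (rule msmoothD[OF c msmooth_chart[OF d]])
  have ev: "\<forall>\<^sub>F q in nhds p. fd ?T (psi q) (std_complex a) = std_complex (fd ?T (psi q) a)" for a
   using ev_chart(1)[OF c(1) c(2)] ev_chart(1)[OF d(1) d(2)]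
  proof eventually_elim
   case (elim q)
   note cq = c(1) elim(1) and dq = d(1) elim(2)
   have "dd eta q (J q (lift psi q a)) = std_complex (dd eta q (lift psi q a))" by (rule holomorphic_chartD(2)[OF k(1) elim(2)])
   then show ?case
    unfolding dd_in_chart[OF cq msmooth_chart[OF dq]] holomorphic_chartD(2)[OF h(1) elim(1)] lift(1)[OF cq] .
  qed
  note lT = smooth_at_linear[OF T]
  have T0: "fd ?T (psi p) (std_complex a) = std_complex (fd ?T (psi p) a)" for a
   by (rule eventually_nhds_x_imp_x[OF ev])
  have T1: "fd (\<lambda>x. fd ?T x (std_complex a)) (psi p) b = std_complex (fd (\<lambda>x. fd ?T x a) (psi p) b)" for a b
  proof -
   have "dd (\<lambda>q. fd ?T (psi q) (std_complex a)) p (lift psi p b) = dd (\<lambda>q. std_complex (fd ?T (psi q) a)) p (lift psi p b)"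
    unfolding dd_cong[OF ev] ..
   also have "\<dots> = std_complex (dd (\<lambda>q. fd ?T (psi q) a) p (lift psi p b))"
    by (rule dd_linear_compose[OF linear_std_complex msmooth_fd_chart[OF c msmooth_chart[OF d]]])
   finally show ?thesis
    unfolding dd_compose[OF smooth_at_fd[OF T] msmooth_chart[OF c]] lift(1)[OF c] .
  qed
  let ?y = "\<lambda>q. dd psi q (Y q)"
  have "?R eta = (1/2) *\<^sub>R (fd ?T (psi p) (dd ?y p u) + std_complex (fd ?T (psi p) (dd ?y p (J p u))))"
   unfolding dd_dd[OF c msmooth_chart[OF d] vector_fieldD[OF Y]] holomorphic_chartD(2)[OF h] T1
   by (simp add: linear_add[OF linear_std_complex])
  also have "\<dots> = fd ?T (psi p) (?R psi)"
   unfolding T0[symmetric] by (simp add: linear_add[OF lT] linear_scale[OF lT])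
  also have "\<dots> = dd eta p w" unfolding dd_in_chart[OF c msmooth_chart[OF d]] w ..
  finally show ?thesis ..
 qed
 have "cauchy_riemann A J p u Y = w"
  unfolding cauchy_riemann_def Let_def
 proof (rule the_equality)
  show "\<forall>(V, eta)\<in>holomorphic_charts A J. p \<in> V --> dd eta p w = ?R eta"
  proof (rule ballI)
   fix x assume x: "x \<in> holomorphic_charts A J"
   obtain V eta where xV: "x = (V, eta)" by (cases x)
   show "case x of (V, eta) => p \<in> V --> dd eta p w = ?R eta"
    unfolding xV case_prod_conv by (rule impI, rule other[OF x[unfolded xV]])
  qed
  fix w' assume "\<forall>(V, eta)\<in>holomorphic_charts A J. p \<in> V --> dd eta p w' = ?R eta"
  from bspec[OF this h(1), unfolded case_prod_conv, rule_format, OF h(2)] have "dd psi p w' = ?R psi" .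
  then show "w' = w" by (rule dd_chart_inj[OF c trans[OF _ w[symmetric]]])
 qed
 then show ?thesis by (simp only: w)
qed

lemma dd_metric:
 assumes g: "hermitian_metric A J g" and h: "(U, psi) \<in> holomorphic_charts A J" "p \<in> U"
  and Y: "vector_field A Y" and Z: "vector_field A Z"
 shows "dd (\<lambda>q. g q (Y q) (Z q)) p u = dgram g psi p (dd psi p u) (dd psi p (Y p)) (dd psi p (Z p))
  + gram g psi p (dd (\<lambda>q. dd psi q (Y q)) p u) (dd psi p (Z p)) + gram g psi p (dd psi p (Y p)) (dd (\<lambda>q. dd psi q (Z q)) p u)"
proof -
 note c = holomorphic_chartD(1)[OF h(1)] h(2) and G = gram_props[OF g h(1)]
 note ev = ev_chart(1)[OF c(1) c(2)]
 let ?y = "\<lambda>q. dd psi q (Y q)" and ?z = "\<lambda>q. dd psi q (Z q)"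
 have y: "msmooth ?y p" and z: "msmooth ?z p" by (rule vsmoothD[OF c vector_fieldD], fact)+
 have 1: "\<forall>\<^sub>F q in nhds p. linear (\<lambda>a. gram g psi q a b)" for b using ev by eventually_elim (rule G(2))
 have 2: "\<forall>\<^sub>F q in nhds p. linear (gram g psi q (?y q))" using ev by eventually_elim (rule G(1))
 note s1 = dd_linear_field[OF 1 G(5)[OF h(2)] y]
 note s2 = dd_linear_field[OF 2 s1(1) z]
 have "dd (\<lambda>q. g q (Y q) (Z q)) p u = dd (\<lambda>q. gram g psi q (?y q) (?z q)) p u"
  by (rule fun_cong[OF dd_cong_on[OF c]]) (simp add: gram_def lift(2)[OF c(1)])
 then show ?thesis using s2(2)[of u] s1(2)[of "?z p" u] by (simp add: dgram_def lift(2)[OF c])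
qed

lemma metric_gram:
 assumes c: "(U, psi) \<in> max_atlas A" "p \<in> U"
 shows "g p v w = gram g psi p (dd psi p v) (dd psi p w)"
 by (simp add: gram_def lift(2)[OF c])

lemma dd_J_field:
 assumes h: "(U, psi) \<in> holomorphic_charts A J" "p \<in> U" and Y: "vector_field A Y"
 shows "dd (\<lambda>q. dd psi q (J q (Y q))) p u = std_complex (dd (\<lambda>q. dd psi q (Y q)) p u)"
proof -
 note c = holomorphic_chartD(1)[OF h(1)] h(2)
 have "dd (\<lambda>q. dd psi q (J q (Y q))) p = dd (\<lambda>q. std_complex (dd psi q (Y q))) p"
  by (rule dd_cong_on[OF c]) (rule holomorphic_chartD(2)[OF h(1)])
 then show ?thesis
  by (simp only: dd_linear_compose[OF linear_std_complex vsmoothD[OF c vector_fieldD[OF Y]]])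
qed

lemma local_chern_conn:
 assumes J: "almost_complex A J" and g: "hermitian_metric A J g" and h: "(U, psi) \<in> holomorphic_charts A J" "p \<in> U"
  and Y: "vector_field A Y"
 defines "L \<equiv> local_conn psi (chern_gamma g psi) p"
 shows "L u (\<lambda>q. J q (Y q)) = J p (L u Y)"
  "vector_field A Z ==> dd (\<lambda>q. g q (Y q) (Z q)) p u = g p (L u Y) (Z p) + g p (Y p) (L u Z)"
  "(1/2) *\<^sub>R (L u Y + J p (L (J p u) Y)) = cauchy_riemann A J p u Y"
proof -
 note c = holomorphic_chartD(1)[OF h(1)] h(2) and ch = chern_gamma[OF g h(1)]
 note lc = local_conn(5)[OF c ch(4), folded L_def]
 note J0 = holomorphic_chartD(2)[OF h] and lin = dd_chart_linear[OF c]
 show "L u (\<lambda>q. J q (Y q)) = J p (L u Y)"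
  by (rule dd_chart_inj[OF c])
   (simp add: lc Y almost_complex_vf[OF J Y] J0 dd_J_field[OF h Y] ch(2)[OF h(2)] linear_add[OF linear_std_complex])
 show "dd (\<lambda>q. g q (Y q) (Z q)) p u = g p (L u Y) (Z p) + g p (Y p) (L u Z)" if Z: "vector_field A Z"
 proof -
  note G = gram_props[OF g h] and dG = dgram_props[OF g h]
  let ?u = "dd psi p u" and ?y = "dd psi p (Y p)" and ?z = "dd psi p (Z p)"
  \<comment> \<open>In the sum of the expressions for (y, z) and (z, y) the terms differentiated in
    the direction I u cancel by skew-symmetry, while the two halves of the derivative in the
    direction u add up.\<close>
  have "gram g psi p (chern_gamma g psi p ?u ?y) ?z + gram g psi p ?y (chern_gamma g psi p ?u ?z)
   = chern_rhs g psi p ?u ?y ?z + chern_rhs g psi p ?u ?z ?y"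
   by (simp only: G(3)[of ?y "chern_gamma g psi p ?u ?z"] ch(1)[OF h(2)])
  also have "\<dots> = dgram g psi p ?u ?y ?z"
   using dG(3)[of ?u ?z ?y] dG(3)[of "std_complex ?u" ?z "std_complex ?y"] dG(5)[of "std_complex ?u" ?y ?z]
   by (simp add: chern_rhs_def field_simps)
  finally show ?thesis
   by (simp add: dd_metric[OF g h Y Z] metric_gram[OF c, of g] lc Y Z linear_add[OF G(1)] linear_add[OF G(2)])
 qed
 show "(1/2) *\<^sub>R (L u Y + J p (L (J p u) Y)) = cauchy_riemann A J p u Y"
  by (rule dd_chart_inj[OF c])
   (simp add: cauchy_riemann_local[OF h Y] lc Y J0 linear_add[OF lin] linear_scale[OF lin] ch(3)[OF h(2)]
    linear_add[OF linear_std_complex])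
qed

end

context compact_manifold
begin

text \<open>Euclidean metrics of charts are glued to a Riemannian metric, positivity being preserved
  by convex combinations; compatibility with \<open>J\<close> is arranged afterwards.\<close>

lemma exists_hermitian_metric:
 assumes J: "almost_complex A J"
 obtains g where "hermitian_metric A J g"
proof -
 have "open (cU i)" for i using is_chartD(1)[OF chart_at_is_chart] .
 then obtain I K and wt :: "'m => 'm => real" where P: "finite I" "\<And>i. closed (K i)" "\<And>i. K i \<subseteq> cU i"
  "\<And>i q. msmooth (wt i) q" "\<And>i q. wt i q \<ge> 0" "\<And>i q. q \<notin> K i ==> wt i q = 0" "\<And>q. (\<Sum>i\<in>I. wt i q) = 1"
  by (rule partition_of_unity[of cU]) (use chart_at_in in blast)+
 have in_U: "p \<in> cU i" if "wt i p \<noteq> 0" for i p using P(3,6) that by blast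
 have lJ: "linear (J p)" and JJ: "J p (J p v) = - v" for p v using J by (auto simp: almost_complex_def)
 define g0 where "g0 p u v = (\<Sum>i\<in>I. wt i p * (dd (cf i) p u \<bullet> dd (cf i) p v))" for p u v
 have sym0: "g0 p u v = g0 p v u" for p u v by (simp add: g0_def inner_commute)
 have lin0: "linear (g0 p u)" for p u
  unfolding g0_def
 proof (intro linear_compose_sum ballI)
  fix i
  show "linear (\<lambda>v. wt i p * (dd (cf i) p u \<bullet> dd (cf i) p v))"
  proof (cases "wt i p = 0")
   case False
   note l = dd_chart_linear[OF chart_at_max in_U[OF False]]
   show ?thesis by (simp add: linear_iff linear_add[OF l] linear_scale[OF l] inner_add_right distrib_left)
  qed (simp add: linear_zero)
 qed
 have pos0: "g0 p u u > 0" if u: "u \<noteq> 0" for p u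
 proof -
  obtain i where i: "i \<in> I" "wt i p \<noteq> 0" using P(7)[of p] by (metis (no_types, lifting) sum.neutral zero_neq_one)
  note l = dd_chart_linear[OF chart_at_max in_U[OF i(2)]]
  have "dd (cf i) p u \<noteq> 0"
  proof
   assume "dd (cf i) p u = 0"
   then have "dd (cf i) p u = dd (cf i) p 0" by (simp only: linear_0[OF l])
   from dd_chart_inj[OF chart_at_max in_U[OF i(2)] this] u show False by simp
  qed
  moreover have "wt i p > 0" using P(5)[of i p] i(2) by simp
  ultimately show ?thesis
   unfolding g0_def by (intro sum_pos2[OF P(1) i(1)]) (use P(5) in auto)
 qed
 have sm0: "msmooth (\<lambda>p. g0 p (X p) (Y p)) p" if X: "vector_field A X" and Y: "vector_field A Y" for X Y p
  unfolding g0_def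
 proof (rule msmooth_sum)
  fix i
  have "msmooth (\<lambda>p. wt i p *\<^sub>R (dd (cf i) p (X p) \<bullet> dd (cf i) p (Y p))) p"
   by (rule msmooth_cutoff[where b = "wt i" and K = "K i" and U = "cU i", OF P(4) P(2) P(3) P(6)], assumption)
    (intro msmooth_inner vsmoothD[OF chart_at_max] vector_fieldD X Y)
  then show "msmooth (\<lambda>p. wt i p * (dd (cf i) p (X p) \<bullet> dd (cf i) p (Y p))) p" by simp
 qed
 \<comment> \<open>Summation over the action of \<open>J\<close> makes the metric invariant; two
   terms suffice because \<open>J\<close> squares to minus the identity, which leaves
   \<open>g0\<close> unchanged.\<close>
 define g where "g p u v = g0 p u v + g0 p (J p u) (J p v)" for p u v
 have "hermitian_metric A J g"
  unfolding hermitian_metric_def smooth_fun_iff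
 proof (intro conjI allI impI)
  fix p u v X Y
  show "linear (g p u)"
   unfolding g_def using linear_compose[OF lJ lin0] by (intro linear_compose_add lin0) (simp add: comp_def)
  show "g p u v = g p v u" by (simp add: g_def sym0[of p u] sym0[of p "J p u"])
  show "g p (J p u) (J p v) = g p u v"
  proof -
   have "g0 p (- u) (- v) = g0 p u v"
    by (simp add: linear_neg[OF lin0] sym0[of p "- u"] sym0[of p v])
   then show ?thesis by (simp add: g_def JJ)
  qed
  show "g p u u > 0" if u: "u \<noteq> 0"
  proof -
   have "J p u \<noteq> 0" using JJ[of p u] u by (metis linear_0 lJ neg_equal_0_iff_equal)
   then show ?thesis using pos0[OF u, of p] pos0[of "J p u" p] by (simp add: g_def)
  qed
  show "msmooth (\<lambda>p. g p (X p) (Y p)) p" if "vector_field A X" "vector_field A Y"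
   unfolding g_def by (intro msmooth_add sm0 almost_complex_vf[OF J] that)
 qed
 then show ?thesis by (rule that)
qed

lemma exists_chern_connection:
 assumes J: "integrable_complex A J" and g: "hermitian_metric A J g"
 obtains D where "chern_connection A J g D"
proof -
 note aJ = integrable_almost_complex[OF J]
 have lJ: "linear (J p)" for p using aJ by (simp add: almost_complex_def)
 have "\<exists>c. c \<in> holomorphic_charts A J \<and> p \<in> fst c" for p
 proof -
  have "p \<in> (\<Union>c\<in>holomorphic_charts A J. fst c)" using J by (simp add: integrable_complex_def)
  then show ?thesis by blast
 qed
 then obtain c where c: "\<And>i. c i \<in> holomorphic_charts A J" "\<And>i. i \<in> fst (c i)" by metis
 let ?U = "\<lambda>i. fst (c i)" and ?psi = "\<lambda>i. snd (c i)"
 have h: "(?U i, ?psi i) \<in> holomorphic_charts A J" for i using c by simp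
 let ?Gam = "\<lambda>i. chern_gamma g (?psi i)"
 obtain D where D: "connection A D" "\<forall>p. \<exists>I w. finite I \<and> (\<forall>i\<in>I. p \<in> ?U i) \<and> (\<Sum>i\<in>I. w i) = (1::real) \<and>
   (\<forall>u Y. D p u Y = (\<Sum>i\<in>I. w i *\<^sub>R local_conn (?psi i) (?Gam i) p u Y))"
  by (rule glue_connection[where U = ?U and psi = ?psi, OF holomorphic_chartD(1)[OF h] c(2) chern_gamma(4)[OF g h]])
 have "chern_connection A J g D"
  unfolding chern_connection_def
 proof (intro conjI D(1) allI impI)
  fix p u Y assume Y: "vector_field A Y"
  obtain I w where I: "\<forall>i\<in>I. p \<in> ?U i" "(\<Sum>i\<in>I. w i) = (1::real)"
   "\<And>u Y. D p u Y = (\<Sum>i\<in>I. w i *\<^sub>R local_conn (?psi i) (?Gam i) p u Y)" using spec[OF D(2), of p] by blast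
  note loc = local_chern_conn[OF aJ g h bspec[OF I(1)] Y]
  show "D p u (\<lambda>q. J q (Y q)) = J p (D p u Y)"
   unfolding I(3) linear_sum[OF lJ] linear_scale[OF lJ] by (rule sum.cong[OF refl]) (simp add: loc(1))
  show "(1/2) *\<^sub>R (D p u Y + J p (D p (J p u) Y)) = cauchy_riemann A J p u Y"
  proof -
   have "(\<Sum>i\<in>I. w i *\<^sub>R ((1/2) *\<^sub>R (local_conn (?psi i) (?Gam i) p u Y + J p (local_conn (?psi i) (?Gam i) p (J p u) Y))))
    = cauchy_riemann A J p u Y"
    by (rule sum_weights_eq[OF I(2)]) (rule loc(3))
   then show ?thesis
    unfolding I(3) linear_sum[OF lJ] linear_scale[OF lJ]
    by (simp add: scaleR_add_right sum.distrib scaleR_sum_right)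
  qed
 next
  fix p u Y Z assume Y: "vector_field A Y" and Z: "vector_field A Z"
  obtain I w where I: "\<forall>i\<in>I. p \<in> ?U i" "(\<Sum>i\<in>I. w i) = (1::real)"
   "\<And>u Y. D p u Y = (\<Sum>i\<in>I. w i *\<^sub>R local_conn (?psi i) (?Gam i) p u Y)" using spec[OF D(2), of p] by blast
  have l1: "linear (g p (Y p))" by (rule hermitian_metricD(1)[OF g])
  have l2: "linear (\<lambda>v. g p v (Z p))" unfolding hermitian_metricD(2)[OF g, of p _ "Z p"] by (rule hermitian_metricD(1)[OF g])
  have "(\<Sum>i\<in>I. w i *\<^sub>R (g p (local_conn (?psi i) (?Gam i) p u Y) (Z p) + g p (Y p) (local_conn (?psi i) (?Gam i) p u Z)))
   = dd (\<lambda>q. g q (Y q) (Z q)) p u"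
   by (rule sum_weights_eq[OF I(2)]) (rule local_chern_conn(2)[OF aJ g h bspec[OF I(1)] Y Z, symmetric])
  then show "dd (\<lambda>q. g q (Y q) (Z q)) p u = g p (D p u Y) (Z p) + g p (Y p) (D p u Z)"
   unfolding I(3) linear_sum[OF l1] linear_scale[OF l1] linear_sum[OF l2] linear_scale[OF l2]
   by (simp add: distrib_left sum.distrib)
 qed
 then show ?thesis by (rule that)
qed

end

context manifold
begin

lemma det_lift_nonzero:
 assumes c: "(U, psi) \<in> max_atlas A" "p \<in> U"
 shows "det (\<chi> k. lift psi p (axis k 1)) \<noteq> 0"
proof -
 have "(\<chi> k. lift psi p (axis k 1)) = transpose (matrix (lift psi p))"
  by (simp add: matrix_def transpose_def vec_eq_iff)
 moreover have "inj (lift psi p)" by (rule inj_on_inverseI[of _ "dd psi p"]) (rule lift(1)[OF c])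
 ultimately show ?thesis using det_nz_iff_inj[OF lift(3)[OF c]] by simp
qed

text \<open>The description of the first class ranges over all Hermitian metrics and all their Chern
  connections, so metric compatibility, complex linearity and the Cauchy--Riemann condition are
  translated into identities for the symbols of an arbitrary one.\<close>

lemma chern_christoffel:
 assumes J: "almost_complex A J" and g: "hermitian_metric A J g" and h: "(U, psi) \<in> holomorphic_charts A J"
  and D: "chern_connection A J g D" and r: "conn_rep U psi D W Gam" "q \<in> W"
 shows "dgram g psi q u y z = gram g psi q (Gam q u y) z + gram g psi q y (Gam q u z)"
  "Gam q u (std_complex y) = std_complex (Gam q u y)" "Gam q (std_complex u) y = std_complex (Gam q u y)"
proof -
 note c = conn_repD(1,2)[OF r] and hq = h conn_repD(2)[OF r]
 note G = gram_props[OF g hq] and J0 = holomorphic_chartD(2)[OF hq] and lin = dd_chart_linear[OF c]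
 note lS = linear_std_complex
 define Y where "Y = extend A q (lift psi q y)"
 define Z where "Z = extend A q (lift psi q z)"
 have Y: "vector_field A Y" "dd psi q (Y q) = y" and Z: "vector_field A Z" "dd psi q (Z q) = z"
  by (simp_all add: Y_def Z_def extend lift(1)[OF c])
 note DY = conn_repD(7)[OF r Y(1)] and DZ = conn_repD(7)[OF r Z(1)]
 note DJY = conn_repD(7)[OF r almost_complex_vf[OF J Y(1)]]
 have D1: "D q v (\<lambda>q. J q (Y q)) = J q (D q v Y)"
  and D2: "dd (\<lambda>q. g q (Y q) (Z q)) q v = g q (D q v Y) (Z q) + g q (Y q) (D q v Z)"
  and D3: "(1/2) *\<^sub>R (D q v Y + J q (D q (J q v) Y)) = cauchy_riemann A J q v Y" for v
  using D Y(1) Z(1) unfolding chern_connection_def by blast+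
 let ?u = "lift psi q u"
 show "dgram g psi q u y z = gram g psi q (Gam q u y) z + gram g psi q y (Gam q u z)"
  using D2[of ?u] by (simp add: dd_metric[OF g hq Y(1) Z(1)] metric_gram[OF c, of g] DY DZ Y(2) Z(2) lift(1)[OF c]
    linear_add[OF G(1)] linear_add[OF G(2)])
 have "dd psi q (D q ?u (\<lambda>q. J q (Y q))) = dd psi q (J q (D q ?u Y))" by (simp only: D1)
 then show "Gam q u (std_complex y) = std_complex (Gam q u y)"
  by (simp add: DJY DY J0 dd_J_field[OF hq Y(1)] Y(2) lift(1)[OF c] linear_add[OF lS])
 have "dd psi q ((1/2) *\<^sub>R (D q ?u Y + J q (D q (J q ?u) Y))) = dd psi q (cauchy_riemann A J q ?u Y)" by (simp only: D3)
 then have "Gam q u y + std_complex (Gam q (std_complex u) y) = 0"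
  by (simp add: cauchy_riemann_local[OF hq Y(1)] DY J0 Y(2) lift(1)[OF c] linear_add[OF lS] linear_add[OF lin] linear_scale[OF lin])
 then have "std_complex (Gam q u y + std_complex (Gam q (std_complex u) y)) = std_complex 0" by (simp only:)
 then show "Gam q (std_complex u) y = std_complex (Gam q u y)"
  by (simp add: linear_add[OF lS] linear_0[OF lS])
qed

text \<open>The derivative of the Gram matrix G is A G + G A^t with A the transposed Christoffel
  matrix, so the logarithmic derivative of its determinant is twice the trace of A. The rows
  \<open>R i\<close> stand for the first summand, the map \<open>T\<close> acting on every row for
  the second.\<close>

lemma dd_ln_det_gram:
 assumes J: "almost_complex A J" and g: "hermitian_metric A J g" and h: "(U, psi) \<in> holomorphic_charts A J"
  and D: "chern_connection A J g D" and r: "conn_rep U psi D W Gam" "q \<in> W"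
 shows "dd (\<lambda>q. ln \<bar>det (gram_matrix g psi q)\<bar>) q w = 2 * endo_trace (Gam q (dd psi q w))"
proof -
 note c = conn_repD(1,2)[OF r] and hq = h conn_repD(2)[OF r]
 note G = gram_props[OF g hq]
 let ?M = "gram_matrix g psi" and ?S = "Gam q (dd psi q w)"
 let ?e = "\<lambda>i. axis i (1::real) :: 'n model"
 have S: "linear ?S" by (rule conn_repD(5)[OF r])
 have S_exp: "?S (?e i) = (\<Sum>l\<in>UNIV. (?S (?e i) $ l) *\<^sub>R ?e l)" for i by (simp only: sum_axis)
 define b where "b i q = (\<chi> j. gram g psi q (?e i) (?e j))" for i q
 have Mb: "?M q = (\<chi> i. b i q)" for q by (simp add: gram_matrix_def b_def)
 have bs: "msmooth (b i) q" for i by (rule msmooth_vecI) (simp add: b_def G(5))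
 define T where "T x = (\<chi> j. \<Sum>l\<in>UNIV. ?S (?e j) $ l * x $ l)" for x :: "'n model"
 have T: "linear T"
  by (rule linearI) (simp_all add: T_def vec_eq_iff sum.distrib sum_distrib_left algebra_simps)
 define R where "R i = (\<Sum>l\<in>UNIV. ?S (?e i) $ l *\<^sub>R b l q)" for i
 have db: "dd (b i) q w = R i + T (b i q)" for i
 proof (rule vec_eq_iff[THEN iffD2], rule allI)
  fix j
  have "dd (b i) q w $ j = dd (\<lambda>q. gram g psi q (?e i) (?e j)) q w"
   using dd_vec_nth[OF bs, of i j w] by (simp add: b_def)
  also have "\<dots> = dgram g psi q (dd psi q w) (?e i) (?e j)" by (simp add: dgram_def lift(2)[OF c])
  also have "\<dots> = gram g psi q (?S (?e i)) (?e j) + gram g psi q (?e i) (?S (?e j))"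
   by (rule chern_christoffel(1)[OF J g h D r])
  also have "gram g psi q (?S (?e i)) (?e j) = R i $ j"
   by (subst S_exp) (simp add: R_def b_def linear_sum[OF G(2)] linear_scale[OF G(2)])
  also have "gram g psi q (?e i) (?S (?e j)) = T (b i q) $ j"
   by (subst S_exp) (simp add: T_def b_def linear_sum[OF G(1)] linear_scale[OF G(1)])
  finally show "dd (b i) q w $ j = (R i + T (b i q)) $ j" by simp
 qed
 let ?det = "\<lambda>b. det (\<chi> k. b k) :: real" and ?b = "\<lambda>i. b i q"
 have lin: "linear (\<lambda>v. ?det (?b(j := v)))" for j
  using alternating_det[where 'k = "'n \<times> bool"] unfolding alternating_def by blast
 have R: "?det (?b(i := R i)) = ?S (?e i) $ i * ?det ?b" for i
 proof -
  have row: "row l (\<chi> k. ?b k) = ?b l" for l by (simp add: row_def)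
  have "(\<chi> k. (?b(i := R i)) k) = (\<chi> k. if k = i then (\<Sum>l\<in>UNIV. ?S (?e i) $ l *s row l (\<chi> k. ?b k)) else row k (\<chi> k. ?b k))"
   unfolding row scalar_mult_eq_scaleR by (simp add: vec_eq_iff R_def)
  then show ?thesis using cramer_lemma_transpose[of i "?S (?e i)" "\<chi> k. ?b k"] by simp
 qed
 have "dd (\<lambda>q. det (?M q)) q w = (\<Sum>j\<in>UNIV. ?det (?b(j := R j + T (?b j))))"
  unfolding Mb dd_det[OF bs] db ..
 also have "\<dots> = (\<Sum>j\<in>UNIV. ?S (?e j) $ j * ?det ?b) + (\<Sum>j\<in>UNIV. T (?e j) $ j) * ?det ?b"
  unfolding linear_add[OF lin] sum.distrib R sum_det_upd[OF T] ..
 also have "(\<Sum>j\<in>UNIV. T (?e j) $ j) = endo_trace ?S"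
  unfolding endo_trace_sum by (rule sum.cong[OF refl]) (simp add: T_def axis_def if_distrib[of "\<lambda>x. _ * x"] cong: if_cong)
 also have "(\<Sum>j\<in>UNIV. ?S (?e j) $ j * ?det ?b) = endo_trace ?S * ?det ?b"
  by (simp add: endo_trace_sum sum_distrib_right)
 finally have "dd (\<lambda>q. det (?M q)) q w = 2 * endo_trace ?S * det (?M q)" by (simp add: Mb)
 moreover have "msmooth (\<lambda>q. det (?M q)) q" by (intro msmooth_det) (simp add: gram_matrix_def G(5))
 ultimately show ?thesis
  using dd_ln_abs(2)[of "\<lambda>q. det (?M q)" q w] det_gram_nonzero[OF g hq] by simp
qed

text \<open>Half the logarithm of the Gram determinant has the trace of the Christoffel endomorphism
  as its differential. Complex linearity in the direction makes \<open>trJ\<close> this differential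
  composed with I, and since the endomorphisms commute with I, the commutator has no contribution.
  The complex trace of the curvature has imaginary part - trace (J R) / 2, which multiplied by i * i
  / (2 pi) gives the factor 1 / (4 pi).\<close>

lemma chern_form_local:
 assumes J: "almost_complex A J" and g: "hermitian_metric A J g" and h: "(U, psi) \<in> holomorphic_charts A J" "p \<in> U"
  and D: "chern_connection A J g D"
 shows "chern_form A J D p u v = 1 / (4 * pi) * ddc J (\<lambda>q. ln \<bar>det (gram_matrix g psi q)\<bar> / 2) p u v"
proof -
 note c = holomorphic_chartD(1)[OF h(1)] h(2)
 have conn: "connection A D" using D by (simp add: chern_connection_def)
 obtain W Gam where r: "conn_rep U psi D W Gam" "p \<in> W" by (rule connection_local[OF conn c])
 define k where "k q = ln \<bar>det (gram_matrix g psi q)\<bar> / 2" for q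
 have ls: "msmooth (\<lambda>q. ln \<bar>det (gram_matrix g psi q)\<bar>) q" if "q \<in> U" for q
 proof (rule dd_ln_abs(1))
  show "msmooth (\<lambda>q. det (gram_matrix g psi q)) q"
   by (intro msmooth_det) (simp add: gram_matrix_def gram_props(5)[OF g h(1) that])
 qed (rule det_gram_nonzero[OF g h(1) that])
 have ks: "msmooth k q" if "q \<in> U" for q
  unfolding k_def by (intro msmooth_divide ls that msmooth_const) simp
 have dk: "dd k q w = endo_trace (Gam q (dd psi q w))" if q: "q \<in> W" for q w
 proof -
  have "dd k q w = dd (\<lambda>q. (1/2) *\<^sub>R ln \<bar>det (gram_matrix g psi q)\<bar>) q w" by (simp add: k_def[abs_def])
  also have "\<dots> = (1/2) *\<^sub>R dd (\<lambda>q. ln \<bar>det (gram_matrix g psi q)\<bar>) q w"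
   using dd_scaleR[OF msmooth_const ls[OF conn_repD(2)[OF r(1) q]], of "1/2" w] by simp
  finally show ?thesis by (simp add: dd_ln_det_gram[OF J g h(1) D r(1) q])
 qed
 note ch = chern_christoffel[OF J g h(1) D r(1)]
 have tr: "dd (trJ Gam (axis i 1)) p w = dd (jcoeff U psi k i) p w" for i w
 proof -
  have "\<forall>\<^sub>F q in nhds p. trJ Gam (axis i 1) q = jcoeff U psi k i q"
   using conn_repD(3)[OF r]
  proof eventually_elim
   case (elim q)
   note qU = conn_repD(2)[OF r(1) elim]
   have "trJ Gam (axis i 1) q = endo_trace (\<lambda>x. Gam q (std_complex (axis i 1)) x)" by (simp only: trJ_def ch(3)[OF elim])
   also have "\<dots> = dd k q (lift psi q (std_complex (axis i 1)))" by (simp add: dk[OF elim] lift(1)[OF c(1) qU])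
   also have "\<dots> = jcoeff U psi k i q"
    by (simp add: jcoeff_def dd_in_chart[OF c(1) qU ks[OF qU]] lift(1)[OF c(1) qU])
   finally show ?case .
  qed
  from dd_cong[OF this] show ?thesis by simp
 qed
 let ?S = "Gam p (dd psi p u)" and ?T = "Gam p (dd psi p v)" and ?C = "curvature A D p u v"
 have ST: "linear ?S" "linear ?T" by (rule conn_repD(5)[OF r])+
 have comm: "endo_trace (\<lambda>w. std_complex (?S (?T w) - ?T (?S w))) = 0"
 proof -
  have "endo_trace (\<lambda>w. std_complex (?T (?S w))) = endo_trace (\<lambda>w. ?S (std_complex (?T w)))"
   by (rule endo_trace_comm[OF linear_std_complex_compose[OF ST(2)] ST(1)])
  then show ?thesis by (simp add: linear_diff[OF linear_std_complex] endo_trace_diff ch(2)[OF r(2)])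
 qed
 have "endo_trace (J p \<circ> ?C) = dd (trJ Gam (dd psi p v)) p u - dd (trJ Gam (dd psi p u)) p v"
  unfolding trace_J_curvature(1)[OF h(1) conn r] comm by simp
 also have "\<dots> = ddc J k p u v"
  unfolding ddc_local[OF h ks[OF h(2)]] dd_trJ(2)[OF r, of "dd psi p v"] dd_trJ(2)[OF r, of "dd psi p u"] tr
  by (simp add: dd_chart_nth[OF c] sum_subtractf mult.commute)
 finally have trC: "endo_trace (J p \<circ> ?C) = ddc J k p u v" .
 have CJ: "?C (J p w) = J p (?C w)" for w
 proof (rule dd_chart_inj[OF c])
  have "dd (\<lambda>q. Gam q a (std_complex y)) p t = std_complex (dd (\<lambda>q. Gam q a y) p t)" for a y t
  proof -
   have "\<forall>\<^sub>F q in nhds p. Gam q a (std_complex y) = std_complex (Gam q a y)"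
    using conn_repD(3)[OF r] by eventually_elim (rule ch(2))
   from dd_cong[OF this] show ?thesis
    by (simp only: dd_linear_compose[OF linear_std_complex conn_repD(6)[OF r]])
  qed
  then show "dd psi p (?C (J p w)) = dd psi p (J p (?C w))"
   by (simp add: holomorphic_chartD(2)[OF h] curvature_local[OF conn r] ch(2)[OF r(2)]
     linear_add[OF linear_std_complex] linear_diff[OF linear_std_complex])
 qed
 have "complex_basis (J p) (\<lambda>i. lift psi p (axis (i, False) 1))"
 proof -
  have a: "std_complex (axis (i, False) 1) = (axis (i, True) 1 :: 'n model)" for i
   by (auto simp: std_complex_def vec_eq_iff axis_def)
  have "complex_frame (J p) (\<lambda>i. lift psi p (axis (i, False) 1)) = (\<lambda>k. lift psi p (axis k 1))"
   by (auto simp: complex_frame_def fun_eq_iff lift_J[OF h, symmetric] a)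
  then show ?thesis using det_lift_nonzero[OF c] by (simp add: complex_basis_def)
 qed
 then have ex: "\<exists>e. complex_basis (J p) e" by blast
 have "linear (J p)" "\<And>w. J p (J p w) = - w" using J by (auto simp: almost_complex_def)
 from complex_trace_eq[OF trace_J_curvature(2)[OF h(1) conn r] this CJ ex]
 have "complex_trace (J p) ?C = Complex (endo_trace ?C / 2) (- ddc J k p u v / 2)"
  using trC by (simp add: comp_def)
 then show ?thesis
  unfolding chern_form_def k_def[symmetric, abs_def] by (simp add: complex_eq_iff Re_divide Im_divide field_simps power2_eq_square)
qed

end

section \<open>Rearrangement of densities along coordinate lines\<close>

lemma has_derivative_integral_param:
 fixes F :: "'a::euclidean_space \<times> real => real"
 assumes F: "\<And>z. smooth_at F z"
 shows "((\<lambda>x. integral {0..1} (\<lambda>s. F (x, s))) has_derivative (\<lambda>v. integral {0..1} (\<lambda>s. fd F (x, s) (v, 0)))) (at x)"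
proof -
 define D where "D x s = Blinfun (\<lambda>v. fd F (x, s) (v, 0))" for x s
 have bl: "bounded_linear (\<lambda>v. fd F (x, s) (v, 0))" for x s
 proof -
  have "linear (\<lambda>v. fd F (x, s) (v, 0))"
   using linear_compose[OF _ smooth_at_linear[OF F[of "(x, s)"]], of "\<lambda>v. (v, 0)"]
   by (simp add: comp_def linear_iff)
  then show ?thesis by (rule linear_conv_bounded_linear[THEN iffD1])
 qed
 have D: "blinfun_apply (D x s) v = fd F (x, s) (v, 0)" for x s v
  by (simp add: D_def bounded_linear_Blinfun_apply[OF bl])
 have contF: "continuous_on S F" for S
  by (rule continuous_at_imp_continuous_on) (simp add: smooth_at_isCont F)
 have cont: "continuous_on S (\<lambda>z. fd F z v)" for S v
  by (rule continuous_at_imp_continuous_on) (simp add: smooth_at_isCont smooth_at_fd F)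
 have contD: "continuous_on S (\<lambda>(x, s). D x s)" for S
  by (rule continuous_on_blinfun_componentwise) (simp add: case_prod_unfold D cont)
 have "((\<lambda>x. integral (cbox 0 1) (\<lambda>s. F (x, s))) has_derivative blinfun_apply (integral (cbox 0 1) (D x))) (at x within UNIV)"
 proof (rule leibniz_rule)
  fix x s
  have "((\<lambda>y. F (y, s)) has_derivative (\<lambda>v. fd F (x, s) (v, 0))) (at x)"
   by (rule has_derivative_compose[OF _ smooth_at_has_derivative[OF F]]) (auto intro!: derivative_eq_intros)
  then show "((\<lambda>y. F (y, s)) has_derivative blinfun_apply (D x s)) (at x within UNIV)" by (simp add: D[abs_def])
 next
  fix x show "(\<lambda>s. F (x, s)) integrable_on cbox 0 1"
   by (rule integrable_continuous, rule continuous_on_compose2[OF contF[of UNIV]]) (auto intro!: continuous_intros)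
 qed (auto intro: contD)
 moreover have "D x integrable_on {0..1}" for x
  unfolding cbox_interval[symmetric]
  by (rule integrable_continuous, rule continuous_on_compose2[OF contD[of UNIV], of _ "\<lambda>s. (x, s)", simplified])
   (auto intro!: continuous_intros)
 then have "blinfun_apply (integral {0..1} (D x)) = (\<lambda>v. integral {0..1} (\<lambda>s. fd F (x, s) (v, 0)))"
  using integral_linear[OF _ blinfun.bounded_linear_left, of "D x" "{0..1}"] by (simp add: comp_def D fun_eq_iff)
 ultimately show ?thesis by (simp only: cbox_interval)
qed

lemma Ck_on_integral_param:
 fixes F :: "'a::euclidean_space \<times> real => real"
 assumes F: "\<And>z. smooth_at F z"
 shows "Ck_on k UNIV (\<lambda>x. integral {0..1} (\<lambda>s. F (x, s)))"
 using F
proof (induction k arbitrary: F)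
 case 0
 have "continuous_on UNIV (\<lambda>x. integral {0..1} (\<lambda>s. F (x, s)))"
  using has_derivative_continuous[OF has_derivative_integral_param[OF 0]] by (simp add: continuous_on_eq_continuous_at)
 then show ?case by (simp add: Ck_on.simps)
next
 case (Suc k)
 show ?case
  by (rule Ck_on_SucI[OF has_derivative_integral_param[OF Suc.prems]]) (rule Suc.IH[OF smooth_at_fd[OF Suc.prems]])
qed

text \<open>For a unit vector \<open>e\<close>, the integral of \<open>F\<close> along the line
  through \<open>x\<close> in direction \<open>e\<close>, from the hyperplane orthogonal to
  \<open>e\<close> up to \<open>x\<close>. The substitution to the fixed interval
  \<open>{0..1}\<close> moves the variable endpoint into the integrand, so that differentiation
  under the integral applies.\<close>

definition antideriv :: "'a::euclidean_space => ('a => real) => 'a => real" where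
 "antideriv e F x = (x \<bullet> e) * integral {0..1} (\<lambda>s. F (x + ((s - 1) * (x \<bullet> e)) *\<^sub>R e))"

lemma antideriv:
 fixes F :: "'a::euclidean_space => real"
 assumes e: "e \<bullet> e = 1" and F: "\<And>x. smooth_at F x"
 shows "smooth_at (antideriv e F) x" "fd (antideriv e F) x e = F x"
proof -
 define H where "H z = F (fst z + ((snd z - 1) * (fst z \<bullet> e)) *\<^sub>R e)" for z
 have H: "smooth_at H z" for z
  unfolding H_def by (rule smooth_at_compose[OF F]) (intro smooth_intros)
 let ?I = "\<lambda>x. integral {0..1} (\<lambda>s. H (x, s))"
 have anti: "antideriv e F = (\<lambda>x. (x \<bullet> e) * ?I x)" by (simp add: antideriv_def[abs_def] H_def)
 have I: "smooth_at ?I x" for x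
  unfolding smooth_at_iff_Ck using Ck_on_integral_param[OF H] by (intro exI[of _ UNIV]) simp
 show "smooth_at (antideriv e F) x" unfolding anti by (intro smooth_intros I)
 define c where "c = x \<bullet> e"
 let ?y = "\<lambda>s. x + ((s - 1) * c) *\<^sub>R e"
 have line: "((\<lambda>s. F (?y s)) has_real_derivative c * fd F (?y s) e) (at s)" for s
 proof -
  have 1: "((\<lambda>s. ?y s) has_derivative (\<lambda>h. (h * c) *\<^sub>R e)) (at s)" by (auto intro!: derivative_eq_intros)
  have "((\<lambda>s. F (?y s)) has_derivative (\<lambda>h. fd F (?y s) ((h * c) *\<^sub>R e))) (at s)"
   by (rule has_derivative_compose[OF 1 smooth_at_has_derivative[OF F]])
  moreover have "(\<lambda>h. fd F (?y s) ((h * c) *\<^sub>R e)) = (*) (c * fd F (?y s) e)"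
   by (simp add: fun_eq_iff fd_scale_right[OF F])
  ultimately show ?thesis by (simp only: has_field_derivative_def)
 qed
 have fdH: "fd H (x, s) (e, 0) = s * fd F (?y s) e" for s
 proof -
  have "smooth_at (\<lambda>z. fst z + ((snd z - 1) * (fst z \<bullet> e)) *\<^sub>R e) (x, s)" by (intro smooth_intros)
  then have "fd H (x, s) (e, 0) = fd F (?y s) (fd (\<lambda>z. fst z + ((snd z - 1) * (fst z \<bullet> e)) *\<^sub>R e) (x, s) (e, 0))"
   unfolding H_def using fd_compose[OF F, of _ "(x, s)" "(e, 0)"] by (simp add: c_def)
  also have "fd (\<lambda>z. fst z + ((snd z - 1) * (fst z \<bullet> e)) *\<^sub>R e) (x, s) = (\<lambda>h. fst h + ((s - 1) * (fst h \<bullet> e) + snd h * c) *\<^sub>R e)"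
   by (rule fd_eqI) (auto intro!: derivative_eq_intros simp: c_def)
  also have "fd F (?y s) (fst (e, 0::real) + ((s - 1) * (fst (e, 0::real) \<bullet> e) + snd (e, 0::real) * c) *\<^sub>R e) = s * fd F (?y s) e"
   using fd_scale_right[OF F, of "?y s" s e] e by (simp add: algebra_simps)
  finally show ?thesis .
 qed
 \<comment> \<open>The integrand is the derivative of s F(y(s)), so its integral is
   \<open>F x\<close>. Its two summands are those that the product rule gives for the derivative of
   the antiderivative.\<close>
 have "((\<lambda>s. F (?y s) + c * (s * fd F (?y s) e)) has_integral (1 * F (?y 1) - 0 * F (?y 0))) {0..1}"
 proof (rule fundamental_theorem_of_calculus)
  fix s :: real
  have "((\<lambda>s. s * F (?y s)) has_real_derivative F (?y s) + c * (s * fd F (?y s) e)) (at s)"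
   by (rule derivative_eq_intros line refl | simp)+
  then show "((\<lambda>s. s * F (?y s)) has_vector_derivative F (?y s) + c * (s * fd F (?y s) e)) (at s within {0..1})"
   by (rule has_real_derivative_iff_has_vector_derivative[THEN iffD1, OF has_field_derivative_at_within])
 qed simp
 then have int: "((\<lambda>s. F (?y s) + c * (s * fd F (?y s) e)) has_integral F x) {0..1}" by simp
 have cont: "continuous_on {0..1} f" if "\<And>s. isCont f s" for f :: "real => real"
  using that by (simp add: continuous_at_imp_continuous_on)
 have cy: "isCont ?y s" for s by (intro continuous_intros)
 have c1: "isCont (\<lambda>s. F (?y s)) s" for s using DERIV_isCont[OF line] .
 have c2: "isCont (\<lambda>s. fd F (?y s) e) s" for s
  using isCont_o2[OF cy smooth_at_isCont[OF smooth_at_fd[OF F]]] .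
 have i1: "(\<lambda>s. F (?y s)) integrable_on {0..1}" by (intro integrable_continuous_interval cont c1)
 have i2: "(\<lambda>s. s * fd F (?y s) e) integrable_on {0..1}" by (intro integrable_continuous_interval cont continuous_intros c2)
 have fdl: "fd (\<lambda>x. x \<bullet> e) x = (\<lambda>v. v \<bullet> e)"
  by (rule fd_linear) (simp add: linear_iff inner_simps)
 have sl: "smooth_at (\<lambda>x. x \<bullet> e) x" by (intro smooth_intros)
 have 1: "fd (\<lambda>x. (x \<bullet> e) * ?I x) x e = (x \<bullet> e) * fd ?I x e + fd (\<lambda>x. x \<bullet> e) x e * ?I x"
  by (rule fd_bilinear[OF bounded_bilinear_mult sl I])
 have 2: "fd ?I x e = integral {0..1} (\<lambda>s. s * fd F (?y s) e)"
  unfolding fd_eqI[OF has_derivative_integral_param[OF H]] fdH ..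
 have 3: "?I x = integral {0..1} (\<lambda>s. F (?y s))" by (simp add: H_def c_def)
 have 4: "integral {0..1} (\<lambda>s. F (?y s)) + c * integral {0..1} (\<lambda>s. s * fd F (?y s) e) = F x"
  using integral_add[OF i1 integrable_on_cmult_left[OF i2, of c]] integral_unique[OF int] by simp
 show "fd (antideriv e F) x e = F x"
  unfolding anti 1 2 fdl e 3 using 4 by (simp add: c_def)
qed

text \<open>The map replaces the coordinate along \<open>e\<close> by \<open>f\<close>. Its inverse
  is continuous by invariance of domain; the derivative of the inverse is an explicit smooth field
  of linear maps evaluated at the inverse itself, which raises the order of differentiability by one
  in each induction step.\<close>

lemma smooth_at_shear_inverse:
 fixes f :: "'a::euclidean_space => real"
 assumes e: "e \<bullet> e = 1" and f: "\<And>x. smooth_at f x" and pos: "\<And>x. fd f x e > 0"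
  and bij: "bij (\<lambda>x. x + (f x - x \<bullet> e) *\<^sub>R e)"
 shows "smooth_at (inv (\<lambda>x. x + (f x - x \<bullet> e) *\<^sub>R e)) y"
proof -
 define P where "P = (\<lambda>x. x + (f x - x \<bullet> e) *\<^sub>R e)"
 note bij = bij[folded P_def]
 define g where "g = inv P"
 have g: "P (g y) = y" "g (P x) = x" for x y
  using surj_f_inv_f[OF bij_is_surj[OF bij]] inv_f_f[OF bij_is_inj[OF bij]] by (simp_all add: g_def)
 have sP: "smooth_at P x" for x unfolding P_def by (intro smooth_intros f)
 have contg: "isCont g y" for y
 proof -
  have "continuous_on UNIV P" by (simp add: continuous_at_imp_continuous_on smooth_at_isCont[OF sP])
  then obtain g' where "homeomorphism UNIV (range P) P g'"
   by (rule invariance_of_domain_homeomorphism[OF open_UNIV _ order_refl bij_is_inj[OF bij]])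
  then have "continuous_on UNIV g'" "\<And>x. g' (P x) = x" using bij_is_surj[OF bij] by (simp_all add: homeomorphism_def)
  moreover have "g' x = g x" for x using g(1)[of x] calculation(2)[of "g x"] by simp
  then have "g' = g" by blast
  ultimately show ?thesis by (simp add: continuous_on_eq_continuous_at)
 qed
 \<comment> \<open>Inverts the differential of the shear by hand: the part orthogonal to
   \<open>e\<close> is kept, and the component along \<open>e\<close> is recovered by division by
   the positive derivative of \<open>f\<close> along \<open>e\<close>.\<close>
 define L where "L x v = v + ((v \<bullet> e - fd f x (v - (v \<bullet> e) *\<^sub>R e)) / fd f x e - v \<bullet> e) *\<^sub>R e" for x v
 have fdP: "fd P x = (\<lambda>v. v + (fd f x v - v \<bullet> e) *\<^sub>R e)" for x
  unfolding P_def by (rule fd_eqI) (auto intro!: derivative_eq_intros smooth_at_has_derivative[OF f])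
 note lin = smooth_at_linear[OF f]
 have linL: "linear (L x)" for x
  unfolding L_def
  by (rule linearI) (simp_all add: linear_diff[OF lin] linear_add[OF lin] linear_scale[OF lin] inner_simps algebra_simps add_divide_distrib diff_divide_distrib)
 have LP: "L x \<circ> fd P x = id" for x
 proof
  fix v
  define v' where "v' = fd P x v"
  have 1: "v' \<bullet> e = fd f x v" using e by (simp add: v'_def fdP inner_simps)
  have 2: "v' - fd f x v *\<^sub>R e = v - (v \<bullet> e) *\<^sub>R e" by (simp add: v'_def fdP algebra_simps)
  have 3: "fd f x (v - (v \<bullet> e) *\<^sub>R e) = fd f x v - (v \<bullet> e) * fd f x e" by (simp add: linear_diff[OF lin] linear_scale[OF lin])
  have "L x v' = v' + (v \<bullet> e - fd f x v) *\<^sub>R e"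
   unfolding L_def 1 2 3 using pos[of x] by simp
  also have "\<dots> = v" by (simp add: v'_def fdP algebra_simps)
  finally show "(L x \<circ> fd P x) v = id v" by (simp add: v'_def)
 qed
 have sL: "smooth_at (\<lambda>x. L x v) x" for x v
  unfolding L_def using pos[of x] by (intro smooth_intros smooth_at_fd f) simp
 have der: "(g has_derivative L (g y)) (at y)" for y
  by (rule has_derivative_inverse_basic[where T = UNIV, OF smooth_at_has_derivative[OF sP] _ LP contg])
   (simp_all add: g linL linear_conv_bounded_linear[symmetric])
 have "Ck_on k UNIV g" for k
 proof (induction k)
  case 0
  show ?case by (simp add: Ck_on.simps continuous_on_eq_continuous_at contg)
 next
  case (Suc k)
  have "Ck_on k UNIV (\<lambda>x. L x v)" for v
  proof -
   have "smooth_on UNIV (\<lambda>x. L x v)" by (simp add: smooth_on_iff_smooth_at sL)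
   then show ?thesis by (simp add: smooth_on_def)
  qed
  then show ?case by (intro Ck_on_SucI[OF der] Ck_on_compose[OF _ Suc]) auto
 qed
 then show ?thesis unfolding smooth_at_iff_Ck g_def P_def by (intro exI[of _ UNIV]) simp
qed

text \<open>The rearrangement of the measure \<open>g dx\<close> into \<open>(g + \<partial>\<^sub>e w) dx\<close> along the lines parallel to the
 coordinate direction \<open>e\<close>: \<open>Phi t\<close> matches the primitives of the two densities, \<open>antideriv e g\<close> and
 \<open>antideriv e g + w\<close>, on each line.\<close>

lemma line_rearrangement:
 fixes g w :: "real ^ 'k::finite => real" and k :: 'k
 assumes g: "\<And>x. smooth_at g x" and w: "\<And>x. smooth_at w x" and dlt: "dlt > 0" "\<And>x. g x \<ge> dlt"
  and B: "\<And>x. \<bar>w x\<bar> \<le> B" and pos: "\<And>x. g x + fd w x (axis k 1) > 0"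
 obtains Phi Psi :: "real => real ^ 'k => real ^ 'k" where
  "\<And>z. smooth_at (\<lambda>(t, x). Phi t x) z" "\<And>t x. smooth_at (Psi t) x" "\<And>t x. Phi t (Psi t x) = x" "\<And>t x. Psi t (Phi t x) = x"
  "\<And>x. Phi 0 x = x" "\<And>t x. w x = 0 ==> Phi t x = x"
  "\<And>x. det (matrix (fd (Phi 1) x)) * (g (Phi 1 x) + fd w (Phi 1 x) (axis k 1)) = g x"
proof -
 define e where "e = (axis k 1 :: real ^ 'k)"
 have ee: "e \<bullet> e = 1" by (simp add: e_def inner_axis_axis)
 have xe: "x \<bullet> e = x $ k" for x by (simp add: e_def inner_axis)
 define G where "G = antideriv e g"
 note G = antideriv[OF ee g, folded G_def]
 \<comment> \<open>\<open>smooth_step\<close> confines the weight of \<open>w\<close> to the unit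
   interval, so the interpolated density is positive for every real \<open>t\<close>, and all real
   times are in the domain of an isotopy.\<close>
 define f where "f t x = G x + smooth_step t * w x" for t x
 define P where "P t = (\<lambda>x. x + (f t x - x \<bullet> e) *\<^sub>R e)" for t
 have sf: "smooth_at (f t) x" for t x unfolding f_def by (intro smooth_intros G w)
 have fde: "fd (f t) x e = g x + smooth_step t * fd w x e" for t x
  unfolding f_def using fd_add[OF G(1), of "\<lambda>x. smooth_step t * w x" x e]
   fd_bilinear[OF bounded_bilinear_mult smooth_at_const w, of "smooth_step t" x e] w
  by (simp add: smooth_intros G(2))
 have fpos: "fd (f t) x e > 0" for t x
 proof -
  have "g x + s * fd w x e > 0" if s: "0 \<le> s" "s \<le> 1" for s
  proof -
   have "g x + s * fd w x e = (1 - s) * g x + s * (g x + fd w x e)" by (simp add: algebra_simps)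
   moreover have "(1 - s) * g x \<ge> 0" "s * (g x + fd w x e) \<ge> 0"
    using s dlt(1) dlt(2)[of x] pos[of x] by (simp_all add: e_def)
   moreover have "(1 - s) * g x > 0 \<or> s * (g x + fd w x e) > 0"
    using s dlt(1) dlt(2)[of x] pos[of x] by (cases "s = 1") (simp_all add: e_def)
   ultimately show ?thesis by linarith
  qed
  then show ?thesis unfolding fde using smooth_step_props(1,2) by blast
 qed
 have mono: "f t x < f t (x + r *\<^sub>R e)" if r: "r > 0" for t x r
 proof -
  obtain s where "f t (x + r *\<^sub>R e) - f t x = r * fd (f t) (x + s *\<^sub>R e) e"
   by (rule fd_mean_value[OF r, of "f t" x e]) (rule sf)
  moreover have "r * fd (f t) (x + s *\<^sub>R e) e > 0" using r fpos by simp
  ultimately show ?thesis by linarith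
 qed
 have Gmono: "G x + r * dlt \<le> G (x + r *\<^sub>R e)" if r: "r > 0" for x r
 proof -
  obtain s where "G (x + r *\<^sub>R e) - G x = r * fd G (x + s *\<^sub>R e) e"
   by (rule fd_mean_value[OF r, of G x e]) (rule G(1))
  moreover have "r * fd G (x + s *\<^sub>R e) e \<ge> r * dlt" using r dlt(2) by (simp add: G(2))
  ultimately show ?thesis by linarith
 qed
 have wb: "\<bar>smooth_step t * w x\<bar> \<le> B" for t x
  using mult_mono[OF smooth_step_props(2)[of t] B[of x]] smooth_step_props(1)[of t] by (simp add: abs_mult)
 have inj: "inj (P t)" for t
 proof (rule injI)
  fix x y assume eq: "P t x = P t y"
  have "P t z \<bullet> e = f t z" for z using ee by (simp add: P_def inner_simps)
  then have f: "f t x = f t y" using eq by metis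
  define r where "r = y \<bullet> e - x \<bullet> e"
  have y: "y = x + r *\<^sub>R e" and x: "x = y + (- r) *\<^sub>R e" using eq f by (simp_all add: P_def r_def algebra_simps)
  have "\<not> r > 0" using mono[of r t x, folded y] f by auto
  moreover have "\<not> - r > 0" using mono[of "- r" t y, folded x] f by auto
  ultimately show "x = y" using y by simp
 qed
 have "surj (P t)" for t
  unfolding surj_def
 proof
  fix y
  \<comment> \<open>Along the line \<open>G\<close> grows with slope at least \<open>dlt\<close>
    while the perturbation is bounded by \<open>B\<close>, so the value \<open>y \<bullet> e\<close>
    is attained within distance \<open>R\<close>.\<close>
  define R where "R = (\<bar>y \<bullet> e\<bar> + \<bar>G y\<bar> + \<bar>B\<bar> + 1) / dlt"
  have R: "R > 0" "R * dlt = \<bar>y \<bullet> e\<bar> + \<bar>G y\<bar> + \<bar>B\<bar> + 1" using dlt(1) by (simp_all add: R_def)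
  have "\<exists>r. - R \<le> r \<and> r \<le> R \<and> f t (y + r *\<^sub>R e) = y \<bullet> e"
  proof (rule IVT')
   show "y \<bullet> e \<le> f t (y + R *\<^sub>R e)"
    using Gmono[OF R(1), of y] wb[of t "y + R *\<^sub>R e"] R(2) by (simp add: f_def)
   show "f t (y + (- R) *\<^sub>R e) \<le> y \<bullet> e"
    using Gmono[OF R(1), of "y + (- R) *\<^sub>R e"] wb[of t "y + (- R) *\<^sub>R e"] R(2) by (simp add: f_def)
   show "continuous_on {- R..R} (\<lambda>r. f t (y + r *\<^sub>R e))"
    by (rule continuous_at_imp_continuous_on, rule ballI, rule isCont_o2[OF _ smooth_at_isCont[OF sf]])
     (intro continuous_intros)
  qed (use R in simp)
  then obtain r where "f t (y + r *\<^sub>R e) = y \<bullet> e" by blast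
  then have "P t (y + r *\<^sub>R e) = y" using ee by (simp add: P_def inner_simps algebra_simps)
  then show "\<exists>x. y = P t x" by metis
 qed
 then have bij: "bij (P t)" for t using inj by (simp add: bij_def)
 define Q where "Q t = inv (P t)" for t
 have Q: "P t (Q t x) = x" "Q t (P t x) = x" for t x
  using surj_f_inv_f[OF bij_is_surj[OF bij]] inv_f_f[OF inj] by (simp_all add: Q_def)
 have sw: "smooth_at (\<lambda>z. f (fst z) (snd z)) z" for z
  unfolding f_def by (intro smooth_intros smooth_at_compose[OF G(1)] smooth_at_compose[OF w] smooth_at_compose[OF smooth_at_step])
 \<comment> \<open>Time is treated as an additional coordinate; smoothness of the inverse jointly in
   time and space is then another instance of \<open>smooth_at_shear_inverse\<close>.\<close>
 let ?P = "\<lambda>z. z + (f (fst z) (snd z) - z \<bullet> (0, e)) *\<^sub>R (0, e)"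
 have bij': "bij ?P"
  by (rule o_bij[of "\<lambda>z. (fst z, Q (fst z) (snd z))"]) (auto simp: fun_eq_iff Q[unfolded P_def])
 have "inv ?P = (\<lambda>z. (fst z, Q (fst z) (snd z)))"
  by (rule inv_unique_comp) (auto simp: fun_eq_iff Q[unfolded P_def])
 moreover have "smooth_at (inv ?P) z" for z
 proof (rule smooth_at_shear_inverse[OF _ sw _ bij'])
  fix z :: "real \<times> (real ^ 'k)"
  obtain t x where z: "z = (t, x)" by (cases z)
  have "fd (\<lambda>y. f (fst (t, y)) (snd (t, y))) x e = fd (\<lambda>z. f (fst z) (snd z)) (t, x) (fd (\<lambda>y. (t, y)) x e)"
   by (rule fd_compose[OF sw]) (intro smooth_intros)
  also have "fd (\<lambda>y. (t, y)) x = (\<lambda>v. (0, v))" by (rule fd_eqI) (auto intro!: derivative_eq_intros)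
  finally show "fd (\<lambda>z. f (fst z) (snd z)) z (0, e) > 0" using fpos[of t x] by (simp add: z)
 qed (simp add: ee)
 ultimately have sQ': "smooth_at (\<lambda>z. (fst z, Q (fst z) (snd z))) z" for z by simp
 have sQ: "smooth_at (\<lambda>z. Q (fst z) (snd z)) z" for z using smooth_at_snd[OF sQ'] by simp
 have sP: "smooth_at (P t) x" for t x unfolding P_def by (intro smooth_intros sf)
 define Phi where "Phi t x = Q t (P 0 x)" for t x
 define Psi where "Psi t x = Q 0 (P t x)" for t x
 have PPhi: "P t (Phi t x) = P 0 x" for t x by (simp add: Phi_def Q)
 have sPhi: "smooth_at (\<lambda>(t, x). Phi t x) z" for z
 proof -
  have "smooth_at (\<lambda>z. (fst z, P 0 (snd z))) z" by (intro smooth_intros smooth_at_compose[OF sP])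
  from smooth_at_compose[OF sQ this] show ?thesis by (simp add: Phi_def case_prod_unfold)
 qed
 have sPhi1: "smooth_at (Phi t) x" for t x
  using smooth_at_compose[OF sPhi, of "\<lambda>x. (t, x)" x] by (simp add: smooth_intros)
 have fdP: "fd (P t) x v = v + (fd (f t) x v - v \<bullet> e) *\<^sub>R e" for t x v
 proof -
  have "fd (P t) x = (\<lambda>v. v + (fd (f t) x v - v \<bullet> e) *\<^sub>R e)"
   unfolding P_def by (rule fd_eqI) (auto intro!: derivative_eq_intros smooth_at_has_derivative[OF sf])
  then show ?thesis by simp
 qed
 have detP: "det (matrix (fd (P t) x)) = g x + smooth_step t * fd w x e" for t x
 proof -
  have "matrix (fd (P t) x) = (\<chi> i. ((\<lambda>i. axis i 1)(k := (\<chi> j. fd (f t) x (axis j 1)))) i)"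
   by (auto simp: matrix_def vec_eq_iff fdP xe) (auto simp: e_def axis_def)
  then have "det (matrix (fd (P t) x)) = fd (f t) x (axis k 1)" by (simp only: det_axis_upd) simp
  then show ?thesis using fde by (simp add: e_def)
 qed
 show thesis
 proof (rule that[of Phi Psi])
  fix t :: real and x
  show "smooth_at (Psi t) x"
  proof -
   have "smooth_at (\<lambda>x. (0 :: real, P t x)) x" by (intro smooth_intros sP)
   from smooth_at_compose[OF sQ this] show ?thesis by (simp add: Psi_def[abs_def])
  qed
  show "Phi t (Psi t x) = x" "Psi t (Phi t x) = x" "Phi 0 x = x" by (simp_all add: Phi_def Psi_def Q)
  show "Phi t x = x" if "w x = 0"
  proof -
   have "P 0 x = P t x" by (simp add: P_def f_def that)
   then show ?thesis by (simp add: Phi_def Q)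
  qed
  have "det (matrix (fd (Phi 1) x)) * det (matrix (fd (P 1) (Phi 1 x))) = det (matrix (fd (P 0) x))"
  proof -
   have "fd (P 1) (Phi 1 x) \<circ> fd (Phi 1) x = fd (P 0) x"
    using fd_compose[OF sP sPhi1, of 1 1 x] by (simp add: fun_eq_iff PPhi)
   then have "matrix (fd (P 1) (Phi 1 x)) ** matrix (fd (Phi 1) x) = matrix (fd (P 0) x)"
    using matrix_compose[OF smooth_at_linear[OF sPhi1] smooth_at_linear[OF sP]] by metis
   then show ?thesis by (metis det_mul mult.commute)
  qed
  then show "det (matrix (fd (Phi 1) x)) * (g (Phi 1 x) + fd w (Phi 1 x) (axis k 1)) = g x"
   by (simp add: detP e_def smooth_step_props(3,4))
 qed (rule sPhi)
qed

section \<open>Diffeomorphisms and isotopies\<close>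

context manifold
begin

definition mmap :: "('m => 'm) => 'm => bool" where
 "mmap F p \<longleftrightarrow> isCont F p \<and> msmooth (\<lambda>q. cf (F p) (F q)) p"

lemma mmap_isCont: "mmap F p ==> isCont F p" by (simp add: mmap_def)

lemma eventually_mmap:
 "mmap F p ==> \<forall>\<^sub>F q in nhds (F p). P q ==> \<forall>\<^sub>F q in nhds p. P (F q)"
 using mmap_isCont by (auto simp: isCont_iff_filterlim_nhds filterlim_iff)

lemma mmap_msmooth:
 assumes F: "mmap F p" and f: "msmooth f (F p)"
 shows "msmooth (\<lambda>q. f (F q)) p" "dd (\<lambda>q. f (F q)) p v = dd f (F p) (tmap A F p v)"
proof -
 let ?f = "\<lambda>x. f (ci (F p) x)"
 have s: "msmooth (\<lambda>q. cf (F p) (F q)) p" using F by (simp add: mmap_def)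
 have f': "smooth_at ?f (cf (F p) (F p))" using f by (simp add: msmooth_def)
 have ev: "\<forall>\<^sub>F q in nhds p. ?f (cf (F p) (F q)) = f (F q)"
  using eventually_mmap[OF F eventually_in_chart(1)[OF chart_at_is_chart chart_at_in(2)]]
  by eventually_elim (simp add: is_chartD(6)[OF chart_at_is_chart])
 show "msmooth (\<lambda>q. f (F q)) p"
  by (rule msmooth_cong[OF msmooth_compose[OF f' s] ev])
 show "dd (\<lambda>q. f (F q)) p v = dd f (F p) (tmap A F p v)"
  unfolding dd_cong[OF ev, symmetric] dd_compose[of ?f "\<lambda>q. cf (F p) (F q)", OF f' s]
  by (simp add: dd_def tmap_def comp_def)
qed

lemma mmap_iff:
 assumes c: "(V, psi) \<in> max_atlas A" "F p \<in> V"
 shows "mmap F p \<longleftrightarrow> isCont F p \<and> msmooth (\<lambda>q. psi (F q)) p"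
proof
 show "isCont F p \<and> msmooth (\<lambda>q. psi (F q)) p" if "mmap F p"
  using mmap_msmooth(1)[OF that msmooth_chart[OF c]] mmap_isCont[OF that] by blast
next
 assume a: "isCont F p \<and> msmooth (\<lambda>q. psi (F q)) p"
 then have "filterlim F (nhds (F p)) (nhds p)" by (simp add: isCont_iff_filterlim_nhds)
 then have "\<forall>\<^sub>F q in nhds p. F q \<in> V" using ev_chart(1)[OF c(1) c(2)]
  by (auto simp: filterlim_iff)
 then have ev: "\<forall>\<^sub>F q in nhds p. cf (F p) (inv_into V psi (psi (F q))) = cf (F p) (F q)"
  by eventually_elim (simp add: max_chartD(6)[OF c(1)])
 have "smooth_at (\<lambda>x. cf (F p) (inv_into V psi x)) (psi (F p))"
  using max_transition[OF c(1) chart_at_max c(2) chart_at_in(2)] by (simp add: comp_def)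
 from msmooth_cong[OF msmooth_compose[of _ "\<lambda>q. psi (F q)", OF this conjunct2[OF a]] ev] a
 show "mmap F p" by (simp add: mmap_def)
qed

lemma tmap_chart:
 assumes "(V, psi) \<in> max_atlas A" "F p \<in> V" "mmap F p"
 shows "dd psi (F p) (tmap A F p v) = dd (\<lambda>q. psi (F q)) p v"
 using mmap_msmooth(2)[OF assms(3) msmooth_chart[OF assms(1,2)]] by simp

lemma linear_tmap: "mmap F p ==> linear (tmap A F p)"
 unfolding tmap_def comp_def mmap_def by (blast intro: dd_linear)

lemma smooth_map_iff: "smooth_map A F \<longleftrightarrow> (\<forall>p. mmap F p)"
proof
 assume F: "smooth_map A F"
 show "\<forall>p. mmap F p"
 proof
  fix p
  have "smooth_fun_on A (F -` cU (F p)) (cf (F p) \<circ> F)"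
   using F chart_at_in(1)[of "F p"] unfolding smooth_map_def by fastforce
  then have "msmooth (cf (F p) \<circ> F) p" using chart_at_in(2)[of "F p"] by (simp add: smooth_fun_on_iff)
  then show "mmap F p" using F by (simp add: mmap_def smooth_map_def continuous_on_eq_continuous_at comp_def)
 qed
next
 assume F: "\<forall>p. mmap F p"
 then have cont: "continuous_on UNIV F" by (simp add: continuous_on_eq_continuous_at mmap_isCont)
 have "smooth_fun_on A (F -` V) (psi \<circ> F)" if c: "(V, psi) \<in> A" for V psi
  unfolding smooth_fun_on_iff comp_def
 proof (intro conjI ballI)
  note c' = in_atlas_max[OF c]
  show "open (F -` V)" using open_vimage[OF max_chartD(1)[OF c'] cont] .
  show "msmooth (\<lambda>q. psi (F q)) p" if "p \<in> F -` V" for p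
   using mmap_iff[OF c', of F p] that F by auto
 qed
 with cont show "smooth_map A F" by (auto simp: smooth_map_def)
qed

lemma mmap_compose:
 assumes F: "mmap F p" and G: "mmap G (F p)"
 shows "mmap (\<lambda>q. G (F q)) p" "tmap A (\<lambda>q. G (F q)) p v = tmap A G (F p) (tmap A F p v)"
proof -
 have s: "msmooth (\<lambda>q. cf (G (F p)) (G q)) (F p)" using G by (simp add: mmap_def)
 show "mmap (\<lambda>q. G (F q)) p"
  using mmap_msmooth(1)[OF F s] isCont_o2[OF mmap_isCont[OF F] mmap_isCont[OF G]] by (simp add: mmap_def)
 show "tmap A (\<lambda>q. G (F q)) p v = tmap A G (F p) (tmap A F p v)"
  using mmap_msmooth(2)[OF F s, of v] by (simp add: tmap_def comp_def)
qed

lemma mmap_cong: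
 assumes "mmap F p" "\<forall>\<^sub>F q in nhds p. F q = G q"
 shows "mmap G p" "tmap A F p = tmap A G p"
proof -
 have "F p = G p" using assms(2) by (rule eventually_nhds_x_imp_x)
 moreover have "isCont G p" using isCont_cong[OF assms(2)] mmap_isCont[OF assms(1)] by simp
 moreover have ev: "\<forall>\<^sub>F q in nhds p. cf (F p) (F q) = cf (F p) (G q)" using assms(2) by eventually_elim simp
 moreover note msmooth_cong[OF _ ev]
 ultimately show "mmap G p" using assms(1) by (simp add: mmap_def)
 show "tmap A F p = tmap A G p" unfolding tmap_def comp_def using dd_cong[OF ev] \<open>F p = G p\<close> by simp
qed

lemma mmap_id: "mmap (\<lambda>q. q) p" "tmap A (\<lambda>q. q) p v = v"
 by (simp_all add: mmap_def msmooth_chart[OF chart_at_max chart_at_in(2)] tmap_def comp_def)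

definition diffeo_pair :: "('m => 'm) => ('m => 'm) => bool" where
 "diffeo_pair F G \<longleftrightarrow> (\<forall>p. mmap F p \<and> mmap G p \<and> F (G p) = p \<and> G (F p) = p)"

lemma diffeo_pairD:
 assumes "diffeo_pair F G"
 shows "mmap F p" "mmap G p" "F (G p) = p" "G (F p) = p"
 using assms by (auto simp: diffeo_pair_def)

lemma diffeo_iff: "diffeo A F \<longleftrightarrow> (\<exists>G. diffeo_pair F G)"
 unfolding diffeo_pair_def
proof
 assume F: "diffeo A F"
 then have "bij F" by (simp add: diffeo_def)
 then have "F (inv F p) = p" "inv F (F p) = p" for p
  by (simp_all add: bij_is_surj surj_f_inv_f bij_is_inj)
 then show "\<exists>G. (\<forall>p. mmap F p \<and> mmap G p \<and> F (G p) = p \<and> G (F p) = p)"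
  using F unfolding diffeo_def smooth_map_iff by blast
next
 assume "\<exists>G. (\<forall>p. mmap F p \<and> mmap G p \<and> F (G p) = p \<and> G (F p) = p)"
 then obtain G where G: "\<And>p. mmap F p" "\<And>p. mmap G p" "\<And>p. F (G p) = p" "\<And>p. G (F p) = p" by blast
 then have "bij F" by (intro o_bij[of G]) (auto simp: fun_eq_iff)
 moreover have "inv F = G" by (rule inv_unique_comp) (auto simp: fun_eq_iff G)
 ultimately show "diffeo A F" by (simp add: diffeo_def smooth_map_iff G)
qed

lemma diffeo_tmap:
 assumes "diffeo A F"
 shows "bij (tmap A F p)" "linear (tmap A F p)"
proof -
 obtain G where "diffeo_pair F G" using assms diffeo_iff by blast
 note G = diffeo_pairD[OF this]
 show "linear (tmap A F p)" by (rule linear_tmap[OF G(1)])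
 have "tmap A G (F p) (tmap A F p v) = v" for p v
  using mmap_compose(2)[OF G(1) G(2), of p v] mmap_id(2) by (simp add: G)
 moreover have "tmap A F p (tmap A G (F p) v) = v" for v
  using mmap_compose(2)[OF G(2) G(1), of "F p" v] mmap_id(2) by (simp add: G)
 ultimately show "bij (tmap A F p)" by (intro o_bij[of "tmap A G (F p)"]) (auto simp: fun_eq_iff)
qed

text \<open>The new coordinate expression is the old one composed with transition maps on both
  sides. Continuity of the homotopy keeps nearby points in the domains where this composition is
  legitimate.\<close>

lemma homotopy_change_charts:
 fixes H :: "real => 'm => 'm"
 assumes cont: "isCont (\<lambda>(t, p). H t p) (t, p)"
  and c: "(U, phi) \<in> max_atlas A" "p \<in> U" "(U', phi') \<in> max_atlas A" "p \<in> U'"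
  and d: "(V, psi) \<in> max_atlas A" "H t p \<in> V" "(V', psi') \<in> max_atlas A" "H t p \<in> V'"
  and s: "smooth_at (\<lambda>(t, x). psi (H t (inv_into U phi x))) (t, phi p)"
 shows "smooth_at (\<lambda>(t, x). psi' (H t (inv_into U' phi' x))) (t, phi' p)"
proof -
 note chU = max_is_chart[OF c(1)] and chU' = max_is_chart[OF c(3)] and chV = max_is_chart[OF d(1)]
 have ip: "inv_into U' phi' (phi' p) = p" "inv_into U phi (phi p) = p"
  by (rule is_chartD(6)[OF chU' c(4)], rule is_chartD(6)[OF chU c(2)])
 have 1: "smooth_at (\<lambda>z. (fst z, phi (inv_into U' phi' (snd z)))) (t, phi' p)"
 proof (intro smooth_intros)
  have "smooth_at (\<lambda>x. phi (inv_into U' phi' x)) (snd (t, phi' p))"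
   using max_transition[OF c(3,1,4,2)] by (simp add: comp_def)
  then show "smooth_at (\<lambda>z. phi (inv_into U' phi' (snd z))) (t, phi' p)"
   by (rule smooth_at_compose) (intro smooth_intros)
 qed
 have 2: "smooth_at (\<lambda>z. psi (H (fst z) (inv_into U phi (phi (inv_into U' phi' (snd z)))))) (t, phi' p)"
  using smooth_at_compose[OF _ 1, of "\<lambda>(t, x). psi (H t (inv_into U phi x))"] s by (simp add: ip)
 have "smooth_at (\<lambda>x. psi' (inv_into V psi x)) (psi (H t (inv_into U phi (phi (inv_into U' phi' (snd (t, phi' p)))))))"
  using max_transition[OF d(1,3,2,4)] by (simp add: comp_def ip)
 then have 3: "smooth_at (\<lambda>z. psi' (inv_into V psi (psi (H (fst z) (inv_into U phi (phi (inv_into U' phi' (snd z)))))))) (t, phi' p)"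
  using smooth_at_compose[OF _ 2, of "\<lambda>x. psi' (inv_into V psi x)"] by simp
 have lim: "filterlim (\<lambda>z. inv_into U' phi' (snd z)) (nhds p) (nhds (t :: real, phi' p))"
  by (rule filterlim_compose[OF chart_filterlim(2)[OF chU' c(4)]])
   (simp add: nhds_prod filterlim_snd)
 have lim2: "filterlim (\<lambda>z. H (fst z) (inv_into U' phi' (snd z))) (nhds (H t p)) (nhds (t, phi' p))"
 proof -
  have f1: "filterlim fst (nhds t) (nhds (t, phi' p))" by (simp add: nhds_prod filterlim_fst)
  have "filterlim (\<lambda>z. (fst z, inv_into U' phi' (snd z))) (nhds (t, p)) (nhds (t, phi' p))"
   unfolding nhds_prod[of t p] by (rule filterlim_Pair[OF f1 lim])
  moreover have "filterlim (\<lambda>(t, p). H t p) (nhds (H t p)) (nhds (t, p))"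
   using cont by (simp add: isCont_iff_filterlim_nhds)
  ultimately show ?thesis using filterlim_compose by fastforce
 qed
 have "\<forall>\<^sub>F z in nhds (t, phi' p). inv_into U' phi' (snd z) \<in> U"
  using lim eventually_in_chart(1)[OF chU c(2)] by (auto simp: filterlim_iff)
 moreover have "\<forall>\<^sub>F z in nhds (t, phi' p). H (fst z) (inv_into U' phi' (snd z)) \<in> V"
  using lim2 eventually_in_chart(1)[OF chV d(2)] by (auto simp: filterlim_iff)
 ultimately have "\<forall>\<^sub>F z in nhds (t, phi' p). psi' (inv_into V psi (psi (H (fst z) (inv_into U phi (phi (inv_into U' phi' (snd z)))))))
  = (\<lambda>(t, x). psi' (H t (inv_into U' phi' x))) z"
  by eventually_elim (simp add: case_prod_unfold is_chartD(6)[OF chU] is_chartD(6)[OF chV])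
 from smooth_at_cong[OF 3 this] show ?thesis .
qed

lemma smooth_homotopyI:
 assumes cont: "\<And>t p. isCont (\<lambda>(t, p). H t p) (t, p)"
  and s: "\<And>t p. \<exists>(U, phi)\<in>max_atlas A. \<exists>(V, psi)\<in>max_atlas A. p \<in> U \<and> H t p \<in> V \<and>
   smooth_at (\<lambda>(t, x). psi (H t (inv_into U phi x))) (t, phi p)"
 shows "smooth_homotopy A H"
proof -
 have co: "continuous_on UNIV (\<lambda>(t, p). H t p)"
  using cont by (auto simp: continuous_on_eq_continuous_at split_paired_all)
 have "smooth_on {(t, x). x \<in> phi ` U \<and> H t (inv_into U phi x) \<in> V} (\<lambda>(t, x). psi (H t (inv_into U phi x)))"
  if c: "(U, phi) \<in> A" and d: "(V, psi) \<in> A" for U phi V psi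
  unfolding smooth_on_iff_smooth_at
 proof (intro conjI ballI)
  note c' = in_atlas_max[OF c] and d' = in_atlas_max[OF d]
  note ch = max_is_chart[OF c'] and dh = max_is_chart[OF d']
  have "continuous_on (UNIV \<times> phi ` U) (\<lambda>z. (\<lambda>(t, p). H t p) (fst z, inv_into U phi (snd z)))"
   by (rule continuous_on_compose2[OF co])
    (auto intro!: continuous_intros continuous_on_compose2[OF is_chartD(5)[OF ch] continuous_on_snd])
  moreover have "open (UNIV \<times> phi ` U)" by (intro open_Times open_UNIV is_chartD(2)[OF ch])
  ultimately have "open ((\<lambda>z. (\<lambda>(t, p). H t p) (fst z, inv_into U phi (snd z))) -` V \<inter> (UNIV \<times> phi ` U))"
   using continuous_on_open_vimage is_chartD(1)[OF dh] by blast
  also have "((\<lambda>z. (\<lambda>(t, p). H t p) (fst z, inv_into U phi (snd z))) -` V \<inter> (UNIV \<times> phi ` U))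
   = {(t, x). x \<in> phi ` U \<and> H t (inv_into U phi x) \<in> V}" by auto
  finally show "open {(t, x). x \<in> phi ` U \<and> H t (inv_into U phi x) \<in> V}" .
  fix z assume "z \<in> {(t, x). x \<in> phi ` U \<and> H t (inv_into U phi x) \<in> V}"
  then obtain t p where z: "z = (t, phi p)" "p \<in> U" "H t p \<in> V" using is_chartD(6)[OF ch] by fastforce
  obtain U' phi' V' psi' where *: "(U', phi') \<in> max_atlas A" "(V', psi') \<in> max_atlas A" "p \<in> U'" "H t p \<in> V'"
   "smooth_at (\<lambda>(t, x). psi' (H t (inv_into U' phi' x))) (t, phi' p)" using s[of p t] by blast
  show "smooth_at (\<lambda>(t, x). psi (H t (inv_into U phi x))) z"
   unfolding z(1) by (rule homotopy_change_charts[OF cont *(1,3) c' z(2) *(2,4) d' z(3) *(5)])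
 qed
 with co show ?thesis by (auto simp: smooth_homotopy_def)
qed

lemma smooth_homotopyD:
 assumes H: "smooth_homotopy A H"
 shows "isCont (\<lambda>(t, p). H t p) (t, p)"
  "(U, phi) \<in> A ==> (V, psi) \<in> A ==> p \<in> U ==> H t p \<in> V ==> smooth_at (\<lambda>(t, x). psi (H t (inv_into U phi x))) (t, phi p)"
proof -
 show "isCont (\<lambda>(t, p). H t p) (t, p)" using H by (simp add: smooth_homotopy_def continuous_on_eq_continuous_at)
 assume c: "(U, phi) \<in> A" "(V, psi) \<in> A" "p \<in> U" "H t p \<in> V"
 then have "smooth_on {(t, x). x \<in> phi ` U \<and> H t (inv_into U phi x) \<in> V} (\<lambda>(t, x). psi (H t (inv_into U phi x)))"
  using H by (fastforce simp: smooth_homotopy_def)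
 then show "smooth_at (\<lambda>(t, x). psi (H t (inv_into U phi x))) (t, phi p)"
  using c(3,4) max_chartD(6)[OF in_atlas_max[OF c(1)] c(3)] by (auto simp: smooth_on_iff_smooth_at)
qed

lemma smooth_homotopy_compose:
 assumes H: "smooth_homotopy A H" and H': "smooth_homotopy A H'"
 shows "smooth_homotopy A (\<lambda>t p. H t (H' t p))"
proof (rule smooth_homotopyI)
 fix t p
 have "isCont (\<lambda>z. H' (fst z) (snd z)) (t, p)" using smooth_homotopyD(1)[OF H'] by (simp add: case_prod_unfold)
 then have "isCont (\<lambda>z. (fst z, H' (fst z) (snd z))) (t, p)" by (intro continuous_intros)
 from isCont_o2[OF this, of "\<lambda>(t, p). H t p"] show "isCont (\<lambda>(t, p). H t (H' t p)) (t, p)"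
  using smooth_homotopyD(1)[OF H] by (simp add: case_prod_unfold)
 let ?q = "H' t p" and ?r = "H t (H' t p)"
 note c = chart_at_in
 have 1: "smooth_at (\<lambda>(t, x). cf ?q (H' t (ci p x))) (t, cx p)"
  using smooth_homotopyD(2)[OF H', of "cU p" "cf p" "cU ?q" "cf ?q" p t] by (simp add: c)
 have 2: "smooth_at (\<lambda>(t, x). cf ?r (H t (ci ?q x))) (t, cx ?q)"
  using smooth_homotopyD(2)[OF H, of "cU ?q" "cf ?q" "cU ?r" "cf ?r" ?q t] by (simp add: c)
 have "smooth_at (\<lambda>z. (fst z, (\<lambda>(t, x). cf ?q (H' t (ci p x))) z)) (t, cx p)" by (intro smooth_intros 1)
 from smooth_at_compose[OF _ this, of "\<lambda>(t, x). cf ?r (H t (ci ?q x))"] 2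
 have 3: "smooth_at (\<lambda>z. cf ?r (H (fst z) (ci ?q (cf ?q (H' (fst z) (ci p (snd z))))))) (t, cx p)"
  by (simp add: case_prod_unfold)
 have "isCont (\<lambda>z. (\<lambda>(t, p). H' t p) (fst z, ci p (snd z))) (t, cx p)"
 proof (rule isCont_o2[where f = "\<lambda>z. (fst z, ci p (snd z))"])
  show "isCont (\<lambda>z. (fst z, ci p (snd z))) (t, cx p)"
   unfolding isCont_iff_filterlim_nhds fst_conv snd_conv nhds_prod ci_cx
   by (rule filterlim_Pair[OF filterlim_fst filterlim_compose[OF chart_filterlim(2)[OF chart_at_is_chart chart_at_in(2)] filterlim_snd]])
  show "isCont (\<lambda>(t, p). H' t p) (fst (t, cx p), ci p (snd (t, cx p)))" by (simp add: smooth_homotopyD(1)[OF H', simplified])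
 qed
 then have "filterlim (\<lambda>z. H' (fst z) (ci p (snd z))) (nhds ?q) (nhds (t, cx p))"
  by (simp add: isCont_iff_filterlim_nhds)
 then have "\<forall>\<^sub>F z in nhds (t, cx p). H' (fst z) (ci p (snd z)) \<in> cU ?q"
  using eventually_in_chart(1)[OF chart_at_is_chart chart_at_in(2)] by (auto simp: filterlim_iff)
 then have "\<forall>\<^sub>F z in nhds (t, cx p). cf ?r (H (fst z) (ci ?q (cf ?q (H' (fst z) (ci p (snd z))))))
  = (\<lambda>(t, x). cf ?r (H t (H' t (ci p x)))) z"
  by eventually_elim (simp add: case_prod_unfold is_chartD(6)[OF chart_at_is_chart])
 from smooth_at_cong[OF 3 this]
 show "\<exists>(U, phi)\<in>max_atlas A. \<exists>(V, psi)\<in>max_atlas A. p \<in> U \<and> ?r \<in> V \<and>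
   smooth_at (\<lambda>(t, x). psi (H t (H' t (inv_into U phi x)))) (t, phi p)"
  using chart_at_max chart_at_in(2) by blast
qed

lemma diffeo_compose: "diffeo A F ==> diffeo A G ==> diffeo A (\<lambda>p. F (G p))"
proof -
 assume "diffeo A F" "diffeo A G"
 then obtain F' G' where "diffeo_pair F F'" "diffeo_pair G G'" unfolding diffeo_iff by blast
 note * = this[THEN diffeo_pairD(1)] this[THEN diffeo_pairD(2)] this[THEN diffeo_pairD(3)] this[THEN diffeo_pairD(4)]
 show ?thesis
  unfolding diffeo_iff diffeo_pair_def by (rule exI[of _ "\<lambda>p. G' (F' p)"]) (simp add: * mmap_compose(1))
qed

lemma Diff0_compose: "F \<in> Diff0 A ==> G \<in> Diff0 A ==> (\<lambda>p. F (G p)) \<in> Diff0 A"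
proof -
 assume "F \<in> Diff0 A" "G \<in> Diff0 A"
 then obtain H K where *: "smooth_homotopy A H" "\<forall>t\<in>{0..1}. diffeo A (H t)" "H 0 = id" "H 1 = F"
  "smooth_homotopy A K" "\<forall>t\<in>{0..1}. diffeo A (K t)" "K 0 = id" "K 1 = G" by (auto simp: Diff0_def)
 show ?thesis
  unfolding Diff0_def
 proof (intro CollectI exI conjI ballI)
  show "smooth_homotopy A (\<lambda>t p. H t (K t p))" by (rule smooth_homotopy_compose[OF *(1,5)])
  show "diffeo A (\<lambda>p. H t (K t p))" if "t \<in> {0..1}" for t by (rule diffeo_compose[OF bspec[OF *(2) that] bspec[OF *(6) that]])
 qed (simp_all add: *(3,4,7,8) fun_eq_iff)
qed

lemma Diff0_diffeo: "F \<in> Diff0 A ==> diffeo A F"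
 by (auto simp: Diff0_def)

end

section \<open>Rearrangements supported in a compact part of coordinate space\<close>

lemma compact_bump:
 fixes K V :: "'a::euclidean_space set"
 assumes K: "compact K" and V: "open V" "K \<subseteq> V"
 obtains eta :: "'a => real" and K' where "\<And>x. smooth_at eta x" "\<And>x. 0 \<le> eta x" "\<And>x. eta x \<le> 1" "\<And>x. x \<in> K ==> eta x = 1"
  "compact K'" "K' \<subseteq> V" "\<And>x. x \<notin> K' ==> eta x = 0"
proof -
 have "\<exists>r>0. cball x (2 * r) \<subseteq> V" if x: "x \<in> K" for x
 proof -
  obtain e where "e > 0" "cball x e \<subseteq> V" using V x open_contains_cball by blast
  then show ?thesis by (intro exI[of _ "e / 2"]) simp
 qed
 then obtain r where r: "\<And>x. x \<in> K ==> r x > 0" "\<And>x. x \<in> K ==> cball x (2 * r x) \<subseteq> V" by metis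
 have "K \<subseteq> (\<Union>x\<in>K. ball x (r x))" using r(1) by force
 then obtain T where T: "T \<subseteq> K" "finite T" "K \<subseteq> (\<Union>x\<in>T. ball x (r x))"
  using compactE_image[OF K, of K "\<lambda>x. ball x (r x)"] by auto
 \<comment> \<open>One minus the product of the complements: it is 1 as soon as one of the bumps is
   1 and 0 where all of them vanish.\<close>
 define eta where "eta y = 1 - (\<Prod>x\<in>T. 1 - ball_bump x (r x) y)" for y
 note b = ball_bump_props[OF r(1)[OF subsetD[OF T(1)]]]
 show thesis
 proof (rule that[of eta "\<Union>x\<in>T. cball x (2 * r x)"])
  fix y
  show "smooth_at eta y" unfolding eta_def by (intro smooth_intros smooth_at_ball_bump)
  show "0 \<le> eta y" "eta y \<le> 1" unfolding eta_def using b(1,2) by (auto intro!: prod_le_1 prod_nonneg)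
  show "eta y = 1" if y: "y \<in> K"
  proof -
   obtain x where x: "x \<in> T" "dist x y < r x" using y T(3) by auto
   then have "1 - ball_bump x (r x) y = 0" using b(3)[OF x(1), of y] by (simp add: dist_commute)
   then show ?thesis unfolding eta_def using T(2) x(1) by (simp add: prod_zero_iff) blast
  qed
  show "eta y = 0" if y: "y \<notin> (\<Union>x\<in>T. cball x (2 * r x))"
  proof -
   have "ball_bump x (r x) y = 0" if x: "x \<in> T" for x
    using b(4)[OF x, of y] y x by (auto simp: dist_commute)
   then show ?thesis by (simp add: eta_def)
  qed
  show "(\<Union>x\<in>T. cball x (2 * r x)) \<subseteq> V" using r(2) T(1) by blast
 qed (use T(2) in "simp add: compact_UN")
qed

text \<open>The density is given on \<open>V\<close> only, whereas \<open>line_rearrangement\<close>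
  asks for one on the whole space that is bounded away from 0. Interpolation to the constant 1 by a
  cut-off function changes nothing on \<open>K\<close>, and outside \<open>K\<close> no point is
  moved.\<close>

lemma local_rearrangement:
 fixes f w :: "real ^ 'k::finite => real" and k :: 'k
 assumes V: "open V" and f: "\<And>x. x \<in> V ==> smooth_at f x" "\<And>x. x \<in> V ==> f x > 0"
  and K: "compact K" "K \<subseteq> V" and w: "\<And>x. smooth_at w x" "\<And>x. x \<notin> K ==> w x = 0"
  and pos: "\<And>x. x \<in> K ==> f x + fd w x (axis k 1) > 0"
 obtains Phi Psi :: "real => real ^ 'k => real ^ 'k" where
  "\<And>z. smooth_at (\<lambda>(t, x). Phi t x) z" "\<And>t x. smooth_at (Psi t) x" "\<And>t x. Phi t (Psi t x) = x" "\<And>t x. Psi t (Phi t x) = x"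
  "\<And>x. Phi 0 x = x" "\<And>t x. x \<notin> K ==> Phi t x = x" "\<And>t x. x \<in> K ==> Phi t x \<in> K"
  "\<And>x. x \<in> K ==> det (matrix (fd (Phi 1) x)) * (f (Phi 1 x) + fd w (Phi 1 x) (axis k 1)) = f x"
proof -
 obtain eta :: "real ^ 'k => real" and K' where eta: "\<And>x. smooth_at eta x" "\<And>x. 0 \<le> eta x" "\<And>x. eta x \<le> 1" "\<And>x. x \<in> K ==> eta x = 1"
  and K': "compact K'" "K' \<subseteq> V" "\<And>x. x \<notin> K' ==> eta x = 0"
  by (rule compact_bump[OF K(1) V K(2)]) blast
 define g where "g x = 1 + eta x * (f x - 1)" for x
 have ev: "\<forall>\<^sub>F y in nhds x. y \<notin> C" if "compact C" "x \<notin> C" for x :: "real ^ 'k" and C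
  using that eventually_nhds_in_open[of "- C" x] by (simp add: compact_imp_closed open_Compl)
 have g: "smooth_at g x" for x
 proof (cases "x \<in> V")
  case True then show ?thesis unfolding g_def by (intro smooth_intros eta f)
 next
  case False
  then have "\<forall>\<^sub>F y in nhds x. y \<notin> K'" using ev[OF K'(1)] K'(2) by blast
  then have "\<forall>\<^sub>F y in nhds x. 1 = g y" by eventually_elim (simp add: g_def K'(3))
  from smooth_at_cong[OF smooth_at_const this] show ?thesis .
 qed
 have cf: "continuous_on K' f"
  using smooth_at_isCont[OF f(1)] K'(2) by (intro continuous_at_imp_continuous_on) blast
 obtain dlt where dlt: "dlt > 0" "dlt \<le> 1" "\<And>x. x \<in> K' ==> dlt \<le> f x"
 proof (cases "K' = {}")
  case False
  then obtain z where z: "z \<in> K'" "\<And>x. x \<in> K' ==> f z \<le> f x" using continuous_attains_inf[OF K'(1) _ cf] by blast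
  then show thesis using that[of "min 1 (f z)"] f(2) K'(2) by fastforce
 qed (use that[of 1] in simp)
 have gdlt: "g x \<ge> dlt" for x
 proof (cases "x \<in> K'")
  case True
  have "g x = (1 - eta x) * 1 + eta x * f x" by (simp add: g_def algebra_simps)
  moreover have "(1 - eta x) * 1 \<ge> (1 - eta x) * dlt" "eta x * f x \<ge> eta x * dlt"
   by (rule mult_left_mono, use eta(2,3)[of x] dlt(2) dlt(3)[OF True] in simp_all)+
  ultimately show ?thesis by (simp add: algebra_simps)
 qed (simp add: g_def K'(3) dlt)
 have "compact (w ` K)"
  by (rule compact_continuous_image[OF _ K(1)]) (simp add: continuous_at_imp_continuous_on smooth_at_isCont[OF w(1)])
 then obtain B where "\<And>x. x \<in> K ==> \<bar>w x\<bar> \<le> B"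
  using compact_imp_bounded[of "w ` K"] by (auto simp: bounded_iff)
 then have B: "\<bar>w x\<bar> \<le> \<bar>B\<bar>" for x using w(2)[of x] by (cases "x \<in> K") force+
 have gK: "g x = f x" if "x \<in> K" for x using eta(4)[OF that] by (simp add: g_def)
 have dw: "fd w x v = 0" if "x \<notin> K" for x v
 proof -
  have "\<forall>\<^sub>F y in nhds x. w y = 0" using ev[OF K(1) that] by eventually_elim (rule w(2))
  from fd_cong[OF this] show ?thesis by simp
 qed
 have gpos: "g x + fd w x (axis k 1) > 0" for x
  using pos[of x] dw[of x] gK[of x] gdlt[of x] dlt(1) by (cases "x \<in> K") auto
 obtain Phi Psi :: "real => real ^ 'k => real ^ 'k" where Phi:
  "\<And>z. smooth_at (\<lambda>(t, x). Phi t x) z" "\<And>t x. smooth_at (Psi t) x" "\<And>t x. Phi t (Psi t x) = x" "\<And>t x. Psi t (Phi t x) = x"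
  "\<And>x. Phi 0 x = x" "\<And>t x. w x = 0 ==> Phi t x = x"
  "\<And>x. det (matrix (fd (Phi 1) x)) * (g (Phi 1 x) + fd w (Phi 1 x) (axis k 1)) = g x"
  by (rule line_rearrangement[OF g w(1) dlt(1) gdlt B gpos]) blast
 have fixed: "Phi t x = x" if "x \<notin> K" for t x using Phi(6)[OF w(2)[OF that]] .
 \<comment> \<open>Points outside \<open>K\<close> are fixed and \<open>Phi t\<close> is injective,
   so no point of \<open>K\<close> can leave it.\<close>
 have inK: "Phi t x \<in> K" if "x \<in> K" for t x
 proof (rule ccontr)
  assume "Phi t x \<notin> K"
  then have "Phi t (Phi t x) = Phi t x" by (rule fixed)
  then have "Psi t (Phi t (Phi t x)) = Psi t (Phi t x)" by simp
  then have "Phi t x = x" by (simp only: Phi(4))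
  then show False using that \<open>Phi t x \<notin> K\<close> by simp
 qed
 show thesis
 proof (rule that[OF Phi(1-5) fixed inK])
  show "det (matrix (fd (Phi 1) x)) * (f (Phi 1 x) + fd w (Phi 1 x) (axis k 1)) = f x" if x: "x \<in> K" for x
   using Phi(7)[of x] gK[OF x] gK[OF inK[OF x]] by simp
 qed
qed

lemma det_linear_frame:
 fixes L :: "real ^ 'k::finite => real ^ 'k"
 assumes "linear L"
 shows "det (\<chi> k. L (a k)) = det (matrix L) * det (\<chi> k. a k)"
proof -
 have "(\<chi> k. L (a k)) = (\<chi> k. a k) ** transpose (matrix L)"
 proof (rule vec_eq_iff[THEN iffD2], rule allI)
  fix k
  have "L (a k) = matrix L *v a k" using assms by (simp add: matrix_works linear_matrix_vector_mul_eq)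
  then show "(\<chi> k. L (a k)) $ k = ((\<chi> k. a k) ** transpose (matrix L)) $ k"
   by (simp add: vec_eq_iff matrix_matrix_mult_def transpose_def matrix_vector_mult_def mult.commute)
 qed
 then show ?thesis by (simp add: det_mul det_transpose mult.commute)
qed

lemma mat_axis: "(\<chi> k. axis k 1) = (mat 1 :: real ^ 'k ^ 'k::finite)"
 by (auto simp: mat_def axis_def vec_eq_iff)

lemma det_matrix_axis: "linear L ==> det (\<chi> k. L (axis k 1)) = det (matrix L)"
 for L :: "real ^ 'k::finite => real ^ 'k"
 using det_linear_frame[of L "\<lambda>k. axis k 1"] by (simp add: mat_axis)

section \<open>Densities relative to a fixed volume form and their transport by isotopies\<close>

context manifold
begin

lemma dens_pos:
 assumes rho: "positive_volume_form A rho" and c: "(U, psi) \<in> A" "p \<in> U"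
 shows "dens rho psi p > 0"
proof -
 have "det (matrix (frechet_derivative (psi \<circ> ci p) (at (cf p p)))) > 0"
  using atlas chart_at_in[of p] c unfolding oriented_atlas_def by fastforce
 then have "det (matrix (dd psi p)) > 0" by (simp add: dd_def comp_def)
 moreover have "rho p (\<lambda>k. axis k 1) = dens rho psi p * det (matrix (dd psi p))"
  using top_form_dens[OF _ in_atlas_max[OF c(1)] c(2), of rho "\<lambda>k. axis k 1"] rho
   det_matrix_axis[OF dd_chart_linear[OF in_atlas_max[OF c(1)] c(2)]]
  by (simp add: positive_volume_form_def)
 ultimately show ?thesis using positive_top_form_axis[OF rho, of p] by (simp add: zero_less_mult_iff)
qed

text \<open>Some diffeomorphism isotopic to the identity pulls g rho back to f rho. Volume forms are
  represented by functions relative to the fixed \<open>rho\<close>.\<close>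

definition carries :: "('m, 'n) top_form => ('m => real) => ('m => real) => bool" where
 "carries rho f g \<longleftrightarrow> (\<exists>phi\<in>Diff0 A. \<forall>p b. g (phi p) * rho (phi p) (\<lambda>k. tmap A phi p (b k)) = f p * rho p b)"

lemma carries_trans:
 assumes "carries rho f g" "carries rho g h"
 shows "carries rho f h"
proof -
 obtain phi psi where *: "phi \<in> Diff0 A" "\<And>p b. g (phi p) * rho (phi p) (\<lambda>k. tmap A phi p (b k)) = f p * rho p b"
  "psi \<in> Diff0 A" "\<And>p b. h (psi p) * rho (psi p) (\<lambda>k. tmap A psi p (b k)) = g p * rho p b"
  using assms unfolding carries_def by blast
 have m: "mmap phi p" "mmap psi p" for p using Diff0_diffeo[OF *(1)] Diff0_diffeo[OF *(3)] unfolding diffeo_iff diffeo_pair_def by blast+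
 show ?thesis
  unfolding carries_def
  by (rule bexI[OF _ Diff0_compose[OF *(3,1)]]) (simp add: mmap_compose(2)[OF m] *(2,4))
qed

text \<open>An isotopy of coordinate space that fixes all points outside the image of
  \<open>K\<close> extends to the manifold by the identity. Since \<open>K\<close> is closed, the
  extension is the identity near each point outside the chart domain, which gives smoothness
  there.\<close>

lemma Diff0I_chart:
 fixes Phi Psi :: "real => 'n model => 'n model"
 assumes c: "(U, psi) \<in> max_atlas A" and K: "closed K" "K \<subseteq> U"
  and Phi: "\<And>z. smooth_at (\<lambda>(t, x). Phi t x) z" "\<And>t x. smooth_at (Psi t) x" "\<And>t x. Phi t (Psi t x) = x" "\<And>t x. Psi t (Phi t x) = x"
  "\<And>x. Phi 0 x = x" "\<And>t x. x \<notin> psi ` K ==> Phi t x = x" "\<And>t x. x \<in> psi ` K ==> Phi t x \<in> psi ` K"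
 obtains phi where "phi \<in> Diff0 A" "\<forall>p\<in>U. phi p \<in> U \<and> psi (phi p) = Phi 1 (psi p)" "\<forall>p. p \<notin> K --> phi p = p"
proof -
 note ch = max_is_chart[OF c] and cD = max_chartD[OF c]
 define lf where "lf Th q = (if q \<in> U then inv_into U psi (Th (psi q)) else q)" for Th :: "'n model => 'n model" and q
 define good where "good Th \<longleftrightarrow> (\<forall>x. x \<notin> psi ` K --> Th x = x) \<and> (\<forall>x. x \<in> psi ` K --> Th x \<in> psi ` K)" for Th :: "'n model => 'n model"
 have gPhi: "good (Phi t)" for t using Phi(6,7) by (simp add: good_def)
 have gPsi: "good (Psi t)" for t
  unfolding good_def
 proof (intro conjI allI impI)
  fix x show 1: "Psi t x = x" if "x \<notin> psi ` K" using Phi(4)[of t x] Phi(6)[OF that, of t] by simp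
  show "Psi t x \<in> psi ` K" if "x \<in> psi ` K"
   using Phi(3)[of t x] Phi(6)[of "Psi t x" t] that by force
 qed
 have im: "Th (psi q) \<in> psi ` U" if "good Th" "q \<in> U" for Th q
  using that K(2) unfolding good_def by (cases "psi q \<in> psi ` K") blast+
 have lfU: "lf Th q \<in> U" "psi (lf Th q) = Th (psi q)" if "good Th" "q \<in> U" for Th q
  using im[OF that] that(2) cD(7,8) by (simp_all add: lf_def)
 have lfK: "lf Th q = q" if "good Th" "q \<notin> K" for Th q
 proof (cases "q \<in> U")
  case True
  then have "psi q \<notin> psi ` K" using that(2) cD(3) K(2) by (auto dest: inj_onD)
  then show ?thesis using that(1) True cD(6) by (simp add: lf_def good_def)
 qed (simp add: lf_def)
 have evK: "\<forall>\<^sub>F q in nhds p. q \<notin> K" if "p \<notin> U" for p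
  using eventually_nhds_in_open[of "- K" p] K that by (auto simp: open_Compl)
 have lf_m: "mmap (lf Th) p" if Th: "good Th" "\<And>x. smooth_at Th x" for Th p
 proof (cases "p \<in> U")
  case True
  have "filterlim (\<lambda>q. inv_into U psi (Th (psi q))) (nhds (lf Th p)) (nhds p)"
  proof -
   have f1: "filterlim (inv_into U psi) (nhds (lf Th p)) (nhds (Th (psi p)))"
    using chart_filterlim(2)[OF ch lfU(1)[OF Th(1) True]] lfU(2)[OF Th(1) True] by simp
   have f2: "filterlim Th (nhds (Th (psi p))) (nhds (psi p))"
    using smooth_at_isCont[OF Th(2)] by (simp add: isCont_iff_filterlim_nhds)
   show ?thesis by (rule filterlim_compose[OF f1 filterlim_compose[OF f2 chart_filterlim(1)[OF ch True]]])
  qed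
  moreover note ev = eventually_in_chart(1)[OF ch True]
  have "\<forall>\<^sub>F q in nhds p. inv_into U psi (Th (psi q)) = lf Th q" using ev by eventually_elim (simp add: lf_def)
  ultimately have "filterlim (lf Th) (nhds (lf Th p)) (nhds p)" by (simp only: filterlim_cong[OF refl refl])
  moreover from ev have "\<forall>\<^sub>F q in nhds p. Th (psi q) = psi (lf Th q)" by eventually_elim (simp add: lfU(2)[OF Th(1)])
  note msmooth_cong[OF msmooth_compose[OF Th(2) msmooth_chart[OF c True]] this]
  ultimately show ?thesis
   using mmap_iff[where F = "lf Th" and p = p, OF c lfU(1)[OF Th(1) True]] by (simp add: isCont_iff_filterlim_nhds)
 next
  case False
  have "\<forall>\<^sub>F q in nhds p. q = lf Th q" using evK[OF False] by eventually_elim (simp add: lfK[OF Th(1)])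
  from mmap_cong(1)[OF mmap_id(1) this] show ?thesis .
 qed
 have lf_inv: "lf Th (lf Th' q) = q" if "good Th'" "\<And>x. Th (Th' x) = x" for Th Th' q
 proof (cases "q \<in> U")
  case True
  note l = lfU[OF that(1) True]
  have "lf Th (lf Th' q) = inv_into U psi (Th (psi (lf Th' q)))" using l(1) by (simp add: lf_def[of Th])
  then show ?thesis by (simp add: l(2) that(2) cD(6)[OF True])
 qed (simp add: lf_def)
 define H where "H t = lf (Phi t)" for t
 have sPhi: "smooth_at (Phi t) x" for t x
  using smooth_at_compose[OF Phi(1), of "\<lambda>x. (t, x)" x] by (simp add: smooth_intros)
 have dH: "diffeo A (H t)" for t
  unfolding diffeo_iff diffeo_pair_def H_def
  by (rule exI[of _ "lf (Psi t)"]) (simp add: lf_m gPhi gPsi sPhi Phi(2) lf_inv Phi(3,4))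
 have "smooth_homotopy A H"
 proof (rule smooth_homotopyI)
  fix t p
  have "isCont (\<lambda>(t, p). H t p) (t, p) \<and> (\<exists>(U, phi)\<in>max_atlas A. \<exists>(V, psi)\<in>max_atlas A. p \<in> U \<and> H t p \<in> V \<and>
   smooth_at (\<lambda>(t, x). psi (H t (inv_into U phi x))) (t, phi p))"
  proof (cases "p \<in> U")
   case True
   note l = lfU[OF gPhi True]
   have fl: "filterlim (\<lambda>z. psi (snd z)) (nhds (psi p)) (nhds (t :: real, p))"
    by (rule filterlim_compose[OF chart_filterlim(1)[OF ch True]]) (simp add: nhds_prod filterlim_snd)
   have "filterlim (\<lambda>z. (fst z, psi (snd z))) (nhds (t, psi p)) (nhds (t, p))"
    unfolding nhds_prod[of t "psi p"] by (rule filterlim_Pair[OF _ fl]) (simp add: nhds_prod filterlim_fst)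
   moreover have "filterlim (\<lambda>(t, x). Phi t x) (nhds (Phi t (psi p))) (nhds (t, psi p))"
    using smooth_at_isCont[OF Phi(1)[of "(t, psi p)"]] by (simp add: isCont_iff_filterlim_nhds)
   ultimately have 1: "filterlim (\<lambda>z. Phi (fst z) (psi (snd z))) (nhds (Phi t (psi p))) (nhds (t, p))"
    using filterlim_compose by fastforce
   have "filterlim (inv_into U psi) (nhds (H t p)) (nhds (Phi t (psi p)))"
    using chart_filterlim(2)[OF ch l(1)] l(2) by (simp add: H_def)
   from filterlim_compose[OF this 1]
   have 2: "filterlim (\<lambda>z. inv_into U psi (Phi (fst z) (psi (snd z)))) (nhds (H t p)) (nhds (t, p))" .
   have "filterlim snd (nhds p) (nhds (t, p))" by (simp add: nhds_prod filterlim_snd)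
   then have "\<forall>\<^sub>F z in nhds (t, p). snd z \<in> U" using eventually_in_chart(1)[OF ch True] by (auto simp: filterlim_iff)
   then have "\<forall>\<^sub>F z in nhds (t, p). inv_into U psi (Phi (fst z) (psi (snd z))) = (\<lambda>(t, p). H t p) z"
    by eventually_elim (simp add: H_def lf_def case_prod_unfold)
   with 2 have "filterlim (\<lambda>(t, p). H t p) (nhds (H t p)) (nhds (t, p))"
    by (simp only: filterlim_cong[OF refl refl])
   then have C: "isCont (\<lambda>(t, p). H t p) (t, p)" by (simp add: isCont_iff_filterlim_nhds)
   have "filterlim snd (nhds (psi p)) (nhds (t, psi p))" by (simp add: nhds_prod filterlim_snd)
   then have "\<forall>\<^sub>F z in nhds (t, psi p). snd z \<in> psi ` U" using eventually_in_chart(2)[OF ch True] by (auto simp: filterlim_iff)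
   then have "\<forall>\<^sub>F z in nhds (t, psi p). (\<lambda>(t, x). Phi t x) z = (\<lambda>(t, x). psi (H t (inv_into U psi x))) z"
   proof eventually_elim
    case (elim z)
    then show ?case
     using lfU(2)[OF gPhi cD(8)[OF elim], of "fst z"] cD(7)[OF elim] by (simp add: H_def case_prod_unfold)
   qed
   from smooth_at_cong[OF Phi(1) this] C c True l(1) show ?thesis by (auto simp: H_def)
  next
   case False
   have e: "\<forall>\<^sub>F z in nhds (t, p). snd z = (\<lambda>(t, p). H t p) z"
   proof -
    have "filterlim snd (nhds p) (nhds (t, p))" by (simp add: nhds_prod filterlim_snd)
    then have "\<forall>\<^sub>F z in nhds (t, p). snd z \<notin> K" using evK[OF False] by (auto simp: filterlim_iff)
    then show ?thesis by eventually_elim (simp add: H_def lfK[OF gPhi] case_prod_unfold)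
   qed
   have "isCont snd (t, p)" by (intro continuous_intros)
   then have C: "isCont (\<lambda>(t, p). H t p) (t, p)" using isCont_cong[OF e] by simp
   have Hp: "H t p = p" using lfK[OF gPhi] False K(2) by (auto simp: H_def)
   have "filterlim (\<lambda>z. ci p (snd z)) (nhds p) (nhds (t, cx p))"
    by (rule filterlim_compose[OF chart_filterlim(2)[OF chart_at_is_chart chart_at_in(2)]])
     (simp add: nhds_prod filterlim_snd)
   then have "\<forall>\<^sub>F z in nhds (t, cx p). ci p (snd z) \<notin> K" using evK[OF False] by (auto simp: filterlim_iff)
   moreover have "filterlim snd (nhds (cx p)) (nhds (t, cx p))" by (simp add: nhds_prod filterlim_snd)
   then have "\<forall>\<^sub>F z in nhds (t, cx p). snd z \<in> cf p ` cU p"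
    using eventually_in_chart(2)[OF chart_at_is_chart chart_at_in(2)] by (auto simp: filterlim_iff)
   ultimately have "\<forall>\<^sub>F z in nhds (t, cx p). snd z = (\<lambda>(t, x). cf p (H t (ci p x))) z"
    by eventually_elim (simp add: H_def lfK[OF gPhi] case_prod_unfold is_chartD(7)[OF chart_at_is_chart])
   from smooth_at_cong[OF smooth_at_snd[OF smooth_at_id] this]
   have "smooth_at (\<lambda>(t, x). cf p (H t (ci p x))) (t, cx p)" .
   with C Hp show ?thesis
    by (intro conjI bexI[OF _ chart_at_max[of p]] case_prodI) (simp_all add: chart_at_in)
  qed
  then show "isCont (\<lambda>(t, p). H t p) (t, p)" "\<exists>(U, phi)\<in>max_atlas A. \<exists>(V, psi)\<in>max_atlas A. p \<in> U \<and> H t p \<in> V \<and>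
   smooth_at (\<lambda>(t, x). psi (H t (inv_into U phi x))) (t, phi p)" by blast+
 qed
 moreover have "H 0 = id"
  by (rule ext) (simp add: H_def lf_def Phi(5) cD(6))
 ultimately have "H 1 \<in> Diff0 A" using dH unfolding Diff0_def by blast
 then show thesis
  using lfU[OF gPhi] lfK[OF gPhi] by (intro that[of "H 1"]) (simp_all add: H_def)
qed

text \<open>The coordinate density of f rho, extended by zero. It is smooth on the whole model space
  when \<open>f\<close> has compact support in the chart domain.\<close>

definition chart_ext :: "('m, 'n) top_form => 'm set => ('m => 'n model) => ('m => real) => 'n model => real" where
 "chart_ext rho U psi f x = (if x \<in> psi ` U then f (inv_into U psi x) * dens rho psi (inv_into U psi x) else 0)"

lemma chart_ext:
 assumes rho: "positive_volume_form A rho" and c: "(U, psi) \<in> A" and f: "\<And>q. msmooth f q"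
  and K: "compact K" "K \<subseteq> U" "\<And>q. q \<notin> K ==> f q = 0"
 shows "smooth_at (chart_ext rho U psi f) x" "compact (psi ` K)" "y \<notin> psi ` K ==> chart_ext rho U psi f y = 0"
proof -
 note c' = in_atlas_max[OF c] and cD = max_chartD[OF in_atlas_max[OF c]]
 note rho' = positive_top_form[OF rho]
 show cK: "compact (psi ` K)" by (rule compact_continuous_image[OF continuous_on_subset[OF cD(4) K(2)] K(1)])
 have 0: "chart_ext rho U psi f y = 0" if "y \<notin> psi ` K" for y
 proof (cases "y \<in> psi ` U")
  case True
  then obtain q where q: "q \<in> U" "y = psi q" by blast
  with that have "q \<notin> K" by blast
  then show ?thesis by (simp add: chart_ext_def q cD(6) K(3))
 qed (simp add: chart_ext_def)
 then show "y \<notin> psi ` K ==> chart_ext rho U psi f y = 0" .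
 show "smooth_at (chart_ext rho U psi f) x"
 proof (cases "x \<in> psi ` U")
  case True
  then obtain q where q: "q \<in> U" "x = psi q" by blast
  have "msmooth (\<lambda>q. f q * dens rho psi q) q"
   by (rule msmooth_mult[OF f msmooth_dens[OF rho' c' q(1)]])
  from msmoothD[OF c' q(1) this] have 1: "smooth_at (\<lambda>x. f (inv_into U psi x) * dens rho psi (inv_into U psi x)) x" by (simp add: q(2))
  have "\<forall>\<^sub>F x in nhds x. f (inv_into U psi x) * dens rho psi (inv_into U psi x) = chart_ext rho U psi f x"
   using eventually_nhds_in_open[OF cD(2) True] by eventually_elim (simp add: chart_ext_def)
  from smooth_at_cong[OF 1 this] show ?thesis .
 next
  case False
  have "\<forall>\<^sub>F x in nhds x. x \<in> - (psi ` K)"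
   by (rule eventually_nhds_in_open[OF open_Compl[OF compact_imp_closed[OF cK]]]) (use False K(2) in blast)
  then have "\<forall>\<^sub>F x in nhds x. 0 = chart_ext rho U psi f x" by eventually_elim (simp add: 0)
  from smooth_at_cong[OF smooth_at_const this] show ?thesis .
 qed
qed

text \<open>In one chart h rho is a partial derivative of a compactly supported function times the
  coordinate volume. Such a form is exact with compactly supported primitive, and \<open>w\<close>
  is the only coefficient of that primitive.\<close>

definition elementary :: "('m, 'n) top_form => ('m => real) => bool" where
 "elementary rho h \<longleftrightarrow> (\<exists>U psi k K w. (U, psi) \<in> A \<and> compact K \<and> K \<subseteq> U \<and> (\<forall>q. msmooth w q) \<and> (\<forall>q. q \<notin> K --> w q = 0) \<and>
   (\<forall>q\<in>U. h q * dens rho psi q = fd (\<lambda>x. w (inv_into U psi x)) (psi q) (axis k 1)) \<and> (\<forall>q. q \<notin> U --> h q = (0::real)))"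

lemma fd_chart_off_support:
 assumes c: "(U, psi) \<in> max_atlas A" "q \<in> U" and K: "closed K" "\<And>q. q \<notin> K ==> w q = (0::real)" "q \<notin> K"
 shows "fd (\<lambda>x. w (inv_into U psi x)) (psi q) v = 0"
proof -
 have "\<forall>\<^sub>F q in nhds q. q \<notin> K" using eventually_nhds_in_open[of "- K" q] K by (auto simp: open_Compl)
 then have "\<forall>\<^sub>F q in nhds q. w q = 0" by eventually_elim (rule K(2))
 then have "\<forall>\<^sub>F x in nhds (psi q). w (inv_into U psi x) = 0" by (rule eventually_chart_iff[OF max_is_chart[OF c(1)] c(2), THEN iffD2])
 from fd_cong[OF this] show ?thesis by simp
qed

lemma elementary_scale: "elementary rho h ==> elementary rho (\<lambda>q. s * h q)"
proof -
 assume "elementary rho h"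
 then obtain U psi k K w where *: "(U, psi) \<in> A" "compact K" "K \<subseteq> U" "\<forall>q. msmooth w q" "\<forall>q. q \<notin> K --> w q = 0"
  "\<forall>q\<in>U. h q * dens rho psi q = fd (\<lambda>x. w (inv_into U psi x)) (psi q) (axis k 1)" "\<forall>q. q \<notin> U --> h q = 0"
  unfolding elementary_def by blast
 have "s * h q * dens rho psi q = fd (\<lambda>x. s * w (inv_into U psi x)) (psi q) (axis k 1)" if q: "q \<in> U" for q
 proof -
  have "smooth_at (\<lambda>x. w (inv_into U psi x)) (psi q)" by (rule msmoothD[OF in_atlas_max[OF *(1)] q *(4)[rule_format]])
  from fd_bilinear[OF bounded_bilinear_mult smooth_at_const this, of s]
  show ?thesis using bspec[OF *(6) q] by simp
 qed
 moreover have "\<forall>q. msmooth (\<lambda>q. s * w q) q"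
  using msmooth_mult[OF msmooth_const] *(4) by blast
 ultimately show ?thesis
  unfolding elementary_def
  using * by (rule_tac exI[of _ U], rule_tac exI[of _ psi], rule_tac exI[of _ k], rule_tac exI[of _ K], rule_tac exI[of _ "\<lambda>q. s * w q"]) simp
qed

lemma elementary_support:
 assumes rho: "positive_volume_form A rho" and e: "(U, psi) \<in> A" "closed K" "\<And>q. q \<notin> K ==> w q = 0"
  "\<And>q. q \<in> U ==> h q * dens rho psi q = fd (\<lambda>x. w (inv_into U psi x)) (psi q) (axis k 1)" "\<And>q. q \<notin> U ==> h q = (0::real)"
  and q: "q \<notin> K"
 shows "h q = 0"
proof (cases "q \<in> U")
 case True
 note c = in_atlas_max[OF e(1)] True
 have "h q * dens rho psi q = 0" using e(4)[OF True] fd_chart_off_support[OF c e(2,3) q] by simp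
 then show ?thesis using dens_nonzero[OF rho c] by simp
qed (rule e(5))

lemma elementary_smooth:
 assumes rho: "positive_volume_form A rho" and h: "elementary rho h"
 shows "msmooth h q"
proof -
 obtain U psi k K w where *: "(U, psi) \<in> A" "compact K" "K \<subseteq> U" "\<And>q. msmooth w q" "\<And>q. q \<notin> K ==> w q = 0"
  "\<And>q. q \<in> U ==> h q * dens rho psi q = fd (\<lambda>x. w (inv_into U psi x)) (psi q) (axis k 1)" "\<And>q. q \<notin> U ==> h q = 0"
  using h unfolding elementary_def by blast
 note cK = compact_imp_closed[OF *(2)]
 show ?thesis
 proof (cases "q \<in> U")
  case True
  note c = in_atlas_max[OF *(1)] True
  note rho' = positive_top_form[OF rho]
  have 1: "msmooth (\<lambda>q. fd (\<lambda>x. w (inv_into U psi x)) (psi q) (axis k 1) / dens rho psi q) q"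
   by (intro msmooth_divide msmooth_fd_chart[OF c *(4)] msmooth_dens[OF rho' c] dens_nonzero[OF rho c])
  have "\<forall>\<^sub>F q in nhds q. fd (\<lambda>x. w (inv_into U psi x)) (psi q) (axis k 1) / dens rho psi q = h q"
   using ev_chart(1)[OF c(1) True]
   by eventually_elim (use *(6) dens_nonzero[OF rho c(1)] in "simp add: field_simps")
  from msmooth_cong[OF 1 this] show ?thesis .
 next
  case False
  have "\<forall>\<^sub>F q in nhds q. q \<notin> K" using eventually_nhds_in_open[of "- K" q] cK *(3) False by (auto simp: open_Compl)
  then have "\<forall>\<^sub>F q in nhds q. 0 = h q"
   by eventually_elim (rule elementary_support[OF rho *(1) cK *(5-7), symmetric])
  from msmooth_cong[OF msmooth_const this] show ?thesis .
 qed
qed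

text \<open>In the chart the densities of f rho and (f + h) rho differ by the k-th partial
  derivative of \<open>W\<close>; the rearrangement along the k-th coordinate lines relates them and
  is transplanted to the manifold. Outside \<open>K\<close> both forms agree and nothing
  moves.\<close>

lemma elementary_carries:
 assumes rho: "positive_volume_form A rho" and h: "elementary rho h"
  and f: "\<And>q. msmooth f q" "\<And>q. f q > 0" "\<And>q. f q + h q > 0"
 shows "carries rho f (\<lambda>q. f q + h q)"
proof -
 obtain U psi k K w where *: "(U, psi) \<in> A" "compact K" "K \<subseteq> U" "\<And>q. msmooth w q" "\<And>q. q \<notin> K ==> w q = 0"
  "\<And>q. q \<in> U ==> h q * dens rho psi q = fd (\<lambda>x. w (inv_into U psi x)) (psi q) (axis k 1)" "\<And>q. q \<notin> U ==> h q = 0"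
  using h unfolding elementary_def by blast
 note c = in_atlas_max[OF *(1)] and cK = compact_imp_closed[OF *(2)]
 note cD = max_chartD[OF c]
 note rho' = positive_top_form[OF rho]
 define F where "F x = f (inv_into U psi x) * dens rho psi (inv_into U psi x)" for x
 define W where "W x = (if x \<in> psi ` U then w (inv_into U psi x) else 0)" for x
 have kK: "compact (psi ` K)" "psi ` K \<subseteq> psi ` U"
  using compact_continuous_image[OF continuous_on_subset[OF cD(4) *(3)] *(2)] *(3) by auto
 have F: "smooth_at F x" "F x > 0" if x: "x \<in> psi ` U" for x
 proof -
  obtain q where q: "q \<in> U" "x = psi q" using x by blast
  have "msmooth (\<lambda>q. f q * dens rho psi q) q"
   by (rule msmooth_mult[OF f(1) msmooth_dens[OF rho' c q(1)]])
  from msmoothD[OF c q(1) this] show "smooth_at F x" by (simp add: F_def[abs_def] q(2))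
  show "F x > 0" using f(2) dens_pos[OF rho *(1) q(1)] by (simp add: F_def q cD(6))
 qed
 have WU: "\<forall>\<^sub>F x in nhds x. W x = w (inv_into U psi x)" if "x \<in> psi ` U" for x
  using eventually_nhds_in_open[OF cD(2) that] by eventually_elim (simp add: W_def)
 have W0: "W x = 0" if "x \<notin> psi ` K" for x
 proof (cases "x \<in> psi ` U")
  case True
  then obtain q where q: "q \<in> U" "x = psi q" by blast
  with that have "q \<notin> K" by blast
  then show ?thesis by (simp add: W_def q cD(6)[OF q(1)] *(5))
 qed (simp add: W_def)
 have W: "smooth_at W x" for x
 proof (cases "x \<in> psi ` U")
  case True
  then obtain q where q: "q \<in> U" "x = psi q" by blast
  from WU[OF True] have "\<forall>\<^sub>F x in nhds x. w (inv_into U psi x) = W x" by eventually_elim simp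
  from smooth_at_cong[OF _ this] show ?thesis using msmoothD[OF c q(1) *(4)] q(2) by simp
 next
  case False
  then have "\<forall>\<^sub>F x in nhds x. x \<in> - (psi ` K)"
   using kK compact_imp_closed[OF kK(1)] by (intro eventually_nhds_in_open) (auto simp: open_Compl)
  then have "\<forall>\<^sub>F x in nhds x. 0 = W x" by eventually_elim (simp add: W0)
  from smooth_at_cong[OF smooth_at_const this] show ?thesis .
 qed
 have FW: "F (psi q) + fd W (psi q) (axis k 1) = (f q + h q) * dens rho psi q" if q: "q \<in> U" for q
 proof -
  have "fd W (psi q) (axis k 1) = h q * dens rho psi q"
   using fd_cong[OF WU[OF imageI[OF q]]] *(6)[OF q] by simp
  then show ?thesis by (simp add: F_def cD(6)[OF q] distrib_right)
 qed
 have pos: "F x + fd W x (axis k 1) > 0" if x: "x \<in> psi ` K" for x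
 proof -
  obtain q where q: "q \<in> U" "x = psi q" using x *(3) by blast
  show ?thesis unfolding q(2) FW[OF q(1)] using f(3) dens_pos[OF rho *(1) q(1)] by simp
 qed
 show ?thesis
 proof (rule local_rearrangement[OF cD(2) F kK W W0 pos])
  fix Phi Psi :: "real => 'n model => 'n model"
  assume Phi:
  "\<And>z. smooth_at (\<lambda>(t, x). Phi t x) z" "\<And>t x. smooth_at (Psi t) x" "\<And>t x. Phi t (Psi t x) = x" "\<And>t x. Psi t (Phi t x) = x"
  "\<And>x. Phi 0 x = x" "\<And>t x. x \<notin> psi ` K ==> Phi t x = x" "\<And>t x. x \<in> psi ` K ==> Phi t x \<in> psi ` K"
  "\<And>x. x \<in> psi ` K ==> det (matrix (fd (Phi 1) x)) * (F (Phi 1 x) + fd W (Phi 1 x) (axis k 1)) = F x"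
 obtain phi where phi': "phi \<in> Diff0 A" "\<forall>p\<in>U. phi p \<in> U \<and> psi (phi p) = Phi 1 (psi p)" "\<forall>p. p \<notin> K --> phi p = p"
  by (rule Diff0I_chart[OF c cK *(3) Phi(1-7)])
 then have phi: "phi \<in> Diff0 A" "\<And>p. p \<in> U ==> phi p \<in> U" "\<And>p. p \<in> U ==> psi (phi p) = Phi 1 (psi p)" "\<And>p. p \<notin> K ==> phi p = p"
  by blast+
 have m: "mmap phi p" for p using Diff0_diffeo[OF phi(1)] unfolding diffeo_iff diffeo_pair_def by blast
 have s1: "smooth_at (Phi 1) x" for x
  using smooth_at_compose[OF Phi(1), of "\<lambda>x. (1, x)" x] by (simp add: smooth_intros)
 have "(f (phi p) + h (phi p)) * rho (phi p) (\<lambda>k. tmap A phi p (b k)) = f p * rho p b" for p b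
 proof (cases "p \<in> K")
  case True
  then have p: "p \<in> U" using *(3) by blast
  have e: "dd (\<lambda>q. psi (phi q)) p = dd (\<lambda>q. Phi 1 (psi q)) p" by (rule dd_cong_on[OF c p phi(3)])
  have t: "dd psi (phi p) (tmap A phi p v) = fd (Phi 1) (psi p) (dd psi p v)" for v
   unfolding tmap_chart[OF c phi(2)[OF p] m] e
   by (rule dd_compose[OF s1 msmooth_chart[OF c p]])
  let ?D = "det (matrix (fd (Phi 1) (psi p)))"
  have "rho (phi p) (\<lambda>k. tmap A phi p (b k)) = dens rho psi (phi p) * (?D * det (\<chi> k. dd psi p (b k)))"
   unfolding top_form_dens[OF rho' c phi(2)[OF p]] t det_linear_frame[OF smooth_at_linear[OF s1]] ..
  moreover have "?D * ((f (phi p) + h (phi p)) * dens rho psi (phi p)) = f p * dens rho psi p"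
   using Phi(8)[OF imageI[OF True]] FW[OF phi(2)[OF p]] by (simp add: phi(3)[OF p, symmetric] F_def cD(6)[OF p])
  ultimately have "(f (phi p) + h (phi p)) * rho (phi p) (\<lambda>k. tmap A phi p (b k)) = f p * dens rho psi p * det (\<chi> k. dd psi p (b k))"
   by (simp add: mult_ac)
  then show ?thesis unfolding top_form_dens[OF rho' c p] by (simp add: mult_ac)
 next
  case False
  have "\<forall>\<^sub>F q in nhds p. q \<in> - K" by (rule eventually_nhds_in_open) (use cK False in "auto simp: open_Compl")
  then have "\<forall>\<^sub>F q in nhds p. q = phi q" by eventually_elim (simp add: phi(4))
  from mmap_cong(2)[OF mmap_id(1) this] have t: "tmap A phi p v = v" for v using mmap_id(2)[of p v] by simp
  have "h p = 0" by (rule elementary_support[OF rho *(1) cK *(5-7) False])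
  then show ?thesis by (simp add: t phi(4)[OF False])
 qed
 then show ?thesis unfolding carries_def using phi(1) by blast
 qed
qed

lemma Diff0_id: "(\<lambda>p. p) \<in> Diff0 A"
proof -
 fix p
 obtain phi where phi: "phi \<in> Diff0 A" "\<forall>q\<in>cU p. phi q \<in> cU p \<and> cf p (phi q) = cf p q" "\<forall>q. q \<notin> {} --> phi q = q"
  by (rule Diff0I_chart[where K = "{}" and Phi = "\<lambda>t x. x" and Psi = "\<lambda>t x. x", OF chart_at_max])
   (simp_all add: case_prod_unfold smooth_at_id smooth_at_snd)
 then have "phi = (\<lambda>p. p)" by auto
 then show ?thesis using phi(1) by simp
qed

text \<open>Finite sums of elementary functions, built one summand at a time because each summand
  costs one rearrangement. As multiples of elementary functions are elementary, this is their linear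
  span.\<close>

inductive mspan :: "('m, 'n) top_form => ('m => real) => bool" for rho where
 zero: "mspan rho (\<lambda>q. 0)"
| step: "mspan rho h ==> elementary rho e ==> mspan rho (\<lambda>q. h q + e q)"

lemma mspan_smooth:
 assumes rho: "positive_volume_form A rho"
 shows "mspan rho h ==> msmooth h q"
 by (induction rule: mspan.induct) (simp_all add: msmooth_const msmooth_add elementary_smooth[OF rho])

lemma mspan_add: "mspan rho g ==> mspan rho h ==> mspan rho (\<lambda>q. g q + h q)"
proof (induction g rule: mspan.induct)
 case (step g e)
 have "(\<lambda>q. g q + e q + h q) = (\<lambda>q. (g q + h q) + e q)" by (simp add: ac_simps)
 then show ?case using mspan.step[OF step.IH[OF step.prems] step.hyps(2)] by simp
qed simp

lemma mspan_scale: "mspan rho h ==> mspan rho (\<lambda>q. s * h q)"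
proof (induction h rule: mspan.induct)
 case (step h e)
 show ?case using mspan.step[OF step.IH elementary_scale[OF step.hyps(2)]] by (simp add: distrib_left)
qed (simp add: mspan.zero)

end

context compact_manifold
begin

lemma msmooth_bounded:
 fixes f :: "'m => real"
 assumes "\<And>q. msmooth f q"
 obtains B where "B > 0" "\<And>q. \<bar>f q\<bar> \<le> B"
proof -
 have "continuous_on UNIV f" using msmooth_isCont[OF assms] by (simp add: continuous_on_eq_continuous_at)
 then have "bounded (range f)" using compact_imp_bounded[OF compact_continuous_image] compact by blast
 then show thesis using that by (auto simp: bounded_pos)
qed

lemma msmooth_lower_bound:
 fixes f :: "'m => real"
 assumes "\<And>q. msmooth f q" "\<And>q. f q > 0"
 obtains dlt where "dlt > 0" "\<And>q. f q \<ge> dlt"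
proof -
 have "continuous_on UNIV f" using msmooth_isCont[OF assms(1)] by (simp add: continuous_on_eq_continuous_at)
 from continuous_attains_inf[OF compact _ this] obtain p where "\<And>q. f p \<le> f q" by auto
 then show thesis using that assms(2) by blast
qed

text \<open>Adding the summands one after another may destroy positivity in between. For small
  multiples it does not, and the admissible size depends on \<open>h\<close> and on the lower bound
  \<open>dlt\<close> but not on \<open>f\<close>.\<close>

lemma mspan_small_step:
 assumes rho: "positive_volume_form A rho" and h: "mspan rho h" and dlt: "dlt > 0"
 shows "\<exists>eps>0. \<forall>f s. (\<forall>q. msmooth f q) --> (\<forall>q. f q \<ge> dlt) --> 0 \<le> s --> s \<le> eps --> carries rho f (\<lambda>q. f q + s * h q)"
 using h
proof (induction rule: mspan.induct)
 case zero
 have "carries rho f f" for f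
  unfolding carries_def by (rule bexI[OF _ Diff0_id]) (simp add: mmap_id(2))
 then show ?case by (intro exI[of _ 1]) simp
next
 case (step h e)
 obtain eps where eps: "eps > 0" "\<And>f s. (\<forall>q. msmooth f q) ==> (\<forall>q. f q \<ge> dlt) ==> 0 \<le> s ==> s \<le> eps ==> carries rho f (\<lambda>q. f q + s * h q)"
  using step.IH by blast
 note sh = mspan_smooth[OF rho step.hyps(1)] and se = elementary_smooth[OF rho step.hyps(2)]
 obtain B where B: "B > 0" "\<And>q. \<bar>h q\<bar> \<le> B" by (rule msmooth_bounded[OF sh]) blast
 obtain C where C: "C > 0" "\<And>q. \<bar>e q\<bar> \<le> C" by (rule msmooth_bounded[OF se]) blast
 \<comment> \<open>With \<open>B\<close> and \<open>C\<close> bounding the two parts, the total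
   change is at most half of \<open>dlt\<close>.\<close>
 define eps' where "eps' = min eps (dlt / (2 * (B + C)))"
 have "carries rho f (\<lambda>q. f q + s * (h q + e q))"
  if f: "\<forall>q. msmooth f q" "\<forall>q. f q \<ge> dlt" and s: "0 \<le> s" "s \<le> eps'" for f s
 proof -
  have "s * (B + C) \<le> dlt / (2 * (B + C)) * (B + C)" using s B C by (intro mult_right_mono) (auto simp: eps'_def)
  moreover have "dlt / (2 * (B + C)) * (B + C) = dlt / 2" using B(1) C(1) by (simp add: field_simps)
  ultimately have sBC: "s * B + s * C \<le> dlt / 2" unfolding distrib_left[symmetric] by linarith
  have 1: "\<bar>s * h q\<bar> \<le> s * B" "\<bar>s * e q\<bar> \<le> s * C" for q using s(1) B(2) C(2) by (simp_all add: abs_mult mult_left_mono)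
  have 2: "s * B \<ge> 0" "s * C \<ge> 0" using s(1) B C by simp_all
  have b: "f q + s * h q > 0" "f q + s * h q + s * e q > 0" for q
   using 1[of q] 2 sBC dlt f(2)[rule_format, of q] unfolding abs_le_iff by linarith+
  have "carries rho f (\<lambda>q. f q + s * h q)" using eps(2)[OF f s(1)] s(2) by (simp add: eps'_def)
  moreover have "carries rho (\<lambda>q. f q + s * h q) (\<lambda>q. f q + s * h q + s * e q)"
   by (rule elementary_carries[OF rho elementary_scale[OF step.hyps(2)] _ b])
    (intro msmooth_add msmooth_mult msmooth_const f[rule_format] sh)
  ultimately show ?thesis using carries_trans by (simp add: distrib_left add.assoc)
 qed
 moreover have "eps' > 0" using eps(1) dlt B C by (simp add: eps'_def)
 ultimately show ?case by blast
qed

text \<open>The segment from \<open>f\<close> to \<open>f + h\<close> is cut into \<open>N\<close>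
  equal steps shorter than \<open>eps\<close>. All its points are bounded below by one
  \<open>dlt\<close>, since both ends are, so the same \<open>eps\<close> serves every step.\<close>

lemma mspan_carries:
 assumes rho: "positive_volume_form A rho" and h: "mspan rho h"
  and f: "\<And>q. msmooth f q" "\<And>q. f q > 0" "\<And>q. f q + h q > 0"
 shows "carries rho f (\<lambda>q. f q + h q)"
proof -
 note sh = mspan_smooth[OF rho h]
 obtain a where a: "a > 0" "\<And>q. f q \<ge> a" by (rule msmooth_lower_bound[OF f(1,2)]) blast
 obtain b where b: "b > 0" "\<And>q. f q + h q \<ge> b"
  by (rule msmooth_lower_bound[OF msmooth_add[OF f(1) sh] f(3)]) blast
 define dlt where "dlt = min a b"
 have dlt: "dlt > 0" using a b by (simp add: dlt_def)
 have low: "f q + s * h q \<ge> dlt" if s: "0 \<le> s" "s \<le> 1" for s q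
 proof -
  have "(1 - s) * f q \<ge> (1 - s) * dlt" "s * (f q + h q) \<ge> s * dlt"
   by (rule mult_left_mono, use s a(2)[of q] b(2)[of q] in \<open>simp_all add: dlt_def\<close>)+
  then show ?thesis by (simp add: algebra_simps)
 qed
 obtain eps where eps': "eps > 0 \<and> (\<forall>f s. (\<forall>q. msmooth f q) --> (\<forall>q. f q \<ge> dlt) --> 0 \<le> s --> s \<le> eps --> carries rho f (\<lambda>q. f q + s * h q))"
  using mspan_small_step[OF rho h dlt] by (rule exE)
 note eps = conjunct1[OF eps'] conjunct2[OF eps', rule_format]
 obtain n where n: "inverse (real (Suc n)) < eps" using reals_Archimedean[OF eps(1)] by (rule exE)
 define N where "N = Suc n"
 have N: "N > 0" "1 / real N < eps" using n by (simp_all add: N_def inverse_eq_divide)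
 have "i \<le> N ==> i > 0 ==> carries rho f (\<lambda>q. f q + real i / N * h q)" for i
 proof (induction i)
  case (Suc i)
  have s: "carries rho (\<lambda>q. f q + real i / N * h q) (\<lambda>q. f q + real i / N * h q + 1 / N * h q)"
  proof (rule eps(2)[of "\<lambda>q. f q + real i / N * h q" "1 / N"])
   show "msmooth (\<lambda>q. f q + real i / N * h q) q" for q
    by (rule msmooth_add[OF f(1) msmooth_mult[OF msmooth_const sh]])
   show "dlt \<le> f q + real i / N * h q" for q by (rule low) (use Suc.prems N in simp_all)
  qed (use N in simp_all)
  have e: "f q + real i / N * h q + 1 / N * h q = f q + real (Suc i) / N * h q" for q
   by (simp add: add_divide_distrib algebra_simps)
  show ?case
  proof (cases "i = 0")
   case True then show ?thesis using s[unfolded e] by simp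
  next
   case False
   show ?thesis by (rule carries_trans[OF Suc.IH s[unfolded e]]) (use Suc.prems False in simp_all)
  qed
 qed simp
 from this[of N] N(1) show ?thesis by simp
qed

end

section \<open>Moser's theorem\<close>

lemma fd_minus: "smooth_at f x ==> fd (\<lambda>x. - f x) x v = - fd f x v"
 using fd_eqI[OF has_derivative_minus[OF smooth_at_has_derivative]] by metis

lemma fd_diff: "smooth_at f x ==> smooth_at g x ==> fd (\<lambda>x. f x - g x) x v = fd f x v - fd g x v"
 using fd_eqI[OF has_derivative_diff[OF smooth_at_has_derivative smooth_at_has_derivative]] by metis

section \<open>Integration along coordinate lines and compactly supported primitives\<close>

definition coord_upd :: "'k::finite => real => real ^ 'k => real ^ 'k" where
 "coord_upd k c x = x + (c - x $ k) *\<^sub>R axis k 1"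

text \<open>The integral of \<open>F\<close> over the part between the levels \<open>c\<close> and
  \<open>d\<close> of the line through \<open>x\<close> parallel to the k-th axis; it does not
  depend on the k-th coordinate of \<open>x\<close>.\<close>

definition line_int :: "'k::finite => real => real => (real ^ 'k => real) => real ^ 'k => real" where
 "line_int k c d F x = antideriv (axis k 1) F (coord_upd k d x) - antideriv (axis k 1) F (coord_upd k c x)"

lemma axis_unit: "axis k 1 \<bullet> axis k (1::real) = 1"
 by (simp add: inner_axis_axis)

lemma coord_upd_shift: "coord_upd k c (x + t *\<^sub>R axis k 1) = coord_upd k c x"
 by (simp add: coord_upd_def algebra_simps)

lemma coord_upd_same: "coord_upd k (x $ k) x = x"
 by (simp add: coord_upd_def)

lemma coord_upd_nth: "coord_upd k c x $ i = (if i = k then c else x $ i)"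
 by (auto simp: coord_upd_def axis_def)

lemma smooth_at_coord_upd: "smooth_at F (coord_upd k c x) ==> smooth_at (\<lambda>x. F (coord_upd k c x)) x"
 by (rule smooth_at_compose) (auto simp: coord_upd_def intro!: smooth_intros)

text \<open>Statements about the sign and the vanishing of line integrals are all drawn from this
  mean value form.\<close>

lemma antideriv_mvt:
 fixes F :: "real ^ 'k::finite => real"
 assumes F: "\<And>x. smooth_at F x" and cd: "c < d"
 obtains s where "c < s" "s < d"
  "antideriv (axis k 1) F (coord_upd k d x) - antideriv (axis k 1) F (coord_upd k c x) = (d - c) * F (coord_upd k s x)"
proof -
 have eq: "coord_upd k c x + s *\<^sub>R axis k 1 = coord_upd k (c + s) x" for s
  by (simp add: coord_upd_def algebra_simps)
 obtain s where s: "0 < s" "s < d - c"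
  "antideriv (axis k 1) F (coord_upd k c x + (d - c) *\<^sub>R axis k 1) - antideriv (axis k 1) F (coord_upd k c x)
   = (d - c) * fd (antideriv (axis k 1) F) (coord_upd k c x + s *\<^sub>R axis k 1) (axis k 1)"
  by (rule fd_mean_value[of "d - c" "antideriv (axis k 1) F" "coord_upd k c x" "axis k 1"])
   (use cd antideriv(1)[OF axis_unit F] in auto)
 show thesis by (rule that[of "c + s"]) (use s in "auto simp: eq antideriv(2)[OF axis_unit F]")
qed

lemma line_int:
 fixes F :: "real ^ 'k::finite => real"
 assumes F: "\<And>x. smooth_at F x" and cd: "c < d"
 shows "smooth_at (line_int k c d F) x" "line_int k c d F (x + t *\<^sub>R axis k 1) = line_int k c d F x"
  "(\<And>x. F x \<ge> 0) ==> line_int k c d F x \<ge> 0"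
  "(\<And>x. F x \<ge> 0) ==> F x > 0 ==> c < x $ k ==> x $ k < d ==> line_int k c d F x > 0"
  "(\<And>s. F (coord_upd k s x) = 0) ==> line_int k c d F x = 0"
proof -
 note a = antideriv[OF axis_unit F]
 let ?P = "antideriv (axis k 1) F"
 show "smooth_at (line_int k c d F) x"
  unfolding line_int_def by (intro smooth_intros smooth_at_coord_upd a)
 show "line_int k c d F (x + t *\<^sub>R axis k 1) = line_int k c d F x" by (simp only: line_int_def coord_upd_shift)
 show "line_int k c d F x = 0" if "\<And>s. F (coord_upd k s x) = 0"
  using antideriv_mvt[OF F cd, of k x] that by (auto simp: line_int_def)
 have mono: "?P (coord_upd k b x) \<le> ?P (coord_upd k b' x)" if "\<And>x. F x \<ge> 0" "b \<le> b'" for b b'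
 proof (cases "b = b'")
  case False
  then have "b < b'" using that(2) by simp
  then obtain s where "?P (coord_upd k b' x) - ?P (coord_upd k b x) = (b' - b) * F (coord_upd k s x)"
   by (rule antideriv_mvt[OF F])
  moreover have "(b' - b) * F (coord_upd k s x) \<ge> 0" using that by simp
  ultimately show ?thesis by linarith
 qed simp
 show "line_int k c d F x \<ge> 0" if "\<And>x. F x \<ge> 0" using mono[OF that, of c d] cd by (simp add: line_int_def)
 show "line_int k c d F x > 0" if F0: "\<And>x. F x \<ge> 0" and x: "F x > 0" "c < x $ k" "x $ k < d"
 proof -
  have "isCont (\<lambda>s. F (coord_upd k s x)) (x $ k)"
   by (rule isCont_o2[OF _ smooth_at_isCont[OF F]]) (unfold coord_upd_def, intro continuous_intros)
  then have "\<forall>\<^sub>F s in nhds (x $ k). F (coord_upd k s x) > 0"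
   using x(1) by (simp add: isCont_iff_filterlim_nhds coord_upd_same order_tendstoD)
  then obtain e where e: "e > 0" "\<And>s. dist s (x $ k) < e ==> F (coord_upd k s x) > 0"
   unfolding eventually_nhds_metric by blast
  define b where "b = min d (x $ k + e)"
  have b: "x $ k < b" "b \<le> d" using x e(1) by (auto simp: b_def)
  obtain s where s: "x $ k < s" "s < b" "?P (coord_upd k b x) - ?P (coord_upd k (x $ k) x) = (b - x $ k) * F (coord_upd k s x)"
   using b(1) by (rule antideriv_mvt[OF F])
  have "F (coord_upd k s x) > 0" using e(2)[of s] s by (simp add: b_def dist_real_def)
  then have "(b - x $ k) * F (coord_upd k s x) > 0" using b(1) by simp
  then show ?thesis
   using s(3) mono[OF F0 b(2)] mono[OF F0, of c "x $ k"] x(2) by (simp add: line_int_def)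
 qed
qed

lemma line_int_mult:
 assumes "\<And>x t. H (x + t *\<^sub>R axis k 1) = (H x :: real)"
 shows "line_int k c d (\<lambda>x. H x * F x) x = H x * line_int k c d F x"
proof -
 have "antideriv (axis k 1) (\<lambda>x. H x * F x) x = H x * antideriv (axis k 1) F x" for x
  by (simp add: antideriv_def assms)
 moreover have "H (coord_upd k s x) = H x" for s by (simp add: coord_upd_def assms)
 ultimately show ?thesis by (simp add: line_int_def right_diff_distrib)
qed

lemma line_int_invariant:
 assumes "\<And>x t. F (x + t *\<^sub>R axis i 1) = F x" and "i \<noteq> k"
 shows "line_int k c d F (x + t *\<^sub>R axis i 1) = line_int k c d F x"
proof -
 have "axis i (1::real) $ k = 0" using assms(2) by (simp add: axis_def)
 then have 0: "axis i (1::real) $ k = 0" "axis i 1 \<bullet> axis k (1::real) = 0" by (simp_all add: inner_axis)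
 have "antideriv (axis k 1) F (x + t *\<^sub>R axis i 1) = antideriv (axis k 1) F x" for x
 proof -
  have "F (x + t *\<^sub>R axis i 1 + s *\<^sub>R axis k 1) = F (x + s *\<^sub>R axis k 1)" for s
   using assms(1)[of "x + s *\<^sub>R axis k 1" t] by (simp add: add_ac)
  then show ?thesis by (simp add: antideriv_def inner_simps 0)
 qed
 moreover have "coord_upd k s (x + t *\<^sub>R axis i 1) = coord_upd k s x + t *\<^sub>R axis i 1" for s
  by (simp add: coord_upd_def 0)
 ultimately show ?thesis by (simp add: line_int_def)
qed

text \<open>Subtracting the multiple T F / T b of \<open>b\<close> makes the integral across the
  cube zero on every line, so the primitive starting at one face vanishes again from the opposite
  face on. The multiplier is constant along the lines and therefore passes through the
  derivative.\<close>

lemma line_primitive: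
 fixes F b :: "real ^ 'k::finite => real"
 assumes r: "r > 0" and F: "\<And>x. smooth_at F x" "\<And>x. F x \<noteq> 0 ==> \<forall>i. \<bar>x $ i - a $ i\<bar> < r"
  and b: "\<And>x. smooth_at b x" "\<And>x. b x \<noteq> 0 ==> \<bar>x $ k - a $ k\<bar> < r"
 defines "T \<equiv> line_int k (a $ k - r) (a $ k + r)"
 assumes Tb: "\<And>x. T b x \<noteq> 0"
 obtains w where "\<And>x. smooth_at w x" "\<And>x. fd w x (axis k 1) = F x - T F x / T b x * b x"
  "\<And>x. w x \<noteq> 0 ==> \<forall>i. \<bar>x $ i - a $ i\<bar> < r"
proof -
 let ?e = "axis k 1 :: real ^ 'k" and ?c = "a $ k - r" and ?d = "a $ k + r"
 have cd: "?c < ?d" using r by simp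
 define W where "W F x = antideriv ?e F x - antideriv ?e F (coord_upd k ?c x)" for F x
 have W: "smooth_at (W F) x" "fd (W F) x ?e = F x" if F: "\<And>x. smooth_at F x" for F x
 proof -
  note a = antideriv[OF axis_unit F]
  have s: "smooth_at (\<lambda>x. antideriv ?e F (coord_upd k ?c x)) x" by (rule smooth_at_coord_upd[OF a(1)])
  show "smooth_at (W F) x" unfolding W_def by (intro smooth_intros a s)
  have "fd (\<lambda>x. antideriv ?e F (coord_upd k ?c x)) x ?e = 0"
  proof -
   have "((\<lambda>t. antideriv ?e F (coord_upd k ?c (x + t *\<^sub>R ?e))) has_real_derivative
     fd (\<lambda>x. antideriv ?e F (coord_upd k ?c x)) (x + 0 *\<^sub>R ?e) ?e) (at 0)"
    by (rule fd_line_deriv) (use s in simp)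
   moreover have "((\<lambda>t. antideriv ?e F (coord_upd k ?c (x + t *\<^sub>R ?e))) has_real_derivative 0) (at 0)"
    unfolding coord_upd_shift by simp
   ultimately show ?thesis using DERIV_unique by fastforce
  qed
  moreover have "fd (W F) x ?e = fd (antideriv ?e F) x ?e - fd (\<lambda>x. antideriv ?e F (coord_upd k ?c x)) x ?e"
   unfolding W_def by (rule fd_diff[OF a(1) s])
  ultimately show "fd (W F) x ?e = F x" by (simp add: a(2))
 qed
 have Wlow: "W F x = 0" if F: "\<And>x. smooth_at F x" "\<And>s. s < ?c ==> F (coord_upd k s x) = 0" and x: "x $ k \<le> ?c" for F x
 proof (cases "x $ k = ?c")
  case True
  then have "coord_upd k ?c x = x" using coord_upd_same[of k x] by simp
  then show ?thesis by (simp add: W_def)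
 next
  case False
  then have "x $ k < ?c" using x by simp
  then obtain s where "s < ?c" "antideriv ?e F (coord_upd k ?c x) - antideriv ?e F (coord_upd k (x $ k) x) = (?c - x $ k) * F (coord_upd k s x)"
   by (rule antideriv_mvt[OF F(1)])
  then show ?thesis using F(2) by (simp add: W_def coord_upd_same)
 qed
 have Whigh: "W F x = T F x" if F: "\<And>x. smooth_at F x" "\<And>s. s > ?d ==> F (coord_upd k s x) = 0" and x: "x $ k \<ge> ?d" for F x
 proof (cases "x $ k = ?d")
  case True
  then have "coord_upd k ?d x = x" using coord_upd_same[of k x] by simp
  then show ?thesis by (simp add: W_def T_def line_int_def)
 next
  case False
  then have "?d < x $ k" using x by simp
  then obtain s where "?d < s" "antideriv ?e F (coord_upd k (x $ k) x) - antideriv ?e F (coord_upd k ?d x) = (x $ k - ?d) * F (coord_upd k s x)"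
   by (rule antideriv_mvt[OF F(1)])
  then show ?thesis using F(2) by (simp add: W_def T_def line_int_def coord_upd_same)
 qed
 define q where "q x = T F x / T b x" for x
 have q: "smooth_at q x" for x
  unfolding q_def T_def by (intro smooth_intros line_int(1) F(1) b(1) cd) (rule Tb[unfolded T_def])
 have dq: "fd q x ?e = 0" for x
 proof -
  have "((\<lambda>t. q (x + t *\<^sub>R ?e)) has_real_derivative fd q (x + 0 *\<^sub>R ?e) ?e) (at 0)"
   by (rule fd_line_deriv) (simp add: q)
  moreover have "((\<lambda>t. q (x + t *\<^sub>R ?e)) has_real_derivative 0) (at 0)"
   unfolding q_def T_def line_int(2)[OF F(1) cd] line_int(2)[OF b(1) cd] by simp
  ultimately show ?thesis using DERIV_unique by fastforce
 qed
 define w where "w x = W F x + (- q x) * W b x" for x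
 show thesis
 proof (rule that[of w])
  fix x
  show "smooth_at w x" unfolding w_def by (intro smooth_intros W F b q)
  have "fd (\<lambda>x. - q x) x ?e = 0" by (simp add: fd_minus[OF q] dq)
  then show "fd w x (axis k 1) = F x - T F x / T b x * b x"
   unfolding w_def using fd_add[OF W(1)[OF F(1)] smooth_at_mult[OF smooth_at_minus[OF q] W(1)[OF b(1)]], of x ?e]
    fd_bilinear[OF bounded_bilinear_mult smooth_at_minus[OF q] W(1)[OF b(1)], of x ?e]
   by (simp add: W(2)[OF F(1)] W(2)[OF b(1)] q_def[symmetric])
  show "\<forall>i. \<bar>x $ i - a $ i\<bar> < r" if w: "w x \<noteq> 0"
  proof (rule ccontr)
   assume "\<not> (\<forall>i. \<bar>x $ i - a $ i\<bar> < r)"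
   then obtain i where i: "\<not> \<bar>x $ i - a $ i\<bar> < r" by blast
   show False
   proof (cases "i = k")
    case True
    have z: "F (coord_upd k s x) = 0" "b (coord_upd k s x) = 0" if s: "\<not> \<bar>s - a $ k\<bar> < r" for s
    proof -
     show "F (coord_upd k s x) = 0"
     proof (rule ccontr)
      assume "F (coord_upd k s x) \<noteq> 0"
      from spec[OF F(2)[OF this], of k] s show False by (simp add: coord_upd_nth)
     qed
     show "b (coord_upd k s x) = 0" using b(2)[of "coord_upd k s x"] s by (auto simp: coord_upd_nth)
    qed
    from True i have "x $ k \<le> ?c \<or> x $ k \<ge> ?d" by auto
    then consider "x $ k \<le> ?c" | "x $ k \<ge> ?d" by blast
    then show False
    proof cases
     case 1
     have "F (coord_upd k s x) = 0" "b (coord_upd k s x) = 0" if "s < ?c" for s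
      using z[of s] that by simp_all
     then have "W F x = 0" "W b x = 0" using Wlow[OF F(1) _ 1] Wlow[OF b(1) _ 1] by blast+
     then show False using w by (simp add: w_def)
    next
     case 2
     have "F (coord_upd k s x) = 0" "b (coord_upd k s x) = 0" if "s > ?d" for s
      using z[of s] that by simp_all
     then have "W F x = T F x" "W b x = T b x" using Whigh[OF F(1) _ 2] Whigh[OF b(1) _ 2] by blast+
     then show False using w Tb[of x] by (simp add: w_def q_def)
    qed
   next
    case False
    have F0: "F (coord_upd k s x) = 0" for s
    proof (rule ccontr)
     assume "F (coord_upd k s x) \<noteq> 0"
     from spec[OF F(2)[OF this], of i] i False show False by (simp add: coord_upd_nth)
    qed
    have T0: "T F x = 0" unfolding T_def by (rule line_int(5)[OF F(1) cd F0])
    have "W F x = 0"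
    proof (cases "x $ k < ?d")
     case True
     have "line_int k (x $ k) ?d F x = 0" by (rule line_int(5)[OF F(1) True F0])
     then show ?thesis using T0 by (simp add: W_def T_def line_int_def coord_upd_same)
    next
     case False
     then have "W F x = T F x" by (intro Whigh[OF F(1)] F0) simp
     then show ?thesis using T0 by simp
    qed
    then show False using w T0 by (simp add: w_def q_def)
   qed
  qed
 qed
qed

lemma invariant_const:
 fixes h :: "real ^ 'k::finite => real"
 assumes "\<And>i x t. h (x + t *\<^sub>R axis i 1) = h x"
 shows "h x = h 0"
proof -
 have "h (\<Sum>i\<in>S. (x $ i) *\<^sub>R axis i 1) = h 0" if "finite S" for S
  using that
 proof (induction S rule: finite_induct)
  case (insert i S)
  then show ?case using assms[of "\<Sum>i\<in>S. (x $ i) *\<^sub>R axis i 1" "x $ i" i] by (simp add: add.commute)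
 qed simp
 from this[of UNIV] show ?thesis by (simp add: sum_axis)
qed

lemma compact_cube: "compact {x :: real ^ 'k::finite. \<forall>i. \<bar>x $ i - a $ i\<bar> \<le> r}"
proof -
 have "{x. \<forall>i. \<bar>x $ i - a $ i\<bar> \<le> r} = cbox (\<chi> i. a $ i - r) (\<chi> i. a $ i + r)"
  by (auto simp: mem_box_cart abs_le_iff algebra_simps)
 then show ?thesis by (simp add: compact_cbox)
qed

lemma cube_in_open:
 fixes a :: "real ^ 'k::finite"
 assumes "open S" "a \<in> S"
 obtains r where "r > 0" "{x. \<forall>i. \<bar>x $ i - a $ i\<bar> \<le> r} \<subseteq> S"
proof -
 obtain e where e: "e > 0" "ball a e \<subseteq> S" using assms open_contains_ball by blast
 define r where "r = e / (2 * CARD('k))"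
 have "x \<in> S" if "\<forall>i. \<bar>x $ i - a $ i\<bar> \<le> r" for x
 proof -
  have "norm (x - a) \<le> (\<Sum>i\<in>UNIV. \<bar>(x - a) $ i\<bar>)" by (rule norm_le_l1_cart)
  also have "\<dots> \<le> (\<Sum>i\<in>(UNIV :: 'k set). r)" using that by (intro sum_mono) simp
  also have "\<dots> < e" using e(1) by (simp add: r_def)
  finally show ?thesis using e(2) by (auto simp: dist_norm norm_minus_commute)
 qed
 moreover have "r > 0" using e(1) by (simp add: r_def)
 ultimately show thesis using that by blast
qed

section \<open>Reduction of densities modulo derivatives supported in charts\<close>

context manifold
begin

lemma msmooth_support:
 assumes "closed K" "K \<subseteq> U" "\<And>q. q \<in> U ==> msmooth g q" "\<And>q. q \<notin> K ==> g q = (0::real)"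
 shows "msmooth g q"
proof (cases "q \<in> U")
 case False
 then have "\<forall>\<^sub>F q in nhds q. q \<in> - K" using assms(1,2) by (intro eventually_nhds_in_open) (auto simp: open_Compl)
 then have "\<forall>\<^sub>F q in nhds q. 0 = g q" by eventually_elim (simp add: assms(4))
 from msmooth_cong[OF msmooth_const this] show ?thesis .
qed (rule assms(3))

text \<open>The construction inverse to \<open>chart_ext\<close>: the function f for which f rho has
  the coordinate density \<open>F\<close>.\<close>

definition chart_fun :: "('m, 'n) top_form => 'm set => ('m => 'n model) => ('n model => real) => 'm => real" where
 "chart_fun rho U psi F q = (if q \<in> U then F (psi q) / dens rho psi q else 0)"

lemma compact_chart_cube:
 assumes c: "(U, psi) \<in> max_atlas A" and K: "compact B" "B \<subseteq> psi ` U"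
 shows "compact (inv_into U psi ` B)" "inv_into U psi ` B \<subseteq> U" "q \<in> U ==> q \<notin> inv_into U psi ` B ==> psi q \<notin> B"
proof -
 note cD = max_chartD[OF c]
 show "compact (inv_into U psi ` B)" using compact_continuous_image[OF continuous_on_subset[OF cD(5) K(2)] K(1)] .
 show "inv_into U psi ` B \<subseteq> U" using K(2) cD(8) by blast
 show "psi q \<notin> B" if "q \<in> U" "q \<notin> inv_into U psi ` B" using that cD(6) by force
qed

lemma elementary_line:
 assumes rho: "positive_volume_form A rho" and c: "(U, psi) \<in> A" and B: "{x. \<forall>i. \<bar>x $ i - a $ i\<bar> \<le> r} \<subseteq> psi ` U"
  and w: "\<And>x. smooth_at w x" "\<And>x. fd w x (axis k 1) = F x - G x" "\<And>x. w x \<noteq> 0 ==> \<forall>i. \<bar>x $ i - a $ i\<bar> < r"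
 shows "elementary rho (\<lambda>q. chart_fun rho U psi F q - chart_fun rho U psi G q)"
proof -
 note c' = in_atlas_max[OF c]
 note cK = compact_chart_cube[OF c' compact_cube B]
 let ?K = "inv_into U psi ` {x. \<forall>i. \<bar>x $ i - a $ i\<bar> \<le> r}"
 define W where "W q = (if q \<in> U then w (psi q) else 0)" for q
 have W0: "W q = 0" if "q \<notin> ?K" for q
 proof (cases "q \<in> U")
  case True
  have "\<not> (\<forall>i. \<bar>psi q $ i - a $ i\<bar> < r)" using cK(3)[OF True that] by (auto intro: less_imp_le)
  then show ?thesis using w(3) by (auto simp: W_def)
 qed (simp add: W_def)
 have "\<forall>q. msmooth W q"
 proof (rule allI, rule msmooth_support[OF compact_imp_closed[OF cK(1)] cK(2) _ W0])
  fix q assume q: "q \<in> U"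
  have "\<forall>\<^sub>F q in nhds q. w (psi q) = W q"
   using ev_chart(1)[OF c' q] by eventually_elim (simp add: W_def)
  from msmooth_cong[OF msmooth_compose[OF w(1) msmooth_chart[OF c' q]] this] show "msmooth W q" .
 qed
 moreover have "(chart_fun rho U psi F q - chart_fun rho U psi G q) * dens rho psi q = fd (\<lambda>x. W (inv_into U psi x)) (psi q) (axis k 1)"
  if q: "q \<in> U" for q
 proof -
  note cD = max_chartD[OF c']
  have "\<forall>\<^sub>F x in nhds (psi q). W (inv_into U psi x) = w x"
   using ev_chart(2)[OF c' q] by eventually_elim (simp add: W_def cD(7,8))
  from fd_cong[OF this] show ?thesis
   using dens_nonzero[OF rho c' q] q by (simp add: w(2) chart_fun_def field_simps)
 qed
 moreover have "chart_fun rho U psi F q - chart_fun rho U psi G q = 0" if "q \<notin> U" for q using that by (simp add: chart_fun_def)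
 ultimately show ?thesis
  unfolding elementary_def using c cK W0
  by (rule_tac exI[of _ U], rule_tac exI[of _ psi], rule_tac exI[of _ k], rule_tac exI[of _ ?K], rule_tac exI[of _ W]) simp
qed

text \<open>One coordinate after another, the dependence of the density on it is replaced by a fixed
  bump at the cost of one elementary function. The factor left at the end is invariant under all
  coordinate translations, hence constant; it is positive because the density stays non-negative and
  positive somewhere throughout.\<close>

lemma cube_reduction:
 fixes a :: "'n model"
 assumes rho: "positive_volume_form A rho" and c: "(U, psi) \<in> A" and r: "r > 0" and B: "{x. \<forall>i. \<bar>x $ i - a $ i\<bar> \<le> r} \<subseteq> psi ` U"
  and F: "\<And>x. smooth_at F x" "\<And>x. F x \<ge> 0" "\<And>x. F x \<noteq> 0 ==> \<forall>i. \<bar>x $ i - a $ i\<bar> < r" "F x0 > 0"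
 defines "b \<equiv> \<lambda>i x. ball_bump (a $ i) (r / 2) (x $ i)"
 shows "\<exists>kap>0. mspan rho (\<lambda>q. chart_fun rho U psi F q - kap * chart_fun rho U psi (\<lambda>x. \<Prod>i\<in>UNIV. b i x) q)"
proof -
 have r2: "r / 2 > 0" using r by simp
 have b: "smooth_at (b i) x" "b i x \<ge> 0" "x $ i = a $ i ==> b i x = 1" "b i x \<noteq> 0 ==> \<bar>x $ i - a $ i\<bar> < r" for i x
 proof -
  note bb = ball_bump_props[OF r2, where a = "a $ i" and x = "x $ i"]
  show "smooth_at (b i) x" unfolding b_def by (rule smooth_at_compose[OF smooth_at_ball_bump]) (intro smooth_intros)
  show "b i x \<ge> 0" unfolding b_def by (rule bb(1))
  show "b i x = 1" if "x $ i = a $ i" unfolding b_def by (rule bb(3)) (use that r in simp)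
  show "\<bar>x $ i - a $ i\<bar> < r" if "b i x \<noteq> 0"
   using bb(4) that unfolding b_def dist_real_def by (cases "r \<le> \<bar>x $ i - a $ i\<bar>") auto
 qed
 have ax: "axis j (1::real) $ i = (if i = j then 1 else 0)" for i j :: "'n \<times> bool" by (simp add: axis_def)
 have b_shift: "b i (x + t *\<^sub>R axis j 1) = b i x" if "i \<noteq> j" for i j x t using that by (simp add: b_def ax)
 define T where "T k = line_int k (a $ k - r) (a $ k + r)" for k
 have cd: "a $ k - r < a $ k + r" for k using r by simp
 have T_shift: "T k G (x + t *\<^sub>R axis k 1) = T k G x" for k G x t by (simp only: T_def line_int_def coord_upd_shift)
 have T_upd: "T k G (coord_upd k s x) = T k G x" for k G s x by (simp add: coord_upd_def T_shift)
 have Tb: "T k (b k) x > 0" for k x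
 proof -
  have "T k (b k) (coord_upd k (a $ k) x) > 0"
   unfolding T_def by (rule line_int(4)[OF b(1) cd b(2)]) (use r in "simp_all add: coord_upd_nth b(3)")
  then show ?thesis by (simp add: T_upd)
 qed
 \<comment> \<open>\<open>S\<close> is the set of coordinates already treated: \<open>G\<close> is
   the product of their bumps and of a factor \<open>h\<close> that no longer depends on
   them.\<close>
 have "\<exists>G h. (\<forall>x. smooth_at G x) \<and> (\<forall>x. G x \<ge> 0) \<and> (\<forall>x. G x \<noteq> 0 --> (\<forall>i. \<bar>x $ i - a $ i\<bar> < r)) \<and> (\<exists>x. G x > 0) \<and>
  (\<forall>x. G x = (\<Prod>i\<in>S. b i x) * h x) \<and> (\<forall>i\<in>S. \<forall>x t. h (x + t *\<^sub>R axis i 1) = h x) \<and>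
  mspan rho (\<lambda>q. chart_fun rho U psi F q - chart_fun rho U psi G q)" if "finite S" for S
  using that
 proof (induction S rule: finite_induct)
  case empty
  show ?case
   by (rule exI[of _ F], rule exI[of _ F]) (use F mspan.zero in auto)
 next
  case (insert k S)
  from insert.IH obtain G h where I: "(\<forall>x. smooth_at G x) \<and> (\<forall>x. G x \<ge> 0) \<and> (\<forall>x. G x \<noteq> 0 --> (\<forall>i. \<bar>x $ i - a $ i\<bar> < r)) \<and> (\<exists>x. G x > 0) \<and>
   (\<forall>x. G x = (\<Prod>i\<in>S. b i x) * h x) \<and> (\<forall>i\<in>S. \<forall>x t. h (x + t *\<^sub>R axis i 1) = h x) \<and>
   mspan rho (\<lambda>q. chart_fun rho U psi F q - chart_fun rho U psi G q)" by (elim exE) (rule that)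
  have G: "\<And>x. smooth_at G x" "\<And>x. G x \<ge> 0" "\<And>x. G x \<noteq> 0 ==> \<forall>i. \<bar>x $ i - a $ i\<bar> < r"
   "\<exists>x. G x > 0" "\<And>x. G x = (\<Prod>i\<in>S. b i x) * h x" "\<forall>i\<in>S. \<forall>x t. h (x + t *\<^sub>R axis i 1) = h x"
   "mspan rho (\<lambda>q. chart_fun rho U psi F q - chart_fun rho U psi G q)"
   using I by blast+
  define G' where "G' x = T k G x / T k (b k) x * b k x" for x
  define h' where "h' x = T k h x / T k (b k) x" for x
  have TG: "T k G x = (\<Prod>i\<in>S. b i x) * T k h x" for x
  proof -
   have "(\<Prod>i\<in>S. b i (x + t *\<^sub>R axis k 1)) = (\<Prod>i\<in>S. b i x)" for x t
    using insert.hyps(2) by (intro prod.cong refl b_shift) auto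
   moreover have "G = (\<lambda>x. (\<Prod>i\<in>S. b i x) * h x)" by (rule ext) (rule G(5))
   ultimately show ?thesis unfolding T_def using line_int_mult[of "\<lambda>x. \<Prod>i\<in>S. b i x" k _ _ h x] by simp
  qed
  obtain w where w: "\<forall>x. smooth_at w x" "\<forall>x. fd w x (axis k 1) = G x - G' x" "\<forall>x. w x \<noteq> 0 --> (\<forall>i. \<bar>x $ i - a $ i\<bar> < r)"
  proof (rule line_primitive[OF r G(1,3) b(1,4), of k])
   show "line_int k (a $ k - r) (a $ k + r) (b k) x \<noteq> 0" for x using Tb[of k x] by (simp add: T_def)
  qed (auto simp: G'_def T_def intro: that)
  have "elementary rho (\<lambda>q. chart_fun rho U psi G q - chart_fun rho U psi G' q)"
   by (rule elementary_line[OF rho c B spec[OF w(1)] spec[OF w(2)] mp[OF spec[OF w(3)]]])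
  from mspan.step[OF G(7) this] have "mspan rho (\<lambda>q. chart_fun rho U psi F q - chart_fun rho U psi G' q)" by simp
  moreover have "smooth_at G' x" for x
   unfolding G'_def T_def
   by (intro smooth_intros line_int(1)[OF G(1) cd] line_int(1)[OF b(1) cd] b) (use Tb[of k x] in "simp add: T_def")
  moreover have "G' x \<ge> 0" for x
   unfolding G'_def using line_int(3)[OF G(1) cd G(2), where k = k and x = x] Tb[of k x] b(2)[of k x] by (simp add: T_def)
  moreover have "\<forall>i. \<bar>x $ i - a $ i\<bar> < r" if x: "G' x \<noteq> 0" for x
  proof
   fix i
   have bk: "b k x \<noteq> 0" and Tk: "T k G x \<noteq> 0" using x by (auto simp: G'_def)
   show "\<bar>x $ i - a $ i\<bar> < r"
   proof (cases "i = k")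
    case False
    show ?thesis
    proof (rule ccontr)
     assume n: "\<not> \<bar>x $ i - a $ i\<bar> < r"
     have "G (coord_upd k s x) = 0" for s
     proof (rule ccontr)
      assume "G (coord_upd k s x) \<noteq> 0"
      from spec[OF G(3)[OF this], of i] n False show False by (simp add: coord_upd_nth)
     qed
     then show False using line_int(5)[OF G(1) cd, where k = k and x = x] Tk by (simp add: T_def)
    qed
   qed (use b(4)[OF bk] in simp)
  qed
  moreover have "\<exists>x. G' x > 0"
  proof -
   obtain y where y: "G y > 0" using G(4) by blast
   have "\<bar>y $ k - a $ k\<bar> < r" by (rule spec[OF G(3)]) (use y in simp)
   then have yk: "a $ k - r < y $ k" "y $ k < a $ k + r" by (simp_all add: abs_less_iff algebra_simps)
   have "T k G y > 0" unfolding T_def by (rule line_int(4)[OF G(1) cd G(2) y yk])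
   \<comment> \<open>At the level \<open>a $ k\<close> the bump is 1, and moving along the line to
     this level does not change the line integrals.\<close>
   then have "G' (coord_upd k (a $ k) y) > 0"
    using Tb[of k y] b(3)[of "coord_upd k (a $ k) y" k] by (simp add: G'_def T_upd coord_upd_nth)
   then show ?thesis by blast
  qed
  moreover have "G' x = (\<Prod>i\<in>insert k S. b i x) * h' x" for x
   using insert.hyps by (simp add: G'_def TG h'_def)
  moreover have "h' (x + t *\<^sub>R axis i 1) = h' x" if i: "i \<in> insert k S" for i x t
  proof (cases "i = k")
   case True then show ?thesis by (simp add: h'_def T_shift)
  next
   case False
   then have "\<And>x t. h (x + t *\<^sub>R axis i 1) = h x" using G(6) i by blast
   then have "T k h (x + t *\<^sub>R axis i 1) = T k h x" unfolding T_def by (rule line_int_invariant[OF _ False])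
   moreover have "T k (b k) (x + t *\<^sub>R axis i 1) = T k (b k) x"
    unfolding T_def by (rule line_int_invariant[OF b_shift False]) (use False in simp)
   ultimately show ?thesis by (simp add: h'_def)
  qed
  ultimately show ?case by - (rule exI[of _ G'], rule exI[of _ h'], intro conjI allI ballI impI; blast)
 qed
 from this[OF finite_class.finite_UNIV] obtain G h where I: "(\<forall>x. smooth_at G x) \<and> (\<forall>x. G x \<ge> 0) \<and> (\<forall>x. G x \<noteq> 0 --> (\<forall>i. \<bar>x $ i - a $ i\<bar> < r)) \<and> (\<exists>x. G x > 0) \<and>
  (\<forall>x. G x = (\<Prod>i\<in>UNIV. b i x) * h x) \<and> (\<forall>i\<in>UNIV. \<forall>x t. h (x + t *\<^sub>R axis i 1) = h x) \<and>
  mspan rho (\<lambda>q. chart_fun rho U psi F q - chart_fun rho U psi G q)" by (elim exE) (rule that)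
 have h: "h x = h 0" for x by (rule invariant_const) (use I in blast)
 have G: "G x = (\<Prod>i\<in>UNIV. b i x) * h 0" for x
 proof -
  have "G x = (\<Prod>i\<in>UNIV. b i x) * h x" using I by blast
  then show ?thesis by (simp only: h[of x])
 qed
 have "h 0 > 0"
 proof -
  obtain x where "G x > 0" using I by blast
  moreover have "(\<Prod>i\<in>UNIV. b i x) \<ge> 0" by (intro prod_nonneg) (simp add: b(2))
  ultimately show ?thesis by (simp add: G zero_less_mult_iff)
 qed
 moreover have "chart_fun rho U psi G q = h 0 * chart_fun rho U psi (\<lambda>x. \<Prod>i\<in>UNIV. b i x) q" for q
  by (simp add: chart_fun_def G mult.commute)
 ultimately show ?thesis using I by (intro exI[of _ "h 0"]) simp
qed

lemma mspan_sum: "finite I ==> (\<And>i. i \<in> I ==> mspan rho (h i)) ==> mspan rho (\<lambda>q. \<Sum>i\<in>I. h i q)"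
proof (induction I rule: finite_induct)
 case (insert i I)
 have "mspan rho (\<lambda>q. h i q + (\<Sum>i\<in>I. h i q))"
  by (rule mspan_add[OF insert.prems insert.IH]) (simp_all add: insert.prems)
 then show ?case using insert.hyps by simp
qed (simp add: mspan.zero)

text \<open>\<open>N\<close> is the preimage of an open cube and \<open>B\<close> the function whose
  coordinate density is the product bump of that cube, so the cube reduction applies to the
  coordinate density of \<open>f\<close>.\<close>

lemma local_span:
 assumes rho: "positive_volume_form A rho"
 shows "\<exists>N B. open N \<and> p \<in> N \<and> (\<forall>f. (\<forall>q. msmooth f q) --> (\<forall>q. f q \<ge> 0) --> (\<forall>q. f q \<noteq> 0 --> q \<in> N) --> (\<exists>q. f q > 0) -->
  (\<exists>kap>0. mspan rho (\<lambda>q. f q - kap * B q)))"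
proof -
 let ?U = "cU p" and ?psi = "cf p" and ?a = "cx p"
 have c: "(?U, ?psi) \<in> A" and p: "p \<in> ?U" using chart_at_in by simp_all
 note c' = in_atlas_max[OF c] and cD = is_chartD[OF chart_at_is_chart[of p]]
 obtain r where r: "r > 0" and B: "{x. \<forall>i. \<bar>x $ i - ?a $ i\<bar> \<le> r} \<subseteq> ?psi ` ?U"
  by (rule cube_in_open[OF cD(2) imageI[OF p]])
 let ?C = "{x. \<forall>i. \<bar>x $ i - ?a $ i\<bar> \<le> r}"
 define N where "N = ?U \<inter> ?psi -` {x. \<forall>i. \<bar>x $ i - ?a $ i\<bar> < r}"
 define b where "b = chart_fun rho ?U ?psi (\<lambda>x. \<Prod>i\<in>UNIV. ball_bump (?a $ i) (r / 2) (x $ i))"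
 have "open {x :: 'n model. \<forall>i. \<bar>x $ i - ?a $ i\<bar> < r}"
  unfolding Collect_all_eq by (intro open_INT ballI open_Collect_less continuous_intros) simp
 then have "open N" unfolding N_def by (rule continuous_open_preimage[OF cD(4,1)])
 moreover have "p \<in> N" using p r by (simp add: N_def)
 moreover have "\<exists>kap>0. mspan rho (\<lambda>q. f q - kap * b q)"
  if f: "\<forall>q. msmooth f q" "\<forall>q. f q \<ge> 0" "\<forall>q. f q \<noteq> 0 --> q \<in> N" "\<exists>q. f q > 0" for f
 proof -
  note rho' = positive_top_form[OF rho]
  define F where "F = chart_ext rho ?U ?psi f"
  have F0: "\<forall>i. \<bar>x $ i - ?a $ i\<bar> < r" if "F x \<noteq> 0" for x
  proof -
   have x: "x \<in> ?psi ` ?U" "f (ci p x) \<noteq> 0" using that by (auto simp: F_def chart_ext_def split: if_splits)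
   then have "ci p x \<in> N" using f(3) by blast
   then show ?thesis using cD(7)[OF x(1)] by (simp add: N_def)
  qed
  note cK = compact_chart_cube[OF c' compact_cube B]
  have "f q = 0" if "q \<notin> ci p ` ?C" for q
  proof (rule ccontr)
   assume "f q \<noteq> 0"
   then have "q \<in> N" using f(3) by blast
   then have q: "q \<in> ?U" "\<forall>i. \<bar>?psi q $ i - ?a $ i\<bar> < r" unfolding N_def by blast+
   have "?psi q \<in> ?C" unfolding mem_Collect_eq by (rule allI, rule less_imp_le, rule spec[OF q(2)])
   then show False using cK(3)[OF q(1) that] by blast
  qed
  from chart_ext(1)[OF rho c spec[OF f(1)] cK(1,2) this] have sF: "smooth_at F x" for x by (simp add: F_def)
  have Fpos: "F x \<ge> 0" for x
  proof (cases "x \<in> ?psi ` ?U")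
   case True
   then show ?thesis using mult_nonneg_nonneg[OF spec[OF f(2)] less_imp_le[OF dens_pos[OF rho c cD(8)[OF True]]]] by (simp add: F_def chart_ext_def)
  qed (simp add: F_def chart_ext_def)
  obtain q where q: "f q > 0" using f(4) by blast
  have qU: "q \<in> ?U" using f(3)[rule_format, of q] q by (simp add: N_def)
  have "F (?psi q) > 0" using qU q dens_pos[OF rho c qU] cD(6)[OF qU] by (simp add: F_def chart_ext_def)
  from cube_reduction[OF rho c r B sF Fpos F0 this]
  obtain kap where kap: "kap > 0" "mspan rho (\<lambda>q. chart_fun rho ?U ?psi F q - kap * b q)" unfolding b_def by blast
  have "chart_fun rho ?U ?psi F q = f q" for q
  proof (cases "q \<in> ?U")
   case True
   then show ?thesis using dens_pos[OF rho c True] by (simp add: chart_fun_def F_def chart_ext_def cD(6))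
  next
   case False
   then have "f q = 0" using spec[OF f(3), of q] by (auto simp: N_def)
   then show ?thesis using False by (simp add: chart_fun_def)
  qed
  then show ?thesis using kap by auto
 qed
 ultimately show ?thesis by blast
qed

end

context compact_manifold
begin

text \<open>This takes the place of the one-dimensionality of top-degree cohomology: up to sums of
  elementary functions every positive density is a positive multiple of a single function
  \<open>b\<close>.\<close>

lemma global_span:
 assumes rho: "positive_volume_form A rho" and conn: "connected (UNIV :: 'm set)"
 obtains b where "\<forall>f. (\<forall>q. msmooth f q) --> (\<forall>q. f q > 0) --> (\<exists>kap>0. mspan rho (\<lambda>q. f q - kap * b q))"
proof -
 define good where "good p N B \<longleftrightarrow> open N \<and> p \<in> N \<and> (\<forall>f. (\<forall>q. msmooth f q) --> (\<forall>q. f q \<ge> 0) --> (\<forall>q. f q \<noteq> 0 --> q \<in> N) -->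
  (\<exists>q. f q > 0) --> (\<exists>kap>0. mspan rho (\<lambda>q. f q - kap * B q)))" for p N B
 have "\<forall>p. \<exists>N B. good p N B" unfolding good_def using local_span[OF rho] by (rule allI)
 then obtain N B where good: "\<And>p. good p (N p) (B p)" by metis
 have N: "\<And>p. open (N p)" "\<And>p. p \<in> N p" using good unfolding good_def by blast+
 have span: "\<exists>kap>0. mspan rho (\<lambda>q. f q - kap * B p q)"
  if "\<forall>q. msmooth f q" "\<forall>q. f q \<ge> 0" "\<forall>q. f q \<noteq> 0 --> q \<in> N p" "\<exists>q. f q > 0" for p f
  using good[of p] that unfolding good_def by blast
 \<comment> \<open>A bump in the intersection is, up to the span, a multiple of both local models;
   eliminating it compares the models with each other.\<close>
 have overlap: "\<exists>kap>0. mspan rho (\<lambda>s. B p s - kap * B q s)" if s: "s \<in> N p" "s \<in> N q" for p q s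
 proof -
  have op: "open (N p \<inter> N q)" using N by blast
  obtain f :: "'m => real" and K where f: "compact K" "closed K" "K \<subseteq> cU s \<inter> (N p \<inter> N q)" "\<And>q. msmooth f q"
   "\<And>q. 0 \<le> f q" "\<And>q. f q \<le> 1" "\<And>q. q \<notin> K ==> f q = 0" "\<forall>\<^sub>F q in nhds s. f q = 1"
   by (rule manifold_bump[OF chart_at_max chart_at_in(2) op]) (use s in auto)
  have "f s = 1" using f(8) by (rule eventually_nhds_x_imp_x)
  then have ex: "\<exists>q. f q > 0" by (intro exI[of _ s]) simp
  have sup: "\<forall>x. f x \<noteq> 0 --> x \<in> N p" "\<forall>x. f x \<noteq> 0 --> x \<in> N q" using f(3,7) by blast+
  obtain kap1 kap2 where kap: "kap1 > 0" "mspan rho (\<lambda>x. f x - kap1 * B p x)" "kap2 > 0" "mspan rho (\<lambda>x. f x - kap2 * B q x)"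
   using span[of f p, OF _ _ sup(1) ex] span[of f q, OF _ _ sup(2) ex] f(4,5) by blast
  have "mspan rho (\<lambda>x. (- 1 / kap1) * (f x - kap1 * B p x) + (1 / kap1) * (f x - kap2 * B q x))"
   by (rule mspan_add[OF mspan_scale[OF kap(2)] mspan_scale[OF kap(4)]])
  moreover have "(- 1 / kap1) * (f x - kap1 * B p x) + (1 / kap1) * (f x - kap2 * B q x) = B p x - kap2 / kap1 * B q x" for x
   using kap(1) by (simp add: field_simps)
  ultimately have "mspan rho (\<lambda>x. B p x - kap2 / kap1 * B q x)" by simp
  then show ?thesis using kap(1,3) by (intro exI[of _ "kap2 / kap1"]) simp
 qed
 have trans: "\<exists>kap>0. mspan rho (\<lambda>s. f s - kap * h s)"
  if fg: "\<exists>kap>0. mspan rho (\<lambda>s. f s - kap * g s)" and gh: "\<exists>kap>0. mspan rho (\<lambda>s. g s - kap * h s)" for f g h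
 proof -
  obtain k l where kl: "k > 0" "l > 0" "mspan rho (\<lambda>s. f s - k * g s)" "mspan rho (\<lambda>s. g s - l * h s)" using fg gh by blast
  have "mspan rho (\<lambda>s. (f s - k * g s) + k * (g s - l * h s))" by (rule mspan_add[OF kl(3) mspan_scale[OF kl(4)]])
  moreover have "(f s - k * g s) + k * (g s - l * h s) = f s - (k * l) * h s" for s by (simp add: algebra_simps)
  ultimately show ?thesis using kl(1,2) by (intro exI[of _ "k * l"]) simp
 qed
 fix p0
 \<comment> \<open>The points whose local model is comparable with that of \<open>p0\<close>. The
   models of \<open>p\<close> and of any point of \<open>N p\<close> are comparable, so this set and
   its complement are both open.\<close>
 define C where "C = {p. \<exists>kap>0. mspan rho (\<lambda>s. B p s - kap * B p0 s)}"
 have nb: "p \<in> C \<longleftrightarrow> q \<in> C" if q: "q \<in> N p" for p q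
  unfolding C_def mem_Collect_eq using trans[OF overlap[OF q N(2)]] trans[OF overlap[OF N(2) q]] by (rule iffI[rotated])
 have op: "open C" "open (- C)" by (subst open_subopen, use N nb in blast)+
 then have "C = UNIV"
  using connectedD[OF conn op] overlap[OF N(2) N(2), of p0] by (auto simp: C_def)
 then have all: "\<exists>kap>0. mspan rho (\<lambda>s. B p s - kap * B p0 s)" for p unfolding C_def by blast
 show thesis
 proof (rule that[of "B p0"], intro allI impI)
  fix f :: "'m => real" assume f: "\<forall>q. msmooth f q" "\<forall>q. f q > 0"
  obtain I K and wt :: "'m => 'm => real" where P: "finite I" "\<And>i. closed (K i)" "\<And>i. K i \<subseteq> N i"
   "\<And>i q. msmooth (wt i) q" "\<And>i q. wt i q \<ge> 0" "\<And>i q. q \<notin> K i ==> wt i q = 0" "\<And>q. (\<Sum>i\<in>I. wt i q) = 1"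
   by (rule partition_of_unity[of N]) (use N in blast)+
  \<comment> \<open>A weight that vanishes identically contributes the constant 0. At least one
    weight does not, so the sum of the constants is positive.\<close>
  define Q where "Q i kap \<longleftrightarrow> kap \<ge> 0 \<and> mspan rho (\<lambda>q. wt i q * f q - kap * B p0 q) \<and> ((\<exists>q. wt i q \<noteq> 0) --> kap > 0)" for i kap
  have "\<exists>kap\<ge>0. mspan rho (\<lambda>q. wt i q * f q - kap * B p0 q) \<and> ((\<exists>q. wt i q \<noteq> 0) --> kap > 0)" for i
  proof (cases "\<exists>q. wt i q \<noteq> 0")
   case True
   then obtain q where "wt i q \<noteq> 0" by blast
   then have "wt i q * f q > 0" using P(5)[of i q] f(2) by simp
   then have ex: "\<exists>q. wt i q * f q > 0" by blast
   have sup: "\<forall>q. wt i q * f q \<noteq> 0 --> q \<in> N i" using P(3,6) by fastforce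
   have "\<exists>kap>0. mspan rho (\<lambda>q. wt i q * f q - kap * B i q)"
   proof (rule span[OF _ _ sup ex])
    show "\<forall>q. msmooth (\<lambda>q. wt i q * f q) q"
     by (rule allI, rule msmooth_mult[OF P(4) spec[OF f(1)]])
    show "\<forall>q. wt i q * f q \<ge> 0" by (intro allI mult_nonneg_nonneg P(5) less_imp_le[OF spec[OF f(2)]])
   qed
   from trans[OF this all] show ?thesis by (auto intro: less_imp_le)
  next
   case False
   then have "mspan rho (\<lambda>q. wt i q * f q - 0 * B p0 q)" using mspan.zero by simp
   then show ?thesis using False by blast
  qed
  then have "\<forall>i. \<exists>kap. Q i kap" unfolding Q_def by blast
  then obtain kap where "\<forall>i. Q i (kap i)" by (rule exE[OF choice])
  then have kap: "\<And>i. kap i \<ge> 0" "\<And>i. mspan rho (\<lambda>q. wt i q * f q - kap i * B p0 q)" "\<And>i. (\<exists>q. wt i q \<noteq> 0) ==> kap i > 0"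
   unfolding Q_def by blast+
  obtain i where i: "i \<in> I" "wt i p0 \<noteq> 0" using P(7)[of p0] by (metis (no_types, lifting) sum.neutral zero_neq_one)
  have pos: "(\<Sum>i\<in>I. kap i) > 0" by (rule sum_pos2[OF P(1) i(1)]) (use kap i in auto)
  have "mspan rho (\<lambda>q. \<Sum>i\<in>I. wt i q * f q - kap i * B p0 q)" by (rule mspan_sum[OF P(1) kap(2)])
  moreover have "(\<Sum>i\<in>I. wt i q * f q - kap i * B p0 q) = f q - (\<Sum>i\<in>I. kap i) * B p0 q" for q
   by (simp add: sum_subtractf sum_distrib_right[symmetric] P(7))
  ultimately show "\<exists>kap>0. mspan rho (\<lambda>q. f q - kap * B p0 q)" using pos by auto
 qed
qed

theorem moser:
 assumes rho: "positive_volume_form A rho" and conn: "connected (UNIV :: 'm set)"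
  and f: "\<And>q. msmooth f q" "\<And>q. f q > 0"
 obtains c phi where "c > 0" "phi \<in> Diff0 A" "\<forall>p b. c * f (phi p) * rho (phi p) (\<lambda>k. tmap A phi p (b k)) = rho p b"
proof -
 obtain b where b: "\<forall>f. (\<forall>q. msmooth f q) --> (\<forall>q. f q > 0) --> (\<exists>kap>0. mspan rho (\<lambda>q. f q - kap * b q))"
  by (rule global_span[OF rho conn])
 have "\<exists>kap>0. mspan rho (\<lambda>q. f q - kap * b q)" using b f by simp
 then obtain k where k: "k > 0" "mspan rho (\<lambda>q. f q - k * b q)" by blast
 have "\<exists>kap>0. mspan rho (\<lambda>q. 1 - kap * b q)" using spec[OF b, of "\<lambda>q. 1"] by (simp add: msmooth_const)
 then obtain l where l: "l > 0" "mspan rho (\<lambda>q. 1 - l * b q)" by blast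
 \<comment> \<open>Both \<open>f\<close> and the constant 1 are multiples of \<open>b\<close> modulo
   the span; the factor l / k equalises the multiples and so eliminates \<open>b\<close>. It becomes
   the constant \<open>c\<close> of the conclusion.\<close>
 have "mspan rho (\<lambda>q. (l / k) * (f q - k * b q) + (- 1) * (1 - l * b q))"
  by (rule mspan_add[OF mspan_scale[OF k(2)] mspan_scale[OF l(2)]])
 moreover have "(\<lambda>q. (l / k) * (f q - k * b q) + (- 1) * (1 - l * b q)) = (\<lambda>q. l / k * f q - 1)"
  using k(1) by (simp add: fun_eq_iff field_simps)
 ultimately have "mspan rho (\<lambda>q. l / k * f q - 1)" by (simp only:)
 then have "carries rho (\<lambda>q. 1) (\<lambda>q. 1 + (l / k * f q - 1))"
  by (rule mspan_carries[OF rho]) (use k(1) l(1) f(2) in "simp_all add: msmooth_const")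
 then obtain phi where phi: "phi \<in> Diff0 A"
  "\<forall>p b. (1 + (l / k * f (phi p) - 1)) * rho (phi p) (\<lambda>k. tmap A phi p (b k)) = 1 * rho p b"
  unfolding carries_def by blast
 show thesis by (rule that[OF _ phi(1), of "l / k"]) (use phi(2) k(1) l(1) in simp_all)
qed

end

section \<open>Invariance of the total volume\<close>

text \<open>The change of variables formula of the library needs an index type of class \<open>wellorder\<close>.\<close>

typedef 'k idx = "UNIV :: 'k set" ..

instance idx :: (finite) finite
proof
 have "(UNIV :: 'a idx set) = range Abs_idx" by (rule surjI[of _ Rep_idx, OF Rep_idx_inverse, symmetric])
 then show "finite (UNIV :: 'a idx set)" by (rule ssubst) (rule finite_imageI, rule finite)
qed

instantiation idx :: (finite) wellorder
begin

definition "i \<le> j \<longleftrightarrow> to_nat_on UNIV (Rep_idx i) \<le> to_nat_on UNIV (Rep_idx j)"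
definition "i < j \<longleftrightarrow> to_nat_on UNIV (Rep_idx i) < to_nat_on UNIV (Rep_idx j)"

instance
proof
 fix x y z :: "'a idx"
 let ?n = "to_nat_on (UNIV :: 'a set)"
 show "x < y \<longleftrightarrow> x \<le> y \<and> \<not> y \<le> x" "x \<le> x" "x \<le> y \<or> y \<le> x" by (auto simp: less_eq_idx_def less_idx_def)
 show "x \<le> z" if "x \<le> y" "y \<le> z" using that by (simp add: less_eq_idx_def)
 show "x = y" if "x \<le> y" "y \<le> x"
 proof -
  have "?n (Rep_idx x) = ?n (Rep_idx y)" using that by (simp add: less_eq_idx_def)
  moreover have "inj ?n" by (rule inj_on_to_nat_on) (rule countable_finite, rule finite)
  ultimately have "Rep_idx x = Rep_idx y" by (rule injD[rotated])
  then show ?thesis by (rule Rep_idx_inject[THEN iffD1])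
 qed
next
 fix P :: "'a idx => bool" and a assume step: "\<And>x. (\<And>y. y < x ==> P y) ==> P x"
 show "P a"
 proof (induction "to_nat_on UNIV (Rep_idx a)" arbitrary: a rule: less_induct)
  case less
  show ?case by (rule step, rule less) (simp add: less_idx_def)
 qed
qed

end

definition reix :: "real ^ 'k::finite => real ^ 'k idx" where "reix x = (\<chi> i. x $ Rep_idx i)"
definition unreix :: "real ^ 'k idx => real ^ 'k::finite" where "unreix y = (\<chi> k. y $ Abs_idx k)"

lemma reix_inverse [simp]: "unreix (reix x) = x" "reix (unreix y) = y"
 by (simp_all add: reix_def unreix_def vec_eq_iff Abs_idx_inverse Rep_idx_inverse)

lemma linear_reix: "linear reix" "linear unreix"
 by (auto simp: linear_iff reix_def unreix_def vec_eq_iff)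

text \<open>The determinant after renaming of the indices is an alternating function of the frame
  with value 1 on the standard frame, hence it is the determinant itself.\<close>

lemma det_reix:
 fixes L :: "real ^ 'k::finite => real ^ 'k"
 assumes L: "linear L"
 shows "det (matrix (\<lambda>y. reix (L (unreix y)))) = det (matrix L)"
proof -
 define g where "g b = det (\<chi> i. reix (b (Rep_idx i)))" for b :: "'k => real ^ 'k"
 have upd: "(\<lambda>i. reix ((b(k := v)) (Rep_idx i))) = (\<lambda>i. reix (b (Rep_idx i)))(Abs_idx k := reix v)" for b k v
  by (auto simp: fun_eq_iff Abs_idx_inverse Rep_idx_inverse)
 have alt: "alternating g"
  unfolding alternating_def
 proof (intro conjI allI impI)
  fix b :: "'k => real ^ 'k" and k
  have "linear (\<lambda>v. det (\<chi> i. ((\<lambda>i. reix (b (Rep_idx i)))(Abs_idx k := v)) i))"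
   by (rule conjunct1[OF alternating_det[where 'k = "'k idx", unfolded alternating_def], THEN spec, THEN spec])
  from linear_compose[OF linear_reix(1) this] show "linear (\<lambda>v. g (b(k := v)))" by (simp only: g_def upd comp_def)
 next
  fix b :: "'k => real ^ 'k" and j k assume "j \<noteq> k" "b j = b k"
  then have "Abs_idx j \<noteq> Abs_idx k" "reix (b (Rep_idx (Abs_idx j))) = reix (b (Rep_idx (Abs_idx k)))"
   by (simp_all add: Abs_idx_inverse Abs_idx_inject)
  note ne = this
  have "det (\<chi> i. c i) = 0" if "i \<noteq> i'" "c i = c i'" for c :: "'k idx => real ^ 'k idx" and i i'
   using conjunct2[OF alternating_det[where 'k = "'k idx", unfolded alternating_def], THEN spec, THEN spec, THEN spec, of i i' c] that by simp
  from this[of "Abs_idx j" "Abs_idx k" "\<lambda>i. reix (b (Rep_idx i))"] ne show "g b = 0" unfolding g_def by blast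
 qed
 have ax: "reix (axis (Rep_idx i) 1) = axis i 1" for i :: "'k idx" by (auto simp: reix_def axis_def vec_eq_iff Rep_idx_inject)
 have "g (\<lambda>k. axis k 1) = 1" unfolding g_def ax mat_axis by (rule det_I)
 with alternating_eq_det[OF alt] have g: "g b = det (\<chi> k. b k)" for b by simp
 have "linear (\<lambda>y. reix (L (unreix y)))"
  using linear_compose[OF linear_compose[OF linear_reix(2) L] linear_reix(1)] by (simp add: comp_def)
 then have "det (matrix (\<lambda>y. reix (L (unreix y)))) = det (\<chi> i. reix (L (unreix (axis i 1))))" by (rule det_matrix_axis[symmetric])
 also have "\<dots> = g (\<lambda>k. L (axis k 1))" by (simp add: g_def ax[symmetric])
 finally show ?thesis by (simp add: g det_matrix_axis[OF L])
qed

definition vol_int :: "(real ^ 'k::finite => real) => real" where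
 "vol_int F = integral UNIV (\<lambda>y. F (unreix y))"

lemma isCont_reix: "isCont reix x" "isCont unreix y"
 using linear_reix linear_continuous_at linear_conv_bounded_linear by blast+

lemma vol_int_box:
 fixes F :: "real ^ 'k::finite => real"
 assumes F: "\<And>x. isCont F x" "compact C" "\<And>x. x \<notin> C ==> F x = 0"
 obtains a where "reix ` C \<subseteq> box (- a) a" "continuous_on UNIV (\<lambda>y. F (unreix y))" "(\<lambda>y. F (unreix y)) absolutely_integrable_on UNIV"
  "vol_int F = integral (cbox (- a) a) (\<lambda>y. F (unreix y))"
proof -
 have "compact (reix ` C)" by (rule compact_continuous_image[OF _ F(2)]) (simp add: continuous_at_imp_continuous_on isCont_reix)
 then obtain a where a: "reix ` C \<subseteq> box (- a) a" using bounded_subset_box_symmetric compact_imp_bounded by blast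
 have cont: "continuous_on S (\<lambda>y. F (unreix y))" for S
  by (rule continuous_at_imp_continuous_on, rule ballI, rule isCont_o2[OF isCont_reix(2) F(1)])
 have eq: "(\<lambda>y. if y \<in> cbox (- a) a then F (unreix y) else 0) = (\<lambda>y. F (unreix y))"
 proof
  fix y show "(if y \<in> cbox (- a) a then F (unreix y) else 0) = F (unreix y)"
  proof (cases "unreix y \<in> C")
   case True
   then have "y \<in> cbox (- a) a" using a box_subset_cbox[of "- a" a] by (metis imageI reix_inverse(2) subsetD)
   then show ?thesis by simp
  qed (simp add: F(3))
 qed
 have "(\<lambda>y. F (unreix y)) absolutely_integrable_on cbox (- a) a" by (rule absolutely_integrable_continuous[OF cont])
 then have "(\<lambda>y. F (unreix y)) absolutely_integrable_on UNIV"
  using absolutely_integrable_restrict_UNIV[of "cbox (- a) a" "\<lambda>y. F (unreix y)"] by (simp only: eq)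
 moreover have "vol_int F = integral (cbox (- a) a) (\<lambda>y. F (unreix y))"
  using Henstock_Kurzweil_Integration.integral_restrict_UNIV[of "cbox (- a) a" "\<lambda>y. F (unreix y)"] unfolding eq vol_int_def .
 ultimately show thesis using that a cont by blast
qed

lemma vol_int_nonneg:
 fixes F :: "real ^ 'k::finite => real"
 assumes F: "\<And>x. isCont F x" "compact C" "\<And>x. x \<notin> C ==> F x = 0" and pos: "\<And>x. F x \<ge> 0"
 shows "vol_int F \<ge> 0" "F x > 0 ==> vol_int F > 0"
proof -
 obtain a where a: "reix ` C \<subseteq> box (- a) a" "continuous_on UNIV (\<lambda>y. F (unreix y))" "(\<lambda>y. F (unreix y)) absolutely_integrable_on UNIV"
  "vol_int F = integral (cbox (- a) a) (\<lambda>y. F (unreix y))" by (rule vol_int_box[OF F])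
 have i: "(\<lambda>y. F (unreix y)) integrable_on cbox (- a) a"
  by (rule integrable_continuous[OF continuous_on_subset[OF a(2)]]) simp
 show 1: "vol_int F \<ge> 0" unfolding a(4) by (rule integral_nonneg[OF i]) (simp add: pos)
 show "vol_int F > 0" if x: "F x > 0"
 proof (rule ccontr)
  assume "\<not> vol_int F > 0"
  then have "integral (cbox (- a) a) (\<lambda>y. F (unreix y)) = 0" using 1 a(4) by simp
  then have z: "((\<lambda>y. F (unreix y)) has_integral 0) (cbox (- a) a)" using i by (simp add: has_integral_iff)
  have "x \<in> C" using F(3)[of x] x by force
  then have "reix x \<in> box (- a) a" using a(1) by blast
  moreover from this have "reix x \<in> cbox (- a) a" using box_subset_cbox by blast
  ultimately have "F (unreix (reix x)) = 0"
   using has_integral_0_cbox_imp_0[OF continuous_on_subset[OF a(2)] _ z] pos by blast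
  then show False using x by simp
 qed
qed

lemma vol_int_sum:
 fixes F :: "'i => real ^ 'k::finite => real"
 assumes "finite I" "\<And>i x. i \<in> I ==> isCont (F i) x" "\<And>i. i \<in> I ==> compact (C i)" "\<And>i x. i \<in> I ==> x \<notin> C i ==> F i x = 0"
 shows "vol_int (\<lambda>x. \<Sum>i\<in>I. F i x) = (\<Sum>i\<in>I. vol_int (F i))"
 unfolding vol_int_def
proof (rule integral_sum[OF assms(1)])
 fix i assume i: "i \<in> I"
 obtain a where "(\<lambda>y. F i (unreix y)) absolutely_integrable_on UNIV"
  by (rule vol_int_box[OF assms(2)[OF i] assms(3)[OF i] assms(4)[OF i]])
 then show "(\<lambda>y. F i (unreix y)) integrable_on UNIV" by (simp add: absolutely_integrable_on_def)
qed

lemma vol_int_cmult: "vol_int (\<lambda>x. c * F x) = c * vol_int F"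
 by (simp add: vol_int_def)

text \<open>\<open>F\<close> vanishes outside the image of \<open>S\<close> and \<open>H\<close>
  outside \<open>S\<close>, so the integrals over these two sets in the change of variables formula
  are integrals over the whole space.\<close>

lemma vol_int_change:
 fixes F H :: "real ^ 'k::finite => real"
 assumes F: "\<And>x. isCont F x" "compact C" "\<And>x. x \<notin> C ==> F x = 0" "C \<subseteq> g ` S"
  and S: "open S" and g: "\<And>x. x \<in> S ==> (g has_derivative g' x) (at x)" "inj_on g S"
  and H: "\<And>x. x \<in> S ==> H x = \<bar>det (matrix (g' x))\<bar> * F (g x)" "\<And>x. x \<notin> S ==> H x = 0"
 shows "vol_int H = vol_int F"
proof -
 obtain a where ai: "(\<lambda>y. F (unreix y)) absolutely_integrable_on UNIV" by (rule vol_int_box[OF F(1-3)])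
 define G where "G y = reix (g (unreix y))" for y
 define S' where "S' = reix ` S"
 have S'in: "unreix y \<in> S \<longleftrightarrow> y \<in> S'" for y unfolding S'_def by (metis imageE imageI reix_inverse)
 have GS: "G ` S' = reix ` g ` S" by (simp add: G_def S'_def image_image)
 have zero: "F (unreix y) = 0" if "y \<notin> G ` S'" for y
 proof -
  have "unreix y \<notin> g ` S"
  proof
   assume "unreix y \<in> g ` S"
   then have "reix (unreix y) \<in> reix ` g ` S" by (rule imageI)
   then show False using that by (simp add: GS)
  qed
  then show ?thesis using F(3,4) by blast
 qed
 have eqF: "(\<lambda>y. if y \<in> G ` S' then F (unreix y) else 0) = (\<lambda>y. F (unreix y))" using zero by auto
 have eqH: "(\<lambda>y. if y \<in> S' then H (unreix y) else 0) = (\<lambda>y. H (unreix y))" using S'in H(2) by auto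
 have "S' = unreix -` S" using S'in by blast
 moreover have "continuous_on UNIV (unreix :: _ => real ^ 'k)"
  by (simp add: continuous_on_eq_continuous_at isCont_reix(2))
 ultimately have "open S'" using open_vimage[OF S] by blast
 then have leb: "S' \<in> sets lebesgue" by simp
 define G' where "G' y v = reix (g' (unreix y) (unreix v))" for y v
 have der: "(G has_derivative G' y) (at y within S')" if y: "y \<in> S'" for y
 proof -
  have b: "bounded_linear (reix :: real ^ 'k => _)" "bounded_linear (unreix :: _ => real ^ 'k)"
   using linear_reix linear_conv_bounded_linear by blast+
  have "unreix y \<in> S" using y S'in by blast
  note d = has_derivative_compose[OF bounded_linear_imp_has_derivative[OF b(2)] g(1)[OF this]]
  from has_derivative_compose[OF d bounded_linear_imp_has_derivative[OF b(1)]]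
  show ?thesis unfolding G_def[abs_def] G'_def[abs_def] by (rule has_derivative_at_withinI)
 qed
 have inj: "inj_on G S'"
 proof (rule inj_onI)
  fix y z assume yz: "y \<in> S'" "z \<in> S'" "G y = G z"
  then have "unreix (reix (g (unreix y))) = unreix (reix (g (unreix z)))" by (simp only: G_def)
  then have "unreix y = unreix z" using yz(1,2) S'in inj_onD[OF g(2)] by simp
  then have "reix (unreix y) = reix (unreix z)" by (simp only:)
  then show "y = z" by simp
 qed
 \<comment> \<open>The change of variables formula is stated for vector-valued integrands; scalars
   are embedded as \<open>real ^ 1\<close> and read off again as its single component.\<close>
 let ?lift = "\<lambda>r::real. (vec r :: real ^ 1)"
 have bl: "bounded_linear ?lift" "bounded_linear (\<lambda>x :: real ^ 1. x $ 1)"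
  by (auto simp: linear_iff vec_eq_iff simp flip: linear_conv_bounded_linear)
 have ab: "(\<lambda>y. F (unreix y)) absolutely_integrable_on G ` S'"
  using ai absolutely_integrable_restrict_UNIV[of "G ` S'" "\<lambda>y. F (unreix y)"] by (simp only: eqF)
 from absolutely_integrable_linear[OF ab bl(1)] have fi: "(\<lambda>y. ?lift (F (unreix y))) absolutely_integrable_on G ` S'" by (simp add: comp_def)
 have iF: "(\<lambda>y. F (unreix y)) integrable_on G ` S'" using ab by (simp add: absolutely_integrable_on_def)
 let ?h = "\<lambda>y. \<bar>det (matrix (G' y))\<bar> *\<^sub>R ?lift (F (unreix (G y)))"
 have cv: "?h absolutely_integrable_on S' \<and> integral S' ?h = integral (G ` S') (\<lambda>y. ?lift (F (unreix y)))"
  using has_absolute_integral_change_of_variables[OF leb der inj, of "\<lambda>y. ?lift (F (unreix y))"] fi by blast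
 have hH: "?h y $ 1 = H (unreix y)" if "y \<in> S'" for y
 proof -
  have y: "unreix y \<in> S" using that S'in by blast
  have "det (matrix (G' y)) = det (matrix (g' (unreix y)))"
   unfolding G'_def[abs_def] by (rule det_reix) (rule has_derivative_linear[OF g(1)[OF y]])
  then show ?thesis by (simp add: H(1)[OF y] G_def)
 qed
 have "vol_int H = integral S' (\<lambda>y. H (unreix y))"
  using Henstock_Kurzweil_Integration.integral_restrict_UNIV[of S' "\<lambda>y. H (unreix y)"] unfolding eqH vol_int_def .
 also have "\<dots> = integral S' ((\<lambda>x. x $ 1) \<circ> ?h)" by (rule Henstock_Kurzweil_Integration.integral_cong) (simp only: comp_def hH)
 also have "\<dots> = integral S' ?h $ 1" by (rule integral_linear[OF _ bl(2)]) (use cv in "simp add: absolutely_integrable_on_def")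
 also have "\<dots> = integral (G ` S') (?lift \<circ> (\<lambda>y. F (unreix y))) $ 1" using cv by (simp add: comp_def)
 also have "\<dots> = integral (G ` S') (\<lambda>y. F (unreix y))" unfolding integral_linear[OF iF bl(1)] by simp
 also have "\<dots> = vol_int F"
  using Henstock_Kurzweil_Integration.integral_restrict_UNIV[of "G ` S'" "\<lambda>y. F (unreix y)"] unfolding eqF vol_int_def by simp
 finally show ?thesis .
qed

context manifold
begin

text \<open>Change of variables for a function supported in one chart whose support is mapped into
  one chart. The coordinate Jacobian is \<open>c\<close> times a quotient of densities, which are
  positive in charts of \<open>A\<close>, so it equals its absolute value.\<close>

lemma vol_transport:
 assumes rho: "positive_volume_form A rho" and th: "diffeo_pair phi th"
  and c: "c > 0" "\<And>p b. rho (phi p) (\<lambda>k. tmap A phi p (b k)) = c * rho p b"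
  and ch: "(U, psi) \<in> A" "(V, \<chi>') \<in> A" and f: "\<And>q. msmooth f q"
  and K: "compact K" "K \<subseteq> U" "phi ` K \<subseteq> V" "\<And>q. q \<notin> K ==> f q = 0"
 shows "vol_int (chart_ext rho V \<chi>' (\<lambda>q. f (th q))) = c * vol_int (chart_ext rho U psi f)"
proof -
 note phi = diffeo_pairD[OF th]
 note cU = in_atlas_max[OF ch(1)] and cV = in_atlas_max[OF ch(2)]
 note UD = max_chartD[OF cU] and VD = max_chartD[OF cV]
 note rho' = positive_top_form[OF rho]
 have cont: "continuous_on UNIV phi" by (simp add: continuous_on_eq_continuous_at mmap_isCont[OF phi(1)])
 let ?W = "U \<inter> phi -` V"
 let ?g = "\<lambda>x. \<chi>' (phi (inv_into U psi x))"
 have oW: "open (phi -` V)" by (rule open_vimage[OF VD(1) cont])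
 have oS: "open (psi ` ?W)" by (rule open_chart_image[OF cU oW])
 have ft: "msmooth (\<lambda>q. f (th q)) q" for q by (rule mmap_msmooth(1)[OF phi(2) f])
 have ck: "compact (phi ` K)" by (rule compact_continuous_image[OF continuous_on_subset[OF cont] K(1)]) simp
 have zero: "f (th q) = 0" if "q \<notin> phi ` K" for q
 proof (rule K(4))
  show "th q \<notin> K" using that phi(3)[of q] by (metis imageI)
 qed
 note E = smooth_at_isCont[OF chart_ext(1)[OF rho ch(2) ft ck K(3) zero]] chart_ext(2,3)[OF rho ch(2) ft ck K(3) zero]
 have sub: "\<chi>' ` phi ` K \<subseteq> ?g ` psi ` ?W"
 proof
  fix y assume "y \<in> \<chi>' ` phi ` K"
  then obtain q where q: "q \<in> K" "y = \<chi>' (phi q)" by blast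
  then have "q \<in> ?W" "y = ?g (psi q)" using K(2,3) UD(6)[of q] by auto
  then show "y \<in> ?g ` psi ` ?W" by blast
 qed
 have sg: "smooth_at ?g (psi q)" if "q \<in> ?W" for q
  by (rule msmoothD[OF cU _ mmap_msmooth(1)[OF phi(1) msmooth_chart[OF cV]]]) (use that in auto)
 have der: "(?g has_derivative fd ?g x) (at x)" if "x \<in> psi ` ?W" for x
  using smooth_at_has_derivative[OF sg] that by blast
 have inj: "inj_on ?g (psi ` ?W)"
 proof (rule inj_onI)
  fix x y assume xy: "x \<in> psi ` ?W" "y \<in> psi ` ?W" "?g x = ?g y"
  then obtain p q where pq: "p \<in> ?W" "x = psi p" "q \<in> ?W" "y = psi q" by blast
  then have "\<chi>' (phi p) = \<chi>' (phi q)" using xy(3) UD(6) by simp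
  then have "phi p = phi q" using inj_onD[OF VD(3)] pq by blast
  then have "p = q" using phi(4) by metis
  then show "x = y" by (simp add: pq)
 qed
 have H: "c * chart_ext rho U psi f x = \<bar>det (matrix (fd ?g x))\<bar> * chart_ext rho V \<chi>' (\<lambda>q. f (th q)) (?g x)" if x: "x \<in> psi ` ?W" for x
 proof -
  obtain p where p: "p \<in> U" "phi p \<in> V" "x = psi p" using x by blast
  have pW: "p \<in> ?W" using p by simp
  note lin = smooth_at_linear[OF sg[OF pW]]
  have "dd \<chi>' (phi p) (tmap A phi p (lift psi p v)) = fd ?g (psi p) v" for v
   unfolding tmap_chart[OF cV p(2) phi(1)] dd_in_chart[OF cU p(1) mmap_msmooth(1)[OF phi(1) msmooth_chart[OF cV p(2)]]]
   by (simp add: lift(1)[OF cU p(1)])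
  then have "rho (phi p) (\<lambda>k. tmap A phi p (lift psi p (axis k 1))) = dens rho \<chi>' (phi p) * det (matrix (fd ?g (psi p)))"
   unfolding top_form_dens[OF rho' cV p(2)] using det_matrix_axis[OF lin] by simp
  then have e: "dens rho \<chi>' (phi p) * det (matrix (fd ?g (psi p))) = c * dens rho psi p"
   using c(2)[of p "\<lambda>k. lift psi p (axis k 1)"] by (simp add: dens_def)
  have pos: "dens rho \<chi>' (phi p) > 0" "dens rho psi p > 0" by (rule dens_pos[OF rho ch(2) p(2)], rule dens_pos[OF rho ch(1) p(1)])
  then have "dens rho \<chi>' (phi p) * det (matrix (fd ?g (psi p))) > 0" unfolding e using c(1) by simp
  then have dpos: "det (matrix (fd ?g (psi p))) > 0" using pos(1) by (simp add: zero_less_mult_iff)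
  have "chart_ext rho V \<chi>' (\<lambda>q. f (th q)) (\<chi>' (phi p)) = f p * dens rho \<chi>' (phi p)"
   using p(2) by (simp add: chart_ext_def VD(6) phi(4))
  moreover have "chart_ext rho U psi f (psi p) = f p * dens rho psi p" using p(1) by (simp add: chart_ext_def UD(6))
  ultimately show ?thesis using dpos e by (simp add: p(3) UD(6)[OF p(1)] mult_ac)
 qed
 have out: "c * chart_ext rho U psi f x = 0" if x: "x \<notin> psi ` ?W" for x
 proof -
  have "K \<subseteq> ?W" using K(2,3) by auto
  then have "x \<notin> psi ` K" using x image_mono[of K ?W psi] by (meson subsetD)
  from chart_ext(3)[OF rho ch(1) f K(1,2,4) this] show ?thesis by simp
 qed
 have "vol_int (\<lambda>x. c * chart_ext rho U psi f x) = vol_int (chart_ext rho V \<chi>' (\<lambda>q. f (th q)))"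
  by (rule vol_int_change[OF E sub oS der inj H out])
 then show ?thesis by (simp add: vol_int_cmult)
qed

end

context compact_manifold
begin

text \<open>Both \<open>\<Sum>i. vol_int (E i (wt i))\<close> and its multiple by \<open>c\<close> are obtained from the double sum over
 the functions \<open>wt i * (wt j \<circ> phi)\<close>.\<close>

lemma volume_scaling_trivial:
 assumes rho: "positive_volume_form A rho" and d: "diffeo A phi"
  and c: "c > 0" "\<And>p b. rho (phi p) (\<lambda>k. tmap A phi p (b k)) = c * rho p b"
 shows "c = 1"
proof -
 obtain th where th: "diffeo_pair phi th" using d diffeo_iff by blast
 note phi = diffeo_pairD[OF th]
 have "open (cU i)" for i using is_chartD(1)[OF chart_at_is_chart] .
 then obtain I K and wt :: "'m => 'm => real" where P: "finite I" "\<And>i. closed (K i)" "\<And>i. K i \<subseteq> cU i"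
  "\<And>i q. msmooth (wt i) q" "\<And>i q. wt i q \<ge> 0" "\<And>i q. q \<notin> K i ==> wt i q = 0" "\<And>q. (\<Sum>i\<in>I. wt i q) = 1"
  by (rule partition_of_unity[of cU]) (use chart_at_in in blast)+
 have ch: "(cU i, cf i) \<in> A" for i using chart_at_in(1)[of i] by simp
 have cl: "compact S" if "closed S" for S :: "'m set" using compact_Int_closed[OF compact that] by simp
 define E where "E i = chart_ext rho (cU i) (cf i)" for i
 have E_sum: "E i (\<lambda>q. \<Sum>j\<in>I. f j q) x = (\<Sum>j\<in>I. E i (f j) x)" for i x and f :: "'m => 'm => real"
  by (simp add: E_def chart_ext_def sum_distrib_right)
 have ms: "msmooth (\<lambda>q. wt i q * wt j (phi q)) q" "msmooth (\<lambda>q. wt i (th q) * wt j q) q" for i j q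
  by (intro msmooth_mult P(4) mmap_msmooth(1)[OF phi(1) P(4)] mmap_msmooth(1)[OF phi(2) P(4)])+
 have cont: "continuous_on UNIV phi" by (simp add: continuous_on_eq_continuous_at mmap_isCont[OF phi(1)])
 have vs: "vol_int (E i (\<lambda>q. \<Sum>j\<in>I. f j q)) = (\<Sum>j\<in>I. vol_int (E i (f j)))"
  if f: "\<And>j q. msmooth (f j) q" "\<And>j q. q \<notin> K i ==> f j q = 0" for i and f :: "'m => 'm => real"
  unfolding E_sum[abs_def]
  by (rule vol_int_sum[OF P(1), where C = "\<lambda>j. cf i ` K i"]) (simp_all add: E_def chart_ext[OF rho ch f(1) cl[OF P(2)] P(3) f(2)] smooth_at_isCont)
 \<comment> \<open>Each product of a weight and a transported weight is supported in a single chart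
   on the source and on the target, as \<open>vol_transport\<close> demands.\<close>
 have tr: "vol_int (E j (\<lambda>q. wt i (th q) * wt j q)) = c * vol_int (E i (\<lambda>q. wt i q * wt j (phi q)))" for i j
 proof -
  have K': "compact (K i \<inter> phi -` K j)" by (intro cl closed_Int P(2) closed_vimage[OF P(2) cont])
  have z: "wt i q * wt j (phi q) = 0" if "q \<notin> K i \<inter> phi -` K j" for q using that P(6) by auto
  have s: "K i \<inter> phi -` K j \<subseteq> cU i" "phi ` (K i \<inter> phi -` K j) \<subseteq> cU j" using P(3) by auto
  show ?thesis
   using vol_transport[OF rho th c ch ch ms(1) K' s z] by (simp add: E_def phi(3))
 qed
 define V where "V = (\<Sum>i\<in>I. vol_int (E i (wt i)))"
 have "V = (\<Sum>j\<in>I. \<Sum>i\<in>I. vol_int (E j (\<lambda>q. wt i (th q) * wt j q)))"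
  unfolding V_def
 proof (rule sum.cong[OF refl])
  fix j
  have "wt j = (\<lambda>q. \<Sum>i\<in>I. wt i (th q) * wt j q)" by (simp add: sum_distrib_right[symmetric] P(7))
  then show "vol_int (E j (wt j)) = (\<Sum>i\<in>I. vol_int (E j (\<lambda>q. wt i (th q) * wt j q)))"
   using vs[of "\<lambda>i q. wt i (th q) * wt j q" j, OF ms(2)] P(6) by simp
 qed
 also have "\<dots> = c * (\<Sum>i\<in>I. \<Sum>j\<in>I. vol_int (E i (\<lambda>q. wt i q * wt j (phi q))))"
  unfolding tr sum_distrib_left by (rule sum.swap)
 also have "(\<Sum>i\<in>I. \<Sum>j\<in>I. vol_int (E i (\<lambda>q. wt i q * wt j (phi q)))) = V"
  unfolding V_def
 proof (rule sum.cong[OF refl])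
  fix i
  have "wt i = (\<lambda>q. \<Sum>j\<in>I. wt i q * wt j (phi q))" by (simp add: sum_distrib_left[symmetric] P(7))
  then show "(\<Sum>j\<in>I. vol_int (E i (\<lambda>q. wt i q * wt j (phi q)))) = vol_int (E i (wt i))"
   using vs[of "\<lambda>j q. wt i q * wt j (phi q)" i, OF ms(1)] P(6) by simp
 qed
 finally have V: "V = c * V" .
 \<comment> \<open>Cancellation in V = c V requires this. All terms are non-negative, and a weight
   that is positive at \<open>p0\<close> contributes a positive integral.\<close>
 have "V > 0"
 proof -
  fix p0
  obtain i where i: "i \<in> I" "wt i p0 \<noteq> 0" using P(7)[of p0] by (metis (no_types, lifting) sum.neutral zero_neq_one)
  note ce = smooth_at_isCont[OF chart_ext(1)[OF rho ch P(4) cl[OF P(2)] P(3) P(6)]] chart_ext(2,3)[OF rho ch P(4) cl[OF P(2)] P(3) P(6)]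
  have Epos: "E i (wt i) x \<ge> 0" for i x
   unfolding E_def chart_ext_def
   using mult_nonneg_nonneg[OF P(5) less_imp_le[OF dens_pos[OF rho ch is_chartD(8)[OF chart_at_is_chart]]]] by simp
  have p: "p0 \<in> cU i" using i(2) P(3,6) by blast
  have "E i (wt i) (cf i p0) > 0"
   using p i(2) P(5)[of i p0] dens_pos[OF rho ch p] is_chartD(6)[OF chart_at_is_chart p]
   by (simp add: E_def chart_ext_def zero_less_mult_iff)
  then have "vol_int (E i (wt i)) > 0" using vol_int_nonneg(2)[OF ce Epos[unfolded E_def]] by (simp add: E_def)
  moreover have "vol_int (E i (wt i)) \<ge> 0" for i using vol_int_nonneg(1)[OF ce Epos[unfolded E_def]] by (simp add: E_def)
  ultimately show ?thesis unfolding V_def by (intro sum_pos2[OF P(1) i(1)])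
 qed
 with V show ?thesis by simp
qed

end

section \<open>Pluriharmonic functions\<close>

text \<open>On a complex line a pluriharmonic function is the real part of a holomorphic function \<open>g\<close>, and
 the maximum modulus principle applies to \<open>exp g\<close>.\<close>

lemma pluriharmonic_maximum:
 fixes G :: "'n::finite model => real"
 assumes G: "\<And>x. x \<in> ball a r ==> smooth_at G x"
  and hess: "\<And>x u v. x \<in> ball a r ==> fd (\<lambda>y. fd G y (std_complex v)) x u = fd (\<lambda>y. fd G y (std_complex u)) x v"
  and max: "\<And>x. x \<in> ball a r ==> G x \<le> G a" and y: "y \<in> ball a r"
 shows "G y = G a"
proof -
 define v where "v = y - a"
 let ?J = "std_complex v"
 \<comment> \<open>The complex line through \<open>a\<close> and \<open>y\<close>, parametrised so
   that 0 is sent to \<open>a\<close> and 1 to \<open>y\<close>.\<close>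
 define zeta where "zeta z = a + Re z *\<^sub>R v + Im z *\<^sub>R ?J" for z
 define D where "D = zeta -` ball a r"
 have dzeta: "(zeta has_derivative (\<lambda>h. Re h *\<^sub>R v + Im h *\<^sub>R ?J)) (at z within S)" for z S
  unfolding zeta_def by (auto intro!: derivative_eq_intros)
 have "continuous_on UNIV zeta" unfolding zeta_def by (intro continuous_intros)
 then have oD: "open D" unfolding D_def by (intro open_vimage open_ball)
 have cD: "convex D"
 proof (rule convexI)
  fix z w and s t :: real assume zw: "z \<in> D" "w \<in> D" and st: "0 \<le> s" "0 \<le> t" "s + t = 1"
  have "zeta (s *\<^sub>R z + t *\<^sub>R w) = s *\<^sub>R zeta z + t *\<^sub>R zeta w"
   using st(3) by (simp add: zeta_def algebra_simps flip: scaleR_add_left)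
  then show "s *\<^sub>R z + t *\<^sub>R w \<in> D" using zw st convexD[OF convex_ball] by (simp add: D_def)
 qed
 have r0: "a \<in> ball a r" using y by (metis centre_in_ball mem_ball dist_not_less_zero less_le_trans linorder_not_less order_le_less_trans zero_le_dist)
 have D01: "0 \<in> D" "1 \<in> D" "zeta 0 = a" "zeta 1 = y" using y r0 by (simp_all add: D_def zeta_def v_def)
 define p1 where "p1 z = fd G (zeta z) v" for z
 define p2 where "p2 z = fd G (zeta z) ?J" for z
 \<comment> \<open>The derivative that a holomorphic function with real part \<open>G\<close> along
   the line must have. Its Cauchy--Riemann equations are the symmetry of the Hessian and the
   relation \<open>jj\<close>.\<close>
 define f where "f z = of_real (p1 z) - \<i> * of_real (p2 z)" for z
 have hol: "\<exists>f'. (f has_field_derivative f') (at z)" if z: "z \<in> D" for z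
 proof -
  have b: "zeta z \<in> ball a r" using z by (simp add: D_def)
  note s = G[OF b]
  let ?H = "\<lambda>u w. fd (\<lambda>y. fd G y u) (zeta z) w"
  have lin: "linear (\<lambda>w. ?H u w)" for u by (rule smooth_at_linear[OF smooth_at_fd[OF s]])
  have dp: "(p1 has_derivative (\<lambda>h. ?H v (Re h *\<^sub>R v + Im h *\<^sub>R ?J))) (at z)"
   "(p2 has_derivative (\<lambda>h. ?H ?J (Re h *\<^sub>R v + Im h *\<^sub>R ?J))) (at z)"
   unfolding p1_def[abs_def] p2_def[abs_def]
   by (rule has_derivative_compose[OF dzeta smooth_at_has_derivative[OF smooth_at_fd[OF s]]])+
  have "?H (- v) v = - ?H v v"
  proof -
   have "\<forall>\<^sub>F y in nhds (zeta z). fd G y (- v) = - fd G y v"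
    using smooth_at_eventually[OF s] by eventually_elim (simp add: linear_neg[OF smooth_at_linear])
   from fd_cong[OF this] show ?thesis by (simp add: fd_minus[OF smooth_at_fd[OF s]])
  qed
  \<comment> \<open>The hypothesis on the Hessian for the pair I v and v; it says that
    \<open>G\<close> is harmonic along the line.\<close>
  then have jj: "?H ?J ?J = - ?H v v" using hess[OF b, of ?J v] by simp
  have sym: "?H ?J v = ?H v ?J" by (rule fd_commute_real[OF s])
  have "(f has_derivative (\<lambda>h. of_real (?H v (Re h *\<^sub>R v + Im h *\<^sub>R ?J)) - \<i> * of_real (?H ?J (Re h *\<^sub>R v + Im h *\<^sub>R ?J)))) (at z)"
   unfolding f_def by (auto intro!: derivative_eq_intros dp)
  moreover have "(\<lambda>h. of_real (?H v (Re h *\<^sub>R v + Im h *\<^sub>R ?J)) - \<i> * of_real (?H ?J (Re h *\<^sub>R v + Im h *\<^sub>R ?J)))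
   = (*) (Complex (?H v v) (- ?H v ?J))"
   by (simp add: fun_eq_iff complex_eq_iff linear_add[OF lin] linear_scale[OF lin] jj sym algebra_simps)
  ultimately show ?thesis unfolding has_field_derivative_def by auto
 qed
 then have "f holomorphic_on D"
  unfolding holomorphic_on_def field_differentiable_def using has_field_derivative_at_within by blast
 then obtain g where g: "\<And>z. z \<in> D ==> (g has_field_derivative f z) (at z within D)"
  by (rule holomorphic_convex_primitive'[OF cD oD]) (rule that, blast)
 have "((\<lambda>z. G (zeta z) - Re (g z)) has_derivative (\<lambda>h. 0)) (at z within D)" if z: "z \<in> D" for z
 proof -
  have b: "zeta z \<in> ball a r" using z by (simp add: D_def)
  note lin = smooth_at_linear[OF G[OF b]]
  have 1: "((\<lambda>z. G (zeta z)) has_derivative (\<lambda>h. fd G (zeta z) (Re h *\<^sub>R v + Im h *\<^sub>R ?J))) (at z within D)"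
   by (rule has_derivative_compose[OF dzeta smooth_at_has_derivative[OF G[OF b]]])
  have 2: "((\<lambda>z. Re (g z)) has_derivative (\<lambda>h. Re (f z * h))) (at z within D)"
   using has_derivative_Re[OF g[OF z, unfolded has_field_derivative_def]] .
  have 3: "(\<lambda>h. fd G (zeta z) (Re h *\<^sub>R v + Im h *\<^sub>R ?J) - Re (f z * h)) = (\<lambda>h. 0)"
   by (simp add: fun_eq_iff linear_add[OF lin] linear_scale[OF lin] f_def p1_def p2_def)
  from has_derivative_diff[OF 1 2] show ?thesis unfolding 3 .
 qed
 from has_derivative_zero_constant[OF cD this] obtain c where "\<forall>z\<in>D. G (zeta z) - Re (g z) = c" by (rule exE)
 then have c: "\<And>z. z \<in> D ==> G (zeta z) - Re (g z) = c" by (rule bspec)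
 have "(\<lambda>z. exp (g z)) constant_on D"
 proof (rule maximum_modulus_principle[where U = D and \<xi> = 0])
  have "g holomorphic_on D" unfolding holomorphic_on_def field_differentiable_def using g by blast
  then show "(\<lambda>z. exp (g z)) holomorphic_on D" by (intro holomorphic_intros)
  show "norm (exp (g z)) \<le> norm (exp (g 0))" if "z \<in> D" for z
  proof -
   have "Re (g z) = G (zeta z) - c" "Re (g 0) = G a - c" using c[OF that] c[OF D01(1)] D01(3) by simp_all
   then show ?thesis using max[of "zeta z"] that by (simp add: norm_exp_eq_Re D_def)
  qed
 qed (use oD cD D01 convex_connected in auto)
 then have "exp (g 1) = exp (g 0)" using D01 by (auto simp: constant_on_def)
 then have "Re (g 1) = Re (g 0)" by (metis exp_inj_iff norm_exp_eq_Re)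
 then show ?thesis using c[OF D01(1)] c[OF D01(2)] D01(3,4) by simp
qed

context compact_manifold
begin

text \<open>Compactness provides a maximum. The set where it is attained is closed by continuity and
  open by the maximum principle in holomorphic charts, so it is everything by connectedness.\<close>

lemma ddc_zero_constant:
 assumes conn: "connected (UNIV :: 'm set)" and J: "integrable_complex A J" and F: "\<And>q. msmooth F q"
  and z: "\<And>p u v. ddc J F p u v = 0"
 shows "F p = F q"
proof -
 have cont: "continuous_on UNIV F" using msmooth_isCont[OF F] by (simp add: continuous_on_eq_continuous_at)
 obtain m where m: "\<And>p. F p \<le> F m" using continuous_attains_sup[OF compact _ cont] by auto
 define C where "C = {p. F p = F m}"
 have "\<exists>T. open T \<and> p \<in> T \<and> T \<subseteq> C" if p: "p \<in> C" for p
 proof -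
  have "p \<in> (\<Union>c\<in>holomorphic_charts A J. fst c)" using J by (simp add: integrable_complex_def)
  then obtain U psi where h: "(U, psi) \<in> holomorphic_charts A J" "p \<in> U" by auto
  note c = holomorphic_chartD(1)[OF h(1)]
  note cD = max_chartD[OF c]
  obtain r where r: "r > 0" "ball (psi p) r \<subseteq> psi ` U" using cD(2) h(2) open_contains_ball by blast
  define G where "G x = F (inv_into U psi x)" for x
  have ball: "\<exists>q\<in>U. x = psi q" if "x \<in> ball (psi p) r" for x using that r(2) by blast
  have G: "smooth_at G x" if "x \<in> ball (psi p) r" for x
   using ball[OF that] msmoothD[OF c _ F] unfolding G_def by blast
  have hess: "fd (\<lambda>y. fd G y (std_complex v)) x u = fd (\<lambda>y. fd G y (std_complex u)) x v" if x: "x \<in> ball (psi p) r" for x u v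
  proof -
   obtain q where q: "q \<in> U" "x = psi q" using ball[OF x] by blast
   have "0 = ddc J F q (lift psi q u) (lift psi q v)" by (simp add: z)
   also have "\<dots> = fd (\<lambda>y. fd G y (std_complex v)) x u - fd (\<lambda>y. fd G y (std_complex u)) x v"
    unfolding ddc_hess[OF h(1) q(1) F] lift(1)[OF c q(1)] G_def q(2) ..
   finally show ?thesis by simp
  qed
  have Gp: "G (psi p) = F m" using p by (simp add: G_def cD(6)[OF h(2)] C_def)
  have eq: "G x = F m" if "x \<in> ball (psi p) r" for x
   using pluriharmonic_maximum[OF G hess _ that] m by (simp add: Gp) (simp add: G_def)
  let ?T = "U \<inter> psi -` ball (psi p) r"
  have "open ?T" by (rule continuous_open_preimage[OF cD(4,1) open_ball])
  moreover have "p \<in> ?T" using h(2) r(1) by simp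
  moreover have "?T \<subseteq> C"
  proof
   fix q assume q: "q \<in> ?T"
   then have "G (psi q) = F m" by (intro eq) simp
   then show "q \<in> C" using q cD(6) by (simp add: G_def C_def)
  qed
  ultimately show ?thesis by blast
 qed
 then have "open C" by (subst open_subopen) blast
 moreover have "closed C" unfolding C_def by (rule closed_Collect_eq[OF cont continuous_on_const])
 moreover have "m \<in> C" by (simp add: C_def)
 ultimately have "C = UNIV" using connectedD[OF conn, of C "- C"] by (auto simp: open_Compl)
 then have "F p = F m" for p unfolding C_def by blast
 then show ?thesis by metis
qed

end

section \<open>Naturality of charts, potentials and densities under diffeomorphisms\<close>

context manifold
begin

text \<open>With the chart \<open>psi\<close> on the target and its composition with
  \<open>phi\<close> on the source, \<open>phi\<close> has the identity as its coordinate
  expression. The explicit inverse of the new chart allows functions in the two charts to be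
  compared directly.\<close>

lemma pullback_chart:
 assumes th: "diffeo_pair phi th"
  and c: "(V, psi) \<in> max_atlas A"
 shows "(phi -` V, \<lambda>q. psi (phi q)) \<in> max_atlas A"
  "x \<in> psi ` V ==> inv_into (phi -` V) (\<lambda>q. psi (phi q)) x = th (inv_into V psi x)"
proof -
 note phi = diffeo_pairD[OF th]
 note cD = max_chartD[OF c]
 let ?U = "phi -` V" and ?psi = "\<lambda>q. psi (phi q)"
 have cont: "continuous_on UNIV phi" "continuous_on UNIV th"
  by (simp_all add: continuous_on_eq_continuous_at mmap_isCont[OF phi(1)] mmap_isCont[OF phi(2)])
 have inj: "inj_on ?psi ?U"
 proof (rule inj_onI)
  fix p q assume "p \<in> ?U" "q \<in> ?U" "psi (phi p) = psi (phi q)"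
  then have "phi p = phi q" using inj_onD[OF cD(3)] by blast
  then have "th (phi p) = th (phi q)" by (simp only:)
  then show "p = q" by (simp only: phi(4))
 qed
 have im: "?psi ` ?U = psi ` V"
 proof (intro equalityI subsetI)
  fix x assume "x \<in> psi ` V"
  then obtain q where q: "q \<in> V" "x = psi q" by blast
  then show "x \<in> ?psi ` ?U" by (intro image_eqI[of _ _ "th q"]) (simp_all add: phi(3))
 qed blast
 have inv: "inv_into ?U ?psi x = th (inv_into V psi x)" if "x \<in> psi ` V" for x
  by (rule inv_into_f_eq[OF inj]) (simp_all add: phi(3) cD(7,8)[OF that])
 then show "x \<in> psi ` V ==> inv_into ?U ?psi x = th (inv_into V psi x)" .
 have oU: "open ?U" by (rule open_vimage[OF cD(1) cont(1)])
 have hom: "homeomorphism ?U (?psi ` ?U) ?psi (inv_into ?U ?psi)"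
  unfolding homeomorphism_def
 proof (intro conjI ballI refl)
  show "continuous_on ?U ?psi"
   by (rule continuous_on_compose2[OF cD(4) continuous_on_subset[OF cont(1)]]) auto
  have "continuous_on (psi ` V) (\<lambda>x. th (inv_into V psi x))"
   by (rule continuous_on_compose2[OF cont(2) cD(5)]) auto
  then show "continuous_on (?psi ` ?U) (inv_into ?U ?psi)"
   unfolding im by (rule continuous_on_eq) (simp add: inv)
  show "inv_into ?U ?psi (?psi q) = q" if "q \<in> ?U" for q by (rule inv_into_f_f[OF inj that])
  show "inv_into ?U ?psi ` ?psi ` ?U = ?U" by (rule inv_into_image_cancel[OF inj order_refl])
  show "?psi (inv_into ?U ?psi x) = x" if "x \<in> ?psi ` ?U" for x using f_inv_into_f[OF that] .
 qed
 have chart: "is_chart (?U, ?psi)" unfolding is_chart_def using oU cD(2) hom by (simp add: im)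
 have sm: "msmooth ?psi p" if "p \<in> ?U" for p
  using mmap_msmooth(1)[OF phi(1) msmooth_chart[OF c]] that by simp
 have "smooth_transition (?U, ?psi) (W, \<chi>') \<and> smooth_transition (W, \<chi>') (?U, ?psi)" if d: "(W, \<chi>') \<in> A" for W \<chi>'
 proof -
  note d' = in_atlas_max[OF d]
  have oW: "open W" by (rule max_chartD(1)[OF d'])
  have im2: "?psi ` (?U \<inter> W) = psi ` (V \<inter> th -` W)"
  proof (intro equalityI subsetI)
   fix x assume "x \<in> psi ` (V \<inter> th -` W)"
   then obtain q where q: "q \<in> V" "th q \<in> W" "x = psi q" by blast
   then show "x \<in> ?psi ` (?U \<inter> W)" by (intro image_eqI[of _ _ "th q"]) (simp_all add: phi(3))
  qed (auto simp: phi(4))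
  have "smooth_on (?psi ` (?U \<inter> W)) (\<chi>' \<circ> inv_into ?U ?psi)"
   unfolding smooth_on_iff_smooth_at im2
  proof (intro conjI ballI)
   show "open (psi ` (V \<inter> th -` W))" by (rule open_chart_image[OF c open_vimage[OF oW cont(2)]])
   fix x assume "x \<in> psi ` (V \<inter> th -` W)"
   then obtain q where q: "q \<in> V" "th q \<in> W" "x = psi q" by blast
   have 1: "smooth_at (\<lambda>x. \<chi>' (th (inv_into V psi x))) x"
    unfolding q(3) by (rule msmoothD[OF c q(1) mmap_msmooth(1)[OF phi(2) msmooth_chart[OF d' q(2)]]])
   have "\<forall>\<^sub>F x in nhds x. \<chi>' (th (inv_into V psi x)) = (\<chi>' \<circ> inv_into ?U ?psi) x"
    using ev_chart(2)[OF c q(1)] unfolding q(3) by eventually_elim (simp add: inv)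
   from smooth_at_cong[OF 1 this] show "smooth_at (\<chi>' \<circ> inv_into ?U ?psi) x" .
  qed
  moreover have "smooth_on (\<chi>' ` (W \<inter> ?U)) (?psi \<circ> inv_into W \<chi>')"
   unfolding smooth_on_iff_smooth_at
  proof (intro conjI ballI)
   show "open (\<chi>' ` (W \<inter> ?U))" by (rule open_chart_image[OF d' oU])
   fix x assume "x \<in> \<chi>' ` (W \<inter> ?U)"
   then obtain p where p: "p \<in> W" "p \<in> ?U" "x = \<chi>' p" by blast
   show "smooth_at (?psi \<circ> inv_into W \<chi>') x" using msmoothD[OF d' p(1) sm[OF p(2)]] by (simp add: comp_def p(3))
  qed
  ultimately show ?thesis by (simp add: smooth_transition_def)
 qed
 then show "(?U, ?psi) \<in> max_atlas A" unfolding max_atlas_def using chart by auto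
qed

lemma pullback_endo_tmap:
 assumes "diffeo A phi"
 shows "tmap A phi p (pullback_endo A phi J p v) = J (phi p) (tmap A phi p v)"
 unfolding pullback_endo_def using diffeo_tmap(1)[OF assms] by (simp add: bij_is_surj surj_f_inv_f)

lemma dd_pullback_chart:
 assumes "mmap phi p" "(V, psi) \<in> max_atlas A" "phi p \<in> V"
 shows "dd (\<lambda>q. psi (phi q)) p v = dd psi (phi p) (tmap A phi p v)"
 by (rule mmap_msmooth(2)[OF assms(1) msmooth_chart[OF assms(2,3)]])

lemma pullback_holomorphic_chart:
 assumes d: "diffeo A phi" and h: "(V, psi) \<in> holomorphic_charts A J"
 shows "(phi -` V, \<lambda>q. psi (phi q)) \<in> holomorphic_charts A (pullback_endo A phi J)"
proof -
 obtain th where th: "diffeo_pair phi th" using d diffeo_iff by blast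
 note phi = diffeo_pairD[OF th]
 note c = holomorphic_chartD(1)[OF h]
 have "dd (\<lambda>q. psi (phi q)) p (pullback_endo A phi J p v) = std_complex (dd (\<lambda>q. psi (phi q)) p v)" if "phi p \<in> V" for p v
  unfolding dd_pullback_chart[OF phi(1) c that] pullback_endo_tmap[OF d] by (rule holomorphic_chartD(2)[OF h that])
 then show ?thesis
  using pullback_chart(1)[OF th c] unfolding holomorphic_charts_def max_atlas_def by simp
qed

text \<open>In a holomorphic chart \<open>J\<close> is the transported standard structure, so
  linearity, the square and smoothness are read off there. For a pulled back structure this spares
  an argument about tangent maps.\<close>

lemma holomorphic_cover_integrable:
 assumes cover: "\<And>p. \<exists>U psi. (U, psi) \<in> holomorphic_charts A J \<and> p \<in> U"
 shows "integrable_complex A J"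
 unfolding integrable_complex_def almost_complex_def
proof (intro conjI allI impI)
 show "(\<Union>c\<in>holomorphic_charts A J. fst c) = UNIV" using cover by force
 fix p
 obtain U psi where h: "(U, psi) \<in> holomorphic_charts A J" "p \<in> U" using cover by blast
 note c = holomorphic_chartD(1)[OF h(1)] h(2) and J = holomorphic_chartD(2)[OF h]
 have "J p = (\<lambda>v. lift psi p (std_complex (dd psi p v)))"
  using J lift(2)[OF c] by (metis (no_types, lifting) ext)
 then show "linear (J p)"
  using linear_compose[OF linear_compose[OF dd_chart_linear[OF c] linear_std_complex] lift(3)[OF c]] by (simp add: comp_def)
 show "J p (J p v) = - v" for v
  by (rule dd_chart_inj[OF c]) (simp add: J linear_neg[OF dd_chart_linear[OF c]])
next
 fix X assume X: "vector_field A X"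
 show "vector_field A (\<lambda>p. J p (X p))"
  unfolding vector_field_iff
 proof
  fix p
  obtain U psi where h: "(U, psi) \<in> holomorphic_charts A J" "p \<in> U" using cover by blast
  note c = holomorphic_chartD(1)[OF h(1)] h(2)
  show "vsmooth (\<lambda>p. J p (X p)) p"
  proof (rule vsmoothI[OF c])
   show "msmooth (\<lambda>q. std_complex (dd psi q (X q))) p"
    by (rule msmooth_linear[OF linear_std_complex vsmoothD[OF c vector_fieldD[OF X]]])
   show "\<forall>\<^sub>F q in nhds p. dd psi q (J q (X q)) = std_complex (dd psi q (X q))"
    using ev_chart(1)[OF c(1) c(2)] by eventually_elim (rule holomorphic_chartD(2)[OF h(1)])
  qed
 qed
qed

lemma integrable_cover: "integrable_complex A J ==> \<exists>U psi. (U, psi) \<in> holomorphic_charts A J \<and> p \<in> U"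
proof -
 assume "integrable_complex A J"
 then have "p \<in> (\<Union>c\<in>holomorphic_charts A J. fst c)" by (simp add: integrable_complex_def)
 then show ?thesis by auto
qed

lemma integrable_pullback:
 assumes d: "diffeo A phi" and J: "integrable_complex A J"
 shows "integrable_complex A (pullback_endo A phi J)"
proof (rule holomorphic_cover_integrable)
 fix p
 obtain V psi where h: "(V, psi) \<in> holomorphic_charts A J" "phi p \<in> V" using integrable_cover[OF J] by blast
 then show "\<exists>U psi. (U, psi) \<in> holomorphic_charts A (pullback_endo A phi J) \<and> p \<in> U"
  using pullback_holomorphic_chart[OF d h(1)] by (intro exI[of _ "phi -` V"] exI[of _ "\<lambda>q. psi (phi q)"]) simp
qed

text \<open>In the charts related by \<open>pullback_chart\<close> the two functions have the same
  coordinate expression, hence the same Hessian, and \<open>ddc_hess\<close> is evaluated on both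
  sides.\<close>

lemma ddc_pullback:
 assumes d: "diffeo A phi" and h: "(V, psi) \<in> holomorphic_charts A J" "phi p \<in> V" and f: "msmooth f (phi p)"
 shows "ddc (pullback_endo A phi J) (\<lambda>q. f (phi q)) p u v = ddc J f (phi p) (tmap A phi p u) (tmap A phi p v)"
proof -
 obtain th where th: "diffeo_pair phi th" using d diffeo_iff by blast
 note phi = diffeo_pairD[OF th]
 note c = holomorphic_chartD(1)[OF h(1)]
 let ?F = "\<lambda>x. f (phi (inv_into (phi -` V) (\<lambda>q. psi (phi q)) x))" and ?G = "\<lambda>x. f (inv_into V psi x)"
 have "?F x = ?G x" if "x \<in> psi ` V" for x by (simp add: pullback_chart(2)[OF th c that] phi(3))
 then have ev: "\<forall>\<^sub>F y in nhds x. ?F y = ?G y" if "x \<in> psi ` V" for x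
  using eventually_mono[OF eventually_nhds_in_open[OF max_chartD(2)[OF c] that]] by simp
 have eq: "fd ?F x = fd ?G x" if "x \<in> psi ` V" for x by (rule fd_cong[OF ev[OF that]])
 have eq2: "fd (\<lambda>x. fd ?F x w) (psi (phi p)) = fd (\<lambda>x. fd ?G x w) (psi (phi p))" for w
  by (rule fd_cong, rule eventually_mono[OF eventually_nhds_in_open[OF max_chartD(2)[OF c] imageI[OF h(2)]]]) (simp add: eq)
 show ?thesis
  using ddc_hess[OF pullback_holomorphic_chart[OF d h(1)], of p "\<lambda>q. f (phi q)" u v] h(2) mmap_msmooth(1)[OF phi(1) f]
  by (simp add: ddc_hess[OF h f] dd_pullback_chart[OF phi(1) c h(2)] eq2)
qed

lemma dens_pullback:
 assumes d: "diffeo A phi" and c: "(V, psi) \<in> max_atlas A" "phi q \<in> V"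
 shows "dens rho psi (phi q) = rho (phi q) (\<lambda>k. tmap A phi q (lift (\<lambda>q. psi (phi q)) q (axis k 1)))"
proof -
 obtain th where th: "diffeo_pair phi th" using d diffeo_iff by blast
 note phi = diffeo_pairD[OF th]
 have "lift psi (phi q) w = tmap A phi q (lift (\<lambda>q. psi (phi q)) q w)" for w
  using lift(1)[OF pullback_chart(1)[OF th c(1)], of q w] dd_pullback_chart[OF phi(1) c, of "lift (\<lambda>q. psi (phi q)) q w"]
   lift(2)[OF c, of "tmap A phi q (lift (\<lambda>q. psi (phi q)) q w)"] c(2) by simp
 then show ?thesis by (simp add: dens_def)
qed

text \<open>Here f rho is the form whose pullback by \<open>phi\<close> is \<open>rho\<close>. The
  defining quotient involves frames of arbitrarily chosen charts; smoothness is visible in the equal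
  quotient of densities in two related charts. As \<open>phi\<close> may reverse the orientation,
  \<open>f\<close> is nowhere zero but may be negative.\<close>

lemma pullback_ratio:
 assumes rho: "positive_volume_form A rho" and d: "diffeo A phi"
 obtains f where "\<forall>q. msmooth f q" "\<forall>q. f q \<noteq> 0" "\<forall>p b. f (phi p) * rho (phi p) (\<lambda>k. tmap A phi p (b k)) = rho p b"
proof -
 obtain th where th: "diffeo_pair phi th" using d diffeo_iff by blast
 note phi = diffeo_pairD[OF th]
 note rho' = positive_top_form[OF rho]
 let ?e = "\<lambda>k. axis k 1 :: 'n model"
 have frame: "rho (phi p) (\<lambda>k. tmap A phi p (b k)) = rho (phi p) ?e * det (matrix (tmap A phi p)) * det (\<chi> k. b k)" for p b
  by (subst positive_top_form_eq[OF rho]) (simp add: det_linear_frame[OF diffeo_tmap(2)[OF d]])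
 have nz: "det (matrix (tmap A phi p)) \<noteq> 0" for p
  using diffeo_tmap[OF d, of p] det_nz_iff_inj bij_is_inj by blast
 define f where "f q = rho (th q) ?e / (rho q ?e * det (matrix (tmap A phi (th q))))" for q
 have pos: "rho q ?e > 0" for q by (rule positive_top_form_axis[OF rho])
 have rel: "f (phi p) * rho (phi p) (\<lambda>k. tmap A phi p (b k)) = rho p b" for p b
  using pos[of "phi p"] nz[of p] by (simp add: frame f_def phi(4) positive_top_form_eq[OF rho, of p b])
 have "msmooth f q" for q
 proof -
  note c = chart_at_max[of q] and pc = pullback_chart(1)[OF th chart_at_max[of q]]
  have q: "th q \<in> phi -` cU q" by (simp add: phi(3) chart_at_in)
  have "msmooth (\<lambda>r. dens rho (\<lambda>q'. cf q (phi q')) (th r) / dens rho (cf q) r) q"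
   by (intro msmooth_divide mmap_msmooth(1)[OF phi(2) msmooth_dens[OF rho' pc q]] msmooth_dens[OF rho' c] dens_nonzero[OF rho c] chart_at_in)
  moreover have "\<forall>\<^sub>F r in nhds q. dens rho (\<lambda>q'. cf q (phi q')) (th r) / dens rho (cf q) r = f r"
   using eventually_in_chart(1)[OF chart_at_is_chart chart_at_in(2)[of q]]
  proof eventually_elim
   case (elim r)
   have "f r * dens rho (cf q) r = dens rho (\<lambda>q'. cf q (phi q')) (th r)"
    using dens_pullback[OF d c, of "th r" rho] elim rel[of "th r"] by (simp add: phi(3)) (simp add: dens_def)
   then show ?case using dens_nonzero[OF rho c elim] by (simp add: field_simps)
  qed
  ultimately show ?thesis by (rule msmooth_cong)
 qed
 moreover have "f q \<noteq> 0" for q using pos[of q] pos[of "th q"] nz[of "th q"] by (simp add: f_def)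
 ultimately show thesis using that rel by blast
qed

lemma ddc_scale: "almost_complex A J ==> msmooth h p ==> ddc J (\<lambda>q. a * h q) p u v = a * ddc J h p u v"
 using ddc_linear[of J h p "\<lambda>q. 0" a 0 u v] by (simp add: msmooth_const)

end

context compact_manifold
begin

text \<open>By naturality the left side is the pullback of the Ricci form belonging to f rho and
  \<open>J\<close>, and passing from \<open>rho\<close> to f rho adds the logarithm of the absolute
  value of \<open>f\<close> to the local potential.\<close>

lemma Ric_pullback:
 assumes rho: "positive_volume_form A rho" and J: "integrable_complex A J" and d: "diffeo A phi"
  and f: "\<forall>q. msmooth f q" "\<forall>q. f q \<noteq> 0" "\<forall>p b. f (phi p) * rho (phi p) (\<lambda>k. tmap A phi p (b k)) = rho p b"
 shows "Ric A rho (pullback_endo A phi J) p u v = Ric A rho J (phi p) (tmap A phi p u) (tmap A phi p v)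
  + 1 / 2 * ddc J (\<lambda>q. ln \<bar>f q\<bar>) (phi p) (tmap A phi p u) (tmap A phi p v)"
proof -
 obtain th where th: "diffeo_pair phi th" using d diffeo_iff by blast
 note phi = diffeo_pairD[OF th]
 note aJ = integrable_almost_complex[OF J]
 note rho' = positive_top_form[OF rho]
 obtain V psi where h: "(V, psi) \<in> holomorphic_charts A J" "phi p \<in> V" using integrable_cover[OF J] by blast
 note c = holomorphic_chartD(1)[OF h(1)]
 let ?k = "\<lambda>q. ln \<bar>dens rho psi q\<bar>" and ?l = "\<lambda>q. ln \<bar>f q\<bar>"
 have s: "msmooth ?k (phi p)" "msmooth ?l (phi p)"
  using dd_ln_abs(1)[of "dens rho psi" "phi p"] dd_ln_abs(1)[of f "phi p"] msmooth_dens[OF rho' c h(2)] dens_nonzero[OF rho c h(2)] f by simp_all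
 have "\<forall>\<^sub>F q in nhds p. phi q \<in> V"
  by (rule eventually_mmap[OF phi(1) ev_chart(1)[OF c h(2)]])
 then have "\<forall>\<^sub>F q in nhds p. ln \<bar>dens rho (\<lambda>q. psi (phi q)) q\<bar> = 1 * ?k (phi q) + 1 * ?l (phi q)"
 proof eventually_elim
  case (elim q)
  have "dens rho (\<lambda>q. psi (phi q)) q = f (phi q) * dens rho psi (phi q)"
   unfolding dens_pullback[OF d c elim] using f(3) by (simp add: dens_def)
  then show ?case using f(2) dens_nonzero[OF rho c elim] by (simp add: abs_mult ln_mult)
 qed
 from ddc_cong[OF this, of "pullback_endo A phi J"]
 have "Ric A rho (pullback_endo A phi J) p u v = 1 / 2 * ddc (pullback_endo A phi J) (\<lambda>q. 1 * ?k (phi q) + 1 * ?l (phi q)) p u v"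
  using Ric_local[OF rho integrable_pullback[OF d J] pullback_holomorphic_chart[OF d h(1)], of p u v] h(2) by simp
 also have "\<dots> = 1 / 2 * ddc J (\<lambda>q. 1 * ?k q + 1 * ?l q) (phi p) (tmap A phi p u) (tmap A phi p v)"
  using ddc_pullback[OF d h, of "\<lambda>q. 1 * ?k q + 1 * ?l q" u v] msmooth_add[OF s] by simp
 finally show ?thesis
  unfolding ddc_linear[OF aJ s] by (simp add: Ric_local[OF rho J h] distrib_left)
qed

end

section \<open>The Bott--Chern relation and the behaviour of Gram determinants under a change of
  frame\<close>

context manifold
begin

lemma bott_chern_rel_iff:
 "(tau, sig) \<in> bott_chern_rel A J \<longleftrightarrow> tau \<in> closed_form11 A J \<and> sig \<in> closed_form11 A J \<and>
  (\<exists>f. (\<forall>q. msmooth f q) \<and> (\<forall>p u v. sig p u v - tau p u v = ddc J f p u v))"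
 by (simp add: bott_chern_rel_def ddc_def smooth_fun_iff)

lemma ddc_const [simp]: "ddc J (\<lambda>q. c) p u v = 0"
 by (simp add: ddc_def d_one_form_def Let_def)

lemma bott_chern_class_eq:
 assumes J: "almost_complex A J" and r: "(tau, sig) \<in> bott_chern_rel A J"
 shows "bott_chern_class A J tau = bott_chern_class A J sig"
proof -
 obtain f where f: "tau \<in> closed_form11 A J" "sig \<in> closed_form11 A J" "\<And>q. msmooth f q" "\<And>p u v. sig p u v - tau p u v = ddc J f p u v"
  using r unfolding bott_chern_rel_iff by blast
 have "(tau, om) \<in> bott_chern_rel A J \<longleftrightarrow> (sig, om) \<in> bott_chern_rel A J" for om
 proof
  assume "(tau, om) \<in> bott_chern_rel A J"
  then obtain h where h: "om \<in> closed_form11 A J" "\<And>q. msmooth h q" "\<And>p u v. om p u v - tau p u v = ddc J h p u v"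
   unfolding bott_chern_rel_iff by blast
  have "om p u v - sig p u v = ddc J (\<lambda>q. 1 * h q + (- 1) * f q) p u v" for p u v
   unfolding ddc_linear[OF J h(2) f(3)] using f(4)[of p u v] h(3)[of p u v] by simp
  moreover have "msmooth (\<lambda>q. 1 * h q + (- 1) * f q) q" for q
   by (intro msmooth_add msmooth_mult[OF msmooth_const] h(2) f(3))
  ultimately show "(sig, om) \<in> bott_chern_rel A J" unfolding bott_chern_rel_iff using f(2) h(1) by blast
 next
  assume "(sig, om) \<in> bott_chern_rel A J"
  then obtain h where h: "om \<in> closed_form11 A J" "\<And>q. msmooth h q" "\<And>p u v. om p u v - sig p u v = ddc J h p u v"
   unfolding bott_chern_rel_iff by blast
  have "om p u v - tau p u v = ddc J (\<lambda>q. 1 * h q + 1 * f q) p u v" for p u v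
   unfolding ddc_linear[OF J h(2) f(3)] using f(4)[of p u v] h(3)[of p u v] by simp
  moreover have "msmooth (\<lambda>q. 1 * h q + 1 * f q) q" for q
   by (intro msmooth_add msmooth_mult[OF msmooth_const] h(2) f(3))
  ultimately show "(tau, om) \<in> bott_chern_rel A J" unfolding bott_chern_rel_iff using f(1) h(1) by blast
 qed
 then show ?thesis by (simp add: bott_chern_class_def Image_def)
qed

lemma bott_chern_class_eq_iff:
 assumes J: "almost_complex A J" and "tau \<in> closed_form11 A J" "sig \<in> closed_form11 A J"
 shows "bott_chern_class A J tau = bott_chern_class A J sig \<longleftrightarrow> (sig, tau) \<in> bott_chern_rel A J"
  "tau \<in> bott_chern_class A J tau"
proof -
 have "tau p u v - tau p u v = ddc J (\<lambda>q. 0) p u v" for p u v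
  by simp
 then have "(tau, tau) \<in> bott_chern_rel A J" unfolding bott_chern_rel_iff using assms(2) msmooth_const by blast
 then show self: "tau \<in> bott_chern_class A J tau" by (simp add: bott_chern_class_def)
 show "bott_chern_class A J tau = bott_chern_class A J sig \<longleftrightarrow> (sig, tau) \<in> bott_chern_rel A J"
 proof
  assume "bott_chern_class A J tau = bott_chern_class A J sig"
  with self have "tau \<in> bott_chern_class A J sig" by simp
  then show "(sig, tau) \<in> bott_chern_rel A J" by (simp add: bott_chern_class_def)
 qed (rule bott_chern_class_eq[OF J, symmetric])
qed

text \<open>Gram matrices of two frames are congruent, so their determinants differ by the square of
  the factor by which densities differ. For this reason half the logarithm of the Gram determinant
  is compared with the logarithm of a density.\<close>

lemma gram_change:
 assumes g: "hermitian_metric A J g"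
 shows "det (gram_matrix g psi q) = (det (\<chi> k. lift psi q (axis k 1)))\<^sup>2 * det (\<chi> i j. g q (axis i 1) (axis j 1))"
proof -
 let ?M = "\<chi> k. lift psi q (axis k 1)" and ?G = "\<chi> i j. g q (axis i 1) (axis j 1)"
 note lin = hermitian_metricD(1)[OF g] and sym = hermitian_metricD(2)[OF g]
 have ex: "g q x y = (\<Sum>b\<in>UNIV. y $ b * g q x (axis b 1))" for x y
 proof -
  have "g q x y = g q x (\<Sum>b\<in>UNIV. (y $ b) *\<^sub>R axis b 1)" by (simp add: sum_axis)
  also have "\<dots> = (\<Sum>b\<in>UNIV. y $ b * g q x (axis b 1))" by (simp add: linear_sum[OF lin] linear_scale[OF lin])
  finally show ?thesis .
 qed
 have ex1: "g q x (axis b 1) = (\<Sum>a\<in>UNIV. x $ a * g q (axis a 1) (axis b 1))" for x b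
 proof -
  have "g q x (axis b 1) = (\<Sum>a\<in>UNIV. x $ a * g q (axis b 1) (axis a 1))" unfolding sym[of q x] by (rule ex)
  also have "\<dots> = (\<Sum>a\<in>UNIV. x $ a * g q (axis a 1) (axis b 1))"
   by (rule sum.cong[OF refl]) (subst sym, rule refl)
  finally show ?thesis .
 qed
 have "g q x y = (\<Sum>b\<in>UNIV. (\<Sum>a\<in>UNIV. x $ a * g q (axis a 1) (axis b 1)) * y $ b)" for x y
  unfolding ex[of x y] by (rule sum.cong[OF refl]) (subst ex1, rule mult.commute)
 note exp = this
 have "gram_matrix g psi q = ?M ** ?G ** transpose ?M"
  unfolding vec_eq_iff
 proof (intro allI)
  fix i j
  have "gram_matrix g psi q $ i $ j = g q (?M $ i) (?M $ j)" by (simp add: gram_matrix_def gram_def)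
  also have "\<dots> = (?M ** ?G ** transpose ?M) $ i $ j"
   unfolding exp[of "?M $ i" "?M $ j"] by (simp add: matrix_matrix_mult_def transpose_def)
  finally show "gram_matrix g psi q $ i $ j = (?M ** ?G ** transpose ?M) $ i $ j" .
 qed
 then show ?thesis by (simp add: det_mul det_transpose power2_eq_square)
qed

end

section \<open>Ricci-flat volume forms and the Bott--Chern class\<close>

context compact_manifold
begin

lemma ricci_potential:
 assumes rho: "positive_volume_form A rho" and J: "integrable_complex A J"
  and h: "(U, psi) \<in> holomorphic_charts A J" "p \<in> U"
 shows "msmooth (\<lambda>q. 1 / (4 * pi) * ln \<bar>dens rho psi q\<bar>) p"
  "1 / (2 * pi) * Ric A rho J p u v = ddc J (\<lambda>q. 1 / (4 * pi) * ln \<bar>dens rho psi q\<bar>) p u v"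
proof -
 note rho' = positive_top_form[OF rho]
 note aJ = integrable_almost_complex[OF J]
 note c = holomorphic_chartD(1)[OF h(1)] h(2)
 have s: "msmooth (\<lambda>q. ln \<bar>dens rho psi q\<bar>) p"
  using dd_ln_abs(1)[of "dens rho psi" p] msmooth_dens[OF rho' c] dens_nonzero[OF rho c] by blast
 then show "msmooth (\<lambda>q. 1 / (4 * pi) * ln \<bar>dens rho psi q\<bar>) p"
  by (rule msmooth_mult[OF msmooth_const])
 show "1 / (2 * pi) * Ric A rho J p u v = ddc J (\<lambda>q. 1 / (4 * pi) * ln \<bar>dens rho psi q\<bar>) p u v"
  unfolding ddc_scale[OF aJ s] Ric_local[OF rho J h] by simp
qed

lemma ricci_closed_form11:
 assumes rho: "positive_volume_form A rho" and J: "integrable_complex A J"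
 shows "(\<lambda>p u v. 1 / (2 * pi) * Ric A rho J p u v) \<in> closed_form11 A J"
proof (rule local_potential_closed_form11)
 fix p
 obtain U psi where h: "(U, psi) \<in> holomorphic_charts A J" "p \<in> U" using integrable_cover[OF J] by blast
 note pot = ricci_potential[OF rho J h(1)]
 have "\<forall>\<^sub>F q in nhds p. (\<lambda>u v. 1 / (2 * pi) * Ric A rho J q u v) = ddc J (\<lambda>q. 1 / (4 * pi) * ln \<bar>dens rho psi q\<bar>) q"
  using ev_chart(1)[OF holomorphic_chartD(1)[OF h(1)] h(2)]
  by eventually_elim (intro ext, rule pot(2))
 then show "\<exists>U psi h. (U, psi) \<in> holomorphic_charts A J \<and> p \<in> U \<and> msmooth h p \<and>
  (\<forall>\<^sub>F q in nhds p. (\<lambda>u v. 1 / (2 * pi) * Ric A rho J q u v) = ddc J h q)"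
  using h pot(1)[OF h(2)] by blast
qed

lemma zero_closed_form11:
 assumes J: "integrable_complex A J"
 shows "(\<lambda>p u v. 0) \<in> closed_form11 A J"
proof (rule local_potential_closed_form11)
 fix p
 note aJ = integrable_almost_complex[OF J]
 obtain U psi where h: "(U, psi) \<in> holomorphic_charts A J" "p \<in> U" using integrable_cover[OF J] by blast
 have "(\<lambda>u v. 0) = ddc J (\<lambda>q. 0) q" for q
  by (simp add: fun_eq_iff)
 then have "\<forall>\<^sub>F q in nhds p. (\<lambda>u v. 0) = ddc J (\<lambda>q. 0) q" by simp
 then show "\<exists>U psi h. (U, psi) \<in> holomorphic_charts A J \<and> p \<in> U \<and> msmooth h p \<and> (\<forall>\<^sub>F q in nhds p. (\<lambda>u v. 0) = ddc J h q)"
  using h msmooth_const[of 0 p] by blast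
qed

lemma chern_ricci_rel:
 assumes rho: "positive_volume_form A rho" and J: "integrable_complex A J"
  and g: "hermitian_metric A J g" and D: "chern_connection A J g D"
 shows "(chern_form A J D, \<lambda>p u v. 1 / (2 * pi) * Ric A rho J p u v) \<in> bott_chern_rel A J"
proof -
 note aJ = integrable_almost_complex[OF J]
 let ?k = "\<lambda>psi q. ln \<bar>det (gram_matrix g psi q)\<bar> / 2"
 have ks: "msmooth (?k psi) q" if h: "(U, psi) \<in> holomorphic_charts A J" "q \<in> U" for U psi q
 proof (intro msmooth_divide msmooth_const dd_ln_abs(1))
  show "msmooth (\<lambda>q. det (gram_matrix g psi q)) q"
   by (intro msmooth_det) (simp add: gram_matrix_def gram_props(5)[OF g h])
 qed (simp_all add: det_gram_nonzero[OF g h])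
 have chern: "chern_form A J D q u v = ddc J (\<lambda>q. 1 / (4 * pi) * ?k psi q) q u v"
  if h: "(U, psi) \<in> holomorphic_charts A J" "q \<in> U" for U psi q u v
  unfolding chern_form_local[OF aJ g h D] by (rule ddc_scale[OF aJ ks[OF h], symmetric])
 have closed: "chern_form A J D \<in> closed_form11 A J"
 proof (rule local_potential_closed_form11)
  fix p
  obtain U psi where h: "(U, psi) \<in> holomorphic_charts A J" "p \<in> U" using integrable_cover[OF J] by blast
  have "\<forall>\<^sub>F q in nhds p. chern_form A J D q = ddc J (\<lambda>q. 1 / (4 * pi) * ?k psi q) q"
   using ev_chart(1)[OF holomorphic_chartD(1)[OF h(1)] h(2)]
   by eventually_elim (intro ext, rule chern[OF h(1)])
  moreover have "msmooth (\<lambda>q. 1 / (4 * pi) * ?k psi q) p"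
   by (rule msmooth_mult[OF msmooth_const ks[OF h]])
  ultimately show "\<exists>U psi h. (U, psi) \<in> holomorphic_charts A J \<and> p \<in> U \<and> msmooth h p \<and>
   (\<forall>\<^sub>F q in nhds p. chern_form A J D q = ddc J h q)" using h by blast
 qed
 \<comment> \<open>The frame used at \<open>q\<close> belongs to the chart chosen at
   \<open>q\<close> and need not vary continuously. Both logarithmic terms change by the same amount
   under a change of frame, so the difference is nevertheless smooth.\<close>
 define f where "f q = 1 / (4 * pi) * (ln \<bar>rho q (\<lambda>k. axis k 1)\<bar> - ln \<bar>det (\<chi> i j. g q (axis i 1) (axis j 1))\<bar> / 2)" for q
 have f: "f q = 1 * (1 / (4 * pi) * ln \<bar>dens rho psi q\<bar>) + (- 1) * (1 / (4 * pi) * ?k psi q)"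
  if h: "(U, psi) \<in> holomorphic_charts A J" "q \<in> U" for U psi q
 proof -
  note c = holomorphic_chartD(1)[OF h(1)] h(2)
  let ?d = "det (\<chi> k. lift psi q (axis k 1))" and ?r = "rho q (\<lambda>k. axis k 1)" and ?G = "det (\<chi> i j. g q (axis i 1) (axis j 1))"
  have nz: "?d \<noteq> 0" "?r \<noteq> 0" "?G \<noteq> 0"
   using det_lift_nonzero[OF c] positive_top_form_axis[OF rho, of q] det_gram_nonzero[OF g h] gram_change[OF g, of psi q] by auto
  have "dens rho psi q = ?r * ?d" unfolding dens_def by (rule positive_top_form_eq[OF rho])
  then have 1: "ln \<bar>dens rho psi q\<bar> = ln \<bar>?r\<bar> + ln \<bar>?d\<bar>" using nz by (simp add: abs_mult ln_mult)
  have 2: "ln \<bar>det (gram_matrix g psi q)\<bar> = 2 * ln \<bar>?d\<bar> + ln \<bar>?G\<bar>"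
  proof -
   have "\<bar>det (gram_matrix g psi q)\<bar> = \<bar>?d\<bar> * (\<bar>?d\<bar> * \<bar>?G\<bar>)"
    unfolding gram_change[OF g] by (simp add: abs_mult power2_eq_square)
   then show ?thesis using nz by (simp add: ln_mult)
  qed
  show ?thesis unfolding f_def 1 2 by (simp add: field_simps)
 qed
 have loc: "msmooth f p \<and> 1 / (2 * pi) * Ric A rho J p u v - chern_form A J D p u v = ddc J f p u v" for p u v
 proof -
  obtain U psi where h: "(U, psi) \<in> holomorphic_charts A J" "p \<in> U" using integrable_cover[OF J] by blast
  note pot = ricci_potential[OF rho J h]
  let ?f = "\<lambda>q. 1 * (1 / (4 * pi) * ln \<bar>dens rho psi q\<bar>) + (- 1) * (1 / (4 * pi) * ?k psi q)"
  have ev: "\<forall>\<^sub>F q in nhds p. ?f q = f q"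
   using ev_chart(1)[OF holomorphic_chartD(1)[OF h(1)] h(2)]
   by eventually_elim (rule f[OF h(1), symmetric])
  have s: "msmooth (\<lambda>q. 1 / (4 * pi) * ?k psi q) p"
   by (rule msmooth_mult[OF msmooth_const ks[OF h]])
  have "msmooth ?f p" by (intro msmooth_add msmooth_mult[OF msmooth_const] pot(1) s)
  moreover have "ddc J ?f p u v = 1 / (2 * pi) * Ric A rho J p u v - chern_form A J D p u v"
   unfolding ddc_linear[OF aJ pot(1) s] pot(2) chern[OF h] by simp
  ultimately show ?thesis using msmooth_cong[OF _ ev] ddc_cong[OF ev, of J] by simp
 qed
 show ?thesis
  unfolding bott_chern_rel_iff using closed ricci_closed_form11[OF rho J] loc by blast
qed

text \<open>Every metric and every Chern connection lead to the class of the Ricci form; together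
  with the existence of one such pair this evaluates the definite description.\<close>

lemma first_bott_chern_class_eq:
 assumes rho: "positive_volume_form A rho" and J: "integrable_complex A J"
 shows "first_bott_chern_class A J = bott_chern_class A J (\<lambda>p u v. 1 / (2 * pi) * Ric A rho J p u v)"
proof -
 note aJ = integrable_almost_complex[OF J]
 obtain g where g: "hermitian_metric A J g" by (rule exists_hermitian_metric[OF aJ])
 obtain D where D: "chern_connection A J g D" by (rule exists_chern_connection[OF J g])
 note eq = bott_chern_class_eq[OF aJ chern_ricci_rel[OF rho J]]
 show ?thesis
  unfolding first_bott_chern_class_def
 proof (rule the_equality)
  show "\<exists>g D. hermitian_metric A J g \<and> chern_connection A J g D \<and>
   bott_chern_class A J (\<lambda>p u v. 1 / (2 * pi) * Ric A rho J p u v) = bott_chern_class A J (chern_form A J D)"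
   by (intro exI conjI, rule g, rule D, rule eq[OF g D, symmetric])
  show "C = bott_chern_class A J (\<lambda>p u v. 1 / (2 * pi) * Ric A rho J p u v)"
   if C: "\<exists>g D. hermitian_metric A J g \<and> chern_connection A J g D \<and> C = bott_chern_class A J (chern_form A J D)" for C
  proof -
   obtain g D where gD: "hermitian_metric A J g" "chern_connection A J g D" and "C = bott_chern_class A J (chern_form A J D)"
    using C by (elim exE conjE)
   then show ?thesis by (simp only: eq[OF gD])
  qed
 qed
qed

lemma class_zero_iff:
 assumes rho: "positive_volume_form A rho" and J: "integrable_complex A J"
 shows "first_bott_chern_class A J = bott_chern_class A J (\<lambda>p u v. 0) \<longleftrightarrow>
  (\<exists>f. (\<forall>q. msmooth f q) \<and> (\<forall>p u v. 1 / (2 * pi) * Ric A rho J p u v = ddc J f p u v))"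
proof -
 note aJ = integrable_almost_complex[OF J]
 note cl = ricci_closed_form11[OF rho J] zero_closed_form11[OF J]
 show ?thesis
  unfolding first_bott_chern_class_eq[OF rho J] bott_chern_class_eq_iff(1)[OF aJ cl] bott_chern_rel_iff
  using cl by simp
qed

lemma ricci_flat_representative:
 assumes rho: "positive_volume_form A rho" and J: "integrable_complex A J" and conn: "connected (UNIV :: 'm set)"
 shows "(\<exists>f. (\<forall>q. msmooth f q) \<and> (\<forall>p u v. 1 / (2 * pi) * Ric A rho J p u v = ddc J f p u v)) \<longleftrightarrow>
  (\<exists>phi\<in>Diff0 A. Ric A rho (pullback_endo A phi J) = (\<lambda>p u v. 0))"
proof
 note aJ = integrable_almost_complex[OF J]
 assume "\<exists>f. (\<forall>q. msmooth f q) \<and> (\<forall>p u v. 1 / (2 * pi) * Ric A rho J p u v = ddc J f p u v)"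
 then obtain f where f: "\<And>q. msmooth f q" "\<And>p u v. 1 / (2 * pi) * Ric A rho J p u v = ddc J f p u v" by blast
 \<comment> \<open>The Ricci form is 2 pi times \<open>ddc J f\<close>, and multiplying
   \<open>rho\<close> by \<open>F\<close> adds half of \<open>ddc\<close> of ln F to it; the
   exponent is chosen so that the two cancel.\<close>
 define F where "F q = exp ((- 4 * pi) * f q)" for q
 have sF: "msmooth F q" "F q > 0" for q
  unfolding F_def by (intro msmooth_exp msmooth_mult[OF msmooth_const] f(1)) simp
 obtain c phi where m: "c > 0" "phi \<in> Diff0 A" "\<forall>p b. c * F (phi p) * rho (phi p) (\<lambda>k. tmap A phi p (b k)) = rho p b"
  by (rule moser[OF rho conn sF])
 let ?F = "\<lambda>q. c * F q"
 have sm: "\<forall>q. msmooth ?F q" by (rule allI, rule msmooth_mult[OF msmooth_const sF(1)])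
 have nz: "\<forall>q. ?F q \<noteq> 0" using m(1) sF(2) by (metis mult_eq_0_iff less_irrefl)
 \<comment> \<open>The constant from \<open>moser\<close> enters the logarithm additively and is
   annihilated by \<open>ddc\<close>.\<close>
 have ln: "ln \<bar>?F q\<bar> = (- 4 * pi) * f q + ln c * 1" for q using m(1) by (simp add: F_def abs_mult ln_mult)
 have dd: "ddc J (\<lambda>q. ln \<bar>?F q\<bar>) p u v = (- 4 * pi) * ddc J f p u v" for p u v
  unfolding ln ddc_linear[OF aJ f(1) msmooth_const] by simp
 have "Ric A rho (pullback_endo A phi J) p u v = 0" for p u v
  unfolding Ric_pullback[OF rho J Diff0_diffeo[OF m(2)] sm nz m(3)] dd f(2)[symmetric] by simp
 then show "\<exists>phi\<in>Diff0 A. Ric A rho (pullback_endo A phi J) = (\<lambda>p u v. 0)" using m(2) by blast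
next
 note aJ = integrable_almost_complex[OF J]
 assume "\<exists>phi\<in>Diff0 A. Ric A rho (pullback_endo A phi J) = (\<lambda>p u v. 0)"
 then obtain phi where phi: "diffeo A phi" "Ric A rho (pullback_endo A phi J) = (\<lambda>p u v. 0)" using Diff0_diffeo by blast
 obtain f where f: "\<forall>q. msmooth f q" "\<forall>q. f q \<noteq> 0" "\<forall>p b. f (phi p) * rho (phi p) (\<lambda>k. tmap A phi p (b k)) = rho p b"
  by (rule pullback_ratio[OF rho phi(1)])
 have s: "msmooth (\<lambda>q. ln \<bar>f q\<bar>) q" for q using dd_ln_abs(1) f(1,2) by blast
 \<comment> \<open>Vanishing of the pulled back form is carried over to the target, where
   \<open>phi\<close> and its differentials are surjective. The factor is the product of - 1 / 2,
   from the transformation of the Ricci form, and 1 / (2 pi).\<close>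
 have "1 / (2 * pi) * Ric A rho J q u v = ddc J (\<lambda>q. (- 1 / (4 * pi)) * ln \<bar>f q\<bar>) q u v" for q u v
 proof -
  obtain p where p: "q = phi p" using phi(1) unfolding diffeo_def by (metis bij_pointE)
  obtain u' v' where uv: "u = tmap A phi p u'" "v = tmap A phi p v'" using diffeo_tmap(1)[OF phi(1), of p] by (metis bij_pointE)
  have "Ric A rho J q u v + 1 / 2 * ddc J (\<lambda>q. ln \<bar>f q\<bar>) q u v = 0"
   using Ric_pullback[OF rho J phi(1) f, of p u' v'] by (simp add: phi(2) p uv)
  then have "Ric A rho J q u v = - (1 / 2 * ddc J (\<lambda>q. ln \<bar>f q\<bar>) q u v)" by linarith
  then show ?thesis unfolding ddc_scale[OF aJ s] by simp
 qed
 moreover have "msmooth (\<lambda>q. (- 1 / (4 * pi)) * ln \<bar>f q\<bar>) q" for q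
  by (rule msmooth_mult[OF msmooth_const s])
 ultimately show "\<exists>f. (\<forall>q. msmooth f q) \<and> (\<forall>p u v. 1 / (2 * pi) * Ric A rho J p u v = ddc J f p u v)" by blast
qed

lemma ricci_flat_volume_unique:
 assumes rho: "positive_volume_form A rho" and J: "integrable_complex A J" and conn: "connected (UNIV :: 'm set)"
  and d: "diffeo A phi" and orient: "orientation_preserving A phi"
  and flat: "Ric A rho J = (\<lambda>p u v. 0)" "Ric A rho (pullback_endo A phi J) = (\<lambda>p u v. 0)"
 shows "pullback_top_form A phi rho = rho"
proof -
 obtain f where f: "\<forall>q. msmooth f q" "\<forall>q. f q \<noteq> 0" "\<forall>p b. f (phi p) * rho (phi p) (\<lambda>k. tmap A phi p (b k)) = rho p b"
  by (rule pullback_ratio[OF rho d])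
 have surj: "\<exists>p. q = phi p" for q using d unfolding diffeo_def by (metis bij_pointE)
 have s: "msmooth (\<lambda>q. ln \<bar>f q\<bar>) q" for q using dd_ln_abs(1) f(1,2) by blast
 have "ddc J (\<lambda>q. ln \<bar>f q\<bar>) q u v = 0" for q u v
 proof -
  obtain p where p: "q = phi p" using surj by blast
  obtain u' v' where uv: "u = tmap A phi p u'" "v = tmap A phi p v'" using diffeo_tmap(1)[OF d, of p] by (metis bij_pointE)
  show ?thesis using Ric_pullback[OF rho J d f, of p u' v'] by (simp add: flat p uv)
 qed
 from ddc_zero_constant[OF conn J s this] have const: "ln \<bar>f p\<bar> = ln \<bar>f q\<bar>" for p q .
 \<comment> \<open>Constancy of the logarithm of the absolute value leaves the sign of
   \<open>f\<close> open; preservation of the orientation settles it.\<close>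
 have pos: "f q > 0" for q
 proof -
  obtain p where p: "q = phi p" using surj by blast
  have "det (\<chi> k. tmap A phi p (axis k 1)) > 0"
   unfolding det_matrix_axis[OF diffeo_tmap(2)[OF d]] using orient by (simp add: orientation_preserving_def)
  then have "rho (phi p) (\<lambda>k. tmap A phi p (axis k 1)) > 0" using rho by (simp add: positive_volume_form_def positive_frame_def)
  moreover have "f (phi p) * rho (phi p) (\<lambda>k. tmap A phi p (axis k 1)) > 0" using f(3) positive_top_form_axis[OF rho] by simp
  ultimately show ?thesis by (simp add: p zero_less_mult_iff)
 qed
 fix p0
 have fc: "f q = f p0" for q using const[of q p0] pos[of q] pos[of p0] by simp
 have rel: "rho (phi p) (\<lambda>k. tmap A phi p (b k)) = (1 / f p0) * rho p b" for p b
 proof -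
  have "f p0 * rho (phi p) (\<lambda>k. tmap A phi p (b k)) = rho p b" using f(3) fc[of "phi p"] by metis
  then show ?thesis using pos[of p0] by (simp add: field_simps)
 qed
 have "1 / f p0 = 1" by (rule volume_scaling_trivial[OF rho d _ rel]) (simp add: pos)
 then show ?thesis by (simp add: fun_eq_iff pullback_top_form_def rel)
qed

end

theorem theoremC:
  fixes A :: "('m::t2_space, 'n::finite) chart set"
    and \<rho> :: "('m, 'n) top_form"
    and J :: "('m, 'n) endo"
  assumes "closed_connected_oriented_manifold A"
    and "positive_volume_form A \<rho>"
    and "integrable_complex A J"
    and "compatible_with_orientation J"
  shows "(\<lambda>p u v. 1 / (2 * pi) * Ric A \<rho> J p u v) \<in> form11 A J \<and>
    (\<lambda>p u v. 1 / (2 * pi) * Ric A \<rho> J p u v) \<in> first_bott_chern_class A J \<and>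
    (first_bott_chern_class A J = bott_chern_class A J (\<lambda>p u v. 0) \<longleftrightarrow>
       (\<exists>\<phi>\<in>Diff0 A. Ric A \<rho> (pullback_endo A \<phi> J) = (\<lambda>p u v. 0))) \<and>
    (\<forall>\<phi>. diffeo A \<phi> \<longrightarrow> orientation_preserving A \<phi> \<longrightarrow>
       Ric A \<rho> J = (\<lambda>p u v. 0) \<longrightarrow> Ric A \<rho> (pullback_endo A \<phi> J) = (\<lambda>p u v. 0) \<longrightarrow>
       pullback_top_form A \<phi> \<rho> = \<rho>)"
proof -
 have M: "oriented_atlas A" "compact (UNIV :: 'm set)" "connected (UNIV :: 'm set)"
  using assms(1) by (simp_all add: closed_connected_oriented_manifold_def)
 interpret compact_manifold A by unfold_locales (rule M)+
 note \<rho> = assms(2) and J = assms(3)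
 have aJ: "almost_complex A J" using J by (simp add: integrable_complex_def)
 show ?thesis
 proof (intro conjI allI impI)
  show "(\<lambda>p u v. 1 / (2 * pi) * Ric A \<rho> J p u v) \<in> form11 A J"
   using ricci_closed_form11[OF \<rho> J] by (simp add: closed_form11_def)
  show "(\<lambda>p u v. 1 / (2 * pi) * Ric A \<rho> J p u v) \<in> first_bott_chern_class A J"
   unfolding first_bott_chern_class_eq[OF \<rho> J] by (rule bott_chern_class_eq_iff(2)[OF aJ]) (rule ricci_closed_form11[OF \<rho> J])+
  show "first_bott_chern_class A J = bott_chern_class A J (\<lambda>p u v. 0) \<longleftrightarrow>
    (\<exists>\<phi>\<in>Diff0 A. Ric A \<rho> (pullback_endo A \<phi> J) = (\<lambda>p u v. 0))"
   by (rule trans[OF class_zero_iff[OF \<rho> J] ricci_flat_representative[OF \<rho> J M(3)]])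
 qed (rule ricci_flat_volume_unique[OF \<rho> J M(3)])
qed

end
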